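(* Let $\mathfrak g$ be a twisted affine Lie algebra of type $X_N^{(r)}$, $k$ a positive integer, and $\mathfrak g^t$ its transpose algebra. Then there is an algebra isomorphism $$\varphi_k:V_k(\mathfrak g)\to V_{k+h^\vee-h}(\mathfrak g^t)$$ that intertwines the action of $SL(2,\mathbb Z)$ up to scalar.
   Context: Affine algebras. $\mathfrak g=\mathfrak g(A)$ is the affine Kac–Moody algebra with affine Cartan matrix $A=(a_{ij})_{0\le i,j\le\ell}$, of type $X_N^{(r)}$, with nodes labelled as in Kac's tables Aff $r$; twisted means $r\in\{2,3\}$, untwisted means $r=1$. $\alpha_i\in\mathfrak h^*$, $\alpha_i^\vee\in\mathfrak h$ are the simple roots and coroots; $a_i$ are the labels of the Dynkin diagram and $a_i^\vee$ the dual labels (the labels of the diagram of $A^t$); $h=\sum a_i$, $h^\vee=\sum a_i^\vee$; $a_0=2$ for type $A_{2\ell}^{(2)}$, $a_0=1$ otherwise. $\Lambda_i$ are the fundamental weights, $\rho=\sum_{i=0}^\ell\Lambda_i$, $\delta=\sum a_i\alpha_i$, $K=\sum a_i^\vee\alpha_i^\vee$, $\theta=\delta-a_0\alpha_0$. The form on $\mathfrak h^*$ is $(\alpha_i,\alpha_j)=a_i^\vee a_i^{-1}a_{ij}$, $(\alpha_j,\Lambda_0)=a_0^{-1}\delta_{0j}$, $(\Lambda_0,\Lambda_0)=0$; it identifies $\mathfrak h$ with $\mathfrak h^*$. $\mathring{\mathfrak h}^*$ is the span of $\alpha_1,\dots,\alpha_\ell$; $\lambda\mapsto\overline\lambda$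 is the projection $\mathfrak h^*\to\mathring{\mathfrak h}^*$ with respect to the basis $\alpha_1,\dots,\alpha_\ell,\Lambda_0,\delta$. $\mathring W$ is generated by $s_1,\dots,s_\ell$, with sign character $\epsilon$; $M$ is the lattice spanned by $\mathring W(a_0^{-1}\theta)$, and the Weyl group is $W=\mathring W\ltimes\{t_\alpha:\alpha\in M\}$. Theta functions. For $m>0$, $P_m=\{\lambda\in\mathfrak h^*:\langle\lambda,K\rangle=m,\ (\lambda,\alpha)\in\mathbb Z\ \forall\alpha\in M\}$; for $\lambda\in P_m$, $\Theta_\lambda=e^{-\frac{(\lambda,\lambda)}{2m}\delta}\sum_{\alpha\in M}e^{t_\alpha(\lambda)}$ as a function on $Y=\{v\in\mathfrak h:\mathrm{Re}(v,\delta)>0\}$, $e^\lambda(v)=e^{(\lambda,v)}$. $Th_m(\mathfrak g)$ is the span of these; $A_\lambda=\sum_{w\in\mathring W}\epsilon(w)\Theta_{w(\lambda)}$. $Ch_k^-(\mathfrak g)\subseteq Th_{k+h^\vee}(\mathfrak g)$ is the span of $A_{\lambda+\rho}$, $\lambda$ ranging over dominant integral weights of level $\langle\lambda,K\rangle=k$. Modular action. Write $v=2\pi i(z-\sigma\Lambda_0+u\delta)\in Y$ with $z\in\mathring{\mathfrak h}^*$, $u\in\mathbb C$, $\mathrm{Im}\,\sigma>0$. For $X=\begin{pmatrix}a&b\\c&d\end{pmatrix}\in SL(2,\mathbb Z)$ put $X\cdot(\sigma,z,u)=\left(\frac{a\sigma+b}{c\sigma+d},\frac{z}{c\sigma+d},u-\frac{c(z,z)}{2(c\sigma+d)}\right)$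 and $f|_X(\sigma,z,u)=j(\sigma)^{-\ell}f(X\cdot(\sigma,z,u))$ with $j(\sigma)^2=c\sigma+d$ (an action of the metaplectic double cover; well defined up to sign on $SL(2,\mathbb Z)$). $S=\begin{pmatrix}0&-1\\1&0\end{pmatrix}$. $SL(2,\mathbb Z)$-closure. This is the smallest subspace $V\subseteq Th_{k+h^\vee}(\mathfrak g)$ containing $Ch_k^-(\mathfrak g)$, closed under $S$, and having a basis $\{A_\mu\}_{\mu\in X}$ with $X$ a set of regular dominant (not necessarily integral) weights, i.e. $\mu\in P_{k+h^\vee}$ modulo $\mathbb C\delta$ with $\langle\mu,\alpha_i^\vee\rangle>0$ for all $i$. Verlinde algebra. $V_k(\mathfrak g)$ has underlying vector space the $SL(2,\mathbb Z)$-closure $V$ with basis $\{A_\lambda\}_{\lambda\in X}$, and structure constants given by the Verlinde formula: with $A_\lambda|_S=\sum_{\mu\in X}S_{\lambda\mu}A_\mu$, $$A_\lambda\cdot A_\mu=\sum_{\nu\in X}N_{\lambda\mu}^\nu A_\nu,\qquad N_{\lambda\mu}^\nu=\sum_{\phi\in X}\frac{S_{\phi\lambda}S_{\phi\mu}(S^{-1})_{\nu\phi}}{S_{\phi0}},$$ where $0\in X$ is the "smallest" weight, giving the identity element: the one with finite part $\overline\rho$ if $\mathfrak g$ is untwisted or of type $A_{2\ell}^{(2)}$, and the one with finite part $\sum_{i=1}^\ell\frac{a_i}{a_i^\vee}\overline\Lambda_i$ if $\mathfrak g$ is twisted and not of type $A_{2\ell}^{(2)}$. The constants do not change if $S$ is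 rescaled. Transpose. $\mathfrak g^t=\mathfrak g(A^t)$, with nodes relabelled in Kac's standard way in type $A_{2\ell}^{(2)}$, where $\mathfrak g^t\cong\mathfrak g$ and $h=h^\vee$. If $\mathfrak g$ is twisted and not of type $A_{2\ell}^{(2)}$, then $\mathfrak g^t$ is untwisted. "Intertwines up to scalar" means: for each $X\in SL(2,\mathbb Z)$ there is a nonzero scalar $c_X$ with $\varphi_k(f|_X)=c_X\,\varphi_k(f)|_X$ for all $f\in V_k(\mathfrak g)$. *)

theory Defs
  imports "HOL-Analysis.Analysis" "HOL-Library.Function_Algebras"
begin

section \<open>Affine Cartan matrices\<close>

text \<open>
  An affine algebra \<open>\<gg>(A)\<close> enters only through \<open>\<ell>\<close> and the matrix \<open>A = (a\<^sub>i\<^sub>j)\<close> with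
  \<open>0 \<le> i, j \<le> \<ell>\<close>. Matrices are extended by 0 beyond \<open>\<ell>\<close>, so that equality of records is
  equality of (labelled) Cartan matrices.
\<close>

record affine =
  rk :: nat
  cm :: "nat \<Rightarrow> nat \<Rightarrow> int"

datatype twisted_type =
    A2even nat  \<comment> \<open>\<open>A2even \<ell>\<close> is \<open>A\<^bsub>2\<ell>\<^esub>\<^bsup>(2)\<^esup>\<close>\<close>
  | A2odd nat   \<comment> \<open>\<open>A2odd \<ell>\<close> is \<open>A\<^bsub>2\<ell>-1\<^esub>\<^bsup>(2)\<^esup>\<close>\<close>
  | D2 nat      \<comment> \<open>\<open>D2 \<ell>\<close> is \<open>D\<^bsub>\<ell>+1\<^esub>\<^bsup>(2)\<^esup>\<close>\<close>
  | E6_2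
  | D4_3

fun valid_type :: "twisted_type \<Rightarrow> bool" where
  "valid_type (A2even l) = (1 \<le> l)"
| "valid_type (A2odd l) = (3 \<le> l)"
| "valid_type (D2 l) = (2 \<le> l)"
| "valid_type E6_2 = True"
| "valid_type D4_3 = True"

fun type_rank :: "twisted_type \<Rightarrow> nat" where
  "type_rank (A2even l) = l"
| "type_rank (A2odd l) = l"
| "type_rank (D2 l) = l"
| "type_rank E6_2 = 4"
| "type_rank D4_3 = 2"

text \<open>
  \<open>chain i j\<close> is the off-diagonal entry for a string of nodes \<open>0 - 1 - 2 - \<dots>\<close> joined by
  simple edges; \<open>offdiag\<close> gives the entries \<open>a\<^sub>i\<^sub>j\<close>, \<open>i \<noteq> j\<close>, in the node labelling of Kac's
  tables Aff 2 and Aff 3. In particular \<open>\<alpha>\<^sub>0\<close> is the shortest simple root of \<open>A2even\<close>, so that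
  its label is 2.
\<close>

definition chain :: "nat \<Rightarrow> nat \<Rightarrow> int" where
  "chain i j = (if j = Suc i \<or> i = Suc j then -1 else 0)"

fun offdiag :: "twisted_type \<Rightarrow> nat \<Rightarrow> nat \<Rightarrow> int" where
  "offdiag (A2even l) i j =
     (if l = 1 then (if (i, j) = (0, 1) then -4 else -1)
      else if (i, j) = (0, 1) \<or> (i, j) = (l - 1, l) then -2
      else chain i j)"
| "offdiag (A2odd l) i j =
     (if (i, j) = (0, 1) \<or> (i, j) = (1, 0) then 0
      else if (i, j) = (0, 2) \<or> (i, j) = (2, 0) then -1
      else if (i, j) = (l - 1, l) then -2
      else chain i j)"
| "offdiag (D2 l) i j =
     (if (i, j) = (0, 1) \<or> (i, j) = (l, l - 1) then -2 else chain i j)"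
| "offdiag E6_2 i j = (if (i, j) = (2, 3) then -2 else chain i j)"
| "offdiag D4_3 i j = (if (i, j) = (1, 2) then -3 else chain i j)"

definition affine_of :: "twisted_type \<Rightarrow> affine" where
  "affine_of t =
     \<lparr> rk = type_rank t,
       cm = (\<lambda>i j. if i > type_rank t \<or> j > type_rank t then 0
                   else if i = j then 2 else offdiag t i j) \<rparr>"

definition twisted :: "affine \<Rightarrow> bool" where
  "twisted g \<longleftrightarrow> (\<exists>t. valid_type t \<and> g = affine_of t)"

definition is_A2even :: "affine \<Rightarrow> bool" where
  "is_A2even g \<longleftrightarrow> (\<exists>l. valid_type (A2even l) \<and> g = affine_of (A2even l))"

definition plain_transpose :: "affine \<Rightarrow> affine" where
  "plain_transpose g = \<lparr> rk = rk g, cm = (\<lambda>i j. cm g j i) \<rparr>"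

text \<open>The transpose algebra; in type \<open>A2even\<close> the nodes are renumbered by \<open>i \<mapsto> \<ell> - i\<close>.\<close>

definition transpose_alg :: "affine \<Rightarrow> affine" where
  "transpose_alg g =
     (if is_A2even g
      then \<lparr> rk = rk g,
             cm = (\<lambda>i j. if i > rk g \<or> j > rk g then 0 else cm g (rk g - j) (rk g - i)) \<rparr>
      else plain_transpose g)"

text \<open>The labels: the positive coprime integers with \<open>A a = 0\<close>.\<close>

definition label :: "affine \<Rightarrow> nat \<Rightarrow> nat" where
  "label g = (THE a. (\<forall>i > rk g. a i = 0) \<and> (\<forall>i \<le> rk g. 0 < a i) \<and> Gcd (a ` {..rk g}) = 1 \<and>
                (\<forall>i \<le> rk g. (\<Sum>j\<le>rk g. cm g i j * int (a j)) = 0))"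

definition colabel :: "affine \<Rightarrow> nat \<Rightarrow> nat" where
  "colabel g = label (plain_transpose g)"

definition coxeter :: "affine \<Rightarrow> nat" where
  "coxeter g = (\<Sum>i\<le>rk g. label g i)"

definition dual_coxeter :: "affine \<Rightarrow> nat" where
  "dual_coxeter g = (\<Sum>i\<le>rk g. colabel g i)"


section \<open>The space \<open>\<hh>\<^sup>*\<close>\<close>

text \<open>Pointwise scalar multiplication, used both on \<open>\<hh>\<^sup>*\<close> and on functions on \<open>\<hh>\<close>.\<close>

definition scl :: "complex \<Rightarrow> ('a \<Rightarrow> complex) \<Rightarrow> 'a \<Rightarrow> complex" (infixr "*\<^sub>s" 75) where
  "c *\<^sub>s f = (\<lambda>x. c * f x)"

global_interpretation cfun: vector_space "scl :: complex \<Rightarrow> ('a \<Rightarrow> complex) \<Rightarrow> 'a \<Rightarrow> complex"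
  by unfold_locales (auto simp: scl_def fun_eq_iff algebra_simps)

text \<open>
  An element of \<open>\<hh>\<^sup>*\<close> is its coordinate vector in the basis \<open>\<alpha>\<^sub>0, \<dots>, \<alpha>\<^sub>\<ell>, \<Lambda>\<^sub>0\<close>, indexed by
  \<open>0, \<dots>, \<ell>, \<ell> + 1\<close>. Since the form identifies \<open>\<hh>\<close> with \<open>\<hh>\<^sup>*\<close>, elements of \<open>\<hh>\<close> are
  represented by the same vectors.
\<close>

type_synonym vec = "nat \<Rightarrow> complex"

definition hdual :: "affine \<Rightarrow> vec set" where
  "hdual g = {x. \<forall>i > Suc (rk g). x i = 0}"

definition unit_vec :: "nat \<Rightarrow> vec" where
  "unit_vec i = (\<lambda>j. if j = i then 1 else 0)"

abbreviation sroot :: "nat \<Rightarrow> vec" where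
  "sroot i \<equiv> unit_vec i"

definition Lambda0 :: "affine \<Rightarrow> vec" where
  "Lambda0 g = unit_vec (Suc (rk g))"

definition delta :: "affine \<Rightarrow> vec" where
  "delta g = (\<Sum>i\<le>rk g. of_nat (label g i) *\<^sub>s sroot i)"

definition theta_root :: "affine \<Rightarrow> vec" where
  "theta_root g = delta g - of_nat (label g 0) *\<^sub>s sroot 0"

text \<open>The form, extended bilinearly from its values on the basis.\<close>

definition form :: "affine \<Rightarrow> vec \<Rightarrow> vec \<Rightarrow> complex" where
  "form g x y =
     (\<Sum>i\<le>rk g. \<Sum>j\<le>rk g.
        x i * y j * (of_nat (colabel g i) / of_nat (label g i) * of_int (cm g i j)))
     + (x 0 * y (Suc (rk g)) + x (Suc (rk g)) * y 0) / of_nat (label g 0)"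

text \<open>\<open>pairing g x i\<close> is \<open>\<langle>x, \<alpha>\<^sub>i\<^sup>\<or>\<rangle>\<close>, determined by \<open>\<langle>\<alpha>\<^sub>j, \<alpha>\<^sub>i\<^sup>\<or>\<rangle> = a\<^sub>i\<^sub>j\<close> and
  \<open>\<langle>\<Lambda>\<^sub>0, \<alpha>\<^sub>i\<^sup>\<or>\<rangle> = \<delta>\<^sub>0\<^sub>i\<close>.\<close>

definition pairing :: "affine \<Rightarrow> vec \<Rightarrow> nat \<Rightarrow> complex" where
  "pairing g x i =
     (\<Sum>j\<le>rk g. x j * of_int (cm g i j)) + (if i = 0 then x (Suc (rk g)) else 0)"

definition level :: "affine \<Rightarrow> vec \<Rightarrow> complex" where
  "level g x = (\<Sum>i\<le>rk g. of_nat (colabel g i) * pairing g x i)"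

text \<open>The projection along \<open>\<Lambda>\<^sub>0\<close> and \<open>\<delta>\<close> onto the span of \<open>\<alpha>\<^sub>1, \<dots>, \<alpha>\<^sub>\<ell>\<close>; it uses
  \<open>\<alpha>\<^sub>0 = a\<^sub>0\<^sup>-\<^sup>1 (\<delta> - a\<^sub>1\<alpha>\<^sub>1 - \<dots> - a\<^sub>\<ell>\<alpha>\<^sub>\<ell>)\<close>.\<close>

definition fin_part :: "affine \<Rightarrow> vec \<Rightarrow> vec" where
  "fin_part g x =
     (\<lambda>i. if 1 \<le> i \<and> i \<le> rk g then x i - x 0 * of_nat (label g i) / of_nat (label g 0) else 0)"

text \<open>The fundamental weights, normalised (as \<open>\<Lambda>\<^sub>0\<close> is) to have no \<open>\<delta>\<close>-component, i.e. to be
  orthogonal to \<open>\<Lambda>\<^sub>0\<close>.\<close>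

definition fund_weight :: "affine \<Rightarrow> nat \<Rightarrow> vec" where
  "fund_weight g i =
     (THE x. x \<in> hdual g \<and> (\<forall>j\<le>rk g. pairing g x j = (if j = i then 1 else 0)) \<and>
             form g x (Lambda0 g) = 0)"

definition rho :: "affine \<Rightarrow> vec" where
  "rho g = (\<Sum>i\<le>rk g. fund_weight g i)"

definition dominant_integral :: "affine \<Rightarrow> vec set" where
  "dominant_integral g = {x \<in> hdual g. \<forall>i\<le>rk g. pairing g x i \<in> \<nat>}"


section \<open>Finite Weyl group and lattice\<close>

definition simple_refl :: "affine \<Rightarrow> nat \<Rightarrow> vec \<Rightarrow> vec" where
  "simple_refl g i x = x - pairing g x i *\<^sub>s sroot i"

definition word :: "affine \<Rightarrow> nat list \<Rightarrow> vec \<Rightarrow> vec" where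
  "word g is = foldr (\<lambda>i w. simple_refl g i \<circ> w) is id"

definition finite_weyl :: "affine \<Rightarrow> (vec \<Rightarrow> vec) set" where
  "finite_weyl g = {word g is |is. set is \<subseteq> {1..rk g}}"

definition weyl_length :: "affine \<Rightarrow> (vec \<Rightarrow> vec) \<Rightarrow> nat" where
  "weyl_length g w = (LEAST n. \<exists>is. length is = n \<and> set is \<subseteq> {1..rk g} \<and> w = word g is)"

definition weyl_sign :: "affine \<Rightarrow> (vec \<Rightarrow> vec) \<Rightarrow> complex" where
  "weyl_sign g w = (-1) ^ weyl_length g w"

definition M_lattice :: "affine \<Rightarrow> vec set" where
  "M_lattice g =
     module.span (\<lambda>n::int. scl (of_int n))
       {w ((1 / of_nat (label g 0)) *\<^sub>s theta_root g) |w. w \<in> finite_weyl g}"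

definition transl :: "affine \<Rightarrow> vec \<Rightarrow> vec \<Rightarrow> vec" where
  "transl g \<alpha> x =
     x + level g x *\<^sub>s \<alpha> - (form g x \<alpha> + form g \<alpha> \<alpha> / 2 * level g x) *\<^sub>s delta g"


section \<open>Theta functions\<close>

text \<open>A function on \<open>Y\<close> is represented by its extension by 0 to all vectors.\<close>

type_synonym cfunc = "vec \<Rightarrow> complex"

definition Y_dom :: "affine \<Rightarrow> vec set" where
  "Y_dom g = {v \<in> hdual g. Re (form g v (delta g)) > 0}"

definition P_weights :: "affine \<Rightarrow> nat \<Rightarrow> vec set" where
  "P_weights g m =
     {x \<in> hdual g. level g x = of_nat m \<and> (\<forall>\<alpha>\<in>M_lattice g. form g x \<alpha> \<in> \<int>)}"

definition Theta :: "affine \<Rightarrow> nat \<Rightarrow> vec \<Rightarrow> cfunc" where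
  "Theta g m x =
     (\<lambda>v. if v \<in> Y_dom g
          then exp (- (form g x x / (2 * of_nat m)) * form g (delta g) v) *
               (\<Sum>\<^sub>\<infinity>\<alpha>\<in>M_lattice g. exp (form g (transl g \<alpha> x) v))
          else 0)"

definition Th :: "affine \<Rightarrow> nat \<Rightarrow> cfunc set" where
  "Th g m = cfun.span (Theta g m ` P_weights g m)"

definition A_fun :: "affine \<Rightarrow> nat \<Rightarrow> vec \<Rightarrow> cfunc" where
  "A_fun g m x = (\<Sum>w\<in>finite_weyl g. weyl_sign g w *\<^sub>s Theta g m (w x))"

definition Ch_minus :: "affine \<Rightarrow> nat \<Rightarrow> cfunc set" where
  "Ch_minus g k =
     cfun.span {A_fun g (k + dual_coxeter g) (x + rho g) |x.
                  x \<in> dominant_integral g \<and> level g x = of_nat k}"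


section \<open>Modular action\<close>

text \<open>
  \<open>point g \<sigma> z u = 2\<pi>i (z - \<sigma>\<Lambda>\<^sub>0 + u\<delta>)\<close>. The coordinates of \<open>v\<close> are recovered from
  \<open>(\<Lambda>\<^sub>0, \<delta>) = 1\<close>, \<open>(\<Lambda>\<^sub>0, \<Lambda>\<^sub>0) = (\<delta>, \<delta>) = 0\<close> and the orthogonality of \<open>\<Lambda>\<^sub>0, \<delta>\<close> to
  \<open>\<alpha>\<^sub>1, \<dots>, \<alpha>\<^sub>\<ell>\<close>.
\<close>

definition point :: "affine \<Rightarrow> complex \<Rightarrow> vec \<Rightarrow> complex \<Rightarrow> vec" where
  "point g \<sigma> z u = (2 * of_real pi * \<i>) *\<^sub>s (z - \<sigma> *\<^sub>s Lambda0 g + u *\<^sub>s delta g)"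

definition coord_sigma :: "affine \<Rightarrow> vec \<Rightarrow> complex" where
  "coord_sigma g v = - form g v (delta g) / (2 * of_real pi * \<i>)"

definition coord_z :: "affine \<Rightarrow> vec \<Rightarrow> vec" where
  "coord_z g v = (1 / (2 * of_real pi * \<i>)) *\<^sub>s fin_part g v"

definition coord_u :: "affine \<Rightarrow> vec \<Rightarrow> complex" where
  "coord_u g v = form g v (Lambda0 g) / (2 * of_real pi * \<i>)"

definition SL2Z :: "(int \<times> int \<times> int \<times> int) set" where
  "SL2Z = {(a, b, c, d). a * d - b * c = 1}"

definition S_mat :: "int \<times> int \<times> int \<times> int" where
  "S_mat = (0, -1, 1, 0)"

text \<open>
  \<open>slash g X f\<close> is \<open>f|\<^sub>X\<close>, with the principal branch chosen for \<open>j(\<sigma>) = \<surd>(c\<sigma> + d)\<close>; it is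
  holomorphic on the upper half plane. The other branch changes \<open>f|\<^sub>X\<close> at most by a sign.
\<close>

definition slash :: "affine \<Rightarrow> int \<times> int \<times> int \<times> int \<Rightarrow> cfunc \<Rightarrow> cfunc" where
  "slash g X f =
     (case X of (a, b, c, d) \<Rightarrow>
        (\<lambda>v. if v \<in> Y_dom g
             then let \<sigma> = coord_sigma g v; z = coord_z g v; u = coord_u g v;
                      q = of_int c * \<sigma> + of_int d
                  in f (point g ((of_int a * \<sigma> + of_int b) / q) ((1 / q) *\<^sub>s z)
                                (u - of_int c * form g z z / (2 * q)))
                     / csqrt q ^ rk g
             else 0))"


section \<open>Closure and Verlinde algebra\<close>

text \<open>Regular dominant weights modulo \<open>\<complex>\<delta>\<close>, each class represented by its unique element without
  \<open>\<delta>\<close>-component. The functions \<open>A\<^sub>\<mu>\<close> depend on the class only.\<close>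

definition regular_dominant :: "affine \<Rightarrow> nat \<Rightarrow> vec set" where
  "regular_dominant g m =
     {x \<in> P_weights g m. form g x (Lambda0 g) = 0 \<and>
        (\<forall>i\<le>rk g. pairing g x i \<in> \<real> \<and> 0 < Re (pairing g x i))}"

definition A_basis :: "affine \<Rightarrow> nat \<Rightarrow> vec set \<Rightarrow> cfunc set \<Rightarrow> bool" where
  "A_basis g m X V \<longleftrightarrow>
     X \<subseteq> regular_dominant g m \<and> inj_on (A_fun g m) X \<and>
     cfun.independent (A_fun g m ` X) \<and> cfun.span (A_fun g m ` X) = V"

definition sl2_closure :: "affine \<Rightarrow> nat \<Rightarrow> cfunc set" where
  "sl2_closure g k =
     (LEAST V. cfun.subspace V \<and> V \<subseteq> Th g (k + dual_coxeter g) \<and> Ch_minus g k \<subseteq> V \<and>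
               (\<forall>f\<in>V. slash g S_mat f \<in> V) \<and>
               (\<exists>X. A_basis g (k + dual_coxeter g) X V))"

definition weight_set :: "affine \<Rightarrow> nat \<Rightarrow> vec set" where
  "weight_set g k = (THE X. A_basis g (k + dual_coxeter g) X (sl2_closure g k))"

definition A_coeff :: "affine \<Rightarrow> nat \<Rightarrow> cfunc \<Rightarrow> vec \<Rightarrow> complex" where
  "A_coeff g k f x =
     cfun.representation (A_fun g (k + dual_coxeter g) ` weight_set g k) f
       (A_fun g (k + dual_coxeter g) x)"

definition S_entry :: "affine \<Rightarrow> nat \<Rightarrow> vec \<Rightarrow> vec \<Rightarrow> complex" where
  "S_entry g k x y = A_coeff g k (slash g S_mat (A_fun g (k + dual_coxeter g) x)) y"

definition S_inverse :: "affine \<Rightarrow> nat \<Rightarrow> vec \<Rightarrow> vec \<Rightarrow> complex" where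
  "S_inverse g k =
     (THE T. (\<forall>x y. x \<notin> weight_set g k \<or> y \<notin> weight_set g k \<longrightarrow> T x y = 0) \<and>
             (\<forall>x\<in>weight_set g k. \<forall>y\<in>weight_set g k.
                (\<Sum>p\<in>weight_set g k. S_entry g k x p * T p y) = (if x = y then 1 else 0)))"

text \<open>The weight called 0. The second case covers the untwisted types and \<open>A2even\<close>.\<close>

definition zero_weight :: "affine \<Rightarrow> nat \<Rightarrow> vec" where
  "zero_weight g k =
     (THE x. x \<in> weight_set g k \<and>
        fin_part g x =
          (if twisted g \<and> \<not> is_A2even g
           then \<Sum>i=1..rk g. (of_nat (label g i) / of_nat (colabel g i)) *\<^sub>s
                               fin_part g (fund_weight g i)
           else fin_part g (rho g)))"

definition fusion :: "affine \<Rightarrow> nat \<Rightarrow> vec \<Rightarrow> vec \<Rightarrow> vec \<Rightarrow> complex" where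
  "fusion g k x y n =
     (\<Sum>p\<in>weight_set g k.
        S_entry g k p x * S_entry g k p y * S_inverse g k n p / S_entry g k p (zero_weight g k))"

text \<open>The product on the space \<open>sl2_closure g k\<close> underlying the Verlinde algebra.\<close>

definition verlinde_mult :: "affine \<Rightarrow> nat \<Rightarrow> cfunc \<Rightarrow> cfunc \<Rightarrow> cfunc" where
  "verlinde_mult g k f f' =
     (\<Sum>x\<in>weight_set g k. \<Sum>y\<in>weight_set g k. \<Sum>n\<in>weight_set g k.
        (A_coeff g k f x * A_coeff g k f' y * fusion g k x y n) *\<^sub>s
          A_fun g (k + dual_coxeter g) n)"

definition linear_on :: "cfunc set \<Rightarrow> (cfunc \<Rightarrow> cfunc) \<Rightarrow> bool" where
  "linear_on V \<phi> \<longleftrightarrow>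
     (\<forall>f\<in>V. \<forall>f'\<in>V. \<phi> (f + f') = \<phi> f + \<phi> f') \<and> (\<forall>c. \<forall>f\<in>V. \<phi> (c *\<^sub>s f) = c *\<^sub>s \<phi> f)"

definition verlinde_iso :: "affine \<Rightarrow> nat \<Rightarrow> affine \<Rightarrow> nat \<Rightarrow> (cfunc \<Rightarrow> cfunc) \<Rightarrow> bool" where
  "verlinde_iso g k g' k' \<phi> \<longleftrightarrow>
     linear_on (sl2_closure g k) \<phi> \<and>
     bij_betw \<phi> (sl2_closure g k) (sl2_closure g' k') \<and>
     (\<forall>f\<in>sl2_closure g k. \<forall>f'\<in>sl2_closure g k.
        \<phi> (verlinde_mult g k f f') = verlinde_mult g' k' (\<phi> f) (\<phi> f'))"

text \<open>
  The closure is stable under \<open>S\<close> by definition, but in type \<open>A2even\<close> with \<open>k\<close> even (where the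
  lattice \<open>M\<close> and the level \<open>k + h\<^sup>\<or>\<close> are odd) it is not stable under \<open>\<sigma> \<mapsto> \<sigma> + 1\<close>. For
  \<open>\<phi> (f|\<^sub>X)\<close> to be meaningful for every \<open>X\<close>, the map \<open>\<phi>\<close> is required to be linear on the whole
  \<open>SL(2,\<int>)\<close>-module generated by the closure; in all other cases this module is the closure.
\<close>

definition sl2_module :: "affine \<Rightarrow> nat \<Rightarrow> cfunc set" where
  "sl2_module g k = cfun.span {slash g X f |X f. X \<in> SL2Z \<and> f \<in> sl2_closure g k}"

definition intertwines_up_to_scalar ::
  "affine \<Rightarrow> nat \<Rightarrow> affine \<Rightarrow> (cfunc \<Rightarrow> cfunc) \<Rightarrow> bool" where
  "intertwines_up_to_scalar g k g' \<phi> \<longleftrightarrow>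
     linear_on (sl2_module g k) \<phi> \<and>
     (\<forall>X\<in>SL2Z. \<exists>c. c \<noteq> 0 \<and>
        (\<forall>f\<in>sl2_closure g k. \<phi> (slash g X f) = c *\<^sub>s slash g' X (\<phi> f)))"

end

theory Submission
  imports Defs "HOL-Complex_Analysis.Complex_Analysis"
begin

text \<open>
  Let \<open>c\<^sub>i = a\<^sub>i\<^sup>\<or> / a\<^sub>i\<close>. Outside type \<open>A2even\<close> the linear map sending the simple root \<open>\<alpha>\<^sub>i\<close> of the
  transpose to \<open>c\<^sub>i\<^sup>-\<^sup>1 \<alpha>\<^sub>i\<close> is an isometry that preserves \<open>\<delta>\<close>, \<open>\<Lambda>\<^sub>0\<close>, the level, the finite
  Weyl group and the lattice \<open>M\<close>; composition with it carries theta functions to theta functions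
  and commutes with the modular action. It does not match the two spaces \<open>Ch\<^sup>-\<close>, only their
  closures. By Poisson summation \<open>S\<close> maps \<open>A\<^sub>\<mu>\<close> to a combination of all regular dominant \<open>A\<^sub>\<nu>\<close> with
  coefficients the alternating sums \<open>J(\<mu>, \<nu>) = \<Sum>\<^sub>w \<epsilon>(w) exp(-2\<pi>i (w\<mu>, \<nu>) / m)\<close>. For the weight
  with \<open>(\<mu>, \<alpha>\<^sub>i) = 1\<close> for all \<open>i \<ge> 1\<close> none of them vanishes, so a subspace that is stable under \<open>S\<close>, has
  a basis of functions \<open>A\<^sub>\<mu>\<close> and contains \<open>Ch\<^sup>-\<close> of either algebra is spanned by all regular
  dominant \<open>A\<^sub>\<mu>\<close>. Type \<open>A2even\<close> is isomorphic to its transpose and the identity works.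
\<close>

section \<open>Poisson summation in one variable\<close>

text \<open>The two algebras are compared at one level \<open>m\<close> of theta functions: the
  level \<open>k'\<close> of the transpose satisfies k' + h = k + h^v, and h is the dual Coxeter
  number of the transpose. The spaces \<open>Ch_minus\<close> differ because dominant integrality
  asks for integral \<open>pr x i\<close> on one side and integral \<open>c i * pr x i\<close> on
  the other, whereas \<open>P_weights\<close> sees only pairings with \<open>M\<close> and
  corresponds on both sides. \<open>LEAST\<close> requires a least admissible subspace; this is
  settled by showing that exactly one subspace is admissible. The weight with all (mu, alpha_i) = 1
  is both the identity weight prescribed for the twisted algebra and the finite part of rho of the
  transpose. By the denominator formula its alternating sums would be products of sines; a
  minimal-norm argument takes the place of that product. Poisson summation is needed for an
  arbitrary Gram matrix and is obtained by splitting off one coordinate at a time. Invertibility of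
  the S-matrix comes from the fourth power of S acting as a scalar.\<close>

text \<open>
  The roots of unity filter applied to \<open>(2 cosh)\<^sup>2\<^sup>m\<close> is a finite Poisson formula. Dividing by a
  central binomial coefficient and letting \<open>m\<close> grow turns both sides into Gaussian sums; this gives
  the formula for rational imaginary \<open>\<tau>\<close>, and the rest follows by the identity theorem.
\<close>

lemma tannery_infsum:
  fixes f :: "nat \<Rightarrow> 'a \<Rightarrow> complex"
  assumes lim: "\<And>x. x \<in> A \<Longrightarrow> (\<lambda>n. f n x) \<longlonglongrightarrow> g x"
    and bound: "\<And>n x. x \<in> A \<Longrightarrow> norm (f n x) \<le> M x"
    and M: "M summable_on A"
  shows "(\<lambda>n. \<Sum>\<^sub>\<infinity>x\<in>A. f n x) \<longlonglongrightarrow> (\<Sum>\<^sub>\<infinity>x\<in>A. g x)"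
proof -
  \<comment> \<open>The M-test makes the finite partial sums converge uniformly in \<open>n\<close>;
    this uniformity allows the limit over finite subsets and the limit in \<open>n\<close> to be
    interchanged.\<close>
  have ul: "uniform_limit UNIV (\<lambda>X n. \<Sum>x\<in>X. f n x) (\<lambda>n. \<Sum>\<^sub>\<infinity>x\<in>A. f n x) (finite_subsets_at_top A)"
    by (rule Weierstrass_m_test_general[where M = M]) (use bound M in auto)
  have bg: "norm (g x) \<le> M x" if "x \<in> A" for x
    by (rule tendsto_upperbound[OF tendsto_norm[OF lim[OF that]]]) (use bound that in auto)
  have "(\<lambda>x. norm (g x)) summable_on A"
    by (rule Infinite_Sum.abs_summable_on_comparison_test'[where g = M]) (use bg M in auto)
  hence g: "g summable_on A"
    by (rule abs_summable_summable)
  have sg: "((\<lambda>X. \<Sum>x\<in>X. g x) \<longlongrightarrow> (\<Sum>\<^sub>\<infinity>x\<in>A. g x)) (finite_subsets_at_top A)"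
    using has_sum_infsum[OF g] by (simp add: has_sum_def)
  show ?thesis
  proof (rule swap_uniform_limit'[where S = UNIV])
    show "\<forall>\<^sub>F X in finite_subsets_at_top A. ((\<lambda>n. \<Sum>x\<in>X. f n x) \<longlongrightarrow> (\<Sum>x\<in>X. g x)) sequentially"
      by (intro eventually_finite_subsets_at_top_weakI tendsto_sum) (use lim in auto)
  qed (use sg ul in auto)
qed

text \<open>Wallis' product up to \<open>n\<close> equals 16^n / (C(2n,n)^2 (2n+1)). The claim is
  the square root of its reciprocal times n/(2n+1), which tends to 1/2. It supplies the constant in
  the Poisson formula.\<close>

lemma central_binomial_limit:
  "(\<lambda>n. real ((2*n) choose n) / 4 ^ n * sqrt (real n)) \<longlonglongrightarrow> 1 / sqrt pi"
proof -
  have prod: "(\<Prod>k=1..n. (4*real k^2) / (4*real k^2 - 1)) = 16 ^ n / (real ((2*n) choose n) ^ 2 * (2 * real n + 1))" for n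
  proof (induction n)
    case (Suc n)
    have "Suc n * ((2 * Suc n) choose (Suc n)) = (2 * (2 * n + 1)) * ((2*n) choose n)"
    proof -
      have "Suc n * ((2 * Suc n) choose (Suc n)) = (2 * n + 2) * ((2*n+1) choose n)"
        using Suc_times_binomial_eq[of "2*n+1" n] by (simp add: mult.commute)
      also have "(2 * n + 2) * ((2*n+1) choose n) = 2 * (Suc n * ((2*n+1) choose (Suc n)))"
        using binomial_symmetric[of n "2*n+1"] by simp
      also have "Suc n * ((2*n+1) choose (Suc n)) = (2*n+1) * ((2*n) choose n)"
        using Suc_times_binomial_eq[of "2*n" n] by (simp add: mult.commute)
      finally show ?thesis by simp
    qed
    hence "real (Suc n * ((2 * Suc n) choose (Suc n))) = real ((2 * (2 * n + 1)) * ((2*n) choose n))"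
      by (rule arg_cong)
    hence c: "real ((2 * Suc n) choose (Suc n)) = 2 * (2 * real n + 1) * real ((2*n) choose n) / (real n + 1)"
      by (simp add: field_simps del: mult_Suc_right binomial_Suc_Suc)
    define B where "B = real ((2*n) choose n)"
    have B: "B > 0" unfolding B_def by simp
    have ind: "(\<Prod>k=1..Suc n. (4*real k^2) / (4*real k^2 - 1)) =
       16 ^ n / (B ^ 2 * (2 * real n + 1)) * ((4*real (Suc n)^2) / (4*real (Suc n)^2 - 1))"
      using Suc by (simp add: B_def)
    have f: "4*real (Suc n)^2 - 1 = (2 * real n + 1) * (2 * real n + 3)"
      by (simp add: power2_eq_square algebra_simps)
    have p: "2 * real n + 1 > 0" "2 * real n + 3 > 0" "real n + 1 > 0" by auto
    show ?case unfolding ind f c B_def[symmetric]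
      using B p by (simp add: divide_simps power2_eq_square) (simp add: algebra_simps)
  qed simp
  have w: "(\<lambda>n. 16 ^ n / (real ((2*n) choose n) ^ 2 * (2 * real n + 1))) \<longlonglongrightarrow> pi / 2"
    using wallis unfolding prod .
  have h: "(\<lambda>n. real n / (2 * real n + 1)) \<longlonglongrightarrow> 1 / 2" by real_asymp
  have "(\<lambda>n. sqrt (inverse (16 ^ n / (real ((2*n) choose n) ^ 2 * (2 * real n + 1))) * (real n / (2 * real n + 1))))
      \<longlonglongrightarrow> sqrt (inverse (pi/2) * (1/2))"
    by (intro tendsto_real_sqrt tendsto_mult tendsto_inverse w h) auto
  moreover have eq: "sqrt (inverse (16 ^ n / (real ((2*n) choose n) ^ 2 * (2 * real n + 1))) * (real n / (2 * real n + 1)))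
     = real ((2*n) choose n) / 4 ^ n * sqrt (real n)" for n
  proof -
    have e: "(4 ^ n) ^ 2 = (16 :: real) ^ n" by (simp add: power2_eq_square flip: power_mult_distrib)
    have D: "2 * real n + 1 \<noteq> 0" by linarith
    have "inverse (16 ^ n / (real ((2*n) choose n) ^ 2 * (2 * real n + 1))) * (real n / (2 * real n + 1))
       = (real ((2*n) choose n) / 4 ^ n)^2 * real n"
      using D by (simp add: power_divide e)
    thus ?thesis by (simp add: real_sqrt_mult)
  qed
  moreover have "sqrt (inverse (pi/2) * (1/2)) = 1 / sqrt pi" by (simp add: real_sqrt_divide)
  ultimately show ?thesis unfolding eq by metis
qed

text \<open>The quotient of the two binomials is the product of (m - v + i)/(m + i) over i = 1..v.
  Bounding the factors separately yields Gaussian bounds from both sides.\<close>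

lemma binomial_shift_ratio:
  assumes "v \<le> m"
  shows "real ((2*m) choose (m + v)) = real ((2*m) choose m) * (\<Prod>i=1..v. 1 - real v / real (m + i))"
proof -
  have *: "fact (m + k) = (fact m :: real) * (\<Prod>i=1..k. real (m + i))" for m k :: nat
    by (induction k) (auto simp: algebra_simps)
  have pr: "(\<Prod>i=1..v. 1 - real v / real (m + i)) = (\<Prod>i=1..v. real (m - v + i)) / (\<Prod>i=1..v. real (m + i))"
    unfolding prod_dividef[symmetric] using assms
    by (intro prod.cong) (auto simp: field_simps of_nat_diff)
  have a: "fact m = (fact (m - v) :: real) * (\<Prod>i=1..v. real (m - v + i))"
    using *[of "m - v" v] assms by simp
  have "real ((2*m) choose (m + v)) = fact (2*m) / (fact (m + v) * fact (m - v))"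
    using binomial_fact[of "m+v" "2*m", where 'a = real] assms by simp
  also have "\<dots> = fact (2*m) / (fact m * fact m) * (fact m / fact (m - v) / (\<Prod>i=1..v. real (m + i)))"
    unfolding *[of m v] by simp
  also have "fact m / fact (m - v) = (\<Prod>i=1..v. real (m - v + i))"
    by (subst a) simp
  also have "fact (2*m) / (fact m * fact m) = real ((2*m) choose m)"
    using binomial_fact[of "m" "2*m", where 'a = real] by simp
  finally show ?thesis unfolding pr .
qed

text \<open>Each factor of the ratio has i <= v, so it is at most 1 - v/(m + v) <= exp(-v/(m + v));
  there are \<open>v\<close> of them.\<close>

lemma binomial_shift_upper:
  assumes "v \<le> m"
  shows "real ((2*m) choose (m + v)) \<le> real ((2*m) choose m) * exp (- (real v)\<^sup>2 / (real m + real v))"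
proof (cases "v = 0")
  case False
  have "(\<Prod>i=1..v. 1 - real v / real (m + i)) \<le> (\<Prod>i=1..v. exp (- real v / (real m + real v)))"
  proof (rule prod_mono, safe)
    fix i assume i: "i \<in> {1..v}"
    show "0 \<le> 1 - real v / real (m + i)" using i assms by (simp add: field_simps)
    have "real v / (real m + real v) \<le> real v / real (m + i)"
      using i by (intro divide_left_mono) auto
    hence "1 - real v / real (m + i) \<le> 1 + (- real v / (real m + real v))" by simp
    also have "\<dots> \<le> exp (- real v / (real m + real v))" by (rule exp_ge_add_one_self)
    finally show "1 - real v / real (m + i) \<le> exp (- real v / (real m + real v))" .
  qed
  also have "\<dots> = exp (- (real v)\<^sup>2 / (real m + real v))"
    by (simp add: power2_eq_square flip: exp_of_nat_mult)
  finally show ?thesis unfolding binomial_shift_ratio[OF assms] by (intro mult_left_mono) auto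
qed auto

text \<open>Each factor is at least 1 - x with x = v/(m + 1), and 1 - x >= exp(-x/(1 - x)), where
  x/(1 - x) = v/(m + 1 - v).\<close>

lemma binomial_shift_lower:
  assumes "v \<le> m"
  shows "real ((2*m) choose (m + v)) \<ge> real ((2*m) choose m) * exp (- (real v)\<^sup>2 / (real m + 1 - real v))"
proof (cases "v = 0")
  case False
  have "(\<Prod>i=1..v. 1 - real v / real (m + i)) \<ge> (\<Prod>i=1..v. exp (- real v / (real m + 1 - real v)))"
  proof (rule prod_mono, safe)
    fix i assume i: "i \<in> {1..v}"
    define x where "x = real v / (real m + 1)"
    have x: "0 \<le> x" "x < 1" using assms by (auto simp: x_def field_simps)
    have "real v / real (m + i) \<le> x"
      unfolding x_def using i by (intro divide_left_mono) auto
    moreover have "exp (- (x / (1 - x))) \<le> 1 - x"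
    proof -
      have "1 + x / (1 - x) \<le> exp (x / (1 - x))" by (rule exp_ge_add_one_self)
      hence "1 / (1 - x) \<le> exp (x / (1 - x))" using x by (simp add: field_simps)
      thus ?thesis using x by (simp add: exp_minus field_simps)
    qed
    moreover have "x / (1 - x) = real v / (real m + 1 - real v)"
    proof -
      have "1 - x = (real m + 1 - real v) / (real m + 1)" by (simp add: x_def field_simps)
      thus ?thesis by (simp add: x_def)
    qed
    ultimately show "exp (- real v / (real m + 1 - real v)) \<le> 1 - real v / real (m + i)" by simp
  qed auto
  also have "(\<Prod>i=1..v. exp (- real v / (real m + 1 - real v))) = exp (- (real v)\<^sup>2 / (real m + 1 - real v))"
    by (simp add: power2_eq_square flip: exp_of_nat_mult)
  finally show ?thesis unfolding binomial_shift_ratio[OF assms] by (intro mult_left_mono) auto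
qed auto

text \<open>With cosh w = 1 + 2 sinh(w/2)^2 the power is the exponential of n^2 Ln(1 + 2y), and 2
  n^2 y tends to z^2/2. For complex \<open>z\<close> this is read off from the derivatives of sinh w
  and Ln(1 + w) at 0.\<close>

lemma cosh_power_limit:
  fixes z :: complex
  shows "(\<lambda>n. cosh (z / of_nat n) ^ (n^2)) \<longlonglongrightarrow> exp (z^2 / 2)"
proof (cases "z = 0")
  case False
  define y where "y = (\<lambda>n. sinh (z / (2 * of_nat n)) ^ 2)"
  have ch: "cosh (z / of_nat n) = 1 + 2 * y n" for n
    using cosh_double_cosh[of "z / (2 * of_nat n)"] cosh_square_eq[of "z / (2 * of_nat n)"]
    by (simp add: y_def field_simps)
  have z0: "(\<lambda>n. z / (2 * of_nat n)) \<longlonglongrightarrow> 0"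
    by (rule tendsto_divide_0[OF tendsto_const]) 
       (intro tendsto_mult_filterlim_at_infinity[OF tendsto_const] tendsto_of_nat, auto)
  have "((\<lambda>w::complex. sinh w / w) \<longlongrightarrow> 1) (at 0)"
  proof -
    have "(sinh has_field_derivative cosh 0) (at (0::complex))"
      by (auto intro!: derivative_eq_intros)
    thus ?thesis by (simp add: has_field_derivative_iff)
  qed
  moreover have "filterlim (\<lambda>n. z / (2 * of_nat n)) (at 0) sequentially"
    using z0 False by (auto simp: filterlim_at eventually_sequentially intro!: exI[of _ 1])
  ultimately have s: "(\<lambda>n. sinh (z / (2 * of_nat n)) / (z / (2 * of_nat n))) \<longlonglongrightarrow> 1"
    by (rule filterlim_compose)
  have "(\<lambda>n. (sinh (z / (2 * of_nat n)) / (z / (2 * of_nat n)))^2 * (z^2/2)) \<longlonglongrightarrow> 1^2 * (z^2/2)"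
    by (intro tendsto_intros s)
  hence "(\<lambda>n. (sinh (z / (2 * of_nat n)) / (z / (2 * of_nat n)))^2 * (z^2/2)) \<longlonglongrightarrow> z^2/2" by simp
  hence yl: "(\<lambda>n. of_nat (n^2) * (2 * y n)) \<longlonglongrightarrow> z^2/2"
    by (rule Lim_transform_eventually)
       (use False in \<open>auto simp: eventually_sequentially y_def field_simps power2_eq_square intro!: exI[of _ 1]\<close>)
  have y0: "(\<lambda>n. 2 * y n) \<longlonglongrightarrow> 0"
  proof -
    have "(\<lambda>n. 2 * sinh (z / (2 * of_nat n)) ^ 2) \<longlonglongrightarrow> 2 * sinh 0 ^ 2"
      by (intro tendsto_intros z0)
    thus ?thesis by (simp add: y_def)
  qed
  \<comment> \<open>The quotient Ln(1 + w)/w tends to 1 through nonzero w only, so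
    \<open>y n\<close> has to be nonzero eventually; the nonzero limit of 2 n^2 y guarantees
    this.\<close>
  have ynz: "eventually (\<lambda>n. y n \<noteq> 0) sequentially"
  proof -
    have "eventually (\<lambda>n. of_nat (n^2) * (2 * y n) \<noteq> 0) sequentially"
      by (rule tendsto_imp_eventually_ne[OF yl]) (use False in auto)
    thus ?thesis by eventually_elim auto
  qed
  have "((\<lambda>w::complex. Ln (1 + w) / w) \<longlongrightarrow> 1) (at 0)"
  proof -
    have "((\<lambda>w. Ln (1 + w)) has_field_derivative 1) (at (0::complex))"
      by (auto intro!: derivative_eq_intros)
    thus ?thesis by (simp add: has_field_derivative_iff)
  qed
  moreover have "filterlim (\<lambda>n. 2 * y n) (at 0) sequentially"
    using y0 ynz by (auto simp: filterlim_at)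
  ultimately have l: "(\<lambda>n. Ln (1 + 2 * y n) / (2 * y n)) \<longlonglongrightarrow> 1"
    by (rule filterlim_compose)
  have "(\<lambda>n. exp (of_nat (n^2) * (2 * y n) * (Ln (1 + 2 * y n) / (2 * y n)))) \<longlonglongrightarrow> exp (z^2/2 * 1)"
    by (intro tendsto_intros l yl)
  moreover have "eventually (\<lambda>n. 1 + 2 * y n \<noteq> 0) sequentially"
    by (rule tendsto_imp_eventually_ne[of _ 1]) (use tendsto_add[OF tendsto_const[of 1] y0] in auto)
  hence "eventually (\<lambda>n. exp (of_nat (n^2) * (2 * y n) * (Ln (1 + 2 * y n) / (2 * y n))) = cosh (z / of_nat n) ^ (n^2)) sequentially"
    using ynz
  proof eventually_elim
    case (elim n)
    have "exp (of_nat (n^2) * (2 * y n) * (Ln (1 + 2 * y n) / (2 * y n))) = exp (of_nat (n^2) * Ln (1 + 2 * y n))"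
      using elim by simp
    also have "\<dots> = exp (Ln (1 + 2 * y n)) ^ (n^2)" by (rule exp_of_nat_mult)
    also have "\<dots> = cosh (z / of_nat n) ^ (n^2)" using elim by (simp add: ch)
    finally show ?case .
  qed
  ultimately show ?thesis by (simp add: Lim_transform_eventually)
qed auto

text \<open>A full period of \<open>L\<close> consecutive \<open>k\<close> is a geometric sum. The
  starting point \<open>a\<close> is free so that the period can later be centred at 0.\<close>

lemma roots_of_unity_filter:
  fixes L :: nat and v a :: int
  assumes "L > 0"
  shows "(\<Sum>k\<in>{a..<a + int L}. exp (2 * pi * \<i> * of_int k * of_int v / of_nat L))
       = (if int L dvd v then of_nat L else 0 :: complex)"
proof -
  define z where "z = exp (2 * pi * \<i> * of_int v / of_nat L)"
  have L0: "of_nat L \<noteq> (0::complex)" using assms by simp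
  have bij: "bij_betw (\<lambda>i::nat. a + int i) {..<L} {a..<a + int L}"
    by (rule bij_betwI[where g = "\<lambda>k. nat (k - a)"]) auto
  have e: "exp (2 * pi * \<i> * of_int (a + int i) * of_int v / of_nat L) =
      exp (2 * pi * \<i> * of_int a * of_int v / of_nat L) * z ^ i" for i
    unfolding z_def by (simp add: ring_distribs add_divide_distrib exp_add algebra_simps flip: exp_of_nat_mult)
  have "(\<Sum>k\<in>{a..<a + int L}. exp (2 * pi * \<i> * of_int k * of_int v / of_nat L))
      = (\<Sum>i<L. exp (2 * pi * \<i> * of_int (a + int i) * of_int v / of_nat L))"
    by (rule sum.reindex_bij_betw[OF bij, symmetric])
  also have "\<dots> = exp (2 * pi * \<i> * of_int a * of_int v / of_nat L) * (\<Sum>i<L. z ^ i)"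
    unfolding e sum_distrib_left ..
  finally have s: "(\<Sum>k\<in>{a..<a + int L}. exp (2 * pi * \<i> * of_int k * of_int v / of_nat L))
      = exp (2 * pi * \<i> * of_int a * of_int v / of_nat L) * (\<Sum>i<L. z ^ i)" .
  have z1: "z = 1 \<longleftrightarrow> int L dvd v"
  proof -
    have "z = 1 \<longleftrightarrow> (\<exists>n::int. 2 * pi * real_of_int v / real L = of_int (2 * n) * pi)"
      by (simp add: z_def exp_eq_1)
    also have "\<dots> \<longleftrightarrow> (\<exists>n::int. real_of_int v = real_of_int (int L * n))"
      using assms by (simp add: field_simps)
    also have "\<dots> \<longleftrightarrow> int L dvd v" unfolding of_int_eq_iff by (auto simp: dvd_def)
    finally show ?thesis .
  qed
  show ?thesis
  proof (cases "int L dvd v")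
    case True
    then obtain n where v: "v = int L * n" by (auto simp: dvd_def)
    have "exp (2 * pi * \<i> * of_int a * of_int v / of_nat L) = exp (of_int (2 * (a * n)) * pi * \<i>)"
      using L0 by (intro arg_cong[where f = exp]) (simp add: v field_simps)
    also have "\<dots> = 1" unfolding exp_eq_1 by (auto intro!: exI[of _ "a * n"])
    finally show ?thesis using True z1 unfolding s by simp
  next
    case False
    have "z ^ L = exp (of_nat L * (2 * pi * \<i> * of_int v / of_nat L))"
      by (simp only: z_def exp_of_nat_mult)
    also have "of_nat L * (2 * pi * \<i> * of_int v / of_nat L) = of_int (2 * v) * pi * \<i>"
      using L0 by simp
    also have "exp \<dots> = 1" unfolding exp_eq_1 by (auto intro!: exI[of _ v])
    finally show ?thesis using False z1 unfolding s by (simp add: geometric_sum)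
  qed
qed

text \<open>The binomial theorem for exp x + exp(-x), indexed by the displacement \<open>v\<close>
  from the middle term; the symmetry of the coefficients allows the absolute value.\<close>

lemma binomial_cosh_expansion:
  fixes x :: complex
  shows "(2 * cosh x) ^ (2 * m) = (\<Sum>v\<in>{- int m..int m}. of_nat ((2*m) choose (m + nat \<bar>v\<bar>)) * exp (2 * of_int v * x))"
proof -
  have bij: "bij_betw (\<lambda>i::nat. int i - int m) {..2*m} {- int m..int m}"
    by (rule bij_betwI[where g = "\<lambda>k. nat (k + int m)"]) auto
  have "2 * cosh x = exp x + exp (-x)" by (simp add: cosh_field_def field_simps)
  hence "(2 * cosh x) ^ (2 * m) = (exp x + exp (-x)) ^ (2*m)" by simp
  also have "\<dots> = (\<Sum>i\<le>2*m. of_nat ((2*m) choose i) * exp x ^ i * exp (-x) ^ (2*m - i))"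
    by (rule binomial_ring)
  also have "\<dots> = (\<Sum>i\<le>2*m. of_nat ((2*m) choose (m + nat \<bar>int i - int m\<bar>)) * exp (2 * of_int (int i - int m) * x))"
  proof (intro sum.cong refl)
    fix i assume i': "i \<in> {..2*m}"
    hence i: "i \<le> 2*m" by simp
    have "exp x ^ i * exp (-x) ^ (2*m - i) = exp (of_nat i * x + of_nat (2*m - i) * (-x))"
      unfolding exp_add exp_of_nat_mult ..
    also have "of_nat i * x + of_nat (2*m - i) * (-x) = 2 * of_int (int i - int m) * x"
      using i by (simp add: of_nat_diff algebra_simps)
    finally have e: "exp x ^ i * exp (-x) ^ (2*m - i) = exp (2 * of_int (int i - int m) * x)" .
    have "(2*m) choose i = (2*m) choose (m + nat \<bar>int i - int m\<bar>)"
    proof (cases "i \<ge> m")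
      case False
      hence "m + nat \<bar>int i - int m\<bar> = 2 * m - i" by auto
      thus ?thesis using binomial_symmetric[of i "2*m"] i by metis
    qed (simp add: nat_diff_distrib)
    thus "of_nat ((2*m) choose i) * exp x ^ i * exp (-x) ^ (2*m - i) =
      of_nat ((2*m) choose (m + nat \<bar>int i - int m\<bar>)) * exp (2 * of_int (int i - int m) * x)"
      using e by (simp add: mult.assoc)
  qed
  also have "\<dots> = (\<Sum>v\<in>{- int m..int m}. of_nat ((2*m) choose (m + nat \<bar>v\<bar>)) * exp (2 * of_int v * x))"
    by (rule sum.reindex_bij_betw[OF bij])
  finally show ?thesis .
qed

text \<open>The filter keeps the frequencies v = L j of the binomial expansion, which is Poisson
  summation on a cyclic group. The finite right-hand side is written as an infinite sum so that
  dominated convergence applies to it directly.\<close>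

lemma cosh_power_sum:
  fixes s :: complex and L m :: nat and a :: int
  assumes "L > 0"
  shows "(\<Sum>k\<in>{a..<a + int L}. (2 * cosh ((s + 2 * pi * \<i> * of_int k) / (2 * of_nat L))) ^ (2 * m))
       = (\<Sum>\<^sub>\<infinity>j\<in>UNIV. of_nat (L * ((2*m) choose (m + L * nat \<bar>j\<bar>))) * exp (of_int j * s))"
proof -
  have L0: "of_nat L \<noteq> (0::complex)" using assms by simp
  let ?c = "\<lambda>v::int. of_nat ((2*m) choose (m + nat \<bar>v\<bar>)) :: complex"
  have "(\<Sum>k\<in>{a..<a + int L}. (2 * cosh ((s + 2 * pi * \<i> * of_int k) / (2 * of_nat L))) ^ (2 * m))
     = (\<Sum>k\<in>{a..<a + int L}. \<Sum>v\<in>{- int m..int m}. ?c v * exp (of_int v * s / of_nat L) *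
           exp (2 * pi * \<i> * of_int k * of_int v / of_nat L))"
  proof -
    have "2 * of_int v * ((s + 2 * pi * \<i> * of_int k) / (2 * of_nat L)) =
      of_int v * s / of_nat L + 2 * pi * \<i> * of_int k * of_int v / of_nat L" for k v :: int
    proof -
      have "2 * of_int v * ((s + 2 * pi * \<i> * of_int k) / (2 * of_nat L))
        = of_int v * (s + 2 * pi * \<i> * of_int k) / of_nat L" by simp
      also have "\<dots> = of_int v * s / of_nat L + 2 * pi * \<i> * of_int k * of_int v / of_nat L"
        by (simp add: ring_distribs add_divide_distrib mult_ac)
      finally show ?thesis .
    qed
    thus ?thesis unfolding binomial_cosh_expansion by (simp add: exp_add mult.assoc)
  qed
  also have "\<dots> = (\<Sum>v\<in>{- int m..int m}. ?c v * exp (of_int v * s / of_nat L) * (if int L dvd v then of_nat L else 0))"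
    by (subst sum.swap) (simp only: sum_distrib_left[symmetric] roots_of_unity_filter[OF assms])
  also have "\<dots> = (\<Sum>v\<in>(\<lambda>j. int L * j) ` {j. \<bar>int L * j\<bar> \<le> int m}. ?c v * exp (of_int v * s / of_nat L) * of_nat L)"
    by (rule sum.mono_neutral_cong_right) (auto simp: dvd_def)
  also have "\<dots> = (\<Sum>j\<in>{j. \<bar>int L * j\<bar> \<le> int m}. of_nat (L * ((2*m) choose (m + L * nat \<bar>j\<bar>))) * exp (of_int j * s))"
    using assms L0 by (subst sum.reindex) (auto simp: inj_on_def abs_mult nat_mult_distrib intro!: sum.cong)
  also have "\<dots> = (\<Sum>\<^sub>\<infinity>j\<in>{j. \<bar>int L * j\<bar> \<le> int m}. of_nat (L * ((2*m) choose (m + L * nat \<bar>j\<bar>))) * exp (of_int j * s))"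
  proof (rule infsum_finite[symmetric])
    have "{j. \<bar>int L * j\<bar> \<le> int m} \<subseteq> {- int m..int m}"
    proof safe
      fix j assume j: "\<bar>int L * j\<bar> \<le> int m"
      have "1 * \<bar>j\<bar> \<le> int L * \<bar>j\<bar>" using assms by (intro mult_right_mono) auto
      thus "j \<in> {- int m..int m}" using j by (auto simp: abs_mult)
    qed
    thus "finite {j. \<bar>int L * j\<bar> \<le> int m}" by (rule finite_subset) auto
  qed
  also have "\<dots> = (\<Sum>\<^sub>\<infinity>j\<in>UNIV. of_nat (L * ((2*m) choose (m + L * nat \<bar>j\<bar>))) * exp (of_int j * s))"
  proof (rule infsum_cong_neutral)
    fix j assume "j \<in> UNIV - {j. \<bar>int L * j\<bar> \<le> int m}"
    hence "int L * \<bar>j\<bar> > int m" by (simp add: abs_mult)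
    hence "int (L * nat \<bar>j\<bar>) > int m" by simp
    hence "L * nat \<bar>j\<bar> > m" by linarith
    hence "(2*m) choose (m + L * nat \<bar>j\<bar>) = 0" by (intro binomial_eq_0) auto
    thus "of_nat (L * ((2*m) choose (m + L * nat \<bar>j\<bar>))) * exp (of_int j * s) = 0" by simp
  qed auto
  finally show ?thesis .
qed

section \<open>Growth and summability estimates\<close>

lemma summable_exp_abs_int: "(\<lambda>k::int. exp (- \<bar>real_of_int k\<bar>)) summable_on UNIV"
proof -
  have g: "(\<lambda>n::nat. exp (- real n)) summable_on UNIV"
  proof -
    have "summable (\<lambda>n. exp (-1::real) ^ n)" by (rule summable_geometric) auto
    hence "summable (\<lambda>n::nat. exp (- real n))" by (simp flip: exp_of_nat_mult)
    thus ?thesis by (simp add: summable_on_UNIV_nonneg_real_iff)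
  qed
  have "(\<lambda>k::int. exp (- \<bar>real_of_int k\<bar>)) summable_on range int"
    by (subst summable_on_reindex) (use g in \<open>auto simp: o_def\<close>)
  moreover have "(\<lambda>k::int. exp (- \<bar>real_of_int k\<bar>)) summable_on range (\<lambda>n. - int n)"
    by (subst summable_on_reindex) (use g in \<open>auto simp: o_def inj_on_def\<close>)
  ultimately have "(\<lambda>k::int. exp (- \<bar>real_of_int k\<bar>)) summable_on (range int \<union> range (\<lambda>n. - int n))"
    by (rule summable_on_union)
  also have "range int \<union> range (\<lambda>n. - int n) = UNIV"
    by (auto simp: image_iff) (metis int_cases2)
  finally show ?thesis .
qed

lemma summable_gauss_int:
  fixes b c :: real
  assumes "c > 0"
  shows "(\<lambda>k::int. exp (b * \<bar>real_of_int k\<bar> - c * (real_of_int k)^2)) summable_on UNIV"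
proof -
  \<comment> \<open>Completing the square: the linear term together with an extra |x| is absorbed
    into the quadratic one at the cost of a constant.\<close>
  have le: "b * \<bar>x\<bar> - c * x^2 \<le> (b+1)^2/(4*c) - \<bar>x\<bar>" for x :: real
  proof -
    have "0 \<le> c * (\<bar>x\<bar> - (b+1)/(2*c))^2" using assms by simp
    also have "\<dots> = c * x^2 - (b+1) * \<bar>x\<bar> + (b+1)^2/(4*c)"
      using assms by (simp add: power2_eq_square field_simps)
    finally show ?thesis by (simp add: algebra_simps)
  qed
  have "(\<lambda>k::int. exp ((b+1)^2/(4*c)) * exp (- \<bar>real_of_int k\<bar>)) summable_on UNIV"
    by (intro summable_on_cmult_right summable_exp_abs_int)
  thus ?thesis
    by (rule summable_on_comparison_test) (use le in \<open>auto simp flip: exp_add\<close>)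
qed

text \<open>Splits the modulus into growth governed by the real part and decay governed by the
  imaginary part. In the application only the imaginary part depends on the summation index.\<close>

lemma cmod_cosh_squared: "cmod (cosh z) ^ 2 = 1 + sinh (Re z) ^ 2 - sin (Im z) ^ 2"
proof -
  have r: "Re (cosh z) = cosh (Re z) * cos (Im z)" "Im (cosh z) = sinh (Re z) * sin (Im z)"
    by (auto simp: cosh_field_def sinh_field_def Re_exp Im_exp field_simps)
  show ?thesis unfolding cmod_power2 r
    by (simp add: power_mult_distrib cosh_square_eq cos_squared_eq algebra_simps)
qed

text \<open>Monotonicity gives v cos v <= sin v; doubling the angle and cos(w/2)^2 >= 1/2 on the
  quarter period then give sin w >= w/2.\<close>

lemma sin_squared_lower:
  fixes u :: real
  assumes "\<bar>u\<bar> \<le> pi / 2"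
  shows "sin u ^ 2 \<ge> u^2 / 4"
proof -
  have *: "v * cos v \<le> sin v" if v: "0 \<le> v" "v \<le> pi" for v :: real
  proof -
    have "sin 0 - 0 * cos 0 \<le> sin v - v * cos v"
    proof (rule DERIV_nonneg_imp_nondecreasing[OF v(1)])
      fix x assume "0 \<le> x" "x \<le> v"
      hence "x * sin x \<ge> 0" using v by (intro mult_nonneg_nonneg sin_ge_zero) auto
      moreover have "((\<lambda>x. sin x - x * cos x) has_real_derivative x * sin x) (at x)"
        by (auto intro!: derivative_eq_intros)
      ultimately show "\<exists>y. ((\<lambda>x. sin x - x * cos x) has_real_derivative y) (at x) \<and> 0 \<le> y" by blast
    qed
    thus ?thesis by simp
  qed
  have **: "w / 2 \<le> sin w" if w: "0 \<le> w" "w \<le> pi/2" for w :: real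
  proof -
    have c: "cos (w/2) ^ 2 = (1 + cos w) / 2" using cos_double_cos[of "w/2"] by simp
    have "cos w \<ge> 0" using w by (intro cos_ge_zero) auto
    hence "w * (1/2) \<le> w * cos (w/2)^2" unfolding c using w by (intro mult_left_mono) auto
    also have "\<dots> = 2 * (w/2 * cos (w/2)) * cos (w/2)" by (simp add: power2_eq_square)
    also have "\<dots> \<le> 2 * sin (w/2) * cos (w/2)"
      using w by (intro mult_right_mono mult_left_mono *) (auto intro!: cos_ge_zero)
    also have "\<dots> = sin w" using sin_double[of "w/2"] by simp
    finally show ?thesis by simp
  qed
  have "\<bar>u\<bar> / 2 \<le> sin \<bar>u\<bar>" using assms by (intro **) auto
  hence "(\<bar>u\<bar> / 2)^2 \<le> sin \<bar>u\<bar> ^ 2" by (intro power_mono) auto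
  moreover have "sin \<bar>u\<bar> ^ 2 = sin u ^ 2" by (auto simp: abs_if)
  ultimately show ?thesis by (simp add: power_divide)
qed

text \<open>This is |sin u| <= |sin(u + v)| + |v|, squared. It separates the part \<open>u\<close>
  containing the summation index from the fixed perturbation \<open>v\<close> caused by Im
  s.\<close>

lemma sin_squared_shift: "sin (u + v) ^ 2 \<ge> sin u ^ 2 / 2 - (v::real)^2"
proof -
  have "\<bar>sin u\<bar> = \<bar>sin (u + v) * cos v - cos (u + v) * sin v\<bar>"
    using sin_diff[of "u+v" v] by simp
  also have "\<dots> \<le> \<bar>sin (u + v)\<bar> * 1 + 1 * \<bar>sin v\<bar>"
    unfolding abs_mult[symmetric]
    by (rule order_trans[OF abs_triangle_ineq4]) (unfold abs_mult, intro add_mono mult_mono, auto)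
  finally have "\<bar>sin u\<bar> \<le> \<bar>sin (u + v)\<bar> + \<bar>v\<bar>"
    using abs_sin_x_le_abs_x[of v] by simp
  hence "\<bar>sin u\<bar>^2 \<le> (\<bar>sin (u + v)\<bar> + \<bar>v\<bar>)^2" by (intro power_mono) auto
  also have "\<dots> \<le> 2 * \<bar>sin (u+v)\<bar>^2 + 2 * \<bar>v\<bar>^2"
    using zero_le_power2[of "\<bar>sin (u + v)\<bar> - \<bar>v\<bar>"] by (simp add: power2_eq_square algebra_simps)
  finally show ?thesis by simp
qed

text \<open>Both sides are limits of the two sides of \<open>cosh_power_sum\<close>, divided by 4^m,
  for a window length \<open>L\<close> and an exponent \<open>m\<close> with m/L^2 = t exactly. The
  form p/q^2 of \<open>t\<close> provides such integers of every size.\<close>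

lemma gauss_poisson_rational:
  fixes s :: complex and p q :: nat
  assumes p: "p > 0" and q: "q > 0"
  defines "t \<equiv> real p / real q ^ 2"
  shows "(\<Sum>\<^sub>\<infinity>k::int. exp (of_real t * (s + 2 * pi * \<i> * of_int k)^2 / 4)) =
         of_real (1 / sqrt (pi * t)) * (\<Sum>\<^sub>\<infinity>j::int. exp (- ((of_int j)\<^sup>2 / of_real t) + of_int j * s))"
proof -
  \<comment> \<open>The quotient m/L^2 equals p/q^2 for every \<open>n\<close>. The window
    \<open>K\<close> is centred, so every \<open>k\<close> belongs to it eventually, and |k| <= L/2
    inside it.\<close>
  define L where "L = (\<lambda>n. q * Suc n)"
  define m where "m = (\<lambda>n. p * (Suc n)^2)"
  define a where "a = (\<lambda>n. - int (L n div 2))"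
  define K where "K = (\<lambda>n. {a n..<a n + int (L n)})"
  define l where "l = (\<lambda>n k. if k \<in> K n then cosh ((s + 2 * pi * \<i> * of_int k) / (2 * of_nat (L n))) ^ (2 * m n) else 0)"
  define r where "r = (\<lambda>n j. of_nat (L n * ((2*m n) choose (m n + L n * nat \<bar>j\<bar>))) / 4 ^ m n * exp (of_int j * s))"
  have L0: "L n > 0" "m n > 0" for n using p q by (auto simp: L_def m_def)
  have t: "t > 0" using p q by (simp add: t_def)

  have eq: "(\<Sum>\<^sub>\<infinity>k. l n k) = (\<Sum>\<^sub>\<infinity>j. r n j)" for n
  proof -
    have "(\<Sum>\<^sub>\<infinity>k. l n k) = (\<Sum>\<^sub>\<infinity>k\<in>K n. l n k)"
      by (rule infsum_cong_neutral) (auto simp: l_def)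
    also have "\<dots> = (\<Sum>k\<in>K n. l n k)" by (rule infsum_finite) (simp add: K_def)
    also have "\<dots> = (\<Sum>k\<in>K n. (2 * cosh ((s + 2 * pi * \<i> * of_int k) / (2 * of_nat (L n)))) ^ (2 * m n)) / 4 ^ m n"
      by (simp add: l_def sum_divide_distrib power_mult_distrib power_mult)
    also have "\<dots> = (\<Sum>\<^sub>\<infinity>j. of_nat (L n * ((2*m n) choose (m n + L n * nat \<bar>j\<bar>))) * exp (of_int j * s)) / 4 ^ m n"
      unfolding K_def by (subst cosh_power_sum[OF L0(1)]) (rule refl)
    also have "\<dots> = (\<Sum>\<^sub>\<infinity>j. of_nat (L n * ((2*m n) choose (m n + L n * nat \<bar>j\<bar>))) * exp (of_int j * s) * inverse (4 ^ m n))"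
      unfolding divide_inverse by (rule infsum_cmult_left'[symmetric])
    also have "\<dots> = (\<Sum>\<^sub>\<infinity>j. r n j)" by (rule infsum_cong) (simp add: r_def field_simps)
    finally show ?thesis .
  qed

  have lim_l: "(\<lambda>n. l n k) \<longlonglongrightarrow> exp (of_real t * (s + 2 * pi * \<i> * of_int k)^2 / 4)" for k
  proof -
    define z where "z = (s + 2 * pi * \<i> * of_int k) / (2 * of_nat q)"
    have "(\<lambda>n. cosh (z / of_nat n) ^ (n^2)) \<longlonglongrightarrow> exp (z^2 / 2)" by (rule cosh_power_limit)
    hence "(\<lambda>n. (cosh (z / of_nat (Suc n)) ^ ((Suc n)^2)) ^ (2*p)) \<longlonglongrightarrow> exp (z^2 / 2) ^ (2*p)"
      by (intro tendsto_power) (rule LIMSEQ_Suc)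
    also have "exp (z^2 / 2) ^ (2*p) = exp (of_real t * (s + 2 * pi * \<i> * of_int k)^2 / 4)"
      using q unfolding exp_of_nat_mult[symmetric]
      by (intro arg_cong[where f = exp]) (simp add: z_def t_def power_divide power_mult_distrib)
    finally have "(\<lambda>n. (cosh (z / of_nat (Suc n)) ^ ((Suc n)^2)) ^ (2*p)) \<longlonglongrightarrow> exp (of_real t * (s + 2 * pi * \<i> * of_int k)^2 / 4)" .
    moreover have "eventually (\<lambda>n. (cosh (z / of_nat (Suc n)) ^ ((Suc n)^2)) ^ (2*p) = l n k) sequentially"
    proof (rule eventually_sequentiallyI[of "nat (2 * \<bar>k\<bar> + 2)"])
      fix n assume "n \<ge> nat (2 * \<bar>k\<bar> + 2)"
      hence "int n \<ge> 2 * \<bar>k\<bar> + 2" by simp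
      moreover have "L n \<ge> n" using q by (cases q) (auto simp: L_def)
      ultimately have "int (L n) \<ge> 2 * \<bar>k\<bar> + 2" by simp
      hence "k \<in> K n" by (auto simp: K_def a_def zdiv_int)
      thus "(cosh (z / of_nat (Suc n)) ^ ((Suc n)^2)) ^ (2*p) = l n k"
        by (simp add: l_def z_def L_def m_def mult_ac del: of_nat_Suc mult_Suc_right flip: power_mult)
    qed
    ultimately show ?thesis by (rule Lim_transform_eventually)
  qed

  \<comment> \<open>Since L = (q / sqrt p) sqrt m, the central coefficient converges by the central
    binomial limit along the subsequence \<open>m\<close>.\<close>
  have lim_r0: "(\<lambda>n. real (L n * ((2*m n) choose m n)) / 4 ^ m n) \<longlonglongrightarrow> 1 / sqrt (pi * t)"
  proof -
    have sub: "filterlim m at_top sequentially"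
    proof (rule filterlim_at_top_mono[OF filterlim_ident])
      show "\<forall>\<^sub>F n in sequentially. n \<le> m n"
      proof (rule always_eventually, rule allI)
        fix n :: nat
        have "n \<le> 1 * (Suc n)^2" by (simp add: power2_eq_square)
        also have "\<dots> \<le> m n" unfolding m_def using p by (intro mult_right_mono) auto
        finally show "n \<le> m n" .
      qed
    qed
    have "(\<lambda>n. real ((2*m n) choose (m n)) / 4 ^ (m n) * sqrt (real (m n)) * (real q / sqrt p)) \<longlonglongrightarrow> 1 / sqrt pi * (real q / sqrt p)"
      by (intro tendsto_mult tendsto_const filterlim_compose[OF central_binomial_limit sub])
    also have "1 / sqrt pi * (real q / sqrt p) = 1 / sqrt (pi * t)"
      using p q by (simp add: t_def real_sqrt_mult real_sqrt_divide)
    also have "(\<lambda>n. real ((2*m n) choose (m n)) / 4 ^ (m n) * sqrt (real (m n)) * (real q / sqrt p)) =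
        (\<lambda>n. real (L n * ((2*m n) choose m n)) / 4 ^ m n)"
      using p by (auto simp: m_def L_def real_sqrt_mult fun_eq_iff algebra_simps)
    finally show ?thesis .
  qed

  \<comment> \<open>The displacement is L v, and (L v)^2 / m = v^2 / t. The denominators m + L v and
    m + 1 - L v of the two bounds differ from \<open>m\<close> in lower order only, because
    \<open>m\<close> grows like L^2.\<close>
  have lim_ratio: "(\<lambda>n. real ((2*m n) choose (m n + L n * v)) / real ((2*m n) choose m n)) \<longlonglongrightarrow> exp (- ((real v)\<^sup>2 / t))" for v
  proof (rule tendsto_sandwich)
    have ev: "eventually (\<lambda>n. L n * v \<le> m n) sequentially"
    proof (rule eventually_sequentiallyI[of "q * v"])
      fix n assume "n \<ge> q * v"
      hence "q * v * Suc n \<le> 1 * Suc n * Suc n" by (intro mult_right_mono) auto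
      also have "\<dots> \<le> p * Suc n * Suc n" using p by (intro mult_right_mono) auto
      finally show "L n * v \<le> m n" by (simp add: L_def m_def power2_eq_square algebra_simps)
    qed
    show "eventually (\<lambda>n. real ((2*m n) choose (m n + L n * v)) / real ((2*m n) choose m n)
        \<le> exp (- (real (L n * v))\<^sup>2 / (real (m n) + real (L n * v)))) sequentially"
      using ev
    proof eventually_elim
      case (elim n)
      show ?case using binomial_shift_upper[OF elim] by (simp add: divide_le_eq mult.commute)
    qed
    show "eventually (\<lambda>n. exp (- (real (L n * v))\<^sup>2 / (real (m n) + 1 - real (L n * v)))
        \<le> real ((2*m n) choose (m n + L n * v)) / real ((2*m n) choose m n)) sequentially"
      using ev
    proof eventually_elim
      case (elim n)
      show ?case using binomial_shift_lower[OF elim] by (simp add: le_divide_eq mult.commute)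
    qed
    define P Q V where "P = real p" and "Q = real q" and "V = real v"
    have P: "P > 0" "Q > 0" "V \<ge> 0" "V = 0 \<or> V > 0" using p q by (auto simp: P_def Q_def V_def)
    have e: "- ((real v)\<^sup>2 / t) = - (Q * V)\<^sup>2 / P" using q by (simp add: t_def P_def Q_def V_def power_mult_distrib)
    have "(\<lambda>n. exp (- (Q * (real n + 1) * V)\<^sup>2 / (P * (real n + 1)^2 + Q * (real n + 1) * V))) \<longlonglongrightarrow> exp (- (Q * V)\<^sup>2 / P)"
      using P by (intro tendsto_exp) (elim disjE, simp, real_asymp simp: power2_eq_square divide_inverse)
    thus "(\<lambda>n. exp (- (real (L n * v))\<^sup>2 / (real (m n) + real (L n * v)))) \<longlonglongrightarrow> exp (- ((real v)\<^sup>2 / t))"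
      unfolding e by (simp add: P_def Q_def V_def L_def m_def algebra_simps)
    have "(\<lambda>n. exp (- (Q * (real n + 1) * V)\<^sup>2 / (P * (real n + 1)^2 + 1 - Q * (real n + 1) * V))) \<longlonglongrightarrow> exp (- (Q * V)\<^sup>2 / P)"
      using P by (intro tendsto_exp) (elim disjE, simp, real_asymp simp: power2_eq_square divide_inverse)
    thus "(\<lambda>n. exp (- (real (L n * v))\<^sup>2 / (real (m n) + 1 - real (L n * v)))) \<longlonglongrightarrow> exp (- ((real v)\<^sup>2 / t))"
      unfolding e by (simp add: P_def Q_def V_def L_def m_def algebra_simps)
  qed

  have lim_r: "(\<lambda>n. r n j) \<longlonglongrightarrow> of_real (1 / sqrt (pi * t)) * exp (- ((of_int j)\<^sup>2 / of_real t) + of_int j * s)" for j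
  proof -
    have "(\<lambda>n. complex_of_real (real (L n * ((2*m n) choose m n)) / 4 ^ m n *
          (real ((2*m n) choose (m n + L n * nat \<bar>j\<bar>)) / real ((2*m n) choose m n))) * exp (of_int j * s))
        \<longlonglongrightarrow> of_real (1 / sqrt (pi * t) * exp (- ((real (nat \<bar>j\<bar>))\<^sup>2 / t))) * exp (of_int j * s)"
      by (intro tendsto_intros tendsto_of_real lim_r0 lim_ratio)
    moreover have "complex_of_real (real (L n * ((2*m n) choose m n)) / 4 ^ m n *
          (real ((2*m n) choose (m n + L n * nat \<bar>j\<bar>)) / real ((2*m n) choose m n))) * exp (of_int j * s) = r n j" for n
      by (simp add: r_def)
    moreover have "of_real (1 / sqrt (pi * t) * exp (- ((real (nat \<bar>j\<bar>))\<^sup>2 / t))) * exp (of_int j * s) =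
       of_real (1 / sqrt (pi * t)) * exp (- ((of_int j)\<^sup>2 / of_real t) + of_int j * s)"
    proof -
      have "(real (nat \<bar>j\<bar>))\<^sup>2 = (real_of_int j)\<^sup>2" by simp
      hence "complex_of_real (exp (- ((real (nat \<bar>j\<bar>))\<^sup>2 / t))) = exp (of_real (- ((real_of_int j)\<^sup>2 / t)))"
        by (simp only: exp_of_real)
      also have "\<dots> = exp (- ((of_int j)\<^sup>2 / of_real t))" by simp
      finally show ?thesis unfolding exp_add of_real_mult by (simp only: mult.assoc)
    qed
    ultimately show ?thesis by (simp only:)
  qed

  define c1 where "c1 = real p * pi^2 / (8 * real q ^ 2)"
  \<comment> \<open>The real part of the cosh argument is of order 1/n and \<open>m\<close> is of
    order n^2, so m sinh(Re z)^2 stays bounded, with a bound that does not involve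
    \<open>k\<close>.\<close>
  obtain B where B: "\<And>n. real p * (real (Suc n))^2 * sinh (Re s / (2 * real q * real (Suc n)))^2 \<le> B"
  proof -
    define c where "c = Re s / (2 * real q)"
    have "(\<lambda>n. real n * ((exp (c / real n) - exp (- (c / real n))) / 2)) \<longlonglongrightarrow> c"
      by (cases c "0::real" rule: linorder_cases) (real_asymp | simp)+
    from tendsto_power[OF this, of 2]
    have "(\<lambda>n. (real n)^2 * ((exp (c / real n) - exp (- (c / real n))) / 2)^2) \<longlonglongrightarrow> c^2"
      by (simp only: power_mult_distrib)
    hence "(\<lambda>n. real p * ((real (Suc n))^2 * ((exp (c / real (Suc n)) - exp (- (c / real (Suc n)))) / 2)^2)) \<longlonglongrightarrow> real p * c^2"
      by (intro tendsto_mult tendsto_const) (rule LIMSEQ_Suc)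
    hence "Bseq (\<lambda>n. real p * ((real (Suc n))^2 * ((exp (c / real (Suc n)) - exp (- (c / real (Suc n)))) / 2)^2))"
      by (intro convergent_imp_Bseq convergentI)
    then obtain B where "\<And>n. norm (real p * ((real (Suc n))^2 * ((exp (c / real (Suc n)) - exp (- (c / real (Suc n)))) / 2)^2)) \<le> B"
      by (auto simp: Bseq_def)
    hence "\<And>n. real p * ((real (Suc n))^2 * ((exp (c / real (Suc n)) - exp (- (c / real (Suc n)))) / 2)^2) \<le> B"
      by (metis abs_le_D1 real_norm_def)
    thus ?thesis by (intro that[of B]) (simp add: sinh_field_def c_def mult.assoc)
  qed
  define C where "C = B + real p * (Im s)^2 / (4 * real q ^ 2)"
  have c1: "c1 > 0" using p q by (simp add: c1_def)
  have bound_l: "norm (l n k) \<le> exp C * exp (0 * \<bar>real_of_int k\<bar> - c1 * (real_of_int k)^2)" for n k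
  proof (cases "k \<in> K n")
    case True
    define N where "N = real (Suc n)"
    have N: "N > 0" by (simp add: N_def)
    have Q0: "real q > 0" using q by simp
    define z where "z = (s + 2 * pi * \<i> * of_int k) / (2 * of_nat (L n))"
    have Ln: "real (L n) = real q * N" by (simp add: L_def N_def algebra_simps)
    have zz: "z = (s + 2 * pi * \<i> * of_int k) / of_real (2 * real q * N)"
      unfolding z_def by (simp add: L_def N_def algebra_simps)
    have Re: "Re z = Re s / (2 * real q * N)" 
      unfolding zz Re_divide_of_real by simp
    have Im: "Im z = pi * of_int k / (real q * N) + Im s / (2 * real q * N)"
      unfolding zz Im_divide_of_real using Q0 N by (simp add: field_simps)
    \<comment> \<open>The centred window puts pi k / L into [-pi/2, pi/2], the range of
      \<open>sin_squared_lower\<close>.\<close>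
    have "\<bar>real_of_int k\<bar> \<le> real (L n) / 2"
    proof -
      have "2 * \<bar>k\<bar> \<le> int (L n)" using True by (auto simp: K_def a_def zdiv_int)
      hence "real_of_int (2 * \<bar>k\<bar>) \<le> real_of_int (int (L n))" by (subst of_int_le_iff)
      thus ?thesis by simp
    qed
    hence "pi * \<bar>real_of_int k\<bar> \<le> pi * (real q * N / 2)" unfolding Ln by (intro mult_left_mono) auto
    hence u: "\<bar>pi * of_int k / (real q * N)\<bar> \<le> pi / 2"
      using Q0 N by (simp add: abs_mult divide_le_eq mult_ac)
    have s1: "sin (Im z)^2 \<ge> (pi * of_int k / (real q * N))^2 / 8 - (Im s / (2 * real q * N))^2"
      using sin_squared_shift[of "pi * of_int k / (real q * N)" "Im s / (2 * real q * N)"] sin_squared_lower[OF u]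
      unfolding Im by linarith
    have "(cmod (cosh z) ^ 2) ^ (m n) \<le> exp (sinh (Re z)^2 - sin (Im z)^2) ^ (m n)"
      unfolding cmod_cosh_squared
    proof (intro power_mono)
      show "1 + (sinh (Re z))\<^sup>2 - (sin (Im z))\<^sup>2 \<le> exp ((sinh (Re z))\<^sup>2 - (sin (Im z))\<^sup>2)"
        using exp_ge_add_one_self[of "sinh (Re z)^2 - sin (Im z)^2"] by linarith
      show "0 \<le> 1 + (sinh (Re z))\<^sup>2 - (sin (Im z))\<^sup>2"
        using zero_le_power2[of "cmod (cosh z)"] unfolding cmod_cosh_squared .
    qed
    also have "\<dots> = exp (real (m n) * sinh (Re z)^2 - real (m n) * sin (Im z)^2)"
      by (simp add: algebra_simps flip: exp_of_nat_mult)
    also have "\<dots> \<le> exp (B - (c1 * (real_of_int k)^2 - real p * (Im s)^2 / (4 * real q ^ 2)))"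
    proof (subst exp_le_cancel_iff, rule diff_mono)
      show "real (m n) * sinh (Re z)^2 \<le> B"
        using B[of n] unfolding Re N_def by (simp add: m_def mult_ac)
      have "real p * N^2 * ((pi * of_int k / (real q * N))^2 / 8 - (Im s / (2 * real q * N))^2) \<le> real p * N^2 * sin (Im z)^2"
        by (intro mult_left_mono s1) auto
      also have "real p * N^2 * ((pi * of_int k / (real q * N))^2 / 8 - (Im s / (2 * real q * N))^2) =
          c1 * (real_of_int k)^2 - real p * (Im s)^2 / (4 * real q ^ 2)"
        using N Q0 by (simp add: c1_def field_simps power2_eq_square)
      also have "real p * N^2 = real (m n)" by (simp add: m_def N_def)
      finally show "c1 * (real_of_int k)^2 - real p * (Im s)^2 / (4 * real q ^ 2) \<le> real (m n) * sin (Im z)^2" .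
    qed
    also have "\<dots> = exp C * exp (0 * \<bar>real_of_int k\<bar> - c1 * (real_of_int k)^2)"
      by (simp add: C_def algebra_simps flip: exp_add)
    finally show ?thesis using True by (simp add: l_def z_def norm_power power_mult)
  qed (simp add: l_def)

  have LHS: "(\<lambda>n. \<Sum>\<^sub>\<infinity>k. l n k) \<longlonglongrightarrow> (\<Sum>\<^sub>\<infinity>k::int. exp (of_real t * (s + 2 * pi * \<i> * of_int k)^2 / 4))"
    by (rule tannery_infsum[OF lim_l bound_l]) (intro summable_on_cmult_right summable_gauss_int c1)

  obtain D where D: "\<And>n. real (L n * ((2*m n) choose m n)) / 4 ^ m n \<le> D"
    using convergent_imp_Bseq[OF convergentI[OF lim_r0]] by (auto simp: Bseq_def)
  \<comment> \<open>The binomial vanishes once L|j| exceeds \<open>m\<close>; otherwise m + L|j| <=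
    2m, and (L j)^2 / (2m) is \<open>c2\<close> times j^2.\<close>
  define c2 where "c2 = real q ^ 2 / (2 * real p)"
  have c2: "c2 > 0" using p q by (simp add: c2_def)
  have D0: "D \<ge> 0" by (rule order_trans[OF _ D[of 0]]) auto
  have bound_r: "norm (r n j) \<le> D * exp (cmod s * \<bar>real_of_int j\<bar> - c2 * (real_of_int j)^2)" for n j
  proof (cases "L n * nat \<bar>j\<bar> \<le> m n")
    case True
    define v where "v = L n * nat \<bar>j\<bar>"
    have "real ((2*m n) choose (m n + v)) \<le> real ((2*m n) choose m n) * exp (- (c2 * (real_of_int j)^2))"
    proof -
      have "real ((2*m n) choose (m n + v)) \<le> real ((2*m n) choose m n) * exp (- (real v)\<^sup>2 / (real (m n) + real v))"
        using True unfolding v_def by (rule binomial_shift_upper)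
      also have "\<dots> \<le> real ((2*m n) choose m n) * exp (- (c2 * (real_of_int j)^2))"
      proof (intro mult_left_mono, subst exp_le_cancel_iff)
        have "real v = real q * real (Suc n) * \<bar>real_of_int j\<bar>"
          by (simp add: v_def L_def del: of_nat_Suc mult_Suc_right)
        hence "c2 * (real_of_int j)^2 = (real v)\<^sup>2 / (2 * real (m n))"
          by (simp add: c2_def m_def power_mult_distrib del: of_nat_Suc)
        also have "\<dots> \<le> (real v)\<^sup>2 / (real (m n) + real v)"
          using True L0[of n] by (intro divide_left_mono) (auto simp: v_def simp flip: of_nat_mult)
        finally show "- (real v)\<^sup>2 / (real (m n) + real v) \<le> - (c2 * (real_of_int j)^2)" by simp
      qed auto
      finally show ?thesis .
    qed
    hence "real (L n) * real ((2*m n) choose (m n + v)) / 4 ^ m n \<le> real (L n) * (real ((2*m n) choose m n) * exp (- (c2 * (real_of_int j)^2))) / 4 ^ m n"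
      by (intro divide_right_mono mult_left_mono) auto
    also have "\<dots> = real (L n * ((2*m n) choose m n)) / 4 ^ m n * exp (- (c2 * (real_of_int j)^2))" by simp
    also have "\<dots> \<le> D * exp (- (c2 * (real_of_int j)^2))" by (intro mult_right_mono D) auto
    finally have 1: "real (L n) * real ((2*m n) choose (m n + v)) / 4 ^ m n \<le> D * exp (- (c2 * (real_of_int j)^2))" .
    have "norm (r n j) = real (L n) * real ((2*m n) choose (m n + v)) / 4 ^ m n * exp (Re (of_int j * s))"
      by (simp add: r_def v_def norm_mult norm_divide norm_power)
    also have "\<dots> \<le> (D * exp (- (c2 * (real_of_int j)^2))) * exp (cmod s * \<bar>real_of_int j\<bar>)"
    proof (intro mult_mono 1)
      have "Re (of_int j * s) \<le> cmod (of_int j * s)" by (rule complex_Re_le_cmod)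
      thus "exp (Re (of_int j * s)) \<le> exp (cmod s * \<bar>real_of_int j\<bar>)" by (simp add: norm_mult mult.commute)
    qed (use D0 in auto)
    also have "\<dots> = D * exp (cmod s * \<bar>real_of_int j\<bar> - c2 * (real_of_int j)^2)"
      by (simp add: exp_diff exp_minus field_simps)
    finally show ?thesis .
  next
    case False
    hence "(2*m n) choose (m n + L n * nat \<bar>j\<bar>) = 0" by (intro binomial_eq_0) auto
    hence "r n j = 0" unfolding r_def by (simp only: mult_0_right of_nat_0 div_0 mult_zero_left)
    thus ?thesis using D0 by simp
  qed
  have RHS: "(\<lambda>n. \<Sum>\<^sub>\<infinity>j. r n j) \<longlonglongrightarrow> (\<Sum>\<^sub>\<infinity>j::int. of_real (1 / sqrt (pi * t)) * exp (- ((of_int j)\<^sup>2 / of_real t) + of_int j * s))"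
    by (rule tannery_infsum[OF lim_r bound_r]) (intro summable_on_cmult_right summable_gauss_int c2)
  show ?thesis
    using LIMSEQ_unique[OF LHS RHS[folded eq]] by (simp only: infsum_cmult_right')
qed

section \<open>From rational parameters to the upper half plane\<close>

lemma norm_gauss_term:
  fixes T W :: complex
  shows "cmod (exp (pi * \<i> * T * (of_int n)^2 + 2 * pi * \<i> * W * of_int n))
    \<le> exp (2 * pi * cmod W * \<bar>real_of_int n\<bar> - pi * Im T * (real_of_int n)^2)"
proof -
  have "Re (pi * \<i> * T * (of_int n)^2 + 2 * pi * \<i> * W * of_int n) = - (2 * pi * (Im W * real_of_int n)) - pi * Im T * (real_of_int n)^2"
    by (simp add: algebra_simps flip: of_int_power)
  also have "- (2 * pi * (Im W * real_of_int n)) \<le> 2 * pi * (cmod W * \<bar>real_of_int n\<bar>)"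
  proof -
    have "- (Im W * real_of_int n) \<le> \<bar>Im W\<bar> * \<bar>real_of_int n\<bar>" by (metis abs_ge_minus_self abs_mult)
    also have "\<dots> \<le> cmod W * \<bar>real_of_int n\<bar>" by (intro mult_right_mono abs_Im_le_cmod) auto
    finally have "2 * pi * (- (Im W * real_of_int n)) \<le> 2 * pi * (cmod W * \<bar>real_of_int n\<bar>)"
      by (intro mult_left_mono) auto
    thus ?thesis by simp
  qed
  finally show ?thesis by (simp add: mult.assoc)
qed

lemma summable_gauss_term:
  fixes T W :: complex
  assumes "Im T > 0"
  shows "(\<lambda>n::int. cmod (exp (pi * \<i> * T * (of_int n)^2 + 2 * pi * \<i> * W * of_int n))) summable_on UNIV"
  using norm_gauss_term[of T _ W] assms
  by (intro Infinite_Sum.abs_summable_on_comparison_test'[OF summable_gauss_int[of "pi * Im T" "2 * pi * cmod W"]]) auto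

text \<open>Locally uniform convergence by the M-test on closed balls, where Im T is bounded below
  and |W| above. \<open>T\<close> and \<open>W\<close> are general holomorphic functions because one
  side of the Poisson formula has the parameters -1/tau and -w/tau.\<close>

lemma gauss_sum_holomorphic:
  assumes T: "T holomorphic_on S" and W: "W holomorphic_on S" and S: "open S"
    and pos: "\<And>z. z \<in> S \<Longrightarrow> Im (T z) > 0"
  shows "(\<lambda>z. \<Sum>\<^sub>\<infinity>n::int. exp (pi * \<i> * T z * (of_int n)^2 + 2 * pi * \<i> * W z * of_int n)) holomorphic_on S"
proof -
  let ?f = "\<lambda>n z. exp (pi * \<i> * T z * (of_int n)^2 + 2 * pi * \<i> * W z * of_int (n::int))"
  have "\<exists>e>0. (\<lambda>z. \<Sum>\<^sub>\<infinity>n. ?f n z) holomorphic_on ball z0 e" if z0: "z0 \<in> S" for z0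
  proof -
    obtain e where e: "e > 0" "cball z0 e \<subseteq> S" using S z0 open_contains_cball by blast
    have cont: "continuous_on (cball z0 e) T" "continuous_on (cball z0 e) W"
      using T W e(2) by (meson continuous_on_subset holomorphic_on_imp_continuous_on)+
    have ne: "cball z0 e \<noteq> {}" using e by auto
    obtain c where c: "c > 0" "\<And>z. z \<in> cball z0 e \<Longrightarrow> Im (T z) \<ge> c"
    proof -
      have "continuous_on (cball z0 e) (\<lambda>z. Im (T z))" by (intro continuous_intros cont)
      from continuous_attains_inf[OF compact_cball ne this]
      obtain x where "x \<in> cball z0 e" "\<And>y. y \<in> cball z0 e \<Longrightarrow> Im (T x) \<le> Im (T y)" by blast
      thus ?thesis using pos[of x] e by (intro that[of "Im (T x)"]) auto
    qed
    obtain B where B: "\<And>z. z \<in> cball z0 e \<Longrightarrow> cmod (W z) \<le> B"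
    proof -
      have "continuous_on (cball z0 e) (\<lambda>z. cmod (W z))" by (intro continuous_intros cont)
      from continuous_attains_sup[OF compact_cball ne this] show ?thesis using that by blast
    qed
    have bnd: "cmod (?f n z) \<le> exp (2 * pi * B * \<bar>real_of_int n\<bar> - pi * c * (real_of_int n)^2)" if z: "z \<in> cball z0 e" for n z
    proof -
      have "cmod (?f n z) \<le> exp (2 * pi * cmod (W z) * \<bar>real_of_int n\<bar> - pi * Im (T z) * (real_of_int n)^2)"
        by (rule norm_gauss_term)
      also have "\<dots> \<le> exp (2 * pi * B * \<bar>real_of_int n\<bar> - pi * c * (real_of_int n)^2)"
        by (subst exp_le_cancel_iff, intro diff_mono mult_right_mono mult_left_mono B c z) auto
      finally show ?thesis .
    qed
    have ul: "uniform_limit (cball z0 e) (\<lambda>X z. \<Sum>n\<in>X. ?f n z) (\<lambda>z. \<Sum>\<^sub>\<infinity>n. ?f n z) (finite_subsets_at_top UNIV)"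
      by (rule Weierstrass_m_test_general[OF bnd]) (use c in \<open>auto intro: summable_gauss_int\<close>)
    have hol: "?f n holomorphic_on cball z0 e" for n
      by (intro holomorphic_intros holomorphic_on_subset[OF T e(2)] holomorphic_on_subset[OF W e(2)])
    have "(\<lambda>z. \<Sum>\<^sub>\<infinity>n. ?f n z) holomorphic_on ball z0 e"
    proof (rule holomorphic_uniform_limit[OF _ ul])
      have "(\<lambda>z. \<Sum>n\<in>X. ?f n z) holomorphic_on cball z0 e" for X
        by (intro holomorphic_on_sum hol)
      thus "\<forall>\<^sub>F X in finite_subsets_at_top UNIV. continuous_on (cball z0 e) (\<lambda>z. \<Sum>n\<in>X. ?f n z) \<and>
          (\<lambda>z. \<Sum>n\<in>X. ?f n z) holomorphic_on ball z0 e"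
        by (intro always_eventually allI conjI holomorphic_on_imp_continuous_on)
           (auto intro: holomorphic_on_subset[OF _ ball_subset_cball])
    qed auto
    thus ?thesis using e by blast
  qed
  hence "(\<lambda>z. \<Sum>\<^sub>\<infinity>n. ?f n z) analytic_on S" by (simp add: analytic_on_def)
  thus ?thesis by (rule analytic_imp_holomorphic)
qed

lemma gauss_expand_square:
  fixes \<tau> w :: complex
  assumes "\<tau> \<noteq> 0"
  shows "exp (- (pi * \<i> * (of_int n + w)^2 / \<tau>)) =
    exp (- (pi * \<i> * w^2 / \<tau>)) * exp (pi * \<i> * (- (1 / \<tau>)) * (of_int n)^2 + 2 * pi * \<i> * (- (w / \<tau>)) * of_int n)"
  unfolding exp_add[symmetric] by (intro arg_cong[where f = exp]) (use assms in \<open>simp add: field_simps power2_eq_square\<close>)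

lemma Im_minus_inverse_pos: "Im \<tau> > 0 \<Longrightarrow> Im (- (1 / \<tau>)) > 0"
proof -
  assume a: "Im \<tau> > 0"
  hence "\<tau> \<noteq> 0" by auto
  moreover have "Im (- (1 / \<tau>)) = Im \<tau> / (cmod \<tau>)^2" by (simp add: Im_divide cmod_power2)
  ultimately show ?thesis using a by simp
qed

theorem gauss_poisson:
  fixes \<tau> w :: complex
  assumes "Im \<tau> > 0"
  shows "(\<Sum>\<^sub>\<infinity>n::int. exp (- (pi * \<i> * (of_int n + w)^2 / \<tau>))) =
         csqrt (- \<i> * \<tau>) * (\<Sum>\<^sub>\<infinity>k::int. exp (pi * \<i> * \<tau> * (of_int k)^2 + 2 * pi * \<i> * w * of_int k))"
proof -
  define S where "S = {z. Im z > 0}"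
  define F where "F = (\<lambda>\<tau>. exp (- (pi * \<i> * w^2 / \<tau>)) *
     (\<Sum>\<^sub>\<infinity>n::int. exp (pi * \<i> * (- (1 / \<tau>)) * (of_int n)^2 + 2 * pi * \<i> * (- (w / \<tau>)) * of_int n)) -
     csqrt (- \<i> * \<tau>) * (\<Sum>\<^sub>\<infinity>k::int. exp (pi * \<i> * \<tau> * (of_int k)^2 + 2 * pi * \<i> * w * of_int k)))"
  have S: "open S" "connected S"
    using convex_halfspace_Im_gt by (auto simp: S_def open_halfspace_Im_gt intro!: convex_connected)
  have S0: "z \<noteq> 0" if "z \<in> S" for z using that by (auto simp: S_def)
  have F: "F \<tau>' = (\<Sum>\<^sub>\<infinity>n::int. exp (- (pi * \<i> * (of_int n + w)^2 / \<tau>'))) -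
     csqrt (- \<i> * \<tau>') * (\<Sum>\<^sub>\<infinity>k::int. exp (pi * \<i> * \<tau>' * (of_int k)^2 + 2 * pi * \<i> * w * of_int k))" if "\<tau>' \<in> S" for \<tau>'
    unfolding F_def gauss_expand_square[OF S0[OF that]] infsum_cmult_right' ..
  have hol: "F holomorphic_on S"
    unfolding F_def
    by (intro holomorphic_intros gauss_sum_holomorphic S)
       (auto simp: S_def S0 complex_nonpos_Reals_iff Im_minus_inverse_pos[unfolded minus_divide_left] dest: Im_minus_inverse_pos)
  \<comment> \<open>These points are i/(pi t) with t = ((n+1)^2 + 1)/(n+1)^2, a parameter of the
    form p/q^2 that tends to 1 without attaining it; hence they accumulate at i/pi.\<close>
  define Y where "Y = (\<lambda>n::nat. \<i> * of_real (1 / (pi * (real ((Suc n)^2 + 1) / real (Suc n) ^ 2))))"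
  have FY: "F (Y n) = 0" for n
  proof -
    define t where "t = real ((Suc n)^2 + 1) / real (Suc n) ^ 2"
    have t: "t > 0" by (simp add: t_def add_pos_pos)
    have Y: "Y n = \<i> * of_real (1 / (pi * t))" by (simp add: Y_def t_def)
    have YS: "Y n \<in> S" using t by (simp add: S_def Y)
    have c: "csqrt (- \<i> * Y n) = of_real (1 / sqrt (pi * t))"
    proof -
      have "- \<i> * Y n = of_real (1 / (pi * t))" by (simp add: Y)
      thus ?thesis using t by (simp add: of_real_sqrt[symmetric] real_sqrt_divide del: of_real_divide)
    qed
    have "exp (- (pi * \<i> * (of_int k + w)^2 / Y n)) = exp (of_real t * (2 * pi * \<i> * w + 2 * pi * \<i> * of_int k)^2 / 4)" for k
      using t by (intro arg_cong[where f = exp]) (simp add: Y field_simps power2_eq_square)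
    moreover have "exp (pi * \<i> * Y n * (of_int k)^2 + 2 * pi * \<i> * w * of_int k) =
       exp (- ((of_int k)\<^sup>2 / of_real t) + of_int k * (2 * pi * \<i> * w))" for k
      using t by (intro arg_cong[where f = exp]) (simp add: Y field_simps power2_eq_square)
    ultimately show ?thesis
      using gauss_poisson_rational[of "(Suc n)^2 + 1" "Suc n" "2 * pi * \<i> * w"]
      unfolding F[OF YS] c t_def[symmetric] by simp
  qed
  have "F \<tau> = 0"
  proof (rule analytic_continuation[OF hol S])
    show "range Y \<subseteq> S" by (auto simp: Y_def S_def add_pos_pos)
    show "\<i> / pi \<in> S" by (simp add: S_def)
    show "(\<i> / pi) islimpt range Y"
      unfolding islimpt_sequential
    proof (intro exI[of _ Y] conjI allI)
      fix n
      have "Y n \<noteq> \<i> / pi"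
      proof
        assume "Y n = \<i> / pi"
        hence "Im (Y n) = Im (\<i> / pi)" by simp
        hence "1 / (pi * (real ((Suc n)^2 + 1) / real (Suc n) ^ 2)) = 1 / pi" by (simp add: Y_def)
        hence "real ((Suc n)^2 + 1) = real (Suc n) ^ 2" by (simp add: field_simps del: of_nat_Suc)
        thus False by simp
      qed
      thus "Y n \<in> range Y - {\<i> / pi}" by simp
    next
      have "(\<lambda>n. 1 / (pi * ((real n + 1)^2 + 1) / (real n + 1) ^ 2)) \<longlonglongrightarrow> 1 / pi"
        by (real_asymp simp: inverse_eq_divide)
      hence "(\<lambda>n. \<i> * of_real (1 / (pi * ((real n + 1)^2 + 1) / (real n + 1) ^ 2))) \<longlonglongrightarrow> \<i> * of_real (1 / pi)"
        by (rule tendsto_mult[OF tendsto_const tendsto_of_real])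
      thus "Y \<longlonglongrightarrow> \<i> / pi" by (simp add: Y_def[abs_def] algebra_simps)
    qed
  qed (use FY assms in \<open>auto simp: S_def\<close>)
  thus ?thesis using F[of \<tau>] assms by (simp add: S_def)
qed

section \<open>Poisson summation for lattices\<close>

text \<open>Integer vectors are extended by 0 outside the index set, so that adding an index is a
  function update and the sum over the new coordinate can be separated.\<close>

definition int_vecs :: "nat set \<Rightarrow> (nat \<Rightarrow> int) set" where
  "int_vecs S = {n. \<forall>i. i \<notin> S \<longrightarrow> n i = 0}"

lemma int_vecs_empty [simp]: "int_vecs {} = {\<lambda>_. 0}"
  by (auto simp: int_vecs_def)

lemma bij_betw_int_vecs_insert:
  assumes "a \<notin> S"
  shows "bij_betw (\<lambda>(n, k). n(a := k)) (int_vecs S \<times> UNIV) (int_vecs (insert a S))"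
  by (rule bij_betwI[where g = "\<lambda>n. (n(a := 0), n a)"])
     (use assms in \<open>auto simp: int_vecs_def fun_eq_iff\<close>)

lemma summable_on_product_nonneg:
  fixes f :: "'a \<Rightarrow> real" and g :: "'b \<Rightarrow> real"
  assumes "f summable_on A" "g summable_on B" "\<And>x. f x \<ge> 0" "\<And>y. g y \<ge> 0"
  shows "(\<lambda>(x, y). f x * g y) summable_on (A \<times> B)"
  by (rule summable_on_SigmaI[where g = "\<lambda>x. f x * infsum g B"])
     (use assms in \<open>auto intro!: has_sum_cmult_right has_sum_infsum summable_on_cmult_left\<close>)

lemma summable_gauss_vecs:
  fixes b c :: real
  assumes "finite S" "c > 0"
  shows "(\<lambda>n. exp (\<Sum>i\<in>S. b * \<bar>real_of_int (n i)\<bar> - c * (real_of_int (n i))^2)) summable_on int_vecs S"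
  using assms(1)
proof (induction S rule: finite_induct)
  case (insert a S)
  let ?h = "\<lambda>k::int. b * \<bar>real_of_int k\<bar> - c * (real_of_int k)^2"
  have "(\<lambda>(n, k). exp (\<Sum>i\<in>S. ?h (n i)) * exp (?h k)) summable_on (int_vecs S \<times> UNIV)"
    by (rule summable_on_product_nonneg[OF insert.IH summable_gauss_int[OF assms(2)]]) auto
  also have "?this \<longleftrightarrow> ((\<lambda>n. exp (\<Sum>i\<in>insert a S. ?h (n i))) \<circ> (\<lambda>(n, k). n(a := k))) summable_on (int_vecs S \<times> UNIV)"
  proof (rule summable_on_cong)
    fix x assume "x \<in> int_vecs S \<times> (UNIV :: int set)"
    have "(\<Sum>i\<in>S. ?h ((n(a := k)) i)) = (\<Sum>i\<in>S. ?h (n i))" for n :: "nat \<Rightarrow> int" and k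
      by (rule sum.cong) (use insert in auto)
    thus "(\<lambda>(n, k). exp (\<Sum>i\<in>S. ?h (n i)) * exp (?h k)) x = ((\<lambda>n. exp (\<Sum>i\<in>insert a S. ?h (n i))) \<circ> (\<lambda>(n, k). n(a := k))) x"
      using insert by (auto simp: exp_add mult.commute split: prod.splits)
  qed
  also have "\<dots> \<longleftrightarrow> ?case"
    unfolding o_def by (rule summable_on_reindex_bij_betw[OF bij_betw_int_vecs_insert[OF insert.hyps(2)]])
  finally show ?case .
qed auto

lemma summable_gauss_bound:
  fixes f :: "(nat \<Rightarrow> int) \<Rightarrow> complex"
  assumes "finite S" "c > 0"
    and "\<And>n. n \<in> int_vecs S \<Longrightarrow> cmod (f n) \<le> K * exp (\<Sum>i\<in>S. b * \<bar>real_of_int (n i)\<bar> - c * (real_of_int (n i))^2)"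
  shows "(\<lambda>n. cmod (f n)) summable_on int_vecs S"
  by (rule Infinite_Sum.abs_summable_on_comparison_test'[OF summable_on_cmult_right[OF summable_gauss_vecs[OF assms(1,2)]] assms(3)])

definition qf :: "nat set \<Rightarrow> (nat \<Rightarrow> nat \<Rightarrow> real) \<Rightarrow> (nat \<Rightarrow> complex) \<Rightarrow> complex" where
  "qf S G y = (\<Sum>i\<in>S. \<Sum>j\<in>S. of_real (G i j) * y i * y j)"

definition qfr :: "nat set \<Rightarrow> (nat \<Rightarrow> nat \<Rightarrow> real) \<Rightarrow> (nat \<Rightarrow> real) \<Rightarrow> real" where
  "qfr S G y = (\<Sum>i\<in>S. \<Sum>j\<in>S. G i j * y i * y j)"

lemma qf_of_real: "qf S G (\<lambda>i. of_real (y i)) = of_real (qfr S G y)"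
  by (simp add: qf_def qfr_def)

lemma qf_cong: "(\<And>i. i \<in> S \<Longrightarrow> y i = y' i) \<Longrightarrow> qf S G y = qf S G y'"
  unfolding qf_def by (intro sum.cong refl) auto

lemma qfr_cong: "(\<And>i. i \<in> S \<Longrightarrow> y i = y' i) \<Longrightarrow> qfr S G y = qfr S G y'"
  unfolding qfr_def by (intro sum.cong refl) auto

text \<open>Taking the sum of all |mu_j| as a common slope for every coordinate makes the bound a
  product of identical one-variable Gaussians.\<close>

lemma norm_exp_linear_quad_le:
  fixes z :: complex and \<mu> :: "nat \<Rightarrow> complex"
  assumes S: "finite S" and "T > 0" and q: "q \<ge> e * (\<Sum>i\<in>S. (real_of_int (n i))^2)"
  shows "cmod (exp (z + (\<Sum>i\<in>S. \<mu> i * of_int (n i)) - of_real (T * q)))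
     \<le> exp (Re z) * exp (\<Sum>i\<in>S. (\<Sum>j\<in>S. cmod (\<mu> j)) * \<bar>real_of_int (n i)\<bar> - T * e * (real_of_int (n i))^2)"
proof -
  have "Re (\<Sum>i\<in>S. \<mu> i * of_int (n i)) = (\<Sum>i\<in>S. Re (\<mu> i * of_int (n i)))" by simp
  also have "\<dots> \<le> (\<Sum>i\<in>S. (\<Sum>j\<in>S. cmod (\<mu> j)) * \<bar>real_of_int (n i)\<bar>)"
  proof (rule sum_mono)
    fix i assume i: "i \<in> S"
    have "Re (\<mu> i * of_int (n i)) \<le> cmod (\<mu> i * of_int (n i))" by (rule complex_Re_le_cmod)
    also have "\<dots> = cmod (\<mu> i) * \<bar>real_of_int (n i)\<bar>" by (simp add: norm_mult)
    also have "\<dots> \<le> (\<Sum>j\<in>S. cmod (\<mu> j)) * \<bar>real_of_int (n i)\<bar>"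
      using i S by (intro mult_right_mono member_le_sum) auto
    finally show "Re (\<mu> i * of_int (n i)) \<le> (\<Sum>j\<in>S. cmod (\<mu> j)) * \<bar>real_of_int (n i)\<bar>" .
  qed
  finally have 1: "Re (\<Sum>i\<in>S. \<mu> i * of_int (n i)) \<le> (\<Sum>i\<in>S. (\<Sum>j\<in>S. cmod (\<mu> j)) * \<bar>real_of_int (n i)\<bar>)" .
  have "T * (e * (\<Sum>i\<in>S. (real_of_int (n i))^2)) \<le> T * q" using assms by (intro mult_left_mono) auto
  hence 2: "(\<Sum>i\<in>S. T * e * (real_of_int (n i))^2) \<le> T * q" by (simp add: sum_distrib_left mult.assoc)
  show ?thesis using 1 2 by (simp add: sum_subtractf flip: exp_add)
qed

text \<open>The complex shift \<open>w\<close> contributes only terms that are linear in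
  \<open>n\<close>, so the real positive definite part still dominates.\<close>

lemma summable_lattice_gauss:
  fixes G :: "nat \<Rightarrow> nat \<Rightarrow> real" and w :: "nat \<Rightarrow> complex" and b :: "nat \<Rightarrow> complex"
  assumes S: "finite S" and e: "e > 0" and pd: "\<And>y. qfr S G y \<ge> e * (\<Sum>i\<in>S. (y i)^2)"
    and \<sigma>: "Im \<sigma> > 0"
  shows "(\<lambda>n. cmod (exp (pi * \<i> * \<sigma> * qf S G (\<lambda>i. of_int (n i) + w i) + 2 * pi * \<i> * (\<Sum>i\<in>S. b i * (of_int (n i) + w i)))))
    summable_on int_vecs S"
proof -
  define z where "z = pi * \<i> * \<sigma> * qf S G w + 2 * pi * \<i> * (\<Sum>i\<in>S. b i * w i)"
  define \<mu> where "\<mu> = (\<lambda>i. pi * \<i> * \<sigma> * (\<Sum>j\<in>S. of_real (G i j + G j i) * w j) + 2 * pi * \<i> * b i)"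
  have ex: "cmod (exp (pi * \<i> * \<sigma> * qf S G (\<lambda>i. of_int (n i) + w i) + 2 * pi * \<i> * (\<Sum>i\<in>S. b i * (of_int (n i) + w i))))
     = cmod (exp (z + (\<Sum>i\<in>S. \<mu> i * of_int (n i)) - of_real (pi * Im \<sigma> * qfr S G (\<lambda>i. of_int (n i)))))" for n :: "nat \<Rightarrow> int"
  proof -
    have q: "qf S G (\<lambda>i. of_int (n i) + w i) = of_real (qfr S G (\<lambda>i. of_int (n i))) +
        (\<Sum>i\<in>S. (\<Sum>j\<in>S. of_real (G i j + G j i) * w j) * of_int (n i)) + qf S G w"
    proof -
      have "qf S G (\<lambda>i. of_int (n i) + w i) =
        (\<Sum>i\<in>S. \<Sum>j\<in>S. of_real (G i j) * of_int (n i) * of_int (n j)) +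
        ((\<Sum>i\<in>S. \<Sum>j\<in>S. of_real (G i j) * of_int (n i) * w j) +
        (\<Sum>i\<in>S. \<Sum>j\<in>S. of_real (G i j) * w i * of_int (n j))) + qf S G w"
        unfolding qf_def by (simp add: algebra_simps sum.distrib)
      also have "(\<Sum>i\<in>S. \<Sum>j\<in>S. of_real (G i j) * w i * of_int (n j)) = (\<Sum>i\<in>S. \<Sum>j\<in>S. of_real (G j i) * w j * of_int (n i))"
        by (rule sum.swap)
      also have "(\<Sum>i\<in>S. \<Sum>j\<in>S. of_real (G i j) * of_int (n i) * w j) + \<dots> = (\<Sum>i\<in>S. (\<Sum>j\<in>S. of_real (G i j + G j i) * w j) * of_int (n i))"
        by (simp add: algebra_simps sum.distrib sum_distrib_right sum_distrib_left)
      finally show ?thesis by (simp add: qfr_def)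
    qed
    show ?thesis unfolding q norm_exp_eq_Re
      by (rule arg_cong[where f = exp])
         (simp add: z_def \<mu>_def algebra_simps sum.distrib sum_distrib_left)
  qed
  show ?thesis unfolding ex
    by (rule summable_gauss_bound[OF S _ norm_exp_linear_quad_le[OF S _ pd]])
       (use \<sigma> e in auto)
qed

text \<open>Completing the square turns the linear term into the shift omega - b tau on the left and
  into a shift of \<open>k\<close> by \<open>b\<close> on the right. Such linear terms arise when a
  lattice sum is treated one coordinate at a time.\<close>

lemma gauss_poisson_linear:
  fixes \<tau> \<omega> b :: complex
  assumes "Im \<tau> > 0"
  shows "(\<Sum>\<^sub>\<infinity>n::int. exp (- (pi * \<i> * (of_int n + \<omega>)^2 / \<tau>) + 2 * pi * \<i> * b * (of_int n + \<omega>))) =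
         csqrt (- \<i> * \<tau>) * (\<Sum>\<^sub>\<infinity>k::int. exp (pi * \<i> * \<tau> * (of_int k - b)^2 + 2 * pi * \<i> * \<omega> * of_int k))"
proof -
  have t0: "\<tau> \<noteq> 0" using assms by auto
  have "exp (- (pi * \<i> * (of_int n + \<omega>)^2 / \<tau>) + 2 * pi * \<i> * b * (of_int n + \<omega>)) =
    exp (pi * \<i> * \<tau> * b^2) * exp (- (pi * \<i> * (of_int n + (\<omega> - b * \<tau>))^2 / \<tau>))" for n :: int
    unfolding exp_add[symmetric]
    by (rule arg_cong[where f = exp]) (use t0 in \<open>simp add: field_simps power2_eq_square\<close>)
  moreover have "exp (pi * \<i> * \<tau> * (of_int k - b)^2 + 2 * pi * \<i> * \<omega> * of_int k) =
    exp (pi * \<i> * \<tau> * b^2) * exp (pi * \<i> * \<tau> * (of_int k)^2 + 2 * pi * \<i> * (\<omega> - b * \<tau>) * of_int k)" for k :: int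
    unfolding exp_add[symmetric]
    by (rule arg_cong[where f = exp]) (use t0 in \<open>simp add: field_simps power2_eq_square\<close>)
  ultimately show ?thesis
    by (simp only: infsum_cmult_right' gauss_poisson[OF assms] mult.left_commute)
qed

text \<open>The root of tau lies in the open first quadrant, and rotating it by -pi/4 keeps it in
  the right half plane, so no branch is crossed. The factor independent of tau can then be collected
  in one constant.\<close>

lemma csqrt_rotate:
  assumes "Im \<tau> > 0" "d > 0"
  shows "csqrt (- \<i> * (\<tau> / of_real d)) = csqrt (- \<i>) / of_real (sqrt d) * csqrt \<tau>"
proof -
  define c where "c = csqrt \<tau>"
  define h where "h = csqrt (- \<i>)"
  have c2: "c ^ 2 = \<tau>" and h2: "h ^ 2 = - \<i>" by (simp_all add: c_def h_def del: csqrt.simps)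
  have cp: "0 < Re c \<or> Re c = 0 \<and> 0 \<le> Im c" unfolding c_def by (rule csqrt_principal)
  have h: "Re h = sqrt (1/2)" "Im h = - sqrt (1/2)" by (simp_all add: h_def)
  have "2 * Re c * Im c = Im \<tau>" using c2 by (auto simp: Im_power2)
  hence r: "Re c > 0" "Im c > 0"
    using assms(1) cp by (auto simp: zero_less_mult_iff) (smt (verit) mult_nonneg_nonpos)+
  have "csqrt (- \<i> * (\<tau> / of_real d)) = h / of_real (sqrt d) * c"
  proof (rule csqrt_unique)
    have "of_real (sqrt d) ^ 2 = (of_real d :: complex)" using assms by (simp flip: of_real_power)
    thus "(h / of_real (sqrt d) * c)\<^sup>2 = - \<i> * (\<tau> / of_real d)"
      by (simp add: power_mult_distrib power_divide c2 h2)
    have "Re (h / of_real (sqrt d) * c) = Re (h * c) / sqrt d"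
      by (simp add: Re_divide_of_real Im_divide_of_real diff_divide_distrib)
    also have "Re (h * c) = sqrt (1/2) * (Re c + Im c)" by (simp add: h ring_distribs)
    also have "sqrt (1/2) * (Re c + Im c) / sqrt d > 0" using r assms by (intro mult_pos_pos divide_pos_pos) auto
    finally show "0 < Re (h / of_real (sqrt d) * c) \<or> Re (h / of_real (sqrt d) * c) = 0 \<and> 0 \<le> Im (h / of_real (sqrt d) * c)" by simp
  qed
  thus ?thesis by (simp only: c_def h_def)
qed

text \<open>If kappa = G beta, then |kappa|^2 is at most the squared Frobenius norm of
  \<open>G\<close> times |beta|^2; coercivity of \<open>G\<close> therefore bounds its inverse form
  from below.\<close>

lemma dual_form_bound:
  fixes G :: "nat \<Rightarrow> nat \<Rightarrow> real"
  assumes S: "finite S" and e: "e > 0" and pd: "\<And>y. qfr S G y \<ge> e * (\<Sum>i\<in>S. (y i)^2)"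
    and Qd: "\<And>\<beta>. Qd (\<lambda>i. \<Sum>j\<in>S. of_real (G i j) * \<beta> j) = qf S G \<beta>"
    and cong: "\<And>\<kappa> \<kappa>'. (\<And>i. i \<in> S \<Longrightarrow> \<kappa> i = \<kappa>' i) \<Longrightarrow> Qd \<kappa> = Qd \<kappa>'"
    and solv: "\<And>\<kappa>::nat \<Rightarrow> real. \<exists>\<beta>::nat \<Rightarrow> real. \<forall>i\<in>S. (\<Sum>j\<in>S. G i j * \<beta> j) = \<kappa> i"
  shows "\<exists>\<epsilon>>0. \<forall>\<kappa>::nat \<Rightarrow> real. \<exists>q. Qd (\<lambda>i. of_real (\<kappa> i)) = of_real q \<and> q \<ge> \<epsilon> * (\<Sum>i\<in>S. (\<kappa> i)^2)"
proof -
  define M where "M = (\<Sum>i\<in>S. \<Sum>j\<in>S. (G i j)^2) + 1"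
  have M: "M > 0" unfolding M_def by (intro add_nonneg_pos sum_nonneg) auto
  have "\<exists>q. Qd (\<lambda>i. of_real (\<kappa> i)) = of_real q \<and> q \<ge> e / M * (\<Sum>i\<in>S. (\<kappa> i)^2)" for \<kappa> :: "nat \<Rightarrow> real"
  proof -
    obtain \<beta> where \<beta>: "\<And>i. i \<in> S \<Longrightarrow> (\<Sum>j\<in>S. G i j * \<beta> j) = \<kappa> i" using solv[of \<kappa>] by blast
    have "Qd (\<lambda>i. of_real (\<kappa> i)) = Qd (\<lambda>i. \<Sum>j\<in>S. of_real (G i j) * of_real (\<beta> j))"
    proof (rule cong)
      fix i assume "i \<in> S"
      show "complex_of_real (\<kappa> i) = (\<Sum>j\<in>S. of_real (G i j) * of_real (\<beta> j))"
        unfolding \<beta>[OF \<open>i \<in> S\<close>, symmetric] by simp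
    qed
    also have "\<dots> = of_real (qfr S G \<beta>)" unfolding Qd qf_of_real ..
    finally have 1: "Qd (\<lambda>i. of_real (\<kappa> i)) = of_real (qfr S G \<beta>)" .
    have "(\<Sum>i\<in>S. (\<kappa> i)^2) \<le> (\<Sum>i\<in>S. (\<Sum>j\<in>S. (G i j)^2) * (\<Sum>j\<in>S. (\<beta> j)^2))"
      by (rule sum_mono) (simp add: \<beta>[symmetric] Cauchy_Schwarz_ineq_sum)
    also have "\<dots> \<le> M * (\<Sum>j\<in>S. (\<beta> j)^2)"
      unfolding sum_distrib_right[symmetric] by (intro mult_right_mono sum_nonneg) (auto simp: M_def)
    finally have "e / M * (\<Sum>i\<in>S. (\<kappa> i)^2) \<le> e / M * (M * (\<Sum>j\<in>S. (\<beta> j)^2))"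
      using e M by (intro mult_left_mono) auto
    also have "\<dots> = e * (\<Sum>j\<in>S. (\<beta> j)^2)" using M by simp
    also have "\<dots> \<le> qfr S G \<beta>" by (rule pd)
    finally show ?thesis using 1 by blast
  qed
  thus ?thesis using e M by (intro exI[of _ "e / M"]) auto
qed

text \<open>The lower bound on \<open>Qd\<close> is available at real vectors only, hence the real
  \<open>b\<close>. Removing the shift costs half of the constant through k^2 <= 2(k - b)^2 +
  2b^2.\<close>

lemma summable_dual_gauss:
  fixes w :: "nat \<Rightarrow> complex" and b :: "nat \<Rightarrow> real"
  assumes S: "finite S" and \<epsilon>: "\<epsilon> > 0"
    and Qd: "\<And>\<kappa>::nat \<Rightarrow> real. \<exists>q. Qd (\<lambda>i. of_real (\<kappa> i)) = of_real q \<and> q \<ge> \<epsilon> * (\<Sum>i\<in>S. (\<kappa> i)^2)"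
    and \<tau>: "Im \<tau> > 0"
  shows "(\<lambda>k. cmod (exp (pi * \<i> * \<tau> * Qd (\<lambda>i. of_int (k i) - of_real (b i)) + 2 * pi * \<i> * (\<Sum>i\<in>S. of_int (k i) * w i))))
     summable_on int_vecs S"
proof -
  define B where "B = \<epsilon> * (\<Sum>i\<in>S. (b i)^2)"
  define T where "T = pi * Im \<tau>"
  define \<mu> where "\<mu> = (\<lambda>i. 2 * pi * \<i> * w i)"
  have T: "T > 0" using \<tau> by (simp add: T_def)
  show ?thesis
  proof (rule summable_gauss_bound[OF S, of "T * (\<epsilon> / 2)"])
    fix k assume "k \<in> int_vecs S"
    obtain q where q: "Qd (\<lambda>i. of_real (real_of_int (k i) - b i)) = of_real q"
      "q \<ge> \<epsilon> * (\<Sum>i\<in>S. (real_of_int (k i) - b i)^2)"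
      using Qd[of "\<lambda>i. real_of_int (k i) - b i"] by blast
    have "\<epsilon> / 2 * (\<Sum>i\<in>S. (real_of_int (k i))^2) \<le> \<epsilon> / 2 * (\<Sum>i\<in>S. 2 * (real_of_int (k i) - b i)^2 + 2 * (b i)^2)"
    proof (intro mult_left_mono sum_mono)
      fix i
      show "(real_of_int (k i))^2 \<le> 2 * (real_of_int (k i) - b i)^2 + 2 * (b i)^2"
        using zero_le_power2[of "real_of_int (k i) - 2 * b i"] by (simp add: power2_eq_square algebra_simps)
    qed (use \<epsilon> in auto)
    also have "\<dots> \<le> q + B" using q(2) by (simp add: B_def sum.distrib algebra_simps flip: sum_distrib_left)
    finally have q3: "\<epsilon> / 2 * (\<Sum>i\<in>S. (real_of_int (k i))^2) \<le> q + B" .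
    have "cmod (exp (pi * \<i> * \<tau> * Qd (\<lambda>i. of_int (k i) - of_real (b i)) + 2 * pi * \<i> * (\<Sum>i\<in>S. of_int (k i) * w i)))
      = cmod (exp (of_real (T * B) + (\<Sum>i\<in>S. \<mu> i * of_int (k i)) - of_real (T * (q + B))))"
      unfolding norm_exp_eq_Re using q(1)
      by (intro arg_cong[where f = exp]) (simp add: T_def \<mu>_def algebra_simps sum_distrib_left)
    also have "\<dots> \<le> exp (Re (of_real (T * B))) * exp (\<Sum>i\<in>S. (\<Sum>j\<in>S. cmod (\<mu> j)) * \<bar>real_of_int (k i)\<bar> - T * (\<epsilon> / 2) * (real_of_int (k i))^2)"
      by (rule norm_exp_linear_quad_le[OF S T q3])
    finally show "cmod (exp (pi * \<i> * \<tau> * Qd (\<lambda>i. of_int (k i) - of_real (b i)) + 2 * pi * \<i> * (\<Sum>i\<in>S. of_int (k i) * w i)))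
      \<le> exp (Re (of_real (T * B))) * exp (\<Sum>i\<in>S. (\<Sum>j\<in>S. cmod (\<mu> j)) * \<bar>real_of_int (k i)\<bar> - T * (\<epsilon> / 2) * (real_of_int (k i))^2)" .
  qed (use T \<epsilon> in auto)
qed

text \<open>\<open>Qd\<close> is the inverse quadratic form; it is described by its values on the image of the Gram matrix.\<close>

definition poisson_dual :: "nat set \<Rightarrow> (nat \<Rightarrow> nat \<Rightarrow> real) \<Rightarrow> ((nat \<Rightarrow> complex) \<Rightarrow> complex) \<Rightarrow> complex \<Rightarrow> bool" where
  "poisson_dual S G Qd C \<longleftrightarrow> C \<noteq> 0 \<and>
    (\<forall>\<beta>. Qd (\<lambda>i. \<Sum>j\<in>S. of_real (G i j) * \<beta> j) = qf S G \<beta>) \<and>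
    (\<forall>\<kappa> \<kappa>'. (\<forall>i\<in>S. \<kappa> i = \<kappa>' i) \<longrightarrow> Qd \<kappa> = Qd \<kappa>') \<and>
    (\<forall>\<kappa>::nat \<Rightarrow> real. \<exists>\<beta>::nat \<Rightarrow> real. \<forall>i\<in>S. (\<Sum>j\<in>S. G i j * \<beta> j) = \<kappa> i) \<and>
    (\<forall>\<tau> w (b::nat \<Rightarrow> real). Im \<tau> > 0 \<longrightarrow>
      (\<Sum>\<^sub>\<infinity>n\<in>int_vecs S. exp (- (pi * \<i> * qf S G (\<lambda>i. of_int (n i) + w i) / \<tau>) + 2 * pi * \<i> * (\<Sum>i\<in>S. of_real (b i) * (of_int (n i) + w i)))) =
      C * csqrt \<tau> ^ card S *
      (\<Sum>\<^sub>\<infinity>k\<in>int_vecs S. exp (pi * \<i> * \<tau> * Qd (\<lambda>i. of_int (k i) - of_real (b i)) + 2 * pi * \<i> * (\<Sum>i\<in>S. of_int (k i) * w i))))"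

lemma poisson_dualD:
  assumes "poisson_dual S G Qd C"
  shows "C \<noteq> 0"
    and "Qd (\<lambda>i. \<Sum>j\<in>S. of_real (G i j) * \<beta> j) = qf S G \<beta>"
    and "(\<And>i. i \<in> S \<Longrightarrow> \<kappa> i = \<kappa>' i) \<Longrightarrow> Qd \<kappa> = Qd \<kappa>'"
    and "\<exists>\<beta>::nat \<Rightarrow> real. \<forall>i\<in>S. (\<Sum>j\<in>S. G i j * \<beta> j) = x i"
    and "Im \<tau> > 0 \<Longrightarrow>
      (\<Sum>\<^sub>\<infinity>n\<in>int_vecs S. exp (- (pi * \<i> * qf S G (\<lambda>i. of_int (n i) + w i) / \<tau>) + 2 * pi * \<i> * (\<Sum>i\<in>S. of_real (b i) * (of_int (n i) + w i)))) =
      C * csqrt \<tau> ^ card S *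
      (\<Sum>\<^sub>\<infinity>k\<in>int_vecs S. exp (pi * \<i> * \<tau> * Qd (\<lambda>i. of_int (k i) - of_real (b i)) + 2 * pi * \<i> * (\<Sum>i\<in>S. of_int (k i) * w i)))"
proof -
  note a = assms[unfolded poisson_dual_def]
  show "C \<noteq> 0" by (rule conjunct1[OF a])
  note a = conjunct2[OF a]
  show "Qd (\<lambda>i. \<Sum>j\<in>S. of_real (G i j) * \<beta> j) = qf S G \<beta>" by (rule spec[OF conjunct1[OF a]])
  note a = conjunct2[OF a]
  show "(\<And>i. i \<in> S \<Longrightarrow> \<kappa> i = \<kappa>' i) \<Longrightarrow> Qd \<kappa> = Qd \<kappa>'" using conjunct1[OF a] by blast
  note a = conjunct2[OF a]
  show "\<exists>\<beta>::nat \<Rightarrow> real. \<forall>i\<in>S. (\<Sum>j\<in>S. G i j * \<beta> j) = x i" by (rule spec[OF conjunct1[OF a]])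
  note a = conjunct2[OF a]
  show "Im \<tau> > 0 \<Longrightarrow>
      (\<Sum>\<^sub>\<infinity>n\<in>int_vecs S. exp (- (pi * \<i> * qf S G (\<lambda>i. of_int (n i) + w i) / \<tau>) + 2 * pi * \<i> * (\<Sum>i\<in>S. of_real (b i) * (of_int (n i) + w i)))) =
      C * csqrt \<tau> ^ card S *
      (\<Sum>\<^sub>\<infinity>k\<in>int_vecs S. exp (pi * \<i> * \<tau> * Qd (\<lambda>i. of_int (k i) - of_real (b i)) + 2 * pi * \<i> * (\<Sum>i\<in>S. of_int (k i) * w i)))"
    by (rule a[THEN spec, THEN spec, THEN spec, THEN mp])
qed

text \<open>\<open>G\<close> is split as d c c^T + G', with G' the Schur complement of the pivot.
  The one-variable formula replaces the coordinate n_a by a dual index l and leaves a linear term in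
  the other coordinates; \<open>poisson_dual\<close> carries the linear term \<open>b\<close> so
  that the induction hypothesis covers it.\<close>

theorem lattice_poisson:
  fixes G :: "nat \<Rightarrow> nat \<Rightarrow> real"
  assumes "finite S" and "e > 0" and "\<And>i j. G i j = G j i"
    and "\<And>y. qfr S G y \<ge> e * (\<Sum>i\<in>S. (y i)^2)"
  shows "\<exists>Qd C. poisson_dual S G Qd C"
  using assms
proof (induction S arbitrary: G rule: finite_induct)
  case empty
  show ?case
    by (rule exI[of _ "\<lambda>_. 0"], rule exI[of _ 1]) (auto simp: poisson_dual_def qf_def)
next
  case (insert a S)
  define d where "d = G a a"
  define c where "c = (\<lambda>i. G a i / d)"
  define G' where "G' = (\<lambda>i j. G i j - G i a * G a j / d)"
  note sym = insert.prems(2) and pd = insert.prems(3)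
  note aS = insert.hyps(2) and fS = insert.hyps(1) and e = insert.prems(1)
  have d: "d > 0"
  proof -
    have "qfr (insert a S) G (\<lambda>i. if i = a then 1 else 0) = d"
      using fS aS by (simp add: qfr_def d_def if_distrib[where f = "\<lambda>x. _ * x"] cong: if_cong)
    moreover have "(\<Sum>i\<in>insert a S. (if i = a then 1 else 0 :: real)^2) = 1"
      using fS aS by (simp add: if_distrib[where f = "\<lambda>x. x^2"] cong: if_cong)
    ultimately show ?thesis using pd[of "\<lambda>i. if i = a then 1 else 0"] e by simp
  qed
  have G: "G i j = G' i j + d * c i * c j" for i j
    using d sym[of i a] by (simp add: G'_def c_def)
  have Gai: "G a i = d * c i" "G i a = d * c i" for i using d sym[of i a] by (auto simp: c_def)
  have ca: "c a = 1" using d by (simp add: c_def d_def)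
  have sym': "G' i j = G' j i" for i j by (simp add: G'_def sym[of i j] sym[of i a] sym[of a j])
  have dec: "qf (insert a S) G y = of_real d * (y a + (\<Sum>j\<in>S. of_real (c j) * y j))^2 + qf S G' y" for y
  proof -
    have "qf (insert a S) G y = of_real d * y a * y a + (\<Sum>j\<in>S. of_real (d * c j) * y a * y j) +
       (\<Sum>i\<in>S. of_real (d * c i) * y i * y a) + (\<Sum>i\<in>S. \<Sum>j\<in>S. of_real (G' i j + d * c i * c j) * y i * y j)"
      using fS aS by (simp add: qf_def sum.distrib Gai ca G[symmetric])
    also have "(\<Sum>j\<in>S. of_real (d * c j) * y a * y j) = of_real d * y a * (\<Sum>j\<in>S. of_real (c j) * y j)"
      by (simp add: sum_distrib_left mult_ac)
    also have "(\<Sum>i\<in>S. of_real (d * c i) * y i * y a) = of_real d * y a * (\<Sum>j\<in>S. of_real (c j) * y j)"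
      by (simp add: sum_distrib_left mult_ac)
    also have "(\<Sum>i\<in>S. \<Sum>j\<in>S. of_real (G' i j + d * c i * c j) * y i * y j) =
       qf S G' y + of_real d * ((\<Sum>j\<in>S. of_real (c j) * y j) * (\<Sum>j\<in>S. of_real (c j) * y j))"
      unfolding sum_product by (simp add: qf_def sum.distrib sum_distrib_left algebra_simps)
    finally show ?thesis by (simp add: power2_eq_square algebra_simps)
  qed
  have decr: "qfr (insert a S) G y = d * (y a + (\<Sum>j\<in>S. c j * y j))^2 + qfr S G' y" for y
  proof -
    have "complex_of_real (qfr (insert a S) G y) = of_real (d * (y a + (\<Sum>j\<in>S. c j * y j))^2 + qfr S G' y)"
      unfolding qf_of_real[symmetric] dec by (simp add: qf_of_real)
    thus ?thesis by (simp only: of_real_eq_iff)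
  qed
  \<comment> \<open>Choosing the new coordinate so that the completed square vanishes shows that the
    Schur complement inherits the bound with the same constant \<open>e\<close>.\<close>
  have pd': "qfr S G' y \<ge> e * (\<Sum>i\<in>S. (y i)^2)" for y
  proof -
    define y' where "y' = y(a := - (\<Sum>j\<in>S. c j * y j))"
    have y': "y' i = y i" if "i \<in> S" for i using that aS by (auto simp: y'_def)
    have s1: "(\<Sum>j\<in>S. c j * y' j) = (\<Sum>j\<in>S. c j * y j)" by (rule sum.cong) (auto simp: y')
    have s2: "(\<Sum>j\<in>S. (y' j)^2) = (\<Sum>j\<in>S. (y j)^2)" by (rule sum.cong) (auto simp: y')
    have s3: "qfr S G' y' = qfr S G' y" by (rule qfr_cong) (auto simp: y')
    have "e * (\<Sum>i\<in>S. (y i)^2) \<le> e * (\<Sum>i\<in>insert a S. (y' i)^2)"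
      using e fS aS by (intro mult_left_mono) (auto simp: s2)
    also have "\<dots> \<le> qfr (insert a S) G y'" by (rule pd)
    also have "\<dots> = qfr S G' y" unfolding decr s1 s3 by (simp add: y'_def)
    finally show ?thesis .
  qed
  from insert.IH[OF e sym' pd'] obtain Qd' C' where dd: "poisson_dual S G' Qd' C'" by blast
  note C' = poisson_dualD(1)[OF dd] and Qd' = poisson_dualD(2)[OF dd] and cong' = poisson_dualD(3)[OF dd]
    and solv' = poisson_dualD(4)[OF dd] and P' = poisson_dualD(5)[OF dd]
  \<comment> \<open>The inverse of d c c^T + G' by elimination: the square inverts the pivot, and
    \<open>Qd'\<close> acts on what elimination leaves of the remaining components.\<close>
  define Qd where "Qd = (\<lambda>\<kappa>::nat \<Rightarrow> complex. (\<kappa> a)^2 / of_real d + Qd' (\<lambda>i. \<kappa> i - \<kappa> a * of_real (c i)))"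
  define C where "C = csqrt (- \<i>) / of_real (sqrt d) * C'"
  have C: "C \<noteq> 0" using C' d by (simp add: C_def)
  have Qd: "Qd (\<lambda>i. \<Sum>j\<in>insert a S. of_real (G i j) * \<beta> j) = qf (insert a S) G \<beta>" for \<beta>
  proof -
    define s where "s = (\<Sum>j\<in>S. of_real (c j) * \<beta> j)"
    have 1: "(\<Sum>j\<in>insert a S. of_real (G a j) * \<beta> j) = of_real d * (\<beta> a + s)"
      using fS aS by (simp add: Gai ca s_def sum_distrib_left algebra_simps)
    have 2: "(\<Sum>j\<in>insert a S. of_real (G i j) * \<beta> j) - (\<Sum>j\<in>insert a S. of_real (G a j) * \<beta> j) * of_real (c i) = (\<Sum>j\<in>S. of_real (G' i j) * \<beta> j)" for i
    proof -
      have "(\<Sum>j\<in>insert a S. of_real (G i j) * \<beta> j) = of_real (d * c i) * \<beta> a + (\<Sum>j\<in>S. of_real (G' i j + d * c i * c j) * \<beta> j)"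
        using fS aS by (simp add: Gai G[symmetric])
      also have "(\<Sum>j\<in>S. of_real (G' i j + d * c i * c j) * \<beta> j) = (\<Sum>j\<in>S. of_real (G' i j) * \<beta> j) + of_real (d * c i) * s"
        by (simp add: s_def sum.distrib sum_distrib_left algebra_simps)
      finally show ?thesis unfolding 1 by (simp add: algebra_simps)
    qed
    have "Qd (\<lambda>i. \<Sum>j\<in>insert a S. of_real (G i j) * \<beta> j) = (of_real d * (\<beta> a + s))^2 / of_real d + qf S G' \<beta>"
      unfolding Qd_def 2 Qd' unfolding 1 ..
    also have "\<dots> = qf (insert a S) G \<beta>"
      unfolding dec s_def[symmetric] using d by (simp add: power2_eq_square)
    finally show ?thesis .
  qed
  have cong: "Qd \<kappa> = Qd \<kappa>'" if "\<And>i. i \<in> insert a S \<Longrightarrow> \<kappa> i = \<kappa>' i" for \<kappa> \<kappa>'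
    unfolding Qd_def using that by (intro arg_cong2[where f = "(+)"] cong') auto
  have solv: "\<exists>\<beta>::nat \<Rightarrow> real. \<forall>i\<in>insert a S. (\<Sum>j\<in>insert a S. G i j * \<beta> j) = \<kappa> i" for \<kappa> :: "nat \<Rightarrow> real"
  proof -
    obtain \<beta> where \<beta>: "\<And>i. i \<in> S \<Longrightarrow> (\<Sum>j\<in>S. G' i j * \<beta> j) = \<kappa> i - \<kappa> a * c i"
      using solv'[of "\<lambda>i. \<kappa> i - \<kappa> a * c i"] by blast
    define s where "s = (\<Sum>j\<in>S. c j * \<beta> j)"
    define \<beta>' where "\<beta>' = \<beta>(a := \<kappa> a / d - s)"
    have b': "\<beta>' j = \<beta> j" if "j \<in> S" for j using that aS by (auto simp: \<beta>'_def)
    have e1: "(\<Sum>j\<in>insert a S. G i j * \<beta>' j) = G i a * (\<kappa> a / d - s) + (\<Sum>j\<in>S. G i j * \<beta> j)" for i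
      using fS aS b' by (simp add: \<beta>'_def cong: sum.cong_simp)
    have e2: "(\<Sum>j\<in>S. G i j * \<beta> j) = (\<Sum>j\<in>S. G' i j * \<beta> j) + d * c i * s" for i
      by (simp add: G[of i] s_def sum.distrib sum_distrib_left algebra_simps)
    have e3: "(\<Sum>j\<in>S. G' a j * \<beta> j) = 0" using d by (simp add: G'_def d_def)
    have "(\<Sum>j\<in>insert a S. G i j * \<beta>' j) = \<kappa> i" if "i \<in> insert a S" for i
    proof (cases "i = a")
      case True
      thus ?thesis using d unfolding True e1 e2 e3 by (simp add: Gai ca algebra_simps)
    next
      case False
      hence "i \<in> S" using that by simp
      show ?thesis using d unfolding e1 e2 \<beta>[OF \<open>i \<in> S\<close>] by (simp add: Gai algebra_simps)
    qed
    thus ?thesis by blast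
  qed
  have P: "(\<Sum>\<^sub>\<infinity>n\<in>int_vecs (insert a S). exp (- (pi * \<i> * qf (insert a S) G (\<lambda>i. of_int (n i) + w i) / \<tau>) + 2 * pi * \<i> * (\<Sum>i\<in>insert a S. of_real (b i) * (of_int (n i) + w i)))) =
      C * csqrt \<tau> ^ card (insert a S) *
      (\<Sum>\<^sub>\<infinity>k\<in>int_vecs (insert a S). exp (pi * \<i> * \<tau> * Qd (\<lambda>i. of_int (k i) - of_real (b i)) + 2 * pi * \<i> * (\<Sum>i\<in>insert a S. of_int (k i) * w i)))"
    if \<tau>: "Im \<tau> > 0" for \<tau> w and b :: "nat \<Rightarrow> real"
  proof -
    define E where "E = (\<lambda>n::nat \<Rightarrow> int. exp (- (pi * \<i> * qf (insert a S) G (\<lambda>i. of_int (n i) + w i) / \<tau>) + 2 * pi * \<i> * (\<Sum>i\<in>insert a S. of_real (b i) * (of_int (n i) + w i))))"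
    define R where "R = (\<lambda>k::nat \<Rightarrow> int. exp (pi * \<i> * \<tau> * Qd (\<lambda>i. of_int (k i) - of_real (b i)) + 2 * pi * \<i> * (\<Sum>i\<in>insert a S. of_int (k i) * w i)))"
    define u where "u = (\<lambda>n::nat \<Rightarrow> int. \<Sum>j\<in>S. of_real (c j) * (of_int (n j) + w j))"
    \<comment> \<open>The linear coefficient left behind by the one-variable summation with dual
      index \<open>l\<close>; it is again real, as the induction hypothesis requires.\<close>
    define b' where "b' = (\<lambda>l::int. \<lambda>i. b i + (of_int l - b a) * c i)"
    define E' where "E' = (\<lambda>l (n::nat \<Rightarrow> int). exp (- (pi * \<i> * qf S G' (\<lambda>i. of_int (n i) + w i) / \<tau>) + 2 * pi * \<i> * (\<Sum>i\<in>S. of_real (b' l i) * (of_int (n i) + w i))))"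
    define R1 where "R1 = (\<lambda>l::int. exp (pi * \<i> * (\<tau> / of_real d) * (of_int l - of_real (b a))^2 + 2 * pi * \<i> * w a * of_int l))"
    define R' where "R' = (\<lambda>l (k::nat \<Rightarrow> int). exp (pi * \<i> * \<tau> * Qd' (\<lambda>i. of_int (k i) - of_real (b' l i)) + 2 * pi * \<i> * (\<Sum>i\<in>S. of_int (k i) * w i)))"
    define K where "K = csqrt (- \<i>) / of_real (sqrt d) * csqrt \<tau>"
    have t0: "\<tau> \<noteq> 0" using \<tau> by auto
    have d0: "complex_of_real d \<noteq> 0" using d by simp
    have \<tau>d: "Im (\<tau> / of_real d) > 0" using \<tau> d by (simp add: Im_divide_of_real)
    have upd: "(\<Sum>i\<in>S. f i ((n(a := k)) i)) = (\<Sum>i\<in>S. f i (n i))" for f :: "nat \<Rightarrow> int \<Rightarrow> complex" and n k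
      by (rule sum.cong) (use aS in auto)
    have Eupd: "E (n(a := k)) = exp (- (pi * \<i> * (of_int k + (w a + u n))^2 / (\<tau> / of_real d)) + 2 * pi * \<i> * of_real (b a) * (of_int k + (w a + u n)))
       * exp (- (pi * \<i> * qf S G' (\<lambda>i. of_int (n i) + w i) / \<tau>) + 2 * pi * \<i> * ((\<Sum>i\<in>S. of_real (b i) * (of_int (n i) + w i)) - of_real (b a) * u n))" for n k
    proof -
      have "qf S G' (\<lambda>i. of_int ((n(a := k)) i) + w i) = qf S G' (\<lambda>i. of_int (n i) + w i)"
        by (rule qf_cong) (use aS in auto)
      moreover have "(\<Sum>j\<in>S. of_real (c j) * (of_int ((n(a := k)) j) + w j)) = u n"
        unfolding u_def by (rule upd)
      moreover have "(\<Sum>i\<in>insert a S. of_real (b i) * (of_int ((n(a := k)) i) + w i)) =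
         of_real (b a) * (of_int k + w a) + (\<Sum>i\<in>S. of_real (b i) * (of_int (n i) + w i))"
        using fS aS upd[of "\<lambda>i x. of_real (b i) * (of_int x + w i)" n k] by simp
      ultimately show ?thesis
        unfolding E_def dec exp_add[symmetric]
        by (intro arg_cong[where f = exp]) (use t0 d0 in \<open>simp add: field_simps power2_eq_square\<close>)
    qed
    have sumb': "(\<Sum>i\<in>S. of_real (b' l i) * (of_int (n i) + w i)) =
       (\<Sum>i\<in>S. of_real (b i) * (of_int (n i) + w i)) + (of_int l - of_real (b a)) * u n" for l and n :: "nat \<Rightarrow> int"
      by (simp add: b'_def u_def algebra_simps sum.distrib sum_distrib_left sum_subtractf)
    have inner: "(\<Sum>\<^sub>\<infinity>k. E (n(a := k))) = K * (\<Sum>\<^sub>\<infinity>l. R1 l * E' l n)" for n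
    proof -
      define D where "D = exp (- (pi * \<i> * qf S G' (\<lambda>i. of_int (n i) + w i) / \<tau>) + 2 * pi * \<i> * ((\<Sum>i\<in>S. of_real (b i) * (of_int (n i) + w i)) - of_real (b a) * u n))"
      have "(\<Sum>\<^sub>\<infinity>k. E (n(a := k))) = csqrt (- \<i> * (\<tau> / of_real d)) *
          (\<Sum>\<^sub>\<infinity>l. exp (pi * \<i> * (\<tau> / of_real d) * (of_int l - of_real (b a))^2 + 2 * pi * \<i> * (w a + u n) * of_int l)) * D"
        unfolding Eupd D_def[symmetric] infsum_cmult_left' gauss_poisson_linear[OF \<tau>d] ..
      also have "\<dots> = K * (\<Sum>\<^sub>\<infinity>l. exp (pi * \<i> * (\<tau> / of_real d) * (of_int l - of_real (b a))^2 + 2 * pi * \<i> * (w a + u n) * of_int l) * D)"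
        unfolding csqrt_rotate[OF \<tau> d] K_def infsum_cmult_left' by (simp only: mult.assoc)
      also have "(\<lambda>l::int. exp (pi * \<i> * (\<tau> / of_real d) * (of_int l - of_real (b a))^2 + 2 * pi * \<i> * (w a + u n) * of_int l) * D) = (\<lambda>l. R1 l * E' l n)"
        unfolding D_def R1_def E'_def exp_add[symmetric] sumb'
        by (intro ext arg_cong[where f = exp]) (simp add: algebra_simps)
      finally show ?thesis .
    qed
    have sE: "E summable_on int_vecs (insert a S)"
    proof -
      have "finite (insert a S)" using fS by simp
      from summable_lattice_gauss[OF this e pd Im_minus_inverse_pos[OF \<tau>], of w "\<lambda>i. of_real (b i)"]
      have "(\<lambda>n. cmod (E n)) summable_on int_vecs (insert a S)" by (simp add: E_def)
      thus ?thesis by (rule abs_summable_summable)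
    qed
    have sE': "(\<lambda>(n, k). E (n(a := k))) summable_on (int_vecs S \<times> UNIV)"
      using sE summable_on_reindex_bij_betw[OF bij_betw_int_vecs_insert[OF aS], of E]
      by (simp add: case_prod_unfold)
    \<comment> \<open>Exchanging the sums needs absolute values only. The cross factor exp(2 pi i l
      u(n)) has a modulus independent of \<open>n\<close>, since \<open>u n\<close> is real up to
      the constant \<open>W\<close>; hence the double sum of moduli is a product.\<close>
    have sH: "(\<lambda>(n, l). R1 l * E' l n) summable_on (int_vecs S \<times> UNIV)"
    proof -
      have s1: "(\<lambda>n. cmod (E' 0 n)) summable_on int_vecs S"
        using summable_lattice_gauss[OF fS e pd' Im_minus_inverse_pos[OF \<tau>], of w "\<lambda>i. of_real (b' 0 i)"]
        by (simp add: E'_def)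
      define W where "W = (\<Sum>j\<in>S. of_real (c j) * w j)"
      define A where "A = (\<lambda>l::int. cmod (R1 l * exp (2 * pi * \<i> * of_int l * W)))"
      have s2: "A summable_on UNIV"
      proof -
        have "A = (\<lambda>l. cmod (exp (pi * \<i> * (\<tau> / of_real d) * (of_real (b a))^2)) * cmod (exp (pi * \<i> * (\<tau> / of_real d) * (of_int l)^2 + 2 * pi * \<i> * (w a + W - (\<tau> / of_real d) * of_real (b a)) * of_int l)))"
          unfolding A_def R1_def exp_add[symmetric] norm_mult[symmetric]
          by (intro ext arg_cong[where f = "\<lambda>x. cmod (exp x)"]) (simp add: algebra_simps power2_eq_square)
        thus ?thesis by (simp only: summable_on_cmult_right[OF summable_gauss_term[OF \<tau>d]])
      qed
      have "(\<lambda>(n, l). cmod (E' 0 n) * A l) summable_on (int_vecs S \<times> UNIV)"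
        by (rule summable_on_product_nonneg[OF s1 s2]) (auto simp: A_def)
      moreover have "cmod (E' 0 n) * A l = cmod (R1 l * E' l n)" for n l
      proof -
        define v where "v = (\<Sum>j\<in>S. c j * real_of_int (n j))"
        have u: "u n = of_real v + W"
          by (simp add: u_def v_def W_def sum.distrib algebra_simps)
        have "E' l n = E' 0 n * exp (2 * pi * \<i> * of_int l * u n)"
          unfolding E'_def sumb' exp_add[symmetric]
          by (intro arg_cong[where f = exp]) (simp add: algebra_simps)
        also have "exp (2 * pi * \<i> * of_int l * u n) = exp (\<i> * of_real (2 * pi * of_int l * v)) * exp (2 * pi * \<i> * of_int l * W)"
          unfolding u exp_add[symmetric] by (intro arg_cong[where f = exp]) (simp add: algebra_simps)
        finally show ?thesis by (simp add: A_def norm_mult)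
      qed
      ultimately have "(\<lambda>x. cmod ((\<lambda>(n, l). R1 l * E' l n) x)) summable_on (int_vecs S \<times> UNIV)"
        by (simp add: case_prod_unfold)
      thus ?thesis by (rule abs_summable_summable)
    qed
    have finS: "finite (insert a S)" using fS by simp
    have Rupd: "R (k(a := l)) = R1 l * R' l k" for k l
    proof -
      have 1: "Qd' (\<lambda>i. (of_int ((k(a := l)) i) - of_real (b i)) - (of_int l - of_real (b a)) * of_real (c i)) = Qd' (\<lambda>i. of_int (k i) - of_real (b' l i))"
        by (rule cong') (use aS in \<open>auto simp: b'_def\<close>)
      have 2: "(\<Sum>i\<in>insert a S. of_int ((k(a := l)) i) * w i) = of_int l * w a + (\<Sum>i\<in>S. of_int (k i) * w i)"
        using fS aS upd[of "\<lambda>i x. of_int x * w i" k l] by simp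
      have 3: "Qd (\<lambda>i. of_int ((k(a := l)) i) - of_real (b i)) =
          (of_int l - of_real (b a))^2 / of_real d + Qd' (\<lambda>i. of_int (k i) - of_real (b' l i))"
        unfolding Qd_def fun_upd_same 1 ..
      show ?thesis unfolding R_def R1_def R'_def 2 3 exp_add[symmetric]
        by (intro arg_cong[where f = exp]) (simp add: algebra_simps)
    qed
    obtain \<epsilon> where \<epsilon>: "\<epsilon> > 0" "\<And>\<kappa>::nat \<Rightarrow> real. \<exists>q. Qd (\<lambda>i. of_real (\<kappa> i)) = of_real q \<and> q \<ge> \<epsilon> * (\<Sum>i\<in>insert a S. (\<kappa> i)^2)"
      using dual_form_bound[where Qd = Qd, OF finS e pd Qd cong solv] by blast
    have sR: "R summable_on int_vecs (insert a S)"
      using summable_dual_gauss[where Qd = Qd, OF finS \<epsilon> \<tau>, of b w] unfolding R_def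
      by (rule abs_summable_summable)
    have sR': "(\<lambda>(k, l). R (k(a := l))) summable_on (int_vecs S \<times> UNIV)"
      using sR summable_on_reindex_bij_betw[OF bij_betw_int_vecs_insert[OF aS], of R]
      by (simp add: case_prod_unfold)
    have "infsum E (int_vecs (insert a S)) = (\<Sum>\<^sub>\<infinity>(n, k)\<in>int_vecs S \<times> UNIV. E (n(a := k)))"
      using infsum_reindex_bij_betw[OF bij_betw_int_vecs_insert[OF aS], of E] by (simp add: case_prod_unfold)
    also have "\<dots> = (\<Sum>\<^sub>\<infinity>n\<in>int_vecs S. \<Sum>\<^sub>\<infinity>k. E (n(a := k)))"
      by (rule infsum_Sigma'_banach[OF sE', symmetric])
    also have "\<dots> = K * (\<Sum>\<^sub>\<infinity>n\<in>int_vecs S. \<Sum>\<^sub>\<infinity>l. R1 l * E' l n)"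
      unfolding inner infsum_cmult_right' ..
    also have "(\<Sum>\<^sub>\<infinity>n\<in>int_vecs S. \<Sum>\<^sub>\<infinity>l. R1 l * E' l n) = (\<Sum>\<^sub>\<infinity>l. \<Sum>\<^sub>\<infinity>n\<in>int_vecs S. R1 l * E' l n)"
      by (rule infsum_swap_banach[OF sH])
    also have "\<dots> = (\<Sum>\<^sub>\<infinity>l. R1 l * (C' * csqrt \<tau> ^ card S * (\<Sum>\<^sub>\<infinity>k\<in>int_vecs S. R' l k)))"
      unfolding infsum_cmult_right' E'_def R'_def P'[OF \<tau>] ..
    also have "\<dots> = C' * csqrt \<tau> ^ card S * (\<Sum>\<^sub>\<infinity>l. \<Sum>\<^sub>\<infinity>k\<in>int_vecs S. R1 l * R' l k)"
      unfolding infsum_cmult_right'[symmetric] by (simp only: mult_ac)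
    also have "(\<Sum>\<^sub>\<infinity>l. \<Sum>\<^sub>\<infinity>k\<in>int_vecs S. R1 l * R' l k) = (\<Sum>\<^sub>\<infinity>k\<in>int_vecs S. \<Sum>\<^sub>\<infinity>l. R (k(a := l)))"
      unfolding Rupd by (rule infsum_swap_banach[OF sR'[unfolded Rupd], symmetric])
    also have "\<dots> = (\<Sum>\<^sub>\<infinity>(k, l)\<in>int_vecs S \<times> UNIV. R (k(a := l)))"
      by (rule infsum_Sigma'_banach[OF sR'])
    also have "\<dots> = infsum R (int_vecs (insert a S))"
      using infsum_reindex_bij_betw[OF bij_betw_int_vecs_insert[OF aS], of R] by (simp add: case_prod_unfold)
    also have "K * (C' * csqrt \<tau> ^ card S * infsum R (int_vecs (insert a S))) = C * csqrt \<tau> ^ card (insert a S) * infsum R (int_vecs (insert a S))"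
      using fS aS by (simp add: K_def C_def)
    finally show ?thesis unfolding E_def R_def .
  qed
  show ?case
    unfolding poisson_dual_def
    by (rule exI[of _ Qd], rule exI[of _ C], intro conjI allI impI) (fact C Qd solv P | rule cong, blast)+
qed

section \<open>Affine root data\<close>

lemma even_symmetric_sum:
  fixes f :: "nat \<Rightarrow> nat \<Rightarrow> int"
  assumes "\<And>i j. i \<le> l \<Longrightarrow> j \<le> l \<Longrightarrow> f i j = f j i" "\<And>i. i \<le> l \<Longrightarrow> even (f i i)"
  shows "even (\<Sum>i\<le>l. \<Sum>j\<le>l. f i j)"
  using assms
proof (induction l)
  case (Suc l)
  have "(\<Sum>i\<le>Suc l. \<Sum>j\<le>Suc l. f i j) = (\<Sum>i\<le>l. \<Sum>j\<le>l. f i j) + (\<Sum>i\<le>l. f i (Suc l)) + (\<Sum>j\<le>l. f (Suc l) j) + f (Suc l) (Suc l)"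
    by (simp add: sum.distrib)
  also have "(\<Sum>i\<le>l. f i (Suc l)) = (\<Sum>j\<le>l. f (Suc l) j)" using Suc.prems by (intro sum.cong) auto
  finally show ?case using Suc by auto
qed auto

text \<open>Write n = p - m with disjoint supports. Nonpositive off-diagonal entries make the mixed
  term at most 0, so q(p) + q(m) <= 2. As \<open>q\<close> takes even values, one of the two parts
  is isotropic, hence zero or of full support.\<close>

lemma int_quadratic_sign:
  fixes B :: "nat \<Rightarrow> nat \<Rightarrow> int" and n :: "nat \<Rightarrow> int" and l :: nat
  defines "q \<equiv> \<lambda>n::nat \<Rightarrow> int. \<Sum>i\<le>l. \<Sum>j\<le>l. B i j * n i * n j"
  assumes even: "\<And>i. i \<le> l \<Longrightarrow> even (B i i)"
    and sym: "\<And>i j. i \<le> l \<Longrightarrow> j \<le> l \<Longrightarrow> B i j = B j i"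
    and off: "\<And>i j. i \<le> l \<Longrightarrow> j \<le> l \<Longrightarrow> i \<noteq> j \<Longrightarrow> B i j \<le> 0"
    and nonneg: "\<And>n. q n \<ge> 0"
    and zero: "\<And>n. q n = 0 \<Longrightarrow> (\<forall>i\<le>l. n i = 0) \<or> (\<forall>i\<le>l. n i > 0) \<or> (\<forall>i\<le>l. n i < 0)"
    and 2: "q n = 2"
  shows "(\<forall>i\<le>l. n i \<ge> 0) \<or> (\<forall>i\<le>l. n i \<le> 0)"
proof -
  define p m where "p = (\<lambda>i. max (n i) 0)" and "m = (\<lambda>i. max (- n i) 0)"
  define cr where "cr = (\<Sum>i\<le>l. \<Sum>j\<le>l. B i j * p i * m j)"
  have pm: "n i = p i - m i" "p i \<ge> 0" "m i \<ge> 0" "p i * m i = 0" for i by (auto simp: p_def m_def max_def)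
  have ev: "even (q x)" for x
    unfolding q_def by (rule even_symmetric_sum) (use sym even in auto)
  have "cr \<le> 0" unfolding cr_def
  proof (intro sum_nonpos)
    fix i j assume "i \<in> {..l}" "j \<in> {..l}"
    thus "B i j * p i * m j \<le> 0"
      using pm(4)[of j] mult_nonneg_nonneg[OF pm(2)[of i] pm(3)[of j]] off[of i j]
      by (cases "i = j") (simp_all only: mult.assoc mult_zero_right order_refl, simp add: mult_nonpos_nonneg)
  qed
  have "cr = (\<Sum>i\<le>l. \<Sum>j\<le>l. B j i * p j * m i)" unfolding cr_def by (rule sum.swap)
  also have "\<dots> = (\<Sum>i\<le>l. \<Sum>j\<le>l. B i j * m i * p j)" using sym by (intro sum.cong) (auto simp: mult_ac)
  finally have cr2: "cr = (\<Sum>i\<le>l. \<Sum>j\<le>l. B i j * m i * p j)" .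
  have "q n = q p + q m - cr - (\<Sum>i\<le>l. \<Sum>j\<le>l. B i j * m i * p j)"
    unfolding q_def cr_def pm(1) by (simp add: algebra_simps sum.distrib sum_subtractf)
  hence "q n = q p + q m - 2 * cr" using cr2 by simp
  hence "q p + q m \<le> 2" using 2 \<open>cr \<le> 0\<close> by simp
  moreover have "q p = 0 \<or> q p \<ge> 2" "q m = 0 \<or> q m \<ge> 2" using ev[of p] ev[of m] nonneg[of p] nonneg[of m] by presburger+
  ultimately have "q p = 0 \<or> q m = 0" by linarith
  thus ?thesis
  proof
    assume "q p = 0"
    from zero[OF this] show ?thesis by (auto simp: p_def m_def max_def split: if_splits) 
  next
    assume "q m = 0"
    from zero[OF this] show ?thesis by (auto simp: p_def m_def max_def split: if_splits)
  qed
qed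

lemma sgn_const_trichotomy:
  fixes n :: "nat \<Rightarrow> int"
  assumes "\<And>i. i \<le> l \<Longrightarrow> sgn (n i) = sgn (n 0)"
  shows "(\<forall>i\<le>l. n i = 0) \<or> (\<forall>i\<le>l. n i > 0) \<or> (\<forall>i\<le>l. n i < 0)"
proof -
  have "(n i = 0 \<longleftrightarrow> n 0 = 0) \<and> (n i > 0 \<longleftrightarrow> n 0 > 0) \<and> (n i < 0 \<longleftrightarrow> n 0 < 0)" if "i \<le> l" for i
    using assms[OF that] by (auto simp: sgn_if split: if_splits)
  thus ?thesis by (meson less_linear)
qed

text \<open>The common features of the twisted types other than \<open>A2even\<close>, with \<open>c i = a\<^sub>i\<^sup>\<or> / a\<^sub>i\<close>. The last
  two hypotheses force \<open>M\<close> to be the whole lattice spanned by \<open>\<alpha>\<^sub>1, \<dots>, \<alpha>\<^sub>\<ell>\<close>.\<close>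

locale aff_data =
  fixes g :: affine and a av c :: "nat \<Rightarrow> nat" and r :: nat
  assumes rk1: "1 \<le> rk g"
    and label_eq: "label g = a" and colabel_eq: "colabel g = av"
    and cm_out: "\<And>i j. rk g < i \<or> rk g < j \<Longrightarrow> cm g i j = 0"
    and diag: "\<And>i. i \<le> rk g \<Longrightarrow> cm g i i = 2"
    and offd: "\<And>i j. i \<le> rk g \<Longrightarrow> j \<le> rk g \<Longrightarrow> i \<noteq> j \<Longrightarrow> cm g i j \<le> 0"
    and apos: "\<And>i. i \<le> rk g \<Longrightarrow> 0 < a i" and a0: "a 0 = 1"
    and cval: "\<And>i. i \<le> rk g \<Longrightarrow> c i = 1 \<or> c i = r" and c0: "c 0 = 1" and r0: "r > 0"
    and avc: "\<And>i. i \<le> rk g \<Longrightarrow> av i = c i * a i"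
    and csym: "\<And>i j. i \<le> rk g \<Longrightarrow> j \<le> rk g \<Longrightarrow> int (c i) * cm g i j = int (c j) * cm g j i"
    and ker: "\<And>i. i \<le> rk g \<Longrightarrow> (\<Sum>j\<le>rk g. cm g i j * int (a j)) = 0"
    and conn: "\<And>i. i \<le> rk g \<Longrightarrow> (0, i) \<in> {(i, j). i \<le> rk g \<and> j \<le> rk g \<and> cm g i j \<noteq> 0}\<^sup>*"
    and alast: "a (rk g) = 1"
    and reach: "\<And>i. 1 \<le> i \<Longrightarrow> i < rk g \<Longrightarrow> (0, i) \<in> {(j, i). j \<le> rk g \<and> 1 \<le> i \<and> i \<le> rk g \<and> cm g i j = -1}\<^sup>*"
begin

abbreviation l where "l \<equiv> rk g"
abbreviation fm ("\<langle>_, _\<rangle>") where "\<langle>x, y\<rangle> \<equiv> form g x y"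
abbreviation pr where "pr \<equiv> pairing g"
abbreviation sr where "sr \<equiv> simple_refl g"
abbreviation lev where "lev \<equiv> level g"
abbreviation del where "del \<equiv> delta g"

text \<open>The Gram matrix of the simple roots, see \<open>sroot_form\<close>.\<close>

definition Gm :: "nat \<Rightarrow> nat \<Rightarrow> real" where "Gm i j = real (c i) * of_int (cm g i j)"

lemma cpos: "i \<le> l \<Longrightarrow> 0 < c i" using cval r0 by fastforce

lemma Gm_sym: "Gm i j = Gm j i"
proof (cases "i \<le> l \<and> j \<le> l")
  case True
  hence "of_int (int (c i) * cm g i j) = (of_int (int (c j) * cm g j i) :: real)" using csym by simp
  thus ?thesis by (simp add: Gm_def)
next
  case False
  hence "cm g i j = 0" "cm g j i = 0" using cm_out by auto
  thus ?thesis by (simp add: Gm_def)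
qed

lemma Gm_ker: "i \<le> l \<Longrightarrow> (\<Sum>j\<le>l. Gm i j * real (a j)) = 0"
proof -
  assume i: "i \<le> l"
  have "(\<Sum>j\<le>l. Gm i j * real (a j)) = real (c i) * of_int (\<Sum>j\<le>l. cm g i j * int (a j))"
    by (simp add: Gm_def sum_distrib_left mult.assoc)
  thus ?thesis using ker[OF i] by simp
qed

text \<open>Because \<open>a\<close> is a kernel vector, the diagonal contributions cancel and a
  weighted graph Laplacian in the quotients x_i / a_i remains. Semidefiniteness and, by
  connectedness, the one-dimensional kernel follow from it.\<close>

lemma qfr_sos:
  "2 * qfr {..l} Gm x = (\<Sum>i\<le>l. \<Sum>j\<le>l. - Gm i j * real (a i) * real (a j) * (x i / real (a i) - x j / real (a j))^2)"
proof -
  define y where "y = (\<lambda>i. x i / real (a i))"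
  have x: "x i = real (a i) * y i" if "i \<le> l" for i using apos[OF that] by (simp add: y_def)
  have q: "qfr {..l} Gm x = (\<Sum>i\<le>l. \<Sum>j\<le>l. Gm i j * (real (a i) * y i) * (real (a j) * y j))"
    unfolding qfr_def by (intro sum.cong refl) (auto simp: x)
  have z1: "(\<Sum>i\<le>l. \<Sum>j\<le>l. Gm i j * real (a i) * real (a j) * (y i)^2) = 0"
  proof (rule sum.neutral, safe)
    fix i assume "i \<le> l"
    have "(\<Sum>j\<le>l. Gm i j * real (a i) * real (a j) * (y i)^2) = real (a i) * (y i)^2 * (\<Sum>j\<le>l. Gm i j * real (a j))"
      by (simp add: sum_distrib_left mult_ac)
    thus "(\<Sum>j\<le>l. Gm i j * real (a i) * real (a j) * (y i)^2) = 0" using Gm_ker[OF \<open>i \<le> l\<close>] by simp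
  qed
  have "(\<Sum>i\<le>l. \<Sum>j\<le>l. Gm i j * real (a i) * real (a j) * (y j)^2) = (\<Sum>i\<le>l. \<Sum>j\<le>l. Gm j i * real (a j) * real (a i) * (y i)^2)"
    by (rule sum.swap)
  also have "\<dots> = 0" using z1 by (simp add: Gm_sym mult_ac)
  finally have z2: "(\<Sum>i\<le>l. \<Sum>j\<le>l. Gm i j * real (a i) * real (a j) * (y j)^2) = 0" .
  have "(\<Sum>i\<le>l. \<Sum>j\<le>l. - Gm i j * real (a i) * real (a j) * (y i - y j)^2) =
    2 * (\<Sum>i\<le>l. \<Sum>j\<le>l. Gm i j * (real (a i) * y i) * (real (a j) * y j))
     - (\<Sum>i\<le>l. \<Sum>j\<le>l. Gm i j * real (a i) * real (a j) * (y i)^2)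
     - (\<Sum>i\<le>l. \<Sum>j\<le>l. Gm i j * real (a i) * real (a j) * (y j)^2)"
    unfolding sum_distrib_left sum_subtractf[symmetric] by (intro sum.cong refl) (simp add: power2_eq_square algebra_simps)
  thus ?thesis unfolding z1 z2 q[symmetric] by (simp add: y_def)
qed

lemma sos_term_nonneg:
  assumes "i \<le> l" "j \<le> l"
  shows "- Gm i j * real (a i) * real (a j) * (x i / real (a i) - x j / real (a j))^2 \<ge> 0"
proof (cases "i = j")
  case False
  hence "Gm i j \<le> 0" using offd[OF assms] by (simp add: Gm_def mult_nonneg_nonpos)
  thus ?thesis by (intro mult_nonneg_nonneg) auto
qed auto

lemma qfr_nonneg: "qfr {..l} Gm x \<ge> 0"
proof -
  have "2 * qfr {..l} Gm x \<ge> 0" unfolding qfr_sos by (intro sum_nonneg sos_term_nonneg) auto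
  thus ?thesis by simp
qed

text \<open>All terms of the sum of squares are nonnegative, and by integrality an edge has weight
  at least 1.\<close>

lemma qfr_edge:
  assumes "i \<le> l" "j \<le> l" "cm g i j \<noteq> 0"
  shows "(x i / real (a i) - x j / real (a j))^2 \<le> 2 * qfr {..l} Gm x"
proof (cases "i = j")
  case True thus ?thesis using qfr_nonneg by simp
next
  case False
  hence "cm g i j \<le> -1" using offd[OF assms(1,2)] assms(3) by simp
  hence "of_int (cm g i j) \<le> (-1::real)" by linarith
  moreover have "real (c i) \<ge> 1" using cpos[OF assms(1)] by simp
  ultimately have "real (c i) * (- of_int (cm g i j)) \<ge> 1 * 1" by (intro mult_mono) auto
  hence G1: "- Gm i j \<ge> 1" by (simp add: Gm_def)
  have "1 * 1 * 1 \<le> - Gm i j * real (a i) * real (a j)"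
    using apos[OF assms(1)] apos[OF assms(2)] G1 by (intro mult_mono mult_nonneg_nonneg) auto
  hence "1 * (x i / real (a i) - x j / real (a j))^2 \<le> - Gm i j * real (a i) * real (a j) * (x i / real (a i) - x j / real (a j))^2"
    by (intro mult_right_mono) auto
  also have "\<dots> \<le> (\<Sum>j\<le>l. - Gm i j * real (a i) * real (a j) * (x i / real (a i) - x j / real (a j))^2)"
    using assms by (intro member_le_sum[where i = j] sos_term_nonneg) auto
  also have "\<dots> \<le> (\<Sum>i\<le>l. \<Sum>j\<le>l. - Gm i j * real (a i) * real (a j) * (x i / real (a i) - x j / real (a j))^2)"
    using assms by (intro member_le_sum[where i = i] sum_nonneg sos_term_nonneg) auto
  finally show ?thesis unfolding qfr_sos by simp
qed

text \<open>Adds up the edge differences along a path in the diagram from node 0 to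
  \<open>i\<close>.\<close>

lemma qfr_coercive:
  assumes "i \<le> l"
  shows "\<exists>K\<ge>0. \<forall>x. (x i / real (a i) - x 0)^2 \<le> K * qfr {..l} Gm x"
  using conn[OF assms]
proof (induction rule: rtrancl_induct)
  case base
  show ?case by (rule exI[of _ 0]) (simp add: a0)
next
  case (step i j)
  then obtain K where K: "K \<ge> 0" "\<And>x. (x i / real (a i) - x 0)^2 \<le> K * qfr {..l} Gm x" by blast
  from step.hyps have ij: "i \<le> l" "j \<le> l" "cm g i j \<noteq> 0" by auto
  have "(x j / real (a j) - x 0)^2 \<le> (4 + 2 * K) * qfr {..l} Gm x" for x
  proof -
    have "(x j / real (a j) - x 0)^2 \<le> 2 * (x i / real (a i) - x j / real (a j))^2 + 2 * (x i / real (a i) - x 0)^2"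
    proof -
      have "(v - w)^2 \<le> 2 * (u - v)^2 + 2 * (u - w)^2" for u v w :: real
        using zero_le_power2[of "(u - v) + (u - w)"] by (simp add: power2_eq_square algebra_simps)
      thus ?thesis .
    qed
    also have "\<dots> \<le> 2 * (2 * qfr {..l} Gm x) + 2 * (K * qfr {..l} Gm x)"
      by (intro add_mono mult_left_mono qfr_edge ij K) auto
    finally show ?thesis by (simp add: algebra_simps)
  qed
  thus ?case using K(1) by (intro exI[of _ "4 + 2 * K"]) auto
qed

lemma qfr_zero:
  assumes "qfr {..l} Gm x = 0" "i \<le> l"
  shows "x i = real (a i) * x 0"
proof -
  obtain K where "\<And>x. (x i / real (a i) - x 0)^2 \<le> K * qfr {..l} Gm x" using qfr_coercive[OF assms(2)] by blast
  from this[of x] have "(x i / real (a i) - x 0)^2 \<le> 0" using assms by simp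
  hence "x i / real (a i) = x 0" by simp
  thus ?thesis using apos[OF assms(2)] by (simp add: field_simps)
qed

text \<open>Setting the coordinate at node 0 to 0 turns control of the differences x_i / a_i - x_0
  into control of the coordinates themselves: deleting node 0 leaves a definite form.\<close>

lemma fin_pos_def: "\<exists>e>0. \<forall>y. qfr {1..l} Gm y \<ge> e * (\<Sum>i\<in>{1..l}. (y i)^2)"
proof -
  have "\<exists>K. \<forall>i\<in>{1..l}. K i \<ge> 0 \<and> (\<forall>x. (x i / real (a i) - x 0)^2 \<le> K i * qfr {..l} Gm x)"
    by (rule bchoice) (use qfr_coercive in auto)
  then obtain K where K: "\<And>i. i \<in> {1..l} \<Longrightarrow> K i \<ge> 0" "\<And>i x. i \<in> {1..l} \<Longrightarrow> (x i / real (a i) - x 0)^2 \<le> K i * qfr {..l} Gm x" by blast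
  define T where "T = (\<Sum>i\<in>{1..l}. (real (a i))^2 * K i) + 1"
  have T: "T > 0" unfolding T_def by (intro add_nonneg_pos sum_nonneg mult_nonneg_nonneg K) auto
  have "(\<Sum>i\<in>{1..l}. (y i)^2) \<le> T * qfr {1..l} Gm y" for y
  proof -
    define x where "x = y(0 := 0)"
    have d: "{..l} = insert 0 {1..l}" by auto
    have "qfr {..l} Gm x = qfr {1..l} Gm x" unfolding qfr_def d by (simp add: x_def)
    also have "\<dots> = qfr {1..l} Gm y" by (rule qfr_cong) (auto simp: x_def)
    finally have q: "qfr {..l} Gm x = qfr {1..l} Gm y" .
    have "(y i)^2 \<le> (real (a i))^2 * K i * qfr {1..l} Gm y" if i: "i \<in> {1..l}" for i
    proof -
      have "(y i / real (a i))^2 \<le> K i * qfr {1..l} Gm y" using K(2)[OF i, of x] i unfolding q by (simp add: x_def)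
      hence "(real (a i))^2 * (y i / real (a i))^2 \<le> (real (a i))^2 * (K i * qfr {1..l} Gm y)" by (intro mult_left_mono) auto
      thus ?thesis using apos[of i] i by (simp add: power_divide)
    qed
    hence "(\<Sum>i\<in>{1..l}. (y i)^2) \<le> (\<Sum>i\<in>{1..l}. (real (a i))^2 * K i * qfr {1..l} Gm y)" by (rule sum_mono)
    also have "\<dots> = (T - 1) * qfr {1..l} Gm y" by (simp add: T_def sum_distrib_right)
    also have "\<dots> \<le> T * qfr {1..l} Gm y" using qfr_nonneg[of x] q by (simp add: algebra_simps)
    finally show ?thesis .
  qed
  hence "qfr {1..l} Gm y \<ge> inverse T * (\<Sum>i\<in>{1..l}. (y i)^2)" for y using T by (simp add: field_simps)
  thus ?thesis using T by (intro exI[of _ "inverse T"]) auto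
qed

subsection \<open>Root vectors\<close>

definition qz :: "(nat \<Rightarrow> int) \<Rightarrow> int" where
  "qz n = (\<Sum>i\<le>l. \<Sum>j\<le>l. int (c i) * cm g i j * n i * n j)"

lemma qz_real: "of_int (qz n) = qfr {..l} Gm (\<lambda>i. of_int (n i))"
  by (simp add: qz_def qfr_def Gm_def)

text \<open>Vectors on which the form vanishes are multiples of \<open>a\<close> by
  \<open>qfr_zero\<close>, so they have constant sign as \<open>int_quadratic_sign\<close>
  demands.\<close>

lemma sign_short:
  assumes "qz n = 2"
  shows "(\<forall>i\<le>l. n i \<ge> 0) \<or> (\<forall>i\<le>l. n i \<le> 0)"
proof (rule int_quadratic_sign[where B = "\<lambda>i j. int (c i) * cm g i j"])
  show "(\<Sum>i\<le>l. \<Sum>j\<le>l. int (c i) * cm g i j * n i * n j) \<ge> 0" for n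
    using qfr_nonneg[of "\<lambda>i. of_int (n i)"] by (simp only: qz_def[symmetric] qz_real[symmetric] of_int_0_le_iff)
  fix n assume "(\<Sum>i\<le>l. \<Sum>j\<le>l. int (c i) * cm g i j * n i * n j) = 0"
  hence "qfr {..l} Gm (\<lambda>i. of_int (n i)) = 0" by (simp only: qz_def[symmetric] qz_real[symmetric] of_int_0)
  hence h: "real_of_int (n i) = real (a i) * real_of_int (n 0)" if "i \<le> l" for i using qfr_zero that by blast
  have e: "n i = int (a i) * n 0" if "i \<le> l" for i
  proof -
    have "real_of_int (n i) = real_of_int (int (a i) * n 0)" using h[OF that] by simp
    thus ?thesis by (simp only: of_int_eq_iff)
  qed
  have "sgn (n i) = sgn (n 0)" if "i \<le> l" for i
    using arg_cong[OF e[OF that], of sgn] apos[OF that] by (simp add: sgn_mult)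
  thus "(\<forall>i\<le>l. n i = 0) \<or> (\<forall>i\<le>l. n i > 0) \<or> (\<forall>i\<le>l. n i < 0)"
    by (rule sgn_const_trichotomy)
next
  show "(\<Sum>i\<le>l. \<Sum>j\<le>l. int (c i) * cm g i j * n i * n j) = 2" using assms by (simp only: qz_def)
  show "even (int (c i) * cm g i i)" if "i \<le> l" for i using diag[OF that] by simp
  show "int (c i) * cm g i j = int (c j) * cm g j i" if "i \<le> l" "j \<le> l" for i j using csym[OF that] .
  show "int (c i) * cm g i j \<le> 0" if "i \<le> l" "j \<le> l" "i \<noteq> j" for i j
    using offd[OF that] by (intro mult_nonneg_nonpos) auto
qed

text \<open>For a root of norm 2r the numbers p_i = n_i c_i / r are the coordinates of its coroot.
  In them the form is \<open>r\<close> times an even integral form with entries b_j a_ij, where b_j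
  = r / c_j, and the vector has norm 2 again.\<close>

lemma sign_long:
  assumes q: "qz n = 2 * int r" and dv: "\<And>i. i \<le> l \<Longrightarrow> int r dvd n i * int (c i)"
  shows "(\<forall>i\<le>l. n i \<ge> 0) \<or> (\<forall>i\<le>l. n i \<le> 0)"
proof -
  define b where "b = (\<lambda>i. r div c i)"
  have bc: "b i * c i = r" if "i \<le> l" for i using cval[OF that] r0 by (auto simp: b_def)
  have b0: "b i > 0" if "i \<le> l" for i using bc[OF that] r0 by (metis mult_0 neq0_conv)
  define p where "p = (\<lambda>i. n i * int (c i) div int r)"
  have pn: "p i * int (b i) = n i" if "i \<le> l" for i
  proof -
    have "p i * int r = n i * int (c i)" using dv[OF that] by (simp add: p_def)
    hence "p i * int (b i) * int (c i) = n i * int (c i)" unfolding bc[OF that, symmetric] by (simp add: mult_ac)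
    thus ?thesis using cpos[OF that] by simp
  qed
  let ?B = "\<lambda>i j. int (b j) * cm g i j"
  have Bsym: "?B i j = ?B j i" if "i \<le> l" "j \<le> l" for i j
  proof -
    have "int (c i) * int (c j) * (?B i j) = int (c j) * int (b j) * (int (c i) * cm g i j)" by (simp add: mult_ac)
    also have "\<dots> = int r * (int (c i) * cm g i j)" using bc[OF that(2)] by (metis mult.commute of_nat_mult)
    also have "\<dots> = int r * (int (c j) * cm g j i)" using csym[OF that] by simp
    also have "\<dots> = int (c i) * int (b i) * (int (c j) * cm g j i)" using bc[OF that(1)] by (metis mult.commute of_nat_mult)
    also have "\<dots> = int (c i) * int (c j) * (?B j i)" by (simp add: mult_ac)
    finally show ?thesis using cpos[OF that(1)] cpos[OF that(2)] by simp
  qed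
  have qB: "int r * (\<Sum>i\<le>l. \<Sum>j\<le>l. ?B i j * p i * p j) = qz (\<lambda>i. p i * int (b i))" for p
  proof -
    have "int r * (?B i j * p i * p j) = int (c i) * cm g i j * (p i * int (b i)) * (p j * int (b j))" if "i \<le> l" "j \<le> l" for i j
      unfolding bc[OF that(1), symmetric] by (simp add: mult_ac)
    thus ?thesis unfolding qz_def sum_distrib_left by (intro sum.cong refl) auto
  qed
  have "(\<forall>i\<le>l. p i \<ge> 0) \<or> (\<forall>i\<le>l. p i \<le> 0)"
  proof (rule int_quadratic_sign[where B = ?B])
    fix n
    have "int r * (\<Sum>i\<le>l. \<Sum>j\<le>l. ?B i j * n i * n j) \<ge> 0"
      unfolding qB using qfr_nonneg[of "\<lambda>i. of_int (n i * int (b i))"] by (simp only: qz_real[symmetric] of_int_0_le_iff)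
    thus "(\<Sum>i\<le>l. \<Sum>j\<le>l. ?B i j * n i * n j) \<ge> 0" using r0 by (simp add: zero_le_mult_iff)
    assume "(\<Sum>i\<le>l. \<Sum>j\<le>l. ?B i j * n i * n j) = 0"
    hence "qz (\<lambda>i. n i * int (b i)) = 0" using qB[of n] by simp
    hence "qfr {..l} Gm (\<lambda>i. of_int (n i * int (b i))) = 0" by (simp only: qz_real[symmetric] of_int_0)
    hence h: "real_of_int (n i * int (b i)) = real (a i) * real_of_int (n 0 * int (b 0))" if "i \<le> l" for i
      using qfr_zero[of "\<lambda>i. of_int (n i * int (b i))"] that by blast
    have e: "n i * int (b i) = int (a i) * (n 0 * int (b 0))" if "i \<le> l" for i
    proof -
      have "real_of_int (n i * int (b i)) = real_of_int (int (a i) * (n 0 * int (b 0)))" using h[OF that] by simp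
      thus ?thesis by (simp only: of_int_eq_iff)
    qed
    have "sgn (n i) = sgn (n 0)" if "i \<le> l" for i
      using arg_cong[OF e[OF that], of sgn] b0[OF that] b0[of 0] apos[OF that] by (simp add: sgn_mult)
    thus "(\<forall>i\<le>l. n i = 0) \<or> (\<forall>i\<le>l. n i > 0) \<or> (\<forall>i\<le>l. n i < 0)"
      by (rule sgn_const_trichotomy)
  next
    have "qz (\<lambda>i. p i * int (b i)) = qz n" unfolding qz_def by (intro sum.cong refl) (simp add: pn)
    hence "int r * (\<Sum>i\<le>l. \<Sum>j\<le>l. ?B i j * p i * p j) = int r * 2" unfolding qB q by simp
    thus "(\<Sum>i\<le>l. \<Sum>j\<le>l. ?B i j * p i * p j) = 2" using r0 by simp
  next
    show "even (?B i i)" if "i \<le> l" for i using diag[OF that] by simp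
    show "?B i j = ?B j i" if "i \<le> l" "j \<le> l" for i j using Bsym[OF that] .
    show "?B i j \<le> 0" if "i \<le> l" "j \<le> l" "i \<noteq> j" for i j
      using offd[OF that] by (intro mult_nonneg_nonpos) auto
  qed
  thus ?thesis
  proof
    assume "\<forall>i\<le>l. p i \<ge> 0"
    hence "n i \<ge> 0" if "i \<le> l" for i unfolding pn[OF that, symmetric] using that by simp
    thus ?thesis by blast
  next
    assume "\<forall>i\<le>l. p i \<le> 0"
    hence "n i \<le> 0" if "i \<le> l" for i unfolding pn[OF that, symmetric] using that by (simp add: mult_nonpos_nonneg)
    thus ?thesis by blast
  qed
qed

end

section \<open>Linearity of reflections, words and the form\<close>

lemma scl_apply [simp]: "(t *\<^sub>s x) i = t * x i" by (simp add: scl_def)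
lemma sum_vec_apply: "(\<Sum>i\<in>S. f i) (j::'b) = (\<Sum>i\<in>S. f i j)" for f :: "'a \<Rightarrow> 'b \<Rightarrow> complex"
  by (induction S rule: infinite_finite_induct) auto
lemma sroot_apply: "sroot i j = (if j = i then 1 else 0)" by (simp add: unit_vec_def)

lemma word_Nil [simp]: "word g [] = id" by (simp add: word_def)
lemma word_Cons: "word g (i # is) = simple_refl g i \<circ> word g is" by (simp add: word_def)
lemma word_Cons_apply [simp]: "word g (i # is) x = simple_refl g i (word g is x)" by (simp add: word_def)
lemma word_append: "word g (is @ js) = word g is \<circ> word g js"
  by (induction "is") (auto simp: word_Cons)
lemma word_append_apply: "word g (is @ js) x = word g is (word g js x)"
  by (simp add: word_append)

lemma pairing_add: "pairing g (x + y) i = pairing g x i + pairing g y i"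
  by (simp add: pairing_def algebra_simps sum.distrib)
lemma pairing_scl: "pairing g (t *\<^sub>s x) i = t * pairing g x i"
  by (simp add: pairing_def algebra_simps sum_distrib_left)
lemma pairing_diff: "pairing g (x - y) i = pairing g x i - pairing g y i"
  by (simp add: pairing_def algebra_simps sum_subtractf)

lemma simple_refl_add: "simple_refl g i (x + y) = simple_refl g i x + simple_refl g i y"
  by (simp add: simple_refl_def pairing_add fun_eq_iff algebra_simps)
lemma simple_refl_scl: "simple_refl g i (t *\<^sub>s x) = t *\<^sub>s simple_refl g i x"
  by (simp add: simple_refl_def pairing_scl fun_eq_iff algebra_simps)
lemma word_add: "word g is (x + y) = word g is x + word g is y"
  by (induction "is") (simp_all only: word_Nil id_apply word_Cons_apply simple_refl_add)
lemma word_scl: "word g is (t *\<^sub>s x) = t *\<^sub>s word g is x"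
  by (induction "is") (simp_all only: word_Nil id_apply word_Cons_apply simple_refl_scl)
lemma vec_minus: "- x = (-1) *\<^sub>s x" by (simp add: fun_eq_iff)
lemma word_minus: "word g is (- x) = - word g is x"
  unfolding vec_minus by (rule word_scl)
lemma word_diff: "word g is (x - y) = word g is x - word g is y"
  using word_add[of g "is" x "- y"] by (simp add: word_minus)
lemma word_zero [simp]: "word g is 0 = 0"
  using word_scl[of g "is" 0 0] by (simp add: scl_def zero_fun_def)
lemma word_sum: "word g is (\<Sum>i\<in>S. f i) = (\<Sum>i\<in>S. word g is (f i))"
  by (induction S rule: infinite_finite_induct) (simp_all only: sum.infinite sum.empty sum.insert word_zero word_add simp_thms)

lemma form_add_left: "form g (x + y) z = form g x z + form g y z"
  by (simp add: form_def algebra_simps sum.distrib add_divide_distrib)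
lemma form_add_right: "form g z (x + y) = form g z x + form g z y"
  by (simp add: form_def algebra_simps sum.distrib add_divide_distrib)
lemma form_scl_left: "form g (t *\<^sub>s x) y = t * form g x y"
  by (simp add: form_def algebra_simps sum_distrib_left add_divide_distrib)
lemma form_scl_right: "form g x (t *\<^sub>s y) = t * form g x y"
  by (simp add: form_def algebra_simps sum_distrib_left add_divide_distrib)
lemma form_minus_left: "form g (- x) y = - form g x y"
  unfolding vec_minus form_scl_left by simp
lemma form_minus_right: "form g x (- y) = - form g x y"
  unfolding vec_minus form_scl_right by simp
lemma form_diff_left: "form g (x - y) z = form g x z - form g y z"
  using form_add_left[of g x "- y" z] by (simp add: form_minus_left)
lemma form_diff_right: "form g z (x - y) = form g z x - form g z y"
  using form_add_right[of g z x "- y"] by (simp add: form_minus_right)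
lemma form_zero_left [simp]: "form g 0 y = 0" by (simp add: form_def)
lemma form_zero_right [simp]: "form g x 0 = 0" by (simp add: form_def)
lemma form_sum_left: "form g (\<Sum>i\<in>S. f i) y = (\<Sum>i\<in>S. form g (f i) y)"
  by (induction S rule: infinite_finite_induct) (simp_all only: sum.infinite sum.empty sum.insert form_zero_left form_add_left simp_thms)
lemma form_sum_right: "form g y (\<Sum>i\<in>S. f i) = (\<Sum>i\<in>S. form g y (f i))"
  by (induction S rule: infinite_finite_induct) (simp_all only: sum.infinite sum.empty sum.insert form_zero_right form_add_right simp_thms)
lemmas form_bilinear = form_add_left form_add_right form_scl_left form_scl_right form_diff_left form_diff_right
  form_minus_left form_minus_right

context aff_data
begin

lemma form_eq: "\<langle>x, y\<rangle> = (\<Sum>i\<le>l. \<Sum>j\<le>l. x i * y j * (of_nat (c i) * of_int (cm g i j))) + (x 0 * y (Suc l) + x (Suc l) * y 0)"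
proof -
  have "of_nat (av i) / of_nat (a i) = (of_nat (c i) :: complex)" if "i \<le> l" for i
    using avc[OF that] apos[OF that] by simp
  hence "(\<Sum>i\<le>l. \<Sum>j\<le>l. x i * y j * (of_nat (av i) / of_nat (a i) * of_int (cm g i j))) =
      (\<Sum>i\<le>l. \<Sum>j\<le>l. x i * y j * (of_nat (c i) * of_int (cm g i j)))"
    by (intro sum.cong refl) (simp only: atMost_iff)
  thus ?thesis unfolding form_def label_eq colabel_eq a0 by simp
qed

lemma cGm: "of_nat (c i) * of_int (cm g i j) = (of_real (Gm i j) :: complex)" by (simp add: Gm_def)

lemma form_sym: "\<langle>x, y\<rangle> = \<langle>y, x\<rangle>"
proof -
  have "(\<Sum>i\<le>l. \<Sum>j\<le>l. x i * y j * (of_nat (c i) * of_int (cm g i j))) = (\<Sum>i\<le>l. \<Sum>j\<le>l. x j * y i * (of_nat (c j) * of_int (cm g j i)))"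
    by (rule sum.swap)
  thus ?thesis unfolding form_eq cGm by (simp add: Gm_sym mult_ac)
qed

lemma form_sroot: "i \<le> l \<Longrightarrow> \<langle>x, sroot i\<rangle> = of_nat (c i) * pr x i"
proof -
  assume i: "i \<le> l"
  have "\<langle>x, sroot i\<rangle> = \<langle>sroot i, x\<rangle>" by (rule form_sym)
  also have "\<dots> = (\<Sum>i'\<le>l. if i' = i then (\<Sum>j\<le>l. x j * (of_nat (c i) * of_int (cm g i j))) else 0) + (if i = 0 then x (Suc l) else 0)"
    unfolding form_eq
  proof (intro arg_cong2[where f = "(+)"] sum.cong refl)
    fix i'
    show "(\<Sum>j\<le>l. sroot i i' * x j * (of_nat (c i') * of_int (cm g i' j))) = (if i' = i then (\<Sum>j\<le>l. x j * (of_nat (c i) * of_int (cm g i j))) else 0)"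
      by (simp add: sroot_apply)
  qed (use i in \<open>auto simp: sroot_apply\<close>)
  also have "\<dots> = of_nat (c i) * pr x i"
    using i c0 by (simp add: pairing_def sum_distrib_left mult_ac)
  finally show ?thesis .
qed

lemma pr_sroot: "j \<le> l \<Longrightarrow> pr (sroot j) i = of_int (cm g i j)"
  by (simp add: pairing_def sroot_apply if_distrib[where f = "\<lambda>x. x * _"] cong: if_cong)

lemma delta_apply: "del j = (if j \<le> l then of_nat (a j) else 0)"
  by (simp add: delta_def sum_vec_apply sroot_apply label_eq if_distrib[where f = "\<lambda>x. _ * x"] cong: if_cong)

lemma pr_delta [simp]: "pr del i = 0"
proof (cases "i \<le> l")
  case True
  have "(\<Sum>j\<le>l. del j * of_int (cm g i j)) = of_int (\<Sum>j\<le>l. cm g i j * int (a j))"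
    by (simp add: delta_apply mult.commute)
  thus ?thesis using ker[OF True] by (simp add: pairing_def delta_apply)
qed (simp add: pairing_def delta_apply cm_out)

lemma sr_delta [simp]: "sr i del = del" by (simp add: simple_refl_def fun_eq_iff)
lemma word_delta [simp]: "word g is del = del" by (induction "is") auto

text \<open>The dual labels form a left kernel vector of the Cartan matrix, so only the Lambda_0
  coordinate contributes to the level.\<close>

lemma lev_eq: "lev x = x (Suc l)"
proof -
  have k: "(\<Sum>i\<le>l. of_nat (av i) * of_int (cm g i j)) = (0::complex)" if j: "j \<le> l" for j
  proof -
    have "(\<Sum>i\<le>l. of_nat (av i) * of_int (cm g i j)) = of_int (\<Sum>i\<le>l. int (a i) * (int (c i) * cm g i j))"
      by (simp add: avc mult_ac)
    also have "(\<Sum>i\<le>l. int (a i) * (int (c i) * cm g i j)) = (\<Sum>i\<le>l. int (c j) * (cm g j i * int (a i)))"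
      using csym j by (intro sum.cong) (auto simp: mult_ac)
    also have "\<dots> = 0" using ker[OF j] by (simp flip: sum_distrib_left)
    finally show ?thesis by simp
  qed
  have "lev x = (\<Sum>i\<le>l. \<Sum>j\<le>l. of_nat (av i) * (x j * of_int (cm g i j))) + (\<Sum>i\<le>l. of_nat (av i) * (if i = 0 then x (Suc l) else 0))"
    by (simp add: level_def colabel_eq pairing_def distrib_left sum.distrib sum_distrib_left)
  also have "(\<Sum>i\<le>l. of_nat (av i) * (if i = 0 then x (Suc l) else 0)) = x (Suc l)"
    using avc[of 0] c0 a0 by (simp add: if_distrib[where f = "\<lambda>x. _ * x"] cong: if_cong)
  also have "(\<Sum>i\<le>l. \<Sum>j\<le>l. of_nat (av i) * (x j * of_int (cm g i j))) = (\<Sum>j\<le>l. x j * (\<Sum>i\<le>l. of_nat (av i) * of_int (cm g i j)))"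
    by (subst sum.swap) (simp add: sum_distrib_left mult_ac)
  also have "\<dots> = 0" by (intro sum.neutral) (auto simp: k)
  finally show ?thesis by simp
qed

lemma form_delta: "\<langle>x, del\<rangle> = lev x"
proof -
  have "\<langle>x, del\<rangle> = (\<Sum>i\<le>l. of_nat (a i) * \<langle>x, sroot i\<rangle>)"
    unfolding delta_def label_eq by (simp add: form_sum_right form_scl_right)
  also have "\<dots> = lev x" unfolding level_def colabel_eq by (intro sum.cong refl) (simp add: form_sroot avc)
  finally show ?thesis .
qed

lemma form_Lambda0: "\<langle>x, Lambda0 g\<rangle> = x 0"
  unfolding form_eq by (simp add: Lambda0_def sroot_apply)

lemma lev_sr [simp]: "i \<le> l \<Longrightarrow> lev (sr i x) = lev x"
  by (simp add: lev_eq simple_refl_def sroot_apply)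

lemma sr_sr [simp]: "i \<le> l \<Longrightarrow> sr i (sr i x) = x"
  by (simp add: simple_refl_def pairing_diff pairing_scl pr_sroot diag fun_eq_iff algebra_simps)

lemma form_sr: "i \<le> l \<Longrightarrow> \<langle>sr i x, sr i y\<rangle> = \<langle>x, y\<rangle>"
proof -
  assume i: "i \<le> l"
  have "\<langle>sroot i, y\<rangle> = of_nat (c i) * pr y i" using form_sroot[OF i] form_sym by metis
  thus ?thesis
    unfolding simple_refl_def by (simp add: form_bilinear form_sroot i pr_sroot diag algebra_simps)
qed

lemma lev_word: "set is \<subseteq> {..l} \<Longrightarrow> lev (word g is x) = lev x"
  by (induction "is") auto
lemma form_word: "set is \<subseteq> {..l} \<Longrightarrow> \<langle>word g is x, word g is y\<rangle> = \<langle>x, y\<rangle>"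
  by (induction "is") (auto simp: form_sr)
lemma word_rev: "set is \<subseteq> {..l} \<Longrightarrow> word g (rev is) (word g is x) = x"
  by (induction "is" arbitrary: x) (auto simp: word_append_apply)
lemma word_rev': "set is \<subseteq> {..l} \<Longrightarrow> word g is (word g (rev is) x) = x"
  using word_rev[of "rev is" x] by simp
lemma form_word_adj: "set is \<subseteq> {..l} \<Longrightarrow> \<langle>word g is x, y\<rangle> = \<langle>x, word g (rev is) y\<rangle>"
  using form_word[of "rev is" "word g is x" y] by (simp add: word_rev)

subsection \<open>Roots as integer vectors\<close>

text \<open>Elements of the root lattice are handled as integer vectors, where signs and
  divisibility make sense; \<open>sz\<close> and \<open>wz\<close> are the simple reflections and
  words in these coordinates, \<open>uz\<close> gives the simple roots.\<close>

definition rv :: "(nat \<Rightarrow> int) \<Rightarrow> vec" where "rv n = (\<lambda>j. if j \<le> l then of_int (n j) else 0)"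
definition sz :: "nat \<Rightarrow> (nat \<Rightarrow> int) \<Rightarrow> nat \<Rightarrow> int" where
  "sz k n = n(k := n k - (\<Sum>j\<le>l. cm g k j * n j))"
definition wz :: "nat list \<Rightarrow> (nat \<Rightarrow> int) \<Rightarrow> nat \<Rightarrow> int" where "wz is n = foldr sz is n"
definition uz :: "nat \<Rightarrow> nat \<Rightarrow> int" where "uz i j = (if j = i then 1 else 0)"
definition zpos :: "(nat \<Rightarrow> int) \<Rightarrow> bool" where "zpos n \<longleftrightarrow> (\<forall>j\<le>l. n j \<ge> 0)"

lemma wz_Nil [simp]: "wz [] n = n" and wz_Cons [simp]: "wz (k # is) n = sz k (wz is n)"
  by (auto simp: wz_def)

lemma sroot_rv: "i \<le> l \<Longrightarrow> sroot i = rv (uz i)" by (auto simp: rv_def uz_def sroot_apply fun_eq_iff)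
lemma rv_inj: "rv n = rv n' \<Longrightarrow> j \<le> l \<Longrightarrow> n j = n' j"
  by (auto simp: rv_def fun_eq_iff dest: spec[of _ j])
lemma pr_rv: "k \<le> l \<Longrightarrow> pr (rv n) k = of_int (\<Sum>j\<le>l. cm g k j * n j)"
  by (simp add: pairing_def rv_def mult.commute)
lemma sr_rv: "k \<le> l \<Longrightarrow> sr k (rv n) = rv (sz k n)"
  unfolding simple_refl_def using pr_rv[of k n] by (auto simp: rv_def sz_def sroot_apply fun_eq_iff)
lemma word_rv: "set is \<subseteq> {..l} \<Longrightarrow> word g is (rv n) = rv (wz is n)"
  by (induction "is") (auto simp: sr_rv)
lemma lev_rv [simp]: "lev (rv n) = 0" by (simp add: lev_eq rv_def)
lemma form_rv: "\<langle>x, rv n\<rangle> = (\<Sum>j\<le>l. of_int (n j) * (of_nat (c j) * pr x j))"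
proof -
  have "rv n = (\<Sum>j\<le>l. of_int (n j) *\<^sub>s sroot j)"
    by (auto simp: rv_def fun_eq_iff sum_vec_apply sroot_apply if_distrib[where f = "\<lambda>x. _ * x"] cong: if_cong)
  thus ?thesis by (simp add: form_sum_right form_scl_right form_sroot)
qed
lemma form_rv_rv: "\<langle>rv n, rv n\<rangle> = of_int (qz n)"
  by (simp add: form_eq rv_def qz_def mult_ac)

lemma qz_sz: "k \<le> l \<Longrightarrow> qz (sz k n) = qz n"
proof -
  assume k: "k \<le> l"
  have "complex_of_int (qz (sz k n)) = of_int (qz n)"
    unfolding form_rv_rv[symmetric] sr_rv[OF k, symmetric] form_sr[OF k] ..
  thus ?thesis by (simp only: of_int_eq_iff)
qed
lemma qz_wz: "set is \<subseteq> {..l} \<Longrightarrow> qz (wz is n) = qz n"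
  by (induction "is") (auto simp: qz_sz)
lemma qz_uz: "i \<le> l \<Longrightarrow> qz (uz i) = 2 * int (c i)"
proof -
  assume i: "i \<le> l"
  have "complex_of_int (qz (uz i)) = of_int (2 * int (c i))"
    unfolding form_rv_rv[symmetric] sroot_rv[OF i, symmetric] by (simp add: form_sroot i pr_sroot diag)
  thus ?thesis by (simp only: of_int_eq_iff)
qed

text \<open>Integrality of the coroot of a root with c_i = r, as needed by \<open>sign_long\<close>.
  The symmetry c_i a_ij = c_j a_ji carries the divisibility through each reflection.\<close>

lemma root_divisible:
  assumes "set is \<subseteq> {..l}" "i \<le> l" "c i = r" "j \<le> l"
  shows "int r dvd wz is (uz i) j * int (c j)"
  using assms(1,4)
proof (induction "is" arbitrary: j)
  case Nil
  thus ?case using assms by (auto simp: uz_def)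
next
  case (Cons k ks)
  hence k: "k \<le> l" and IH: "\<And>j. j \<le> l \<Longrightarrow> int r dvd wz ks (uz i) j * int (c j)" by auto
  show ?case
  proof (cases "j = k")
    case True
    have "(\<Sum>j\<le>l. cm g k j * wz ks (uz i) j) * int (c k) = (\<Sum>j\<le>l. cm g j k * (wz ks (uz i) j * int (c j)))"
      unfolding sum_distrib_right
    proof (intro sum.cong refl)
      fix j assume "j \<in> {..l}"
      hence "int (c k) * cm g k j = int (c j) * cm g j k" using csym[of k j] k by simp
      thus "cm g k j * wz ks (uz i) j * int (c k) = cm g j k * (wz ks (uz i) j * int (c j))"
        by (metis mult.assoc mult.commute)
    qed
    moreover have "int r dvd (\<Sum>j\<le>l. cm g j k * (wz ks (uz i) j * int (c j)))"
      by (intro dvd_sum dvd_mult IH) auto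
    ultimately show ?thesis using IH[OF k] True by (simp add: sz_def left_diff_distrib)
  qed (use Cons IH in \<open>auto simp: sz_def\<close>)
qed

lemma root_sign:
  assumes "set is \<subseteq> {..l}" "i \<le> l"
  shows "zpos (wz is (uz i)) \<or> zpos (- wz is (uz i))"
proof -
  have q: "qz (wz is (uz i)) = 2 * int (c i)" using assms by (simp add: qz_wz qz_uz)
  have "(\<forall>j\<le>l. wz is (uz i) j \<ge> 0) \<or> (\<forall>j\<le>l. wz is (uz i) j \<le> 0)"
  proof (cases "c i = r")
    case True
    show ?thesis by (rule sign_long) (use q True root_divisible[OF assms True] in auto)
  next
    case False
    hence "c i = 1" using cval[OF assms(2)] by auto
    thus ?thesis using q by (intro sign_short) auto
  qed
  thus ?thesis by (auto simp: zpos_def)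
qed

text \<open>A reflection changes only its own coordinate, so a nonnegative vector that turns
  nonpositive cannot have another nonzero coordinate.\<close>

lemma sz_supported:
  assumes k: "k \<le> l" and pos: "zpos N" and neg: "\<not> zpos (sz k N)"
    and sgn: "zpos (sz k N) \<or> zpos (- sz k N)"
  shows "\<forall>j\<le>l. j \<noteq> k \<longrightarrow> N j = 0"
proof (safe, rule ccontr)
  fix j assume j: "j \<le> l" "j \<noteq> k" "N j \<noteq> 0"
  hence "N j > 0" using pos by (auto simp: zpos_def less_le)
  hence "sz k N j > 0" using j by (simp add: sz_def)
  moreover have "zpos (- sz k N)" using neg sgn by blast
  ultimately show False using j by (auto simp: zpos_def dest: spec[of _ j])
qed

text \<open>Exchange condition: along a word that turns a simple root negative, some letter sends a
  positive root to a negative one; that root is a multiple of the corresponding simple root, so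
  the two reflections agree and the letter can be deleted.\<close>

lemma exchange:
  assumes "set is \<subseteq> {..l}" "i \<le> l" "\<not> zpos (wz is (uz i))"
  shows "\<exists>ks. Suc (length ks) = length is \<and> set ks \<subseteq> set is \<and> word g is \<circ> sr i = word g ks"
  using assms(1,3)
proof (induction "is")
  case Nil
  thus ?case by (auto simp: zpos_def uz_def split: if_splits)
next
  case (Cons k ks)
  hence k: "k \<le> l" and ks: "set ks \<subseteq> {..l}" by auto
  define N where "N = wz ks (uz i)"
  show ?case
  proof (cases "zpos N")
    case False
    then obtain ks' where h: "Suc (length ks') = length ks" "set ks' \<subseteq> set ks" "word g ks \<circ> sr i = word g ks'"
      using Cons.IH[OF ks] unfolding N_def by blast
    have "word g (k # ks) \<circ> sr i = word g (k # ks')"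
      by (rule ext) (use fun_cong[OF h(3)] in simp)
    moreover have "Suc (length (k # ks')) = length (k # ks)" "set (k # ks') \<subseteq> set (k # ks)" using h by auto
    ultimately show ?thesis by blast
  next
    case True
    have sup: "\<forall>j\<le>l. j \<noteq> k \<longrightarrow> N j = 0"
      by (rule sz_supported[OF k True])
         (use Cons.prems root_sign[OF Cons.prems(1) assms(2)] in \<open>auto simp: N_def\<close>)
    define t where "t = N k"
    have rvN: "rv N = of_int t *\<^sub>s sroot k"
      using sup k by (auto simp: rv_def t_def sroot_apply fun_eq_iff)
    have w: "word g ks (sroot i) = of_int t *\<^sub>s sroot k"
      unfolding rvN[symmetric] N_def using word_rv[OF ks, of "uz i"] sroot_rv[OF assms(2)] by simp
    have "\<langle>word g ks (sroot i), word g ks (sroot i)\<rangle> = \<langle>sroot i, sroot i\<rangle>" by (rule form_word[OF ks])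
    hence t: "of_int t * of_int t * of_nat (c k) = (of_nat (c i) :: complex)"
      unfolding w by (simp add: form_bilinear form_sroot k assms(2) pr_sroot diag mult.assoc)
    have t0: "of_int t \<noteq> (0::complex)" using t cpos[OF assms(2)] by auto
    have ck: "of_nat (c k) \<noteq> (0::complex)" using cpos[OF k] by simp
    have "word g ks (sr i y) = sr k (word g ks y)" for y
    proof -
      have "\<langle>word g ks y, word g ks (sroot i)\<rangle> = \<langle>y, sroot i\<rangle>" by (rule form_word[OF ks])
      hence "of_int t * (of_nat (c k) * pr (word g ks y) k) = of_nat (c i) * pr y i"
        unfolding w by (simp add: form_bilinear form_sroot k assms(2))
      hence "of_int t * of_nat (c k) * pr (word g ks y) k = of_int t * of_nat (c k) * (of_int t * pr y i)"
        unfolding t[symmetric] by (simp add: mult_ac)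
      hence e: "pr (word g ks y) k = of_int t * pr y i" using t0 ck by simp
      have "word g ks (sr i y) = word g ks y - pr y i *\<^sub>s (of_int t *\<^sub>s sroot k)"
        by (simp add: simple_refl_def word_diff word_scl w)
      also have "\<dots> = sr k (word g ks y)"
        unfolding simple_refl_def e by (simp add: fun_eq_iff)
      finally show ?thesis .
    qed
    hence "(word g (k # ks) \<circ> sr i) y = word g ks y" for y using k by simp
    hence "word g (k # ks) \<circ> sr i = word g ks" by (rule ext)
    moreover have "Suc (length ks) = length (k # ks)" "set ks \<subseteq> set (k # ks)" by auto
    ultimately show ?thesis by blast
  qed
qed

lemma word_eq_wz:
  assumes "set is \<subseteq> {..l}" "set js \<subseteq> {..l}" "word g is = word g js" "j \<le> l"
  shows "wz is n j = wz js n j"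
  using assms by (metis rv_inj word_rv)

lemma wz_snoc_uz: "i \<le> l \<Longrightarrow> set js \<subseteq> {..l} \<Longrightarrow> j \<le> l \<Longrightarrow> wz (js @ [i]) (uz i) j = - wz js (uz i) j"
proof -
  assume a: "i \<le> l" "set js \<subseteq> {..l}" "j \<le> l"
  have "rv (wz (js @ [i]) (uz i)) = word g js (sr i (sroot i))"
    using a by (simp add: word_rv[symmetric] sroot_rv[symmetric] word_append_apply)
  also have "sr i (sroot i) = - sroot i"
    using a by (simp add: simple_refl_def pr_sroot diag fun_eq_iff sroot_apply)
  also have "word g js (- sroot i) = rv (- wz js (uz i))"
    using a by (simp add: word_minus sroot_rv word_rv) (simp add: rv_def fun_eq_iff)
  finally show ?thesis using rv_inj a(3) by fastforce
qed

lemma wz_uz_nonzero: "i \<le> l \<Longrightarrow> set is \<subseteq> {..l} \<Longrightarrow> \<not> (zpos (wz is (uz i)) \<and> zpos (- wz is (uz i)))"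
proof
  assume a: "i \<le> l" "set is \<subseteq> {..l}" "zpos (wz is (uz i)) \<and> zpos (- wz is (uz i))"
  hence "wz is (uz i) j = 0" if "j \<le> l" for j using that by (force simp: zpos_def)
  hence "qz (wz is (uz i)) = 0" by (simp add: qz_def)
  thus False using qz_wz[OF a(2)] qz_uz[OF a(1)] cpos[OF a(1)] by simp
qed

text \<open>If the last letter is \<open>i\<close>, the rest of the word sends alpha_i to a negative
  root, so \<open>exchange\<close> yields a word with two letters fewer. Parity is recorded along
  the way because letters disappear in pairs.\<close>

lemma positive_word_id:
  assumes "set is \<subseteq> {..l}" "\<And>i. i \<le> l \<Longrightarrow> zpos (wz is (uz i))"
  shows "word g is = id \<and> even (length is)"
  using assms
proof (induction "length is" arbitrary: "is" rule: less_induct)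
  case less
  show ?case
  proof (cases "is" rule: rev_cases)
    case (snoc js i)
    hence i: "i \<le> l" and js: "set js \<subseteq> {..l}" using less.prems by auto
    have "zpos (- wz js (uz i))" using less.prems(2)[OF i] wz_snoc_uz[OF i js] by (simp add: snoc zpos_def)
    hence "\<not> zpos (wz js (uz i))" using wz_uz_nonzero[OF i js] by blast
    from exchange[OF js i this] obtain ks where
      ks: "Suc (length ks) = length js" "set ks \<subseteq> set js" "word g js \<circ> sr i = word g ks" by blast
    have w: "word g is = word g ks" using ks(3) by (simp add: snoc word_append word_Cons)
    have ks': "set ks \<subseteq> {..l}" using ks js by auto
    have "zpos (wz ks (uz i'))" if "i' \<le> l" for i'
      using less.prems(2)[OF that] word_eq_wz[OF less.prems(1) ks' w] by (simp add: zpos_def)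
    moreover have len: "length is = length ks + 2" using ks(1) snoc by simp
    ultimately have "word g ks = id \<and> even (length ks)" by (intro less.hyps ks') auto
    thus ?thesis using w len by simp
  qed auto
qed

text \<open>\<open>positive_word_id\<close> for one word followed by the inverse of the other. This
  makes the sign computable from any word, although \<open>weyl_sign\<close> is defined through the
  minimal length.\<close>

lemma word_length_parity:
  assumes "set is \<subseteq> {..l}" "set js \<subseteq> {..l}" "word g is = word g js"
  shows "even (length is) = even (length js)"
proof -
  have s: "set (rev is @ js) \<subseteq> {..l}" using assms by auto
  have id: "word g (rev is @ js) = id"
    using assms by (auto simp: word_append word_rev fun_eq_iff simp flip: assms(3))
  have "zpos (wz (rev is @ js) (uz i))" if "i \<le> l" for i
    using word_eq_wz[OF s, of "[]"] id by (simp add: zpos_def uz_def)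
  from positive_word_id[OF s this] show ?thesis by simp
qed

end

section \<open>The finite Weyl group\<close>

lemma finite_int_vecs_bounded:
  assumes "finite S"
  shows "finite {n \<in> int_vecs S. (\<Sum>i\<in>S. (real_of_int (n i))^2) \<le> B}"
proof (rule finite_subset)
  define D where "D = \<lceil>B\<rceil> + 1"
  show "{n \<in> int_vecs S. (\<Sum>i\<in>S. (real_of_int (n i))^2) \<le> B} \<subseteq> {n. \<forall>i. (i \<in> S \<longrightarrow> n i \<in> {-D..D}) \<and> (i \<notin> S \<longrightarrow> n i = 0)}"
  proof safe
    fix n i assume n: "n \<in> int_vecs S" "(\<Sum>i\<in>S. (real_of_int (n i))^2) \<le> B"
    show "n i = 0" if "i \<notin> S" using n that by (auto simp: int_vecs_def)
    assume i: "i \<in> S"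
    have "\<bar>n i\<bar> \<le> (n i)^2"
    proof (cases "n i = 0")
      case False
      hence "\<bar>n i\<bar> * 1 \<le> \<bar>n i\<bar> * \<bar>n i\<bar>" by (intro mult_left_mono) auto
      thus ?thesis by (simp add: power2_eq_square)
    qed auto
    hence "real_of_int \<bar>n i\<bar> \<le> (real_of_int (n i))^2" by (simp flip: of_int_power)
    also have "\<dots> \<le> (\<Sum>i\<in>S. (real_of_int (n i))^2)" using i assms by (intro member_le_sum) auto
    finally have "real_of_int \<bar>n i\<bar> \<le> B" using n by linarith
    hence "\<bar>n i\<bar> \<le> D" unfolding D_def by linarith
    thus "n i \<in> {-D..D}" by auto
  qed
  show "finite {n. \<forall>i. (i \<in> S \<longrightarrow> n i \<in> {-D..D}) \<and> (i \<notin> S \<longrightarrow> n i = 0)}"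
    by (rule finite_set_of_finite_funs) (use assms in auto)
qed

interpretation intmod: module "\<lambda>n::int. scl (of_int n) :: vec \<Rightarrow> vec"
  by unfold_locales (auto simp: fun_eq_iff algebra_simps)

context aff_data
begin

abbreviation Wf where "Wf \<equiv> finite_weyl g"
abbreviation eps where "eps \<equiv> weyl_sign g"

lemma sub_l: "set is \<subseteq> {1..l} \<Longrightarrow> set is \<subseteq> {..l}" by auto

lemma weyl_sign_word:
  assumes "set is \<subseteq> {1..l}"
  shows "eps (word g is) = (-1) ^ length is"
proof -
  let ?P = "\<lambda>n. \<exists>js. length js = n \<and> set js \<subseteq> {1..l} \<and> word g is = word g js"
  have "?P (weyl_length g (word g is))" unfolding weyl_length_def
    by (rule LeastI[of ?P "length is"]) (use assms in auto)
  then obtain js where js: "length js = weyl_length g (word g is)" "set js \<subseteq> {1..l}" "word g is = word g js" by blast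
  have "even (length is) = even (length js)" by (rule word_length_parity[OF _ _ js(3)]) (use assms js in auto)
  thus ?thesis by (simp add: weyl_sign_def js(1)[symmetric] minus_one_power_iff)
qed

lemma Wf_word: "set is \<subseteq> {1..l} \<Longrightarrow> word g is \<in> Wf" by (auto simp: finite_weyl_def)
lemma WfE: assumes "w \<in> Wf" obtains "is" where "set is \<subseteq> {1..l}" "w = word g is"
  using assms by (auto simp: finite_weyl_def)

lemma fin_fixed:
  assumes "set is \<subseteq> {1..l}" "\<And>i. i \<in> {1..l} \<Longrightarrow> pr z i = 0"
  shows "word g is z = z"
  using assms(1) by (induction "is") (auto simp: simple_refl_def assms(2))

lemma fin_part_apply: "fin_part g x i = (if i \<in> {1..l} then x i - x 0 * of_nat (a i) else 0)"
  by (simp add: fin_part_def label_eq a0)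

lemma pr_fin_complement:
  assumes "i \<in> {1..l}"
  shows "pr (x - fin_part g x) i = 0"
proof -
  have "pr (x - fin_part g x) i = (\<Sum>j\<le>l. x 0 * del j * of_int (cm g i j))"
    unfolding pairing_def using assms by (auto intro!: sum.cong simp: fin_part_apply delta_apply a0 not_le)
  also have "\<dots> = pr (x 0 *\<^sub>s del) i" using assms by (simp add: pairing_def)
  finally show ?thesis by (simp add: pairing_scl)
qed

lemma wz_fin_zero: "set is \<subseteq> {1..l} \<Longrightarrow> n 0 = 0 \<Longrightarrow> wz is n 0 = 0"
  by (induction "is") (auto simp: sz_def)

lemma qfr_fin: "qfr {1..l} Gm y = qfr {..l} Gm (y(0 := 0))"
proof -
  have d: "{..l} = insert 0 {1..l}" by auto
  have "qfr {..l} Gm (y(0 := 0)) = qfr {1..l} Gm (y(0 := 0))" unfolding qfr_def d by simp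
  also have "\<dots> = qfr {1..l} Gm y" by (rule qfr_cong) auto
  finally show ?thesis by simp
qed

text \<open>An element is determined by its values on the simple roots alpha_1, ..., alpha_l,
  because it fixes a complement pointwise; these values are integer vectors of bounded norm.\<close>

lemma finite_Wf: "finite Wf"
proof -
  obtain e where e: "e > 0" "\<And>y. qfr {1..l} Gm y \<ge> e * (\<Sum>i\<in>{1..l}. (y i)^2)" using fin_pos_def by blast
  \<comment> \<open>The norms 2 c_i are at most 2r + 2, which covers both possible values of
    c_i.\<close>
  define B where "B = 2 * real r / e + 2 / e"
  define F where "F = rv ` {n \<in> int_vecs {1..l}. (\<Sum>i\<in>{1..l}. (real_of_int (n i))^2) \<le> B}"
  have F: "finite F" unfolding F_def by (intro finite_imageI finite_int_vecs_bounded) auto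
  have mem: "word g is (sroot i) \<in> F" if "is": "set is \<subseteq> {1..l}" and i: "i \<in> {1..l}" for "is" i
  proof -
    define n where "n = (\<lambda>j. if j \<in> {1..l} then wz is (uz i) j else 0)"
    have n0: "wz is (uz i) 0 = 0" by (rule wz_fin_zero[OF "is"]) (use i in \<open>auto simp: uz_def\<close>)
    have n: "n j = wz is (uz i) j" if "j \<le> l" for j using that n0 by (cases "j = 0") (auto simp: n_def)
    have "qz n = qz (wz is (uz i))" unfolding qz_def by (intro sum.cong refl) (simp add: n)
    also have "\<dots> = 2 * int (c i)" using qz_wz[OF sub_l[OF "is"]] qz_uz i by simp
    finally have "real_of_int (2 * int (c i)) = qfr {..l} Gm (\<lambda>i. of_int (n i))" by (simp flip: qz_real)
    also have "\<dots> = qfr {1..l} Gm (\<lambda>i. of_int (n i))" unfolding qfr_fin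
      by (rule qfr_cong) (auto simp: n_def)
    finally have "e * (\<Sum>i\<in>{1..l}. (real_of_int (n i))^2) \<le> 2 * real (c i)" using e(2)[of "\<lambda>i. of_int (n i)"] by simp
    moreover have "2 * real (c i) \<le> 2 * real r + 2" using cval[of i] i by auto
    ultimately have "(\<Sum>i\<in>{1..l}. (real_of_int (n i))^2) \<le> B" using e(1) unfolding B_def
      by (simp add: field_simps)
    hence "rv n \<in> F" by (auto simp: F_def int_vecs_def n_def)
    moreover have "rv n = word g is (sroot i)"
    proof -
      have "rv n = rv (wz is (uz i))" by (auto simp: rv_def n fun_eq_iff)
      also have "\<dots> = word g is (sroot i)" using i by (simp add: sroot_rv word_rv[OF sub_l[OF "is"]])
      finally show ?thesis .
    qed
    ultimately show ?thesis by simp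
  qed
  define R where "R = (\<lambda>w::vec \<Rightarrow> vec. restrict (\<lambda>i. w (sroot i)) {1..l})"
  have "inj_on R Wf"
  proof (rule inj_onI)
    fix w w' assume w: "w \<in> Wf" "w' \<in> Wf" and eq: "R w = R w'"
    from w obtain ks js where ks: "set ks \<subseteq> {1..l}" "w = word g ks" and js: "set js \<subseteq> {1..l}" "w' = word g js"
      by (auto elim!: WfE)
    have ww: "w (sroot i) = w' (sroot i)" if "i \<in> {1..l}" for i
      using fun_cong[OF eq, of i] that by (simp add: R_def)
    have fp: "fin_part g x = (\<Sum>i\<in>{1..l}. fin_part g x i *\<^sub>s sroot i)" for x
      by (auto simp: fun_eq_iff sum_vec_apply sroot_apply fin_part_apply if_distrib[where f = "\<lambda>x. _ * x"] cong: if_cong)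
    have "w x = w' x" for x
    proof -
      have "x = fin_part g x + (x - fin_part g x)" by simp
      hence "w x = w (fin_part g x) + w (x - fin_part g x)" "w' x = w' (fin_part g x) + w' (x - fin_part g x)"
        unfolding ks js by (metis word_add)+
      moreover have "w (x - fin_part g x) = x - fin_part g x" "w' (x - fin_part g x) = x - fin_part g x"
        unfolding ks js by (rule fin_fixed; use ks js pr_fin_complement in auto)+
      moreover have "w (fin_part g x) = w' (fin_part g x)"
        using ww unfolding ks js by (subst (1 2) fp) (simp only: word_sum word_scl cong: sum.cong)
      ultimately show ?thesis by simp
    qed
    thus "w = w'" by (rule ext)
  qed
  moreover have "R ` Wf \<subseteq> PiE {1..l} (\<lambda>_. F)"
  proof
    fix f assume "f \<in> R ` Wf"
    then obtain ks where "set ks \<subseteq> {1..l}" "f = R (word g ks)" by (auto elim!: WfE)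
    thus "f \<in> PiE {1..l} (\<lambda>_. F)" using mem[of ks] by (auto simp: R_def)
  qed
  moreover have "finite (PiE {1..l} (\<lambda>_. F))" using F by (intro finite_PiE) auto
  ultimately show ?thesis by (meson finite_imageD finite_subset)
qed

lemma Wf_comp: "w \<in> Wf \<Longrightarrow> w' \<in> Wf \<Longrightarrow> w \<circ> w' \<in> Wf"
  unfolding finite_weyl_def mem_Collect_eq by (metis Un_subset_iff set_append word_append)

lemma id_Wf: "id \<in> Wf" using Wf_word[of "[]"] by simp

lemma eps_comp: "w \<in> Wf \<Longrightarrow> w' \<in> Wf \<Longrightarrow> eps (w \<circ> w') = eps w * eps w'"
proof -
  assume "w \<in> Wf" "w' \<in> Wf"
  then obtain ks js where k: "set ks \<subseteq> {1..l}" "w = word g ks" and j: "set js \<subseteq> {1..l}" "w' = word g js" by (auto elim!: WfE)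
  have "w \<circ> w' = word g (ks @ js)" using k j by (simp add: word_append)
  thus ?thesis using k j weyl_sign_word[of "ks @ js"] by (simp add: weyl_sign_word power_add)
qed

lemma eps_pm: "w \<in> Wf \<Longrightarrow> eps w = 1 \<or> eps w = -1"
  by (auto simp: weyl_sign_def minus_one_power_iff)

lemma Wf_inverse: "w \<in> Wf \<Longrightarrow> \<exists>w'\<in>Wf. w' \<circ> w = id \<and> w \<circ> w' = id \<and> eps w' = eps w \<and> (\<forall>x y. \<langle>w x, y\<rangle> = \<langle>x, w' y\<rangle>)"
proof -
  assume "w \<in> Wf"
  then obtain ks where k: "set ks \<subseteq> {1..l}" "w = word g ks" by (auto elim!: WfE)
  have k': "set (rev ks) \<subseteq> {1..l}" using k by auto
  have "word g (rev ks) (w x) = x" "w (word g (rev ks) x) = x" for x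
    unfolding k(2) by (rule word_rev[OF sub_l[OF k(1)]], rule word_rev'[OF sub_l[OF k(1)]])
  hence "word g (rev ks) \<circ> w = id" "w \<circ> word g (rev ks) = id" by (auto simp: fun_eq_iff)
  moreover have "eps (word g (rev ks)) = eps w" using k k' by (simp add: weyl_sign_word)
  moreover have "\<langle>w x, y\<rangle> = \<langle>x, word g (rev ks) y\<rangle>" for x y
    unfolding k(2) by (rule form_word_adj[OF sub_l[OF k(1)]])
  ultimately show ?thesis using Wf_word[OF k'] by blast
qed

lemma Wf_linear: "w \<in> Wf \<Longrightarrow> w (x + y) = w x + w y" "w \<in> Wf \<Longrightarrow> w (t *\<^sub>s x) = t *\<^sub>s w x"
  by (auto elim!: WfE simp only: word_add word_scl)
lemma Wf_lev: "w \<in> Wf \<Longrightarrow> lev (w x) = lev x"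
  by (metis WfE lev_word sub_l)
lemma Wf_form: "w \<in> Wf \<Longrightarrow> \<langle>w x, w y\<rangle> = \<langle>x, y\<rangle>"
  by (metis WfE form_word sub_l)
lemma Wf_delta: "w \<in> Wf \<Longrightarrow> w del = del"
  by (metis WfE word_delta)
lemma sr_Wf: "i \<in> {1..l} \<Longrightarrow> sr i \<in> Wf"
  using Wf_word[of "[i]"] by (simp add: word_def)
lemma eps_sr: "i \<in> {1..l} \<Longrightarrow> eps (sr i) = -1"
  using weyl_sign_word[of "[i]"] by (simp add: word_def)

subsection \<open>Chambers\<close>

definition sdom :: "vec \<Rightarrow> bool" where "sdom x \<longleftrightarrow> (\<forall>i\<le>l. pr x i \<in> \<real> \<and> 0 < Re (pr x i))"

text \<open>For \<open>x\<close> and \<open>y\<close> strictly dominant, (x, alpha_i) = (y, w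
  alpha_i) is positive, so every w alpha_i is a positive root and w is trivial. The delta term is
  invisible because roots are orthogonal to delta.\<close>

lemma alcove_stabilizer:
  assumes x: "sdom x" and y: "sdom y" and "is": "set is \<subseteq> {..l}" and eq: "word g is x = y + e *\<^sub>s del"
  shows "word g is = id"
proof -
  have "zpos (wz is (uz i))" if i: "i \<le> l" for i
  proof (rule ccontr)
    define N where "N = wz is (uz i)"
    assume "\<not> zpos (wz is (uz i))"
    hence neg: "zpos (- N)" using root_sign[OF "is" i] by (auto simp: N_def)
    have "of_nat (c i) * pr x i = \<langle>x, sroot i\<rangle>" by (simp add: form_sroot i)
    also have "\<dots> = \<langle>word g is x, word g is (sroot i)\<rangle>" by (rule form_word[OF "is", symmetric])
    also have "\<dots> = \<langle>y, rv N\<rangle>"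
      using word_rv[OF "is", of "uz i"] i
      by (simp add: eq N_def sroot_rv form_add_left form_scl_left form_sym[of del] form_delta)
    also have "\<dots> = (\<Sum>j\<le>l. of_int (N j) * (of_nat (c j) * pr y j))" by (rule form_rv)
    finally have "Re (of_nat (c i) * pr x i) = (\<Sum>j\<le>l. Re (of_int (N j) * (of_nat (c j) * pr y j)))" by simp
    also have "\<dots> \<le> 0"
    proof (rule sum_nonpos)
      fix j assume j: "j \<in> {..l}"
      have "N j \<le> 0" using neg j by (auto simp: zpos_def)
      moreover have "real (c j) * Re (pr y j) \<ge> 0" using y j by (intro mult_nonneg_nonneg) (auto simp: sdom_def less_imp_le)
      ultimately show "Re (of_int (N j) * (of_nat (c j) * pr y j)) \<le> 0" by (simp add: mult_nonpos_nonneg)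
    qed
    finally have "real (c i) * Re (pr x i) \<le> 0" by simp
    moreover have "real (c i) * Re (pr x i) > 0" using x i cpos[OF i] by (auto simp: sdom_def)
    ultimately show False by simp
  qed
  from positive_word_id[OF "is" this] show ?thesis by simp
qed

text \<open>Induction on the word: if the image of the root of the last letter is positive, a
  nonnegative multiple of that root is subtracted; otherwise the exchange condition shortens the
  word.\<close>

lemma dominant_minus_orbit:
  assumes \<eta>: "\<And>i. i \<in> {1..l} \<Longrightarrow> pr \<eta> i \<in> \<real> \<and> 0 \<le> Re (pr \<eta> i)" and "is": "set is \<subseteq> {1..l}"
  shows "\<exists>t::nat \<Rightarrow> real. (\<forall>j. t j \<ge> 0) \<and> (\<forall>j. j \<notin> {1..l} \<longrightarrow> t j = 0) \<and> \<eta> - word g is \<eta> = (\<lambda>j. of_real (t j))"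
  using "is"
proof (induction "length is" arbitrary: "is" rule: less_induct)
  case less
  show ?case
  proof (cases "is" rule: rev_cases)
    case Nil
    thus ?thesis by (intro exI[of _ "\<lambda>_. 0"]) (auto simp: fun_eq_iff)
  next
    case (snoc js i)
    hence i: "i \<in> {1..l}" "i \<le> l" and js: "set js \<subseteq> {1..l}" "set js \<subseteq> {..l}" using less.prems by auto
    define N where "N = wz js (uz i)"
    show ?thesis
    proof (cases "zpos N")
      case True
      obtain t where t: "\<And>j. t j \<ge> 0" "\<And>j. j \<notin> {1..l} \<Longrightarrow> t j = 0" "\<eta> - word g js \<eta> = (\<lambda>j. of_real (t j))"
        using less.hyps[OF _ js(1)] snoc by auto
      define t' where "t' = (\<lambda>j. t j + Re (pr \<eta> i) * (if j \<in> {1..l} then real_of_int (N j) else 0))"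
      have N0: "N 0 = 0" unfolding N_def by (rule wz_fin_zero[OF js(1)]) (use i in \<open>auto simp: uz_def\<close>)
      have "word g is \<eta> = word g js \<eta> - pr \<eta> i *\<^sub>s rv N"
        unfolding snoc word_append_apply N_def
        using word_rv[OF js(2), of "uz i"] i by (simp add: simple_refl_def word_diff word_scl sroot_rv)
      moreover have "pr \<eta> i = of_real (Re (pr \<eta> i))" using \<eta>[OF i(1)] by simp
      ultimately have "\<eta> - word g is \<eta> = (\<lambda>j. of_real (t j)) + of_real (Re (pr \<eta> i)) *\<^sub>s rv N"
        using t(3) by (simp add: algebra_simps)
      also have "\<dots> = (\<lambda>j. of_real (t' j))"
        using N0 by (auto simp: fun_eq_iff rv_def t'_def not_le Suc_le_eq)
      finally have "\<eta> - word g is \<eta> = (\<lambda>j. of_real (t' j))" .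
      moreover have "t' j \<ge> 0" for j using t(1) \<eta>[OF i(1)] True by (auto simp: t'_def zpos_def)
      moreover have "t' j = 0" if "j \<notin> {1..l}" for j using t(2)[OF that] that by (simp only: t'_def if_False mult_zero_right add_0)
      ultimately show ?thesis by blast
    next
      case False
      from exchange[OF js(2) i(2) this[unfolded N_def]] obtain ks where
        ks: "Suc (length ks) = length js" "set ks \<subseteq> set js" "word g js \<circ> sr i = word g ks" by blast
      have w: "word g is = word g ks" using ks(3) by (simp only: snoc word_append word_Cons word_Nil comp_id)
      have "length ks < length is" using ks(1) snoc by simp
      from less.hyps[OF this] show ?thesis unfolding w using ks(2) js(1) by blast
    qed
  qed
qed

section \<open>The vector theta and its reflection\<close>

definition th :: vec where "th = del - sroot 0"
definition tz :: "nat \<Rightarrow> int" where "tz j = (if j \<in> {1..l} then int (a j) else 0)"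
abbreviation M where "M \<equiv> M_lattice g"

lemma th_rv: "th = rv tz"
  by (auto simp: th_def rv_def tz_def fun_eq_iff delta_apply sroot_apply a0 Suc_le_eq)

lemma theta_root_eq: "(1 / of_nat (label g 0)) *\<^sub>s theta_root g = th"
  by (simp add: theta_root_def label_eq a0 th_def fun_eq_iff)

lemma lev_del [simp]: "lev del = 0" by (simp add: lev_eq delta_apply)
lemma lev_sroot [simp]: "i \<le> l \<Longrightarrow> lev (sroot i) = 0" by (simp add: lev_eq sroot_apply)
lemma lev_th [simp]: "lev th = 0" by (simp add: th_rv)
lemma form_delta': "\<langle>del, x\<rangle> = lev x" using form_sym form_delta by metis

lemma lev_add: "lev (x + y) = lev x + lev y" and lev_scl: "lev (t *\<^sub>s x) = t * lev x"
  and lev_diff: "lev (x - y) = lev x - lev y"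
  by (simp_all add: lev_eq)

lemma form_th_th: "\<langle>th, th\<rangle> = 2"
  unfolding th_def by (simp add: form_bilinear form_delta form_delta' form_sroot pr_sroot diag c0 lev_diff)

lemma qz_tz: "qz tz = 2"
proof -
  have "complex_of_int (qz tz) = of_int 2" using form_th_th by (simp add: th_rv form_rv_rv)
  thus ?thesis by (simp only: of_int_eq_iff)
qed

lemma qz_expand: "qz n = (\<Sum>i\<le>l. n i * (int (c i) * (\<Sum>j\<le>l. cm g i j * n j)))"
  by (simp add: qz_def sum_distrib_left mult_ac)

text \<open>Descent on the height: some \<open>i\<close> in the support pairs positively with the
  vector, and reflecting in it lowers the height until a simple root is reached. The case needed is
  theta.\<close>

lemma norm2_conj:
  assumes "n 0 = 0" "qz n = 2" "zpos n"
  shows "\<exists>is i. set is \<subseteq> {1..l} \<and> i \<in> {1..l} \<and> c i = 1 \<and> rv n = word g is (sroot i)"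
  using assms
proof (induction "nat (\<Sum>j\<le>l. n j)" arbitrary: n rule: less_induct)
  case (less n)
  have "\<exists>i\<le>l. n i * (int (c i) * (\<Sum>j\<le>l. cm g i j * n j)) > 0"
  proof (rule ccontr)
    assume "\<not> ?thesis"
    hence "qz n \<le> 0" unfolding qz_expand by (intro sum_nonpos) (auto simp: not_less)
    thus False using less.prems by simp
  qed
  then obtain i where i: "i \<le> l" "n i * (int (c i) * (\<Sum>j\<le>l. cm g i j * n j)) > 0" by blast
  define s where "s = (\<Sum>j\<le>l. cm g i j * n j)"
  have ni: "n i > 0" "s > 0"
    using i less.prems(3) cpos[OF i(1)] by (auto simp: zpos_def s_def zero_less_mult_iff)
  have i1: "i \<in> {1..l}" using i(1) ni less.prems(1) by (cases "i = 0") auto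
  have n'0: "sz i n 0 = 0" using less.prems(1) i1 by (simp add: sz_def)
  have q': "qz (sz i n) = 2" using less.prems i by (simp add: qz_sz)
  show ?case
  proof (cases "zpos (sz i n)")
    case True
    have sumn: "(\<Sum>j\<le>l. sz i n j) = (\<Sum>j\<le>l. n j) - s"
    proof -
      have "sz i n j = n j - (if j = i then s else 0)" for j by (simp add: sz_def s_def)
      thus ?thesis using i by (simp add: sum_subtractf)
    qed
    have "(\<Sum>j\<le>l. sz i n j) \<ge> 0" using True by (intro sum_nonneg) (auto simp: zpos_def)
    hence "nat (\<Sum>j\<le>l. sz i n j) < nat (\<Sum>j\<le>l. n j)" using sumn ni by linarith
    from less.hyps[OF this n'0 q' True] obtain "is" i' where
      h: "set is \<subseteq> {1..l}" "i' \<in> {1..l}" "c i' = 1" "rv (sz i n) = word g is (sroot i')" by blast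
    have "rv n = sr i (rv (sz i n))" using i by (simp add: sr_rv[symmetric])
    also have "\<dots> = word g (i # is) (sroot i')" by (simp add: h)
    finally show ?thesis using h i1 by (intro exI[of _ "i # is"] exI[of _ i']) auto
  next
    \<comment> \<open>The reflected vector is negative, so \<open>n\<close> is supported at
      \<open>i\<close> alone, and norm 2 leaves only \<open>n i = 1\<close> and
      \<open>c i = 1\<close>.\<close>
    case False
    have "zpos (sz i n) \<or> zpos (- sz i n)" using sign_short[OF q'] by (auto simp: zpos_def)
    from sz_supported[OF i(1) less.prems(3) False this] have sup: "\<forall>j\<le>l. j \<noteq> i \<longrightarrow> n j = 0" .
    have "qz n = n i * (int (c i) * (cm g i i * n i))"
    proof -
      have "qz n = (\<Sum>j\<le>l. if j = i then n i * (int (c i) * (\<Sum>j\<le>l. cm g i j * n j)) else 0)"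
        unfolding qz_expand using sup by (intro sum.cong) auto
      also have "\<dots> = n i * (int (c i) * (\<Sum>j\<le>l. cm g i j * n j))" using i by simp
      also have "(\<Sum>j\<le>l. cm g i j * n j) = (\<Sum>j\<le>l. if j = i then cm g i i * n i else 0)"
        using sup by (intro sum.cong) auto
      also have "\<dots> = cm g i i * n i" using i by simp
      finally show ?thesis .
    qed
    hence "n i * n i * int (c i) = 1" using less.prems(2) diag[OF i(1)] by (simp add: mult_ac)
    hence "n i = 1 \<and> int (c i) = 1" using ni by (metis mult.commute mult.left_commute pos_zmult_eq_1_iff zmult_eq_1_iff of_nat_0_le_iff)
    hence "n i = 1" "c i = 1" by auto
    moreover have "rv n = sroot i" using sup \<open>n i = 1\<close> i by (auto simp: rv_def sroot_apply fun_eq_iff)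
    ultimately show ?thesis using i1 by (intro exI[of _ "[]"] exI[of _ i]) auto
  qed
qed

text \<open>The reflection in theta, since (theta, theta) = 2.\<close>

definition sth :: "vec \<Rightarrow> vec" where "sth x = x - \<langle>x, th\<rangle> *\<^sub>s th"

text \<open>Theta is conjugate to a simple root, so its reflection is a conjugate of a simple
  reflection: a word, its middle letter, and the reversed word, hence of odd length.\<close>

lemma sth_word: "\<exists>is. set is \<subseteq> {1..l} \<and> odd (length is) \<and> sth = word g is"
proof -
  have "zpos tz" by (auto simp: zpos_def tz_def)
  then obtain ks i where k: "set ks \<subseteq> {1..l}" "i \<in> {1..l}" "c i = 1" "th = word g ks (sroot i)"
    using norm2_conj[of tz] qz_tz by (auto simp: th_rv tz_def)
  have "sth x = word g (ks @ [i] @ rev ks) x" for x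
  proof -
    have "word g (ks @ [i] @ rev ks) x = word g ks (sr i (word g (rev ks) x))" by (simp add: word_append_apply)
    also have "\<dots> = word g ks (word g (rev ks) x) - pr (word g (rev ks) x) i *\<^sub>s th"
      by (simp add: simple_refl_def word_diff word_scl k(4))
    also have "word g ks (word g (rev ks) x) = x" by (rule word_rev'[OF sub_l[OF k(1)]])
    also have "pr (word g (rev ks) x) i = \<langle>x, th\<rangle>"
      using form_sroot[of i "word g (rev ks) x"] k form_word_adj[OF sub_l, of "rev ks" x "sroot i"] by auto
    finally show ?thesis by (simp only: sth_def)
  qed
  thus ?thesis using k by (intro exI[of _ "ks @ [i] @ rev ks"]) auto
qed

lemma sth_Wf: "sth \<in> Wf" and eps_sth: "eps sth = -1"
  using sth_word Wf_word weyl_sign_word by (metis, metis power_minus_odd power_one)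

subsection \<open>The lattice\<close>

lemma M_span: "M = intmod.span {w th |w. w \<in> Wf}"
  unfolding M_lattice_def theta_root_eq ..

lemma M_add: "\<alpha> \<in> M \<Longrightarrow> \<beta> \<in> M \<Longrightarrow> \<alpha> + \<beta> \<in> M"
  and M_scl: "\<alpha> \<in> M \<Longrightarrow> of_int n *\<^sub>s \<alpha> \<in> M"
  and M_diff: "\<alpha> \<in> M \<Longrightarrow> \<beta> \<in> M \<Longrightarrow> \<alpha> - \<beta> \<in> M"
  and M_zero: "0 \<in> M" and M_neg: "\<alpha> \<in> M \<Longrightarrow> - \<alpha> \<in> M"
  unfolding M_span by (auto intro: intmod.span_add intmod.span_scale intmod.span_diff intmod.span_zero intmod.span_neg)
lemma M_sum: "(\<And>i. i \<in> S \<Longrightarrow> f i \<in> M) \<Longrightarrow> (\<Sum>i\<in>S. f i) \<in> M"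
  unfolding M_span by (rule intmod.span_sum)

lemma th_M: "th \<in> M" unfolding M_span using id_Wf by (intro intmod.span_base) (auto intro: exI[of _ id])

lemma intmod_subspaceI:
  assumes "0 \<in> V" "\<And>x y. x \<in> V \<Longrightarrow> y \<in> V \<Longrightarrow> x + y \<in> V" "\<And>x. x \<in> V \<Longrightarrow> - x \<in> V"
  shows "intmod.subspace V"
proof (rule intmod.subspaceI)
  fix n :: int and x assume x: "x \<in> V"
  have nat: "of_int (int k) *\<^sub>s x \<in> V" for k
  proof (induction k)
    case 0
    have "of_int (int 0) *\<^sub>s x = 0" by (simp add: fun_eq_iff)
    thus ?case using assms(1) by (simp only:)
  next
    case (Suc k)
    have "of_int (int (Suc k)) *\<^sub>s x = of_int (int k) *\<^sub>s x + x" by (simp add: fun_eq_iff algebra_simps)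
    thus ?case using assms(2)[OF Suc x] by (simp only:)
  qed
  show "of_int n *\<^sub>s x \<in> V"
  proof (cases "n \<ge> 0")
    case True
    hence "int (nat n) = n" by simp
    thus ?thesis using nat[of "nat n"] by (simp only:)
  next
    case False
    hence "of_int n *\<^sub>s x = - (of_int (int (nat (- n))) *\<^sub>s x)" by (simp add: fun_eq_iff)
    thus ?thesis using assms(3)[OF nat[of "nat (-n)"]] by (simp only:)
  qed
qed (use assms in auto)

lemma M_induct:
  assumes "\<alpha> \<in> M" "\<And>w. w \<in> Wf \<Longrightarrow> w th \<in> V" "0 \<in> V" "\<And>x y. x \<in> V \<Longrightarrow> y \<in> V \<Longrightarrow> x + y \<in> V" "\<And>x. x \<in> V \<Longrightarrow> - x \<in> V"
  shows "\<alpha> \<in> V"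
proof -
  have "intmod.span {w th |w. w \<in> Wf} \<subseteq> V"
    by (rule intmod.span_minimal) (use assms intmod_subspaceI in auto)
  thus ?thesis using assms(1) M_span by blast
qed

lemma Wf_M: "w \<in> Wf \<Longrightarrow> \<alpha> \<in> M \<Longrightarrow> w \<alpha> \<in> M"
proof -
  assume w: "w \<in> Wf" and \<alpha>: "\<alpha> \<in> M"
  have "\<alpha> \<in> {x. w x \<in> M}"
  proof (rule M_induct[OF \<alpha>], unfold mem_Collect_eq)
    fix w' assume "w' \<in> Wf"
    hence "w \<circ> w' \<in> Wf" using w Wf_comp by blast
    thus "w (w' th) \<in> M" unfolding M_span by (intro intmod.span_base) (auto intro: exI[of _ "w \<circ> w'"])
  next
    show "w 0 \<in> M" using w M_zero by (auto elim!: WfE)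
    show "w (x + y) \<in> M" if "w x \<in> M" "w y \<in> M" for x y using that M_add w by (simp only: Wf_linear)
    show "w (- x) \<in> M" if "w x \<in> M" for x
    proof -
      have "w (- x) = - w x" using w by (auto elim!: WfE simp only: word_minus)
      thus ?thesis using M_neg[OF that] by simp
    qed
  qed
  thus ?thesis by simp
qed

text \<open>If x in \<open>M\<close> pairs to 1 or -1 with the coroot of alpha_i, then x - s_i x is
  alpha_i up to sign. Theta pairs to 1 where the entry a_i0 is -1, and further entries -1 pass
  membership on along the diagram.\<close>

lemma sroot_reach_M:
  assumes "1 \<le> i" "i < l"
  shows "sroot i \<in> M"
proof -
  have "i = 0 \<or> sroot i \<in> M"
    using reach[OF assms]
  proof (induction rule: rtrancl_induct)
    case (step j i)
    hence i: "i \<in> {1..l}" "i \<le> l" and j: "j \<le> l" and A: "cm g i j = -1" by auto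
    have gen: "sroot i \<in> M" if x: "x \<in> M" and p: "pr x i = 1 \<or> pr x i = -1" for x
    proof -
      have d: "x - sr i x \<in> M" using Wf_M[OF sr_Wf[OF i(1)] x] x M_diff by blast
      have "x - sr i x = pr x i *\<^sub>s sroot i" by (simp add: simple_refl_def)
      hence "x - sr i x = sroot i \<or> x - sr i x = - sroot i" using p by (auto simp: fun_eq_iff)
      thus ?thesis
      proof
        assume "x - sr i x = - sroot i"
        hence "sroot i = - (x - sr i x)" by (metis minus_minus)
        thus ?thesis using M_neg[OF d] by (simp only:)
      qed (use d in \<open>simp only:\<close>)
    qed
    show ?case
    proof (cases "j = 0")
      case True
      have "pr th i = 1" using A i True by (simp add: th_def pairing_diff pr_sroot)
      thus ?thesis using gen[OF th_M] by blast
    next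
      case False
      hence "sroot j \<in> M" using step.IH by blast
      moreover have "pr (sroot j) i = -1" using A j by (simp add: pr_sroot)
      ultimately show ?thesis using gen by blast
    qed
  qed auto
  thus ?thesis using assms by simp
qed

lemma rv_sum: "(\<And>j. j = 0 \<Longrightarrow> n j = 0) \<Longrightarrow> rv n = (\<Sum>i\<in>{1..l}. of_int (n i) *\<^sub>s sroot i)"
  by (auto simp: fun_eq_iff rv_def sum_vec_apply sroot_apply if_distrib[where f = "\<lambda>x. _ * x"] not_le Suc_le_eq cong: if_cong)

text \<open>The last simple root has coefficient a_l = 1 in theta, so it is theta minus a
  combination of the roots already reached.\<close>

lemma sroot_M: "i \<in> {1..l} \<Longrightarrow> sroot i \<in> M"
proof -
  assume i: "i \<in> {1..l}"
  have "sroot l \<in> M"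
  proof -
    have d: "{1..l} = insert l {1..<l}" using rk1 by auto
    define B where "B = (\<Sum>i\<in>{1..<l}. of_int (tz i) *\<^sub>s sroot i)"
    have "th = (\<Sum>i\<in>{1..l}. of_int (tz i) *\<^sub>s sroot i)"
      unfolding th_rv by (rule rv_sum) (simp add: tz_def)
    also have "\<dots> = of_int (tz l) *\<^sub>s sroot l + B" unfolding d B_def by (subst sum.insert) auto
    also have "tz l = 1" using rk1 alast by (simp add: tz_def)
    finally have "sroot l = th - B" by (simp add: fun_eq_iff)
    moreover have "B \<in> M" unfolding B_def by (intro M_sum M_scl sroot_reach_M) auto
    ultimately show ?thesis using M_diff[OF th_M] by simp
  qed
  thus ?thesis using i sroot_reach_M[of i] by (cases "i = l") auto
qed

lemma M_eq: "M = rv ` int_vecs {1..l}"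
proof
  show "rv ` int_vecs {1..l} \<subseteq> M"
  proof safe
    fix n assume "n \<in> int_vecs {1..l}"
    hence "n 0 = 0" by (simp add: int_vecs_def)
    hence "rv n = (\<Sum>i\<in>{1..l}. of_int (n i) *\<^sub>s sroot i)" by (intro rv_sum) auto
    thus "rv n \<in> M" by (simp only:) (intro M_sum M_scl sroot_M)
  qed
  have rvE: "rv n \<in> rv ` int_vecs {1..l}" if "n 0 = 0" for n
  proof
    show "rv n = rv (\<lambda>j. if j \<in> {1..l} then n j else 0)" using that by (auto simp: rv_def fun_eq_iff not_le Suc_le_eq)
  qed (auto simp: int_vecs_def)
  show "M \<subseteq> rv ` int_vecs {1..l}"
  proof
    fix \<alpha> assume \<alpha>: "\<alpha> \<in> M"
    show "\<alpha> \<in> rv ` int_vecs {1..l}"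
    proof (rule M_induct[OF \<alpha>])
      fix w assume "w \<in> Wf"
      then obtain ks where k: "set ks \<subseteq> {1..l}" "w = word g ks" by (auto elim!: WfE)
      have "w th = rv (wz ks tz)" by (simp only: k th_rv word_rv[OF sub_l[OF k(1)]])
      thus "w th \<in> rv ` int_vecs {1..l}" using rvE[of "wz ks tz", OF wz_fin_zero[OF k(1)]] by (simp add: tz_def)
    next
      show "0 \<in> rv ` int_vecs {1..l}"
        by (rule image_eqI[of _ _ "\<lambda>_. 0"]) (auto simp: rv_def int_vecs_def fun_eq_iff)
      fix x y assume "x \<in> rv ` int_vecs {1..l}" "y \<in> rv ` int_vecs {1..l}"
      then obtain n n' where n: "x = rv n" "n \<in> int_vecs {1..l}" "y = rv n'" "n' \<in> int_vecs {1..l}" by blast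
      show "x + y \<in> rv ` int_vecs {1..l}"
        by (rule image_eqI[of _ _ "\<lambda>j. n j + n' j"]) (use n in \<open>auto simp: rv_def int_vecs_def fun_eq_iff\<close>)
    next
      fix x assume "x \<in> rv ` int_vecs {1..l}"
      then obtain n where n: "x = rv n" "n \<in> int_vecs {1..l}" by blast
      show "- x \<in> rv ` int_vecs {1..l}"
        by (rule image_eqI[of _ _ "\<lambda>j. - n j"]) (use n in \<open>auto simp: rv_def int_vecs_def fun_eq_iff\<close>)
    qed
  qed
qed

lemma bij_rv: "bij_betw rv (int_vecs {1..l}) M"
  unfolding M_eq bij_betw_def
proof (rule conjI[OF inj_onI refl])
  fix n n' assume n: "n \<in> int_vecs {1..l}" "n' \<in> int_vecs {1..l}" "rv n = rv n'"
  show "n = n'"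
  proof
    fix j show "n j = n' j"
      using rv_inj[OF n(3), of j] n(1,2) by (cases "j \<in> {1..l}") (auto simp: int_vecs_def)
  qed
qed

lemma M_supp: "\<alpha> \<in> M \<Longrightarrow> j \<notin> {1..l} \<Longrightarrow> \<alpha> j = 0"
  unfolding M_eq by (auto simp: rv_def int_vecs_def)
lemma M_lev: "\<alpha> \<in> M \<Longrightarrow> lev \<alpha> = 0" using M_supp[of \<alpha> "Suc l"] by (simp add: lev_eq)

subsection \<open>Translations\<close>

abbreviation tr where "tr \<equiv> transl g"

lemma lev_tr: "lev \<alpha> = 0 \<Longrightarrow> lev (tr \<alpha> x) = lev x"
  unfolding transl_def by (simp add: lev_add lev_diff lev_scl)

lemma tr_add: "lev \<alpha> = 0 \<Longrightarrow> lev \<beta> = 0 \<Longrightarrow> tr \<alpha> (tr \<beta> x) = tr (\<alpha> + \<beta>) x"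
proof -
  assume a: "lev \<alpha> = 0" "lev \<beta> = 0"
  have f: "\<langle>tr \<beta> x, \<alpha>\<rangle> = \<langle>x, \<alpha>\<rangle> + lev x * \<langle>\<beta>, \<alpha>\<rangle>"
    unfolding transl_def using a by (simp add: form_bilinear form_delta')
  have s: "\<langle>\<alpha> + \<beta>, \<alpha> + \<beta>\<rangle> = \<langle>\<alpha>, \<alpha>\<rangle> + \<langle>\<beta>, \<beta>\<rangle> + 2 * \<langle>\<beta>, \<alpha>\<rangle>"
    by (simp add: form_bilinear form_sym[of \<alpha> \<beta>])
  show ?thesis
    unfolding transl_def[of g \<alpha>] f lev_tr[OF a(2)] unfolding transl_def s
    by (simp add: fun_eq_iff form_bilinear algebra_simps)
qed

lemma tr_zero [simp]: "tr 0 x = x" by (simp add: transl_def fun_eq_iff)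

lemma tr_word: "set is \<subseteq> {..l} \<Longrightarrow> word g is (tr \<alpha> x) = tr (word g is \<alpha>) (word g is x)"
  unfolding transl_def by (simp only: word_add word_diff word_scl word_delta lev_word form_word)

lemma tr_th: "tr th x = sr 0 (sth x)"
proof -
  have p0: "pr y 0 = \<langle>y, sroot 0\<rangle>" for y by (simp add: form_sroot c0)
  have s0: "sroot 0 = del - th" by (simp add: th_def)
  have "pr (sth x) 0 = lev x + \<langle>x, th\<rangle>"
    unfolding p0 s0 sth_def by (simp add: form_bilinear form_delta form_th_th lev_diff lev_scl)
  thus ?thesis unfolding simple_refl_def s0 unfolding sth_def transl_def form_th_th
    by (simp add: fun_eq_iff algebra_simps)
qed

text \<open>Translation by theta is s_0 composed with the reflection in theta, and conjugation by w
  turns it into translation by w theta. Hence translations by the generators of \<open>M\<close> are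
  words in the affine reflections.\<close>

lemma tr_M_word: "\<alpha> \<in> M \<Longrightarrow> \<exists>is. set is \<subseteq> {..l} \<and> tr \<alpha> = word g is"
proof -
  assume \<alpha>: "\<alpha> \<in> M"
  have "\<alpha> \<in> {\<alpha>. lev \<alpha> = 0 \<and> (\<exists>is. set is \<subseteq> {..l} \<and> tr \<alpha> = word g is)}"
  proof (rule M_induct[OF \<alpha>], unfold mem_Collect_eq)
    fix w assume w: "w \<in> Wf"
    then obtain ks where k: "set ks \<subseteq> {1..l}" "w = word g ks" by (auto elim!: WfE)
    note k' = sub_l[OF k(1)]
    obtain js where js: "set js \<subseteq> {1..l}" "sth = word g js" using sth_word by blast
    have "tr (w th) x = word g (ks @ 0 # js @ rev ks) x" for x
    proof -
      have "tr (w th) x = tr (w th) (w (word g (rev ks) x))" using word_rev'[OF k'] k by simp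
      also have "\<dots> = w (tr th (word g (rev ks) x))" unfolding k(2) tr_word[OF k'] ..
      finally show ?thesis by (simp add: tr_th js k word_append_apply)
    qed
    hence "tr (w th) = word g (ks @ 0 # js @ rev ks)" by (rule ext)
    thus "lev (w th) = 0 \<and> (\<exists>is. set is \<subseteq> {..l} \<and> tr (w th) = word g is)"
      using k' sub_l[OF js(1)] Wf_lev[OF w] by (intro conjI exI[of _ "ks @ 0 # js @ rev ks"]) auto
  next
    show "lev 0 = 0 \<and> (\<exists>is. set is \<subseteq> {..l} \<and> tr 0 = word g is)"
      by (intro conjI exI[of _ "[]"]) (auto simp: lev_eq)
  next
    fix x y assume h: "lev x = 0 \<and> (\<exists>is. set is \<subseteq> {..l} \<and> tr x = word g is)" "lev y = 0 \<and> (\<exists>is. set is \<subseteq> {..l} \<and> tr y = word g is)"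
    then obtain ks js where k: "set ks \<subseteq> {..l}" "tr x = word g ks" "set js \<subseteq> {..l}" "tr y = word g js" by blast
    have "tr (x + y) v = word g (ks @ js) v" for v
      using tr_add[of x y v] h k by (simp add: word_append_apply)
    hence "tr (x + y) = word g (ks @ js)" by (rule ext)
    thus "lev (x + y) = 0 \<and> (\<exists>is. set is \<subseteq> {..l} \<and> tr (x + y) = word g is)"
      using h k by (intro conjI exI[of _ "ks @ js"]) (auto simp: lev_eq)
  next
    fix x assume h: "lev x = 0 \<and> (\<exists>is. set is \<subseteq> {..l} \<and> tr x = word g is)"
    then obtain ks where k: "set ks \<subseteq> {..l}" "tr x = word g ks" by blast
    have lm: "lev (- x) = 0" using h by (simp add: lev_eq)
    have "tr (- x) v = word g (rev ks) v" for v
    proof -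
      have "tr x (tr (- x) v) = v" using tr_add[of x "- x" v] h lm by simp
      thus ?thesis using word_rev[OF k(1), of "tr (- x) v"] k by simp
    qed
    hence "tr (- x) = word g (rev ks)" by (rule ext)
    thus "lev (- x) = 0 \<and> (\<exists>is. set is \<subseteq> {..l} \<and> tr (- x) = word g is)"
      using lm k by (intro conjI exI[of _ "rev ks"]) auto
  qed
  thus ?thesis by simp
qed

lemma Lambda0_fixed: "w \<in> Wf \<Longrightarrow> w (Lambda0 g) = Lambda0 g"
  by (elim WfE) (auto intro!: fin_fixed sum.neutral simp: pairing_def Lambda0_def sroot_apply)

text \<open>Moving everything to one side gives an affine word taking \<open>x\<close> to
  \<open>y\<close> up to delta, which is the identity by \<open>alcove_stabilizer\<close>. Its
  effect on Lambda_0, which the finite Weyl group fixes, forces the translations to agree.\<close>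

lemma alcove_injective:
  assumes x: "sdom x" and y: "sdom y" and w: "w \<in> Wf" and w': "w' \<in> Wf"
    and \<alpha>: "\<alpha> \<in> M" and \<beta>: "\<beta> \<in> M" and eq: "tr \<alpha> (w x) = tr \<beta> (w' y) + e *\<^sub>s del"
  shows "w = w' \<and> \<alpha> = \<beta> \<and> x = y + e *\<^sub>s del"
proof -
  obtain ks js where k: "set ks \<subseteq> {1..l}" "w = word g ks" and j: "set js \<subseteq> {1..l}" "w' = word g js"
    using w w' by (auto elim!: WfE)
  note k' = sub_l[OF k(1)] and j' = sub_l[OF j(1)]
  have \<gamma>: "\<alpha> - \<beta> \<in> M" "- \<beta> \<in> M" using \<alpha> \<beta> M_diff M_neg by auto
  obtain ts where t: "set ts \<subseteq> {..l}" "tr (\<alpha> - \<beta>) = word g ts" using tr_M_word[OF \<gamma>(1)] by blast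
  define us where "us = rev js @ ts @ ks"
  have us: "set us \<subseteq> {..l}" using k' j' t by (auto simp: us_def)
  have u: "word g us v = word g (rev js) (tr (\<alpha> - \<beta>) (w v))" for v
    by (simp add: us_def word_append_apply t k)
  have tr_del: "tr \<gamma> (v + e *\<^sub>s del) = tr \<gamma> v + e *\<^sub>s del" if "lev \<gamma> = 0" for \<gamma> v
    unfolding transl_def using that by (simp add: lev_add lev_scl form_bilinear form_delta' fun_eq_iff)
  have sub: "tr (- \<beta>) (tr \<alpha> v) = tr (\<alpha> - \<beta>) v" for v
    using tr_add[OF M_lev[OF \<gamma>(2)] M_lev[OF \<alpha>], of v] by simp
  have "tr (\<alpha> - \<beta>) (w x) = tr (- \<beta>) (tr \<beta> (w' y) + e *\<^sub>s del)" unfolding sub[symmetric] eq ..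
  also have "\<dots> = w' y + e *\<^sub>s del"
    unfolding tr_del[OF M_lev[OF \<gamma>(2)]] tr_add[OF M_lev[OF \<gamma>(2)] M_lev[OF \<beta>]] by simp
  finally have "word g us x = y + e *\<^sub>s del"
    unfolding u by (simp add: word_add word_scl j word_rev[OF j'])
  from alcove_stabilizer[OF x y us this] have id: "word g us = id" .
  have xy: "x = y + e *\<^sub>s del" using \<open>word g us x = y + e *\<^sub>s del\<close> id by simp
  have h: "tr (\<alpha> - \<beta>) (w v) = w' v" for v
  proof -
    have "w' v = word g js (word g us v)" using id by (simp add: j)
    also have "\<dots> = tr (\<alpha> - \<beta>) (w v)" unfolding u by (rule word_rev'[OF j'])
    finally show ?thesis ..
  qed
  have ab: "\<alpha> = \<beta>"
  proof -
    have L: "lev (Lambda0 g) = 1" by (simp add: lev_eq Lambda0_def sroot_apply)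
    define t where "t = \<langle>Lambda0 g, \<alpha> - \<beta>\<rangle> + \<langle>\<alpha> - \<beta>, \<alpha> - \<beta>\<rangle> / 2"
    have "tr (\<alpha> - \<beta>) (Lambda0 g) = Lambda0 g" using h[of "Lambda0 g"] by (simp add: Lambda0_fixed w w')
    hence "\<alpha> - \<beta> = t *\<^sub>s del" unfolding transl_def L t_def by (simp add: fun_eq_iff algebra_simps)
    moreover have "(\<alpha> - \<beta>) 0 = 0" by (rule M_supp[OF \<gamma>(1)]) auto
    ultimately have "t = 0" by (simp add: delta_apply a0)
    thus ?thesis using \<open>\<alpha> - \<beta> = t *\<^sub>s del\<close> by simp
  qed
  have "w = w'" using h unfolding ab by (simp add: fun_eq_iff)
  thus ?thesis using ab xy by simp
qed

end

text \<open>Dedekind's argument: subtracting psi_a(y) times the relation from its translate by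
  \<open>y\<close> eliminates the index \<open>a\<close>. Only a submonoid \<open>P\<close> is
  involved, so multiplicativity is asked for on \<open>P\<close> alone.\<close>

lemma independent_characters:
  fixes \<psi> :: "'i \<Rightarrow> 'a::monoid_add \<Rightarrow> complex"
  assumes "finite I"
    and P: "0 \<in> P" "\<And>x y. x \<in> P \<Longrightarrow> y \<in> P \<Longrightarrow> x + y \<in> P"
    and hom: "\<And>i x y. i \<in> I \<Longrightarrow> x \<in> P \<Longrightarrow> y \<in> P \<Longrightarrow> \<psi> i (x + y) = \<psi> i x * \<psi> i y"
    and one: "\<And>i. i \<in> I \<Longrightarrow> \<psi> i 0 = 1"
    and dist: "\<And>i j. i \<in> I \<Longrightarrow> j \<in> I \<Longrightarrow> i \<noteq> j \<Longrightarrow> \<exists>x\<in>P. \<psi> i x \<noteq> \<psi> j x"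
    and zero: "\<And>x. x \<in> P \<Longrightarrow> (\<Sum>i\<in>I. c i * \<psi> i x) = 0"
  shows "\<forall>i\<in>I. c i = 0"
  using assms(1) hom one dist zero
proof (induction I arbitrary: c rule: finite_induct)
  case (insert a I)
  have "\<forall>i\<in>I. c i * (\<psi> i y - \<psi> a y) = 0" if y: "y \<in> P" for y
  proof (rule insert.IH)
    fix x assume x: "x \<in> P"
    have 1: "c a * \<psi> a (x + y) + (\<Sum>i\<in>I. c i * \<psi> i (x + y)) = 0"
      using insert.prems(4)[OF P(2)[OF x y]] insert.hyps by simp
    have 2: "c a * \<psi> a x + (\<Sum>i\<in>I. c i * \<psi> i x) = 0"
      using insert.prems(4)[OF x] insert.hyps by simp
    have "(\<Sum>i\<in>I. c i * (\<psi> i y - \<psi> a y) * \<psi> i x) = (\<Sum>i\<in>I. c i * \<psi> i (x + y)) - \<psi> a y * (\<Sum>i\<in>I. c i * \<psi> i x)"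
      using insert.prems(1) x y by (simp add: algebra_simps sum_subtractf sum_distrib_left)
    also have "\<dots> = 0" using 1[unfolded insert.prems(1)[OF insertI1 x y]] 2 by algebra
    finally show "(\<Sum>i\<in>I. c i * (\<psi> i y - \<psi> a y) * \<psi> i x) = 0" .
  qed (use insert.prems in auto)
  hence I: "c i = 0" if "i \<in> I" for i
    using insert.prems(3)[of i a] insert.hyps that by fastforce
  moreover have "c a = 0"
    using insert.prems(4)[OF P(1)] insert.prems(2) insert.hyps I by simp
  ultimately show ?case by auto
qed auto

lemma exists_min_finite_sublevel:
  fixes E :: "'a \<Rightarrow> real"
  assumes "y \<in> A" "finite {z \<in> A. E z \<le> E y}"
  shows "\<exists>z\<in>A. \<forall>z'\<in>A. E z \<le> E z'"
proof -
  obtain z where z: "z \<in> {z \<in> A. E z \<le> E y}" "\<And>z'. z' \<in> {z \<in> A. E z \<le> E y} \<Longrightarrow> E z \<le> E z'"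
    using ex_min_if_finite[of "E ` {z \<in> A. E z \<le> E y}"] assms
    by (metis (mono_tags, lifting) arg_min_if_finite(1) arg_min_least emptyE mem_Collect_eq order_refl)
  thus ?thesis by (metis (mono_tags, lifting) linorder_le_cases mem_Collect_eq order_trans)
qed

lemma Ints_Reals: "(x::complex) \<in> \<int> \<Longrightarrow> x \<in> \<real>" by (auto elim!: Ints_cases)

section \<open>The dual lattice of M\<close>

context aff_data
begin

abbreviation S where "S \<equiv> {1..l}"

definition Efin :: "vec set" where "Efin = {v. \<forall>j. j \<notin> S \<longrightarrow> v j = 0}"

text \<open>Both components are chosen together, so that the quadratic form and the constant come
  from one instance of the Poisson formula.\<close>

definition pdual :: "((nat \<Rightarrow> complex) \<Rightarrow> complex) \<times> complex" where
  "pdual = (SOME p. poisson_dual S Gm (fst p) (snd p))"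
definition Qd where "Qd = fst pdual"
definition Cd where "Cd = snd pdual"

lemma pdual: "poisson_dual S Gm Qd Cd"
proof -
  obtain e where e: "e > 0" "\<And>y. qfr S Gm y \<ge> e * (\<Sum>i\<in>S. (y i)^2)" using fin_pos_def by blast
  obtain Q C where "poisson_dual S Gm Q C" using lattice_poisson[OF _ e(1) Gm_sym e(2)] by blast
  hence "poisson_dual S Gm (fst (Q, C)) (snd (Q, C))" by simp
  thus ?thesis unfolding Qd_def Cd_def pdual_def by (rule someI)
qed

lemma Efin_expand: "v \<in> Efin \<Longrightarrow> v = (\<Sum>j\<in>S. v j *\<^sub>s sroot j)"
  by (auto simp: Efin_def fun_eq_iff sum_vec_apply sroot_apply if_distrib[where f = "\<lambda>x. _ * x"] cong: if_cong)

lemma form_E: "v \<in> Efin \<Longrightarrow> \<langle>x, v\<rangle> = (\<Sum>j\<in>S. v j * \<langle>x, sroot j\<rangle>)"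
  by (subst Efin_expand) (simp_all only: form_sum_right form_scl_right)

lemma sroot_form: "i \<le> l \<Longrightarrow> j \<le> l \<Longrightarrow> \<langle>sroot i, sroot j\<rangle> = of_real (Gm i j)"
  by (simp add: form_sroot pr_sroot Gm_sym[of i j]) (simp add: Gm_def)

lemma form_E_sroot: "v \<in> Efin \<Longrightarrow> i \<in> S \<Longrightarrow> \<langle>v, sroot i\<rangle> = (\<Sum>j\<in>S. of_real (Gm i j) * v j)"
  using form_E[of v "sroot i"] form_sym[of v "sroot i"] by (simp add: sroot_form mult.commute)

lemma form_EE: "v \<in> Efin \<Longrightarrow> \<langle>v, v\<rangle> = qf S Gm v"
  unfolding qf_def by (subst form_E) (auto simp: form_E_sroot sum_distrib_left mult_ac intro!: sum.cong)

text \<open>Identifies the abstract inverse form: it is the norm of a vector, expressed through the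
  pairings of that vector with the simple roots.\<close>

lemma Qd_form: "v \<in> Efin \<Longrightarrow> (\<And>i. i \<in> S \<Longrightarrow> \<kappa> i = \<langle>v, sroot i\<rangle>) \<Longrightarrow> Qd \<kappa> = \<langle>v, v\<rangle>"
proof -
  assume v: "v \<in> Efin" and k: "\<And>i. i \<in> S \<Longrightarrow> \<kappa> i = \<langle>v, sroot i\<rangle>"
  have "Qd \<kappa> = Qd (\<lambda>i. \<Sum>j\<in>S. of_real (Gm i j) * v j)"
    by (rule poisson_dualD(3)[OF pdual]) (simp add: k form_E_sroot[OF v])
  thus ?thesis using poisson_dualD(2)[OF pdual, of v] form_EE[OF v] by simp
qed

text \<open>The vector with pairings \<open>\<kappa> i\<close> against the simple roots, see
  \<open>wtr_sroot\<close>; a solution of the Gram system is picked by choice.\<close>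

definition wtr :: "(nat \<Rightarrow> real) \<Rightarrow> vec" where
  "wtr \<kappa> = (\<lambda>j. if j \<in> S then of_real ((SOME \<beta>. \<forall>i\<in>S. (\<Sum>j\<in>S. Gm i j * \<beta> j) = \<kappa> i) j) else 0)"
definition wt :: "(nat \<Rightarrow> int) \<Rightarrow> vec" where "wt k = wtr (\<lambda>i. of_int (k i))"
text \<open>The dual of the lattice \<open>M\<close>, see \<open>wlat_iff\<close> below.\<close>

definition wlat :: "vec set" where "wlat = {v \<in> Efin. \<forall>i\<in>S. \<langle>v, sroot i\<rangle> \<in> \<int>}"

lemma wtr_E: "wtr \<kappa> \<in> Efin" by (simp add: wtr_def Efin_def)

lemma wtr_sroot: "i \<in> S \<Longrightarrow> \<langle>wtr \<kappa>, sroot i\<rangle> = of_real (\<kappa> i)"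
proof -
  assume i: "i \<in> S"
  define \<beta> where "\<beta> = (SOME \<beta>. \<forall>i\<in>S. (\<Sum>j\<in>S. Gm i j * \<beta> j) = \<kappa> i)"
  have "\<forall>i\<in>S. (\<Sum>j\<in>S. Gm i j * \<beta> j) = \<kappa> i"
    unfolding \<beta>_def by (rule someI_ex[OF poisson_dualD(4)[OF pdual]])
  hence "(\<Sum>j\<in>S. Gm i j * \<beta> j) = \<kappa> i" using i by simp
  moreover have "(\<Sum>j\<in>S. of_real (Gm i j) * wtr \<kappa> j) = complex_of_real (\<Sum>j\<in>S. Gm i j * \<beta> j)"
  proof -
    have "wtr \<kappa> j = of_real (\<beta> j)" if "j \<in> S" for j
      unfolding wtr_def \<beta>_def[symmetric] using that by simp
    thus ?thesis by simp
  qed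
  ultimately show ?thesis unfolding form_E_sroot[OF wtr_E i] by simp
qed

lemma Efin_nondegenerate: "v \<in> Efin \<Longrightarrow> (\<And>i. i \<in> S \<Longrightarrow> \<langle>v, sroot i\<rangle> = 0) \<Longrightarrow> v = 0"
proof
  fix j assume v: "v \<in> Efin" and z: "\<And>i. i \<in> S \<Longrightarrow> \<langle>v, sroot i\<rangle> = 0"
  show "v j = 0 j"
  proof (cases "j \<in> S")
    case True
    \<comment> \<open>A dual basis vector, so that pairing with it reads off the coordinate
      \<open>v j\<close>.\<close>
    define u where "u = wtr (\<lambda>i. if i = j then 1 else 0)"
    have "\<langle>u, v\<rangle> = (\<Sum>i\<in>S. v i * of_real (if i = j then 1 else 0))"
      unfolding form_E[OF v] by (intro sum.cong refl) (simp add: u_def wtr_sroot)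
    also have "\<dots> = v j" using True by (simp add: if_distrib[where f = of_real] if_distrib[where f = "\<lambda>x. _ * x"] cong: if_cong)
    finally have "v j = \<langle>v, u\<rangle>" using form_sym by metis
    also have "\<dots> = 0" unfolding u_def form_E[OF wtr_E] by (intro sum.neutral) (simp add: z)
    finally show ?thesis by simp
  qed (use v in \<open>simp add: Efin_def\<close>)
qed

lemma Efin_closed: "x \<in> Efin \<Longrightarrow> y \<in> Efin \<Longrightarrow> x + y \<in> Efin" "x \<in> Efin \<Longrightarrow> y \<in> Efin \<Longrightarrow> x - y \<in> Efin"
  "x \<in> Efin \<Longrightarrow> t *\<^sub>s x \<in> Efin" "0 \<in> Efin" "x \<in> Efin \<Longrightarrow> - x \<in> Efin" "i \<in> S \<Longrightarrow> sroot i \<in> Efin"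
  by (auto simp: Efin_def sroot_apply)

lemma Efin_eqI: "v \<in> Efin \<Longrightarrow> v' \<in> Efin \<Longrightarrow> (\<And>i. i \<in> S \<Longrightarrow> \<langle>v, sroot i\<rangle> = \<langle>v', sroot i\<rangle>) \<Longrightarrow> v = v'"
  using Efin_nondegenerate[of "v - v'"] Efin_closed(2)[of v v'] by (simp add: form_diff_left)

lemma M_E: "\<alpha> \<in> M \<Longrightarrow> \<alpha> \<in> Efin" by (simp add: Efin_def M_supp)

lemma Wf_E: "w \<in> Wf \<Longrightarrow> v \<in> Efin \<Longrightarrow> w v \<in> Efin"
proof -
  assume w: "w \<in> Wf" and v: "v \<in> Efin"
  then obtain ks where k: "set ks \<subseteq> S" "w = word g ks" by (auto elim!: WfE)
  have "word g ks v \<in> Efin" using k(1)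
    by (induction ks) (use v in \<open>auto simp: simple_refl_def intro!: Efin_closed\<close>)
  thus ?thesis using k by simp
qed

lemma wt_sroot: "i \<in> S \<Longrightarrow> \<langle>wt k, sroot i\<rangle> = of_int (k i)" by (simp add: wt_def wtr_sroot)
lemma wt_wlat: "wt k \<in> wlat" by (simp add: wlat_def wt_sroot wtr_E[of "\<lambda>i. of_int (k i)", folded wt_def])

lemma bij_wt: "bij_betw wt (int_vecs S) wlat"
proof (rule bij_betwI')
  fix k k' assume k: "k \<in> int_vecs S" "k' \<in> int_vecs S"
  show "(wt k = wt k') = (k = k')"
  proof
    assume e: "wt k = wt k'"
    show "k = k'"
    proof
      fix i show "k i = k' i"
      proof (cases "i \<in> S")
        case True
        have "complex_of_int (k i) = of_int (k' i)" using wt_sroot[OF True, of k] wt_sroot[OF True, of k'] e by simp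
        thus ?thesis by (simp only: of_int_eq_iff)
      qed (use k in \<open>simp add: int_vecs_def\<close>)
    qed
  qed simp
next
  fix v assume v: "v \<in> wlat"
  define k where "k = (\<lambda>i. if i \<in> S then \<lfloor>Re \<langle>v, sroot i\<rangle>\<rfloor> else 0)"
  have "v = wt k"
  proof (rule Efin_eqI)
    fix i assume i: "i \<in> S"
    have "\<langle>v, sroot i\<rangle> \<in> \<int>" using v i by (simp add: wlat_def)
    thus "\<langle>v, sroot i\<rangle> = \<langle>wt k, sroot i\<rangle>" unfolding wt_sroot[OF i] using i by (auto simp: k_def elim!: Ints_cases)
  qed (use v wt_wlat[of k] in \<open>auto simp: wlat_def\<close>)
  thus "\<exists>k\<in>int_vecs S. v = wt k" by (intro bexI[of _ k]) (auto simp: int_vecs_def k_def)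
qed (rule wt_wlat)

lemma wlat_E: "y \<in> wlat \<Longrightarrow> y \<in> Efin" by (simp add: wlat_def)
lemma wlatE: assumes "y \<in> wlat" obtains k where "k \<in> int_vecs S" "y = wt k"
  using assms bij_wt by (auto simp: bij_betw_def)

lemma wlat_M_int: "y \<in> wlat \<Longrightarrow> \<alpha> \<in> M \<Longrightarrow> \<langle>y, \<alpha>\<rangle> \<in> \<int>"
proof -
  assume y: "y \<in> wlat" and \<alpha>: "\<alpha> \<in> M"
  have "\<alpha> j \<in> \<int>" for j using \<alpha> unfolding M_eq by (auto simp: rv_def)
  thus ?thesis unfolding form_E[OF M_E[OF \<alpha>]] using y by (auto simp: wlat_def intro!: Ints_sum Ints_mult)
qed

lemma wlat_iff: "y \<in> wlat \<longleftrightarrow> y \<in> Efin \<and> (\<forall>\<alpha>\<in>M. \<langle>y, \<alpha>\<rangle> \<in> \<int>)"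
  using wlat_M_int sroot_M by (auto simp: wlat_def)

lemma pr_rv_int: "k \<le> l \<Longrightarrow> pr (rv n) k \<in> \<int>" unfolding pr_rv by (rule Ints_of_int)

lemma M_wlat: "\<alpha> \<in> M \<Longrightarrow> \<alpha> \<in> wlat"
  unfolding wlat_def using M_E[of \<alpha>] by (auto simp: form_sroot M_eq intro!: Ints_mult pr_rv_int)

lemma wlat_closed: "x \<in> wlat \<Longrightarrow> y \<in> wlat \<Longrightarrow> x + y \<in> wlat" "x \<in> wlat \<Longrightarrow> y \<in> wlat \<Longrightarrow> x - y \<in> wlat"
  "x \<in> wlat \<Longrightarrow> of_nat m *\<^sub>s x \<in> wlat" "0 \<in> wlat" "x \<in> wlat \<Longrightarrow> - x \<in> wlat"
  unfolding wlat_def by (auto simp: Efin_closed form_bilinear intro: Ints_mult)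

lemma Wf_wlat: "w \<in> Wf \<Longrightarrow> y \<in> wlat \<Longrightarrow> w y \<in> wlat"
proof -
  assume w: "w \<in> Wf" and y: "y \<in> wlat"
  obtain w' where w': "w' \<in> Wf" "\<forall>x y. \<langle>w x, y\<rangle> = \<langle>x, w' y\<rangle>" using Wf_inverse[OF w] by blast
  show ?thesis unfolding wlat_iff using Wf_E[OF w wlat_E[OF y]] wlat_M_int[OF y Wf_M[OF w'(1)]] w'(2) by auto
qed

lemma wtr_real: "wtr \<kappa> j \<in> \<real>" by (simp add: wtr_def)
lemma wlat_real: "y \<in> wlat \<Longrightarrow> y j \<in> \<real>" by (auto elim!: wlatE simp: wt_def wtr_real)

lemma form_real_E: "v \<in> Efin \<Longrightarrow> (\<And>j. v j \<in> \<real>) \<Longrightarrow> (\<And>j. x j \<in> \<real>) \<Longrightarrow> x \<in> Efin \<Longrightarrow> \<langle>x, v\<rangle> \<in> \<real>"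
  by (simp add: form_E form_E_sroot)

lemma wtr_norm_bound: "\<exists>\<epsilon>>0. \<forall>\<kappa>. Re \<langle>wtr \<kappa>, wtr \<kappa>\<rangle> \<ge> \<epsilon> * (\<Sum>i\<in>S. (\<kappa> i)^2)"
proof -
  obtain e where e: "e > 0" "\<And>y. qfr S Gm y \<ge> e * (\<Sum>i\<in>S. (y i)^2)" using fin_pos_def by blast
  obtain \<epsilon> where \<epsilon>: "\<epsilon> > 0" "\<And>\<kappa>::nat \<Rightarrow> real. \<exists>q. Qd (\<lambda>i. of_real (\<kappa> i)) = of_real q \<and> q \<ge> \<epsilon> * (\<Sum>i\<in>S. (\<kappa> i)^2)"
    using dual_form_bound[where Qd = Qd, OF _ e poisson_dualD(2)[OF pdual] poisson_dualD(3)[OF pdual] poisson_dualD(4)[OF pdual]]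
    by (metis finite_atLeastAtMost)
  have "Re \<langle>wtr \<kappa>, wtr \<kappa>\<rangle> \<ge> \<epsilon> * (\<Sum>i\<in>S. (\<kappa> i)^2)" for \<kappa>
  proof -
    have "Qd (\<lambda>i. of_real (\<kappa> i)) = \<langle>wtr \<kappa>, wtr \<kappa>\<rangle>" by (rule Qd_form[OF wtr_E]) (simp add: wtr_sroot)
    thus ?thesis using \<epsilon>(2)[of \<kappa>] by auto
  qed
  thus ?thesis using \<epsilon>(1) by blast
qed

text \<open>The centre is arbitrary because two minimisations rely on this: one around a point
  inside the alcove and one around the origin.\<close>

lemma finite_wlat_ball: "finite {y \<in> wlat. Re \<langle>y - wtr \<kappa>, y - wtr \<kappa>\<rangle> \<le> B}"
proof -
  obtain \<epsilon> where \<epsilon>: "\<epsilon> > 0" "\<And>\<kappa>. Re \<langle>wtr \<kappa>, wtr \<kappa>\<rangle> \<ge> \<epsilon> * (\<Sum>i\<in>S. (\<kappa> i)^2)" using wtr_norm_bound by blast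
  define B' where "B' = 2 * (B / \<epsilon>) + 2 * (\<Sum>i\<in>S. (\<kappa> i)^2)"
  have "{y \<in> wlat. Re \<langle>y - wtr \<kappa>, y - wtr \<kappa>\<rangle> \<le> B} \<subseteq> wt ` {n \<in> int_vecs S. (\<Sum>i\<in>S. (real_of_int (n i))^2) \<le> B'}"
  proof safe
    fix y assume y: "y \<in> wlat" "Re \<langle>y - wtr \<kappa>, y - wtr \<kappa>\<rangle> \<le> B"
    obtain k where k: "k \<in> int_vecs S" "y = wt k" using y(1) by (elim wlatE)
    have "y - wtr \<kappa> = wtr (\<lambda>i. of_int (k i) - \<kappa> i)"
      by (rule Efin_eqI) (use y k in \<open>auto simp: wlat_E wtr_E Efin_closed form_diff_left wt_sroot wtr_sroot\<close>)
    hence "\<epsilon> * (\<Sum>i\<in>S. (of_int (k i) - \<kappa> i)^2) \<le> B" using \<epsilon>(2)[of "\<lambda>i. of_int (k i) - \<kappa> i"] y(2) by simp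
    hence 1: "(\<Sum>i\<in>S. (of_int (k i) - \<kappa> i)^2) \<le> B / \<epsilon>" using \<epsilon>(1) by (simp add: field_simps)
    have "(\<Sum>i\<in>S. (real_of_int (k i))^2) \<le> (\<Sum>i\<in>S. 2 * (of_int (k i) - \<kappa> i)^2 + 2 * (\<kappa> i)^2)"
    proof (rule sum_mono)
      fix i show "(real_of_int (k i))^2 \<le> 2 * (of_int (k i) - \<kappa> i)^2 + 2 * (\<kappa> i)^2"
        using zero_le_power2[of "real_of_int (k i) - 2 * \<kappa> i"] by (simp add: power2_eq_square algebra_simps)
    qed
    also have "\<dots> \<le> B'" using 1 by (simp add: B'_def sum.distrib flip: sum_distrib_left)
    finally show "y \<in> wt ` {n \<in> int_vecs S. (\<Sum>i\<in>S. (real_of_int (n i))^2) \<le> B'}" using k by blast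
  qed
  thus ?thesis by (rule finite_subset) (intro finite_imageI finite_int_vecs_bounded, simp)
qed

lemma form_th_E: "v \<in> Efin \<Longrightarrow> \<langle>v, th\<rangle> = (\<Sum>j\<in>S. of_nat (a j) * \<langle>v, sroot j\<rangle>)"
  by (subst form_E[OF M_E[OF th_M]]) (auto simp: th_rv rv_def tz_def intro!: sum.cong)

lemma form_square_add_scl: "\<langle>x + t *\<^sub>s y, x + t *\<^sub>s y\<rangle> = \<langle>x, x\<rangle> + 2 * t * \<langle>x, y\<rangle> + t * t * \<langle>y, y\<rangle>"
  unfolding form_bilinear form_sym[of y x] by (simp add: algebra_simps)

lemma sr_minus: "sr i z - q = (z - q) + (- pr z i) *\<^sub>s sroot i"
  unfolding simple_refl_def by (rule ext) simp

subsection \<open>Alcove representatives\<close>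

text \<open>Take the point of the affine orbit nearest to an interior point \<open>q\<close> of the
  alcove. If it violated a wall, reflecting in that wall would bring it strictly closer to
  \<open>q\<close>.\<close>

lemma alcove_representative:
  assumes y: "y \<in> wlat" and m: "m > 0"
  shows "\<exists>w\<in>Wf. \<exists>\<alpha>\<in>M. (\<forall>i\<in>S. Re \<langle>w y + of_nat m *\<^sub>s \<alpha>, sroot i\<rangle> \<ge> 0) \<and> Re \<langle>w y + of_nat m *\<^sub>s \<alpha>, th\<rangle> \<le> real m"
proof -
  \<comment> \<open>\<open>h\<close> is the Coxeter number. The pairings of \<open>q\<close> with
    the simple roots are 1/h and (q, theta) = (h - 1)/h < 1 <= m, so \<open>q\<close> is strictly
    inside all walls.\<close>
  define h where "h = (\<Sum>j\<in>S. real (a j)) + 1"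
  define q where "q = wtr (\<lambda>_. 1 / h)"
  have h: "h > 0" unfolding h_def by (intro add_nonneg_pos sum_nonneg) auto
  have qth: "\<langle>q, th\<rangle> = of_real ((h - 1) / h)"
  proof -
    have "\<langle>q, th\<rangle> = (\<Sum>j\<in>S. of_real (real (a j) * (1 / h)))"
      unfolding q_def form_th_E[OF wtr_E] by (intro sum.cong refl) (simp add: wtr_sroot)
    also have "\<dots> = of_real (\<Sum>j\<in>S. real (a j) * (1 / h))" by (simp only: of_real_sum)
    also have "(\<Sum>j\<in>S. real (a j) * (1 / h)) = (\<Sum>j\<in>S. real (a j)) * (1 / h)" by (simp only: sum_distrib_right)
    also have "(\<Sum>j\<in>S. real (a j)) = h - 1" by (simp add: h_def)
    finally show ?thesis by simp
  qed
  define Orb where "Orb = {w y + of_nat m *\<^sub>s \<alpha> |w \<alpha>. w \<in> Wf \<and> \<alpha> \<in> M}"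
  have OrbI: "w y + of_nat m *\<^sub>s \<alpha> \<in> Orb" if "w \<in> Wf" "\<alpha> \<in> M" for w \<alpha> using that by (auto simp: Orb_def)
  have OrbPf: "Orb \<subseteq> wlat" using y by (auto simp: Orb_def intro: wlat_closed(1) Wf_wlat wlat_closed(3)[OF M_wlat])
  have yO: "y \<in> Orb" using OrbI[OF id_Wf M_zero] by (simp add: scl_def zero_fun_def plus_fun_def)
  define E where "E = (\<lambda>v. Re \<langle>v - q, v - q\<rangle>)"
  have "finite {z \<in> Orb. E z \<le> E y}"
    by (rule finite_subset[OF _ finite_wlat_ball[of "\<lambda>_. 1 / h" "E y"]]) (use OrbPf in \<open>auto simp: E_def q_def\<close>)
  from exists_min_finite_sublevel[OF yO this]
  obtain z where z: "z \<in> Orb" "\<And>z'. z' \<in> Orb \<Longrightarrow> E z \<le> E z'" by blast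
  obtain w \<alpha> where w: "w \<in> Wf" "\<alpha> \<in> M" "z = w y + of_nat m *\<^sub>s \<alpha>" using z(1) by (auto simp: Orb_def)
  have zP: "z \<in> wlat" using z OrbPf by auto
  have "Re \<langle>z, sroot i\<rangle> \<ge> 0" if i: "i \<in> S" for i
  proof (rule ccontr)
    assume neg: "\<not> Re \<langle>z, sroot i\<rangle> \<ge> 0"
    have i': "i \<le> l" using i by simp
    define p where "p = pr z i"
    have zi: "\<langle>z, sroot i\<rangle> = of_nat (c i) * p" by (simp add: p_def form_sroot i')
    have "\<langle>z, sroot i\<rangle> \<in> \<real>" using zP i by (auto simp: wlat_def intro: Ints_Reals)
    hence "of_nat (c i) * p \<in> \<real>" by (simp add: zi)
    hence "p \<in> \<real>" using cpos[OF i'] Reals_divide[of "of_nat (c i) * p" "of_nat (c i)"] by auto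
    then obtain pr' where pr': "p = of_real pr'" by (auto elim: Reals_cases)
    have pneg: "pr' < 0" using neg zi cpos[OF i'] by (simp add: pr' not_le mult_less_0_iff)
    have "sr i z = sr i (w y) + of_nat m *\<^sub>s sr i \<alpha>" unfolding w(3) simple_refl_add simple_refl_scl ..
    also have "\<dots> = (sr i \<circ> w) y + of_nat m *\<^sub>s sr i \<alpha>" by simp
    also have "\<dots> \<in> Orb" by (rule OrbI[OF Wf_comp[OF sr_Wf[OF i] w(1)] Wf_M[OF sr_Wf[OF i] w(2)]])
    finally have "E z \<le> E (sr i z)" by (rule z(2))
    moreover have "\<langle>sr i z - q, sr i z - q\<rangle> = \<langle>z - q, z - q\<rangle> + 2 * p * of_real (1 / h)"
    proof -
      have "sr i z - q = (z - q) + (- p) *\<^sub>s sroot i" unfolding p_def by (rule sr_minus)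
      hence h1: "\<langle>sr i z - q, sr i z - q\<rangle> = \<langle>z - q, z - q\<rangle> + 2 * (- p) * \<langle>z - q, sroot i\<rangle> + (- p) * (- p) * \<langle>sroot i, sroot i\<rangle>"
        by (simp only: form_square_add_scl)
      have h2: "\<langle>z - q, sroot i\<rangle> = of_nat (c i) * p - of_real (1 / h)"
        using i by (simp add: form_diff_left zi q_def wtr_sroot)
      have h3: "\<langle>sroot i, sroot i\<rangle> = 2 * of_nat (c i)" using i' by (simp add: form_sroot pr_sroot diag)
      show ?thesis unfolding h1 h2 h3 by (simp add: algebra_simps)
    qed
    ultimately have "0 \<le> 2 * pr' * (1 / h)" by (simp add: E_def pr')
    thus False using pneg h by (simp add: zero_le_mult_iff zero_le_divide_iff)
  qed
  moreover have "Re \<langle>z, th\<rangle> \<le> real m"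
  proof (rule ccontr)
    assume neg: "\<not> Re \<langle>z, th\<rangle> \<le> real m"
    have "\<langle>z, th\<rangle> \<in> \<real>" using wlat_M_int[OF zP th_M] by (rule Ints_Reals)
    then obtain x where x: "\<langle>z, th\<rangle> = of_real x" by (auto elim: Reals_cases)
    \<comment> \<open>The mirror image of \<open>z\<close> in the wall where the pairing with theta
      equals \<open>m\<close> is z + kappa theta; a violated wall means kappa < 0.\<close>
    define \<kappa> where "\<kappa> = real m - x"
    have kneg: "\<kappa> < 0" using neg by (simp add: x \<kappa>_def)
    define z' where "z' = sth z + of_nat m *\<^sub>s th"
    have "z' = (sth \<circ> w) y + of_nat m *\<^sub>s (sth \<alpha> + th)"
      unfolding z'_def w(3) Wf_linear[OF sth_Wf] by (simp add: fun_eq_iff algebra_simps)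
    also have "\<dots> \<in> Orb" by (rule OrbI[OF Wf_comp[OF sth_Wf w(1)] M_add[OF Wf_M[OF sth_Wf w(2)] th_M]])
    finally have "E z \<le> E z'" by (rule z(2))
    moreover have "\<langle>z' - q, z' - q\<rangle> = \<langle>z - q, z - q\<rangle> + of_real (2 * \<kappa> * (real m - (h - 1) / h))"
    proof -
      have "z' - q = (z - q) + of_real \<kappa> *\<^sub>s th"
        by (simp add: z'_def sth_def x \<kappa>_def fun_eq_iff algebra_simps)
      hence h1: "\<langle>z' - q, z' - q\<rangle> = \<langle>z - q, z - q\<rangle> + 2 * of_real \<kappa> * \<langle>z - q, th\<rangle> + of_real \<kappa> * of_real \<kappa> * 2"
        by (simp only: form_square_add_scl form_th_th)
      have h2: "\<langle>z - q, th\<rangle> = of_real (x - (h - 1) / h)" by (simp add: form_diff_left x qth)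
      show ?thesis unfolding h1 h2 by (simp add: \<kappa>_def algebra_simps)
    qed
    ultimately have "0 \<le> 2 * \<kappa> * (real m - (h - 1) / h)" by (simp add: E_def)
    moreover have "(h - 1) / h < 1" using h by (simp add: field_simps)
    hence "real m - (h - 1) / h > 0" using m by linarith
    ultimately show False using kneg by (simp add: zero_le_mult_iff)
  qed
  ultimately show ?thesis using w by blast
qed

section \<open>Alternating theta functions\<close>

lemma inv_Wf:
  assumes "w \<in> Wf"
  shows "inv w \<in> Wf" "eps (inv w) = eps w" "\<langle>w x, y\<rangle> = \<langle>x, inv w y\<rangle>" "inv w (w z) = z" "w (inv w z) = z" "inv (inv w) = w"
proof -
  obtain w' where w': "w' \<in> Wf" "w' \<circ> w = id" "w \<circ> w' = id" "eps w' = eps w" "\<forall>x y. \<langle>w x, y\<rangle> = \<langle>x, w' y\<rangle>"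
    using Wf_inverse[OF assms] by blast
  have i: "inv w = w'" using w' by (intro inv_unique_comp) auto
  have i2: "inv w' = w" using w' by (intro inv_unique_comp) auto
  show "inv w \<in> Wf" "eps (inv w) = eps w" "\<langle>w x, y\<rangle> = \<langle>x, inv w y\<rangle>" "inv w (w z) = z" "w (inv w z) = z" "inv (inv w) = w"
    using w'(1,4,5) fun_cong[OF w'(2), of z] fun_cong[OF w'(3), of z] by (simp_all add: i i2)
qed

lemma bij_Wf_left: "v \<in> Wf \<Longrightarrow> bij_betw (\<lambda>w. v \<circ> w) Wf Wf"
  by (rule bij_betwI[where g = "\<lambda>w. inv v \<circ> w"])
     (auto intro!: Wf_comp inv_Wf simp: fun_eq_iff inv_Wf)
lemma bij_Wf_inv: "bij_betw inv Wf Wf"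
  by (rule bij_betwI[where g = inv]) (auto simp: inv_Wf)

text \<open>Up to a constant factor, the entries of the \<open>S\<close>-matrix.\<close>

definition alt_char :: "nat \<Rightarrow> vec \<Rightarrow> vec \<Rightarrow> complex" where
  "alt_char m x y = (\<Sum>w\<in>Wf. eps w * exp (- (2 * pi * \<i> * \<langle>w x, y\<rangle> / of_nat m)))"

lemma alt_char_right: "v \<in> Wf \<Longrightarrow> alt_char m x (v y) = eps v * alt_char m x y"
proof -
  assume v: "v \<in> Wf"
  have "alt_char m x (v y) = (\<Sum>w\<in>Wf. eps (v \<circ> w) * exp (- (2 * pi * \<i> * \<langle>(v \<circ> w) x, v y\<rangle> / of_nat m)))"
    unfolding alt_char_def by (rule sum.reindex_bij_betw[OF bij_Wf_left[OF v], symmetric])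
  also have "\<dots> = (\<Sum>w\<in>Wf. eps v * (eps w * exp (- (2 * pi * \<i> * \<langle>w x, y\<rangle> / of_nat m))))"
    using v by (intro sum.cong refl) (simp add: eps_comp Wf_form)
  finally show ?thesis by (simp add: alt_char_def sum_distrib_left)
qed

lemma alt_char_comm: "alt_char m x y = alt_char m y x"
proof -
  have "alt_char m x y = (\<Sum>w\<in>Wf. eps (inv w) * exp (- (2 * pi * \<i> * \<langle>inv w x, y\<rangle> / of_nat m)))"
    unfolding alt_char_def by (rule sum.reindex_bij_betw[OF bij_Wf_inv, symmetric])
  also have "\<dots> = alt_char m y x"
    unfolding alt_char_def
  proof (intro sum.cong refl)
    fix w assume w: "w \<in> Wf"
    have "\<langle>inv w x, y\<rangle> = \<langle>w y, x\<rangle>" using inv_Wf(3)[OF w, of y x] form_sym by simp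
    thus "eps (inv w) * exp (- (2 * pi * \<i> * \<langle>inv w x, y\<rangle> / of_nat m)) = eps w * exp (- (2 * pi * \<i> * \<langle>w y, x\<rangle> / of_nat m))"
      by (simp add: inv_Wf(2)[OF w])
  qed
  finally show ?thesis .
qed

lemma alt_char_left: "v \<in> Wf \<Longrightarrow> alt_char m (v x) y = eps v * alt_char m x y"
  using alt_char_right[of v m y x] by (simp only: alt_char_comm[of m y])

lemma exp_Ints: "t \<in> \<int> \<Longrightarrow> exp (- (2 * pi * \<i> * t)) = 1"
proof -
  assume "t \<in> \<int>"
  then obtain n where "t = of_int n" by (elim Ints_cases)
  hence "- (2 * pi * \<i> * t) = of_int (2 * (- n)) * pi * \<i>" by simp
  thus ?thesis unfolding exp_eq_1 by (auto intro!: exI[of _ "- n"])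
qed

text \<open>The pairings (w x, alpha) are integers, so each exponent changes by an integer multiple
  of 2 pi i.\<close>

lemma alt_char_shift:
  assumes "x \<in> wlat" "\<alpha> \<in> M" "m > 0"
  shows "alt_char m x (y + of_nat m *\<^sub>s \<alpha>) = alt_char m x y"
  unfolding alt_char_def
proof (intro sum.cong refl)
  fix w assume w: "w \<in> Wf"
  have "- (2 * pi * \<i> * \<langle>w x, y + of_nat m *\<^sub>s \<alpha>\<rangle> / of_nat m) = - (2 * pi * \<i> * \<langle>w x, y\<rangle> / of_nat m) + - (2 * pi * \<i> * \<langle>w x, \<alpha>\<rangle>)"
    using assms(3) by (simp add: form_add_right form_scl_right field_simps)
  thus "eps w * exp (- (2 * pi * \<i> * \<langle>w x, y + of_nat m *\<^sub>s \<alpha>\<rangle> / of_nat m)) = eps w * exp (- (2 * pi * \<i> * \<langle>w x, y\<rangle> / of_nat m))"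
    using exp_Ints[OF wlat_M_int[OF Wf_wlat[OF w assms(1)] assms(2)]] by (simp only: exp_add mult_1_right)
qed

text \<open>The finite parts of the regular dominant weights of level \<open>m\<close>.\<close>

definition reg_fin :: "nat \<Rightarrow> vec set" where
  "reg_fin m = {y \<in> wlat. (\<forall>i\<in>S. 0 < Re \<langle>y, sroot i\<rangle>) \<and> Re \<langle>y, th\<rangle> < real m}"

abbreviation L0 where "L0 \<equiv> Lambda0 g"

lemma pr_L0: "pr L0 i = (if i = 0 then 1 else 0)"
  by (simp add: pairing_def Lambda0_def sroot_apply)
lemma lev_L0 [simp]: "lev L0 = 1" by (simp add: lev_eq Lambda0_def sroot_apply)
lemma pr_E0: "y \<in> Efin \<Longrightarrow> pr y 0 = - \<langle>y, th\<rangle>"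
proof -
  assume y: "y \<in> Efin"
  have "pr y 0 = \<langle>y, sroot 0\<rangle>" by (simp add: form_sroot c0)
  also have "sroot 0 = del - th" by (simp add: th_def)
  also have "\<langle>y, del - th\<rangle> = - \<langle>y, th\<rangle>" using y by (simp add: form_diff_right form_delta lev_eq Efin_def)
  finally show ?thesis .
qed

lemma wlat_form_real: "x \<in> wlat \<Longrightarrow> y \<in> wlat \<Longrightarrow> \<langle>x, y\<rangle> \<in> \<real>"
  by (rule form_real_E) (auto simp: wlat_E wlat_real)

text \<open>The coordinate of the affine weight at node 0 is m - (y, theta), and at the other nodes
  it is (y, alpha_i) / c_i.\<close>

lemma sdom_level: "y \<in> reg_fin m \<Longrightarrow> sdom (y + of_nat m *\<^sub>s L0)"
  unfolding sdom_def
proof (intro allI impI)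
  fix i assume y: "y \<in> reg_fin m" and i: "i \<le> l"
  have yP: "y \<in> wlat" using y by (simp add: reg_fin_def)
  show "pr (y + of_nat m *\<^sub>s L0) i \<in> \<real> \<and> 0 < Re (pr (y + of_nat m *\<^sub>s L0) i)"
  proof (cases "i = 0")
    case True
    have "pr (y + of_nat m *\<^sub>s L0) i = of_nat m - \<langle>y, th\<rangle>"
      by (simp add: True pairing_add pairing_scl pr_L0 pr_E0[OF wlat_E[OF yP]])
    moreover have "\<langle>y, th\<rangle> \<in> \<real>" using wlat_M_int[OF yP th_M] by (rule Ints_Reals)
    ultimately show ?thesis using y by (auto simp: reg_fin_def)
  next
    case False
    have p: "pr (y + of_nat m *\<^sub>s L0) i = \<langle>y, sroot i\<rangle> / of_nat (c i)"
      using False cpos[OF i] by (simp add: pairing_add pairing_scl pr_L0 form_sroot i)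
    have "\<langle>y, sroot i\<rangle> \<in> \<real>" "0 < Re \<langle>y, sroot i\<rangle>" using yP y i False by (auto simp: reg_fin_def wlat_def intro: Ints_Reals)
    thus ?thesis unfolding p using cpos[OF i] by (auto simp: Re_divide_of_nat intro: Reals_divide)
  qed
qed

text \<open>At level \<open>m\<close> translation by alpha adds m alpha up to delta, so this is
  \<open>alcove_injective\<close> for the weights obtained by adding m Lambda_0.\<close>

lemma affine_orbit_inj:
  assumes m: "m > 0" and \<mu>: "\<mu> \<in> reg_fin m" "\<mu>' \<in> reg_fin m" and w: "w \<in> Wf" "w' \<in> Wf" and \<alpha>: "\<alpha> \<in> M" "\<alpha>' \<in> M"
    and eq: "w \<mu> + of_nat m *\<^sub>s \<alpha> = w' \<mu>' + of_nat m *\<^sub>s \<alpha>'"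
  shows "\<mu> = \<mu>' \<and> w = w' \<and> \<alpha> = \<alpha>'"
proof -
  define x where "x = \<mu> + of_nat m *\<^sub>s L0"
  define y where "y = \<mu>' + of_nat m *\<^sub>s L0"
  have lx: "lev x = of_nat m" "lev y = of_nat m"
    using \<mu> by (auto simp: x_def y_def lev_add lev_scl reg_fin_def wlat_def Efin_def lev_eq[of \<mu>] lev_eq[of \<mu>'])
  define u where "u = (\<lambda>(w::vec \<Rightarrow> vec) x \<alpha>. \<langle>w x, \<alpha>\<rangle> + \<langle>\<alpha>, \<alpha>\<rangle> / 2 * of_nat m)"
  have t: "tr \<alpha> (w x) = w x + of_nat m *\<^sub>s \<alpha> - u w x \<alpha> *\<^sub>s del" "tr \<alpha>' (w' y) = w' y + of_nat m *\<^sub>s \<alpha>' - u w' y \<alpha>' *\<^sub>s del"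
    unfolding transl_def u_def Wf_lev[OF w(1)] Wf_lev[OF w(2)] lx by simp_all
  have wx: "w x = w \<mu> + of_nat m *\<^sub>s L0" "w' y = w' \<mu>' + of_nat m *\<^sub>s L0"
    unfolding x_def y_def using w by (simp_all only: Wf_linear Lambda0_fixed)
  have "tr \<alpha> (w x) = tr \<alpha>' (w' y) + (u w' y \<alpha>' - u w x \<alpha>) *\<^sub>s del"
  proof
    fix j
    show "tr \<alpha> (w x) j = (tr \<alpha>' (w' y) + (u w' y \<alpha>' - u w x \<alpha>) *\<^sub>s del) j"
      unfolding t using fun_cong[OF eq, of j] unfolding wx by (simp add: algebra_simps)
  qed
  from alcove_injective[OF sdom_level[OF \<mu>(1), folded x_def] sdom_level[OF \<mu>(2), folded y_def] w \<alpha> this]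
  have r: "w = w'" "\<alpha> = \<alpha>'" by auto
  have "w \<mu> = w \<mu>'" using eq unfolding r by simp
  hence "inv w (w \<mu>) = inv w (w \<mu>')" by simp
  hence "\<mu> = \<mu>'" unfolding inv_Wf(4)[OF w(1)] .
  thus ?thesis using r by blast
qed

text \<open>Move beta into the closed alcove. If it lands on a wall, the reflection in that wall
  fixes it modulo m M but reverses the sign of the alternating sum.\<close>

lemma alt_char_outside:
  assumes m: "m > 0" and x: "x \<in> wlat" and \<beta>: "\<beta> \<in> wlat"
  shows "(\<exists>\<mu>\<in>reg_fin m. \<exists>w\<in>Wf. \<exists>\<alpha>\<in>M. \<beta> = w \<mu> + of_nat m *\<^sub>s \<alpha>) \<or> alt_char m x \<beta> = 0"
proof -
  obtain w \<alpha> where w: "w \<in> Wf" "\<alpha> \<in> M"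
    and p: "\<And>i. i \<in> S \<Longrightarrow> Re \<langle>w \<beta> + of_nat m *\<^sub>s \<alpha>, sroot i\<rangle> \<ge> 0" "Re \<langle>w \<beta> + of_nat m *\<^sub>s \<alpha>, th\<rangle> \<le> real m"
    using alcove_representative[OF \<beta> m] by blast
  define b where "b = w \<beta> + of_nat m *\<^sub>s \<alpha>"
  have bP: "b \<in> wlat" unfolding b_def by (rule wlat_closed(1)[OF Wf_wlat[OF w(1) \<beta>] wlat_closed(3)[OF M_wlat[OF w(2)]]])
  have J: "alt_char m x b = eps w * alt_char m x \<beta>" unfolding b_def alt_char_shift[OF x w(2) m] alt_char_right[OF w(1)] ..
  have eps0: "eps w \<noteq> 0" using eps_pm[OF w(1)] by auto
  show ?thesis
  proof (cases "b \<in> reg_fin m")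
    case True
    have "\<beta> = inv w (w \<beta>)" by (simp add: inv_Wf w)
    also have "w \<beta> = b + of_nat m *\<^sub>s (- \<alpha>)" by (rule ext) (simp add: b_def)
    also have "inv w (b + of_nat m *\<^sub>s (- \<alpha>)) = inv w b + of_nat m *\<^sub>s inv w (- \<alpha>)"
      by (simp only: Wf_linear[OF inv_Wf(1)[OF w(1)]])
    finally show ?thesis using True inv_Wf(1)[OF w(1)] Wf_M[OF inv_Wf(1)[OF w(1)] M_neg[OF w(2)]] by blast
  next
    case False
    hence "(\<exists>i\<in>S. \<not> Re \<langle>b, sroot i\<rangle> > 0) \<or> \<not> Re \<langle>b, th\<rangle> < real m" using bP by (auto simp: reg_fin_def)
    hence "alt_char m x b = 0"
    proof (elim disjE bexE)
      fix i assume i: "i \<in> S" "\<not> Re \<langle>b, sroot i\<rangle> > 0"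
      have "Re \<langle>b, sroot i\<rangle> = 0" using p(1)[OF i(1)] i(2) by (simp add: b_def)
      moreover have "\<langle>b, sroot i\<rangle> \<in> \<real>" using bP i by (auto simp: wlat_def intro: Ints_Reals)
      ultimately have "\<langle>b, sroot i\<rangle> = 0" by (auto elim!: Reals_cases)
      hence "pr b i = 0" using i cpos[of i] by (simp add: form_sroot)
      hence "sr i b = b" by (simp add: simple_refl_def)
      thus ?thesis using alt_char_right[OF sr_Wf[OF i(1)], of m x b] by (simp add: eps_sr[OF i(1)])
    next
      assume "\<not> Re \<langle>b, th\<rangle> < real m"
      hence "Re \<langle>b, th\<rangle> = real m" using p(2) by (simp add: b_def)
      moreover have "\<langle>b, th\<rangle> \<in> \<real>" using wlat_M_int[OF bP th_M] by (rule Ints_Reals)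
      ultimately have e: "\<langle>b, th\<rangle> = of_nat m" by (simp add: complex_eq_iff complex_is_Real_iff)
      have "sth b + of_nat m *\<^sub>s th = b" unfolding sth_def e by simp
      hence "alt_char m x b = alt_char m x (sth b)" using alt_char_shift[OF x th_M m, of "sth b"] by simp
      thus ?thesis using alt_char_right[OF sth_Wf, of m x b] by (simp add: eps_sth)
    qed
    thus ?thesis using J eps0 by simp
  qed
qed

text \<open>The pairings with the simple roots are positive integers whose sum weighted by
  \<open>a\<close> stays below \<open>m\<close>.\<close>

lemma finite_reg_fin: "finite (reg_fin m)"
proof -
  have "reg_fin m \<subseteq> wt ` {n \<in> int_vecs S. (\<Sum>i\<in>S. (real_of_int (n i))^2) \<le> real l * (real m)^2}"
  proof
    fix y assume y: "y \<in> reg_fin m"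
    then obtain k where k: "k \<in> int_vecs S" "y = wt k" by (auto simp: reg_fin_def elim!: wlatE)
    have pos: "k i > 0" if "i \<in> S" for i using y that by (auto simp: reg_fin_def k wt_sroot)
    have "\<langle>y, th\<rangle> = (\<Sum>j\<in>S. of_nat (a j) * of_int (k j))"
      using y by (subst form_th_E) (auto simp: reg_fin_def wlat_def k wt_sroot)
    hence th: "(\<Sum>j\<in>S. real (a j) * of_int (k j)) < real m" using y by (simp add: reg_fin_def)
    have "(real_of_int (k i))^2 \<le> (real m)^2" if i: "i \<in> S" for i
    proof -
      have "1 * real_of_int (k i) \<le> real (a i) * of_int (k i)"
        using apos[of i] pos[OF i] i by (intro mult_right_mono) auto
      also have "\<dots> \<le> (\<Sum>j\<in>S. real (a j) * of_int (k j))"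
      proof (intro member_le_sum)
        fix j assume "j \<in> S - {i}"
        hence "0 < k j" using pos by simp
        thus "0 \<le> real (a j) * of_int (k j)" by simp
      qed (use i in auto)
      finally have "real_of_int (k i) \<le> real m" using th by simp
      thus ?thesis using pos[OF i] by (intro power_mono) auto
    qed
    hence "(\<Sum>i\<in>S. (real_of_int (k i))^2) \<le> (\<Sum>i\<in>S. (real m)^2)" by (rule sum_mono)
    thus "y \<in> wt ` {n \<in> int_vecs S. (\<Sum>i\<in>S. (real_of_int (n i))^2) \<le> real l * (real m)^2}" using k by simp
  qed
  thus ?thesis by (rule finite_subset) (intro finite_imageI finite_int_vecs_bounded, simp)
qed

lemma norm_alt_char: "x \<in> wlat \<Longrightarrow> y \<in> wlat \<Longrightarrow> cmod (alt_char m x y) \<le> real (card Wf)"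
proof -
  assume x: "x \<in> wlat" and y: "y \<in> wlat"
  have "cmod (eps w * exp (- (2 * pi * \<i> * \<langle>w x, y\<rangle> / of_nat m))) \<le> 1" if w: "w \<in> Wf" for w
  proof -
    have "\<langle>w x, y\<rangle> \<in> \<real>" by (rule wlat_form_real[OF Wf_wlat[OF w x] y])
    then obtain t where "\<langle>w x, y\<rangle> = of_real t" by (elim Reals_cases)
    hence "exp (- (2 * pi * \<i> * \<langle>w x, y\<rangle> / of_nat m)) = exp (\<i> * of_real (- 2 * pi * t / real m))" by (simp add: mult_ac)
    thus ?thesis using eps_pm[OF w] by (auto simp: norm_mult)
  qed
  hence "cmod (alt_char m x y) \<le> (\<Sum>w\<in>Wf. 1)" unfolding alt_char_def by (rule sum_norm_le)
  thus ?thesis by simp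
qed

text \<open>The points w mu + m alpha with mu in \<open>reg_fin m\<close> are pairwise distinct. On
  such an orbit \<open>alt_char\<close> is constant up to sign, and outside all of them it
  vanishes.\<close>

lemma alt_char_regroup:
  assumes m: "m > 0" and x: "x \<in> wlat" and E: "(\<lambda>\<beta>. cmod (E \<beta>)) summable_on wlat"
  shows "(\<Sum>\<^sub>\<infinity>\<beta>\<in>wlat. alt_char m x \<beta> * E \<beta>) = (\<Sum>\<mu>\<in>reg_fin m. alt_char m x \<mu> * (\<Sum>w\<in>Wf. eps w * (\<Sum>\<^sub>\<infinity>\<alpha>\<in>M. E (w \<mu> + of_nat m *\<^sub>s \<alpha>))))"
proof -
  define F where "F = (\<lambda>p::vec \<times> (vec \<Rightarrow> vec) \<times> vec. fst (snd p) (fst p) + of_nat m *\<^sub>s snd (snd p) :: vec)"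
  define D where "D = reg_fin m \<times> Wf \<times> M"
  have RP: "\<mu> \<in> wlat" if "\<mu> \<in> reg_fin m" for \<mu> using that by (simp add: reg_fin_def)
  have inj: "inj_on F D"
  proof (rule inj_onI)
    fix p q assume p: "p \<in> D" and q: "q \<in> D" and e: "F p = F q"
    have "fst p = fst q \<and> fst (snd p) = fst (snd q) \<and> snd (snd p) = snd (snd q)"
      by (rule affine_orbit_inj[OF m]) (use p q e in \<open>auto simp: D_def F_def\<close>)
    thus "p = q" by (auto intro: prod_eqI)
  qed
  have img: "F ` D \<subseteq> wlat" 
  proof
    fix y assume "y \<in> F ` D"
    then obtain \<mu> w \<alpha> where h: "\<mu> \<in> reg_fin m" "w \<in> Wf" "\<alpha> \<in> M" "y = w \<mu> + of_nat m *\<^sub>s \<alpha>"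
      by (auto simp: D_def F_def)
    show "y \<in> wlat" unfolding h(4) by (rule wlat_closed(1)[OF Wf_wlat[OF h(2) RP[OF h(1)]] wlat_closed(3)[OF M_wlat[OF h(3)]]])
  qed
  have "(\<lambda>\<beta>. cmod (alt_char m x \<beta> * E \<beta>)) summable_on wlat"
    by (rule Infinite_Sum.abs_summable_on_comparison_test'[OF summable_on_cmult_right[OF E, of "real (card Wf)"]])
       (auto simp: norm_mult intro!: mult_right_mono norm_alt_char x)
  hence sP: "(\<lambda>\<beta>. alt_char m x \<beta> * E \<beta>) summable_on wlat" by (rule abs_summable_summable)
  hence "(\<lambda>\<beta>. alt_char m x \<beta> * E \<beta>) summable_on F ` D" using img by (rule summable_on_subset_banach)
  hence sD: "(\<lambda>p. alt_char m x (F p) * E (F p)) summable_on D"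
    using summable_on_reindex[OF inj, of "\<lambda>\<beta>. alt_char m x \<beta> * E \<beta>"] by (simp add: o_def)
  have "(\<Sum>\<^sub>\<infinity>\<beta>\<in>wlat. alt_char m x \<beta> * E \<beta>) = (\<Sum>\<^sub>\<infinity>\<beta>\<in>F ` D. alt_char m x \<beta> * E \<beta>)"
  proof (rule infsum_cong_neutral)
    fix \<beta> assume b: "\<beta> \<in> wlat - F ` D"
    have "alt_char m x \<beta> = 0"
    proof (rule ccontr)
      assume "alt_char m x \<beta> \<noteq> 0"
      then obtain \<mu> w \<alpha> where "\<mu> \<in> reg_fin m" "w \<in> Wf" "\<alpha> \<in> M" "\<beta> = w \<mu> + of_nat m *\<^sub>s \<alpha>"
        using alt_char_outside[OF m x, of \<beta>] b by blast
      hence "\<beta> \<in> F ` D" by (intro image_eqI[of _ _ "(\<mu>, w, \<alpha>)"]) (simp_all only: F_def D_def fst_conv snd_conv mem_Sigma_iff simp_thms)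
      thus False using b by blast
    qed
    thus "alt_char m x \<beta> * E \<beta> = 0" by simp
  qed (use img in auto)
  also have "\<dots> = (\<Sum>\<^sub>\<infinity>p\<in>D. alt_char m x (F p) * E (F p))"
    using infsum_reindex[OF inj, of "\<lambda>\<beta>. alt_char m x \<beta> * E \<beta>"] by (simp add: o_def)
  also have "\<dots> = (\<Sum>\<^sub>\<infinity>\<mu>\<in>reg_fin m. \<Sum>\<^sub>\<infinity>q\<in>Wf \<times> M. alt_char m x (F (\<mu>, q)) * E (F (\<mu>, q)))"
    using infsum_Sigma_banach[OF sD[unfolded D_def]] unfolding D_def by simp
  also have "\<dots> = (\<Sum>\<mu>\<in>reg_fin m. \<Sum>\<^sub>\<infinity>q\<in>Wf \<times> M. alt_char m x (F (\<mu>, q)) * E (F (\<mu>, q)))"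
    by (rule infsum_finite[OF finite_reg_fin])
  also have "\<dots> = (\<Sum>\<mu>\<in>reg_fin m. alt_char m x \<mu> * (\<Sum>w\<in>Wf. eps w * (\<Sum>\<^sub>\<infinity>\<alpha>\<in>M. E (w \<mu> + of_nat m *\<^sub>s \<alpha>))))"
  proof (intro sum.cong refl)
    fix \<mu> assume \<mu>: "\<mu> \<in> reg_fin m"
    have "(\<lambda>p. alt_char m x (F p) * E (F p)) summable_on (Pair \<mu> ` (Wf \<times> M))"
      by (rule summable_on_subset_banach[OF sD]) (use \<mu> in \<open>auto simp: D_def\<close>)
    hence s: "(\<lambda>q. alt_char m x (F (\<mu>, q)) * E (F (\<mu>, q))) summable_on (Wf \<times> M)"
      using summable_on_reindex[of "Pair \<mu>" "Wf \<times> M" "\<lambda>p. alt_char m x (F p) * E (F p)"] by (simp add: o_def inj_on_def)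
    have "(\<Sum>\<^sub>\<infinity>q\<in>Wf \<times> M. alt_char m x (F (\<mu>, q)) * E (F (\<mu>, q))) = (\<Sum>\<^sub>\<infinity>w\<in>Wf. \<Sum>\<^sub>\<infinity>\<alpha>\<in>M. alt_char m x (F (\<mu>, w, \<alpha>)) * E (F (\<mu>, w, \<alpha>)))"
      using infsum_Sigma_banach[OF s] by simp
    also have "\<dots> = (\<Sum>w\<in>Wf. \<Sum>\<^sub>\<infinity>\<alpha>\<in>M. alt_char m x (F (\<mu>, w, \<alpha>)) * E (F (\<mu>, w, \<alpha>)))"
      by (rule infsum_finite[OF finite_Wf])
    also have "\<dots> = (\<Sum>w\<in>Wf. alt_char m x \<mu> * (eps w * (\<Sum>\<^sub>\<infinity>\<alpha>\<in>M. E (w \<mu> + of_nat m *\<^sub>s \<alpha>))))"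
    proof (intro sum.cong refl)
      fix w assume w: "w \<in> Wf"
      have "(\<Sum>\<^sub>\<infinity>\<alpha>\<in>M. alt_char m x (F (\<mu>, w, \<alpha>)) * E (F (\<mu>, w, \<alpha>))) = (\<Sum>\<^sub>\<infinity>\<alpha>\<in>M. (alt_char m x \<mu> * eps w) * E (w \<mu> + of_nat m *\<^sub>s \<alpha>))"
      proof (intro infsum_cong)
        fix \<alpha> assume \<alpha>: "\<alpha> \<in> M"
        have "alt_char m x (w \<mu> + of_nat m *\<^sub>s \<alpha>) = alt_char m x \<mu> * eps w"
          unfolding alt_char_shift[OF x \<alpha> m] alt_char_right[OF w] by simp
        thus "alt_char m x (F (\<mu>, w, \<alpha>)) * E (F (\<mu>, w, \<alpha>)) = (alt_char m x \<mu> * eps w) * E (w \<mu> + of_nat m *\<^sub>s \<alpha>)"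
          by (simp only: F_def fst_conv snd_conv)
      qed
      thus "(\<Sum>\<^sub>\<infinity>\<alpha>\<in>M. alt_char m x (F (\<mu>, w, \<alpha>)) * E (F (\<mu>, w, \<alpha>))) = alt_char m x \<mu> * (eps w * (\<Sum>\<^sub>\<infinity>\<alpha>\<in>M. E (w \<mu> + of_nat m *\<^sub>s \<alpha>)))"
        by (simp only: infsum_cmult_right' mult.assoc)
    qed
    finally show "(\<Sum>\<^sub>\<infinity>q\<in>Wf \<times> M. alt_char m x (F (\<mu>, q)) * E (F (\<mu>, q))) = alt_char m x \<mu> * (\<Sum>w\<in>Wf. eps w * (\<Sum>\<^sub>\<infinity>\<alpha>\<in>M. E (w \<mu> + of_nat m *\<^sub>s \<alpha>)))"
      by (simp only: sum_distrib_left)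
  qed
  finally show ?thesis .
qed

subsection \<open>Nonvanishing\<close>

text \<open>The characters of the dual lattice attached to two lattice points agree only if the points
  are congruent modulo \<open>m M\<close>, because the dual lattice contains the dual basis of the simple roots.\<close>

lemma character_eq_imp_congruent:
  assumes m: "m > 0" and x: "x \<in> wlat" and y: "y \<in> wlat"
    and eq: "\<And>\<gamma>. \<gamma> \<in> wlat \<Longrightarrow> exp (- (2 * pi * \<i> * \<langle>x, \<gamma>\<rangle> / of_nat m)) = exp (- (2 * pi * \<i> * \<langle>y, \<gamma>\<rangle> / of_nat m))"
  shows "\<exists>\<alpha>\<in>M. x = y + of_nat m *\<^sub>s \<alpha>"
proof -
  define v where "v = x - y"
  have vE: "v \<in> Efin" using x y by (simp add: v_def Efin_closed wlat_E)
  have "\<exists>n::int. v j = of_nat m * of_int n" if j: "j \<in> S" for j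
  proof -
    define \<gamma> where "\<gamma> = wt (\<lambda>i. if i = j then 1 else 0)"
    have "\<langle>v, \<gamma>\<rangle> = \<langle>\<gamma>, v\<rangle>" by (rule form_sym)
    also have "\<dots> = (\<Sum>i\<in>S. v i * of_int (if i = j then 1 else 0))"
      unfolding form_E[OF vE] \<gamma>_def by (intro sum.cong refl) (simp add: wt_sroot)
    also have "\<dots> = v j" using j by (simp add: if_distrib[where f = of_int] if_distrib[where f = "\<lambda>x. _ * x"] cong: if_cong)
    finally have vj: "\<langle>x, \<gamma>\<rangle> - \<langle>y, \<gamma>\<rangle> = v j" by (simp add: v_def form_diff_left)
    obtain n :: int where "- (2 * pi * \<i> * \<langle>x, \<gamma>\<rangle> / of_nat m) = - (2 * pi * \<i> * \<langle>y, \<gamma>\<rangle> / of_nat m) + of_int (2 * n) * pi * \<i>"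
      using eq[of \<gamma>] wt_wlat unfolding \<gamma>_def exp_eq by auto
    hence "(2 * pi * \<i>) * (- (\<langle>x, \<gamma>\<rangle> / of_nat m)) = (2 * pi * \<i>) * (- (\<langle>y, \<gamma>\<rangle> / of_nat m) + of_int n)"
      by (simp add: algebra_simps)
    hence "- (\<langle>x, \<gamma>\<rangle> / of_nat m) = - (\<langle>y, \<gamma>\<rangle> / of_nat m) + of_int n" by (subst (asm) mult_cancel_left) auto
    hence "\<langle>x, \<gamma>\<rangle> - \<langle>y, \<gamma>\<rangle> = of_nat m * of_int (- n)" using m by (simp add: field_simps)
    thus ?thesis unfolding vj by blast
  qed
  then obtain n where n: "\<And>j. j \<in> S \<Longrightarrow> v j = of_nat m * of_int (n j)" by metis
  define n' where "n' = (\<lambda>j. if j \<in> S then n j else 0)"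
  have "v = of_nat m *\<^sub>s rv n'"
  proof
    fix j show "v j = (of_nat m *\<^sub>s rv n') j"
      using n[of j] vE by (cases "j \<in> S") (auto simp: rv_def n'_def Efin_def)
  qed
  hence "x = y + of_nat m *\<^sub>s rv n'" by (simp add: v_def algebra_simps)
  moreover have "rv n' \<in> M" unfolding M_eq by (auto simp: int_vecs_def n'_def)
  ultimately show ?thesis by blast
qed

text \<open>The finite part of the weight called 0 for the twisted algebra
  (\<open>zero_weight_fin\<close>) and of rho of its transpose (\<open>rho_gt\<close>).\<close>

definition unit_wt :: vec where "unit_wt = wt (\<lambda>_. 1)"
lemma unit_wt_sroot: "i \<in> S \<Longrightarrow> \<langle>unit_wt, sroot i\<rangle> = 1" by (simp add: unit_wt_def wt_sroot)
lemma unit_wt_wlat: "unit_wt \<in> wlat" by (simp add: unit_wt_def wt_wlat)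

lemma character_hom:
  "exp (- (2 * pi * \<i> * \<langle>x, y + z\<rangle> / of_nat m)) = exp (- (2 * pi * \<i> * \<langle>x, y\<rangle> / of_nat m)) * exp (- (2 * pi * \<i> * \<langle>x, z\<rangle> / of_nat m))"
  unfolding exp_add[symmetric] form_add_right by (intro arg_cong[where f = exp]) (simp add: add_divide_distrib distrib_left)

text \<open>The points w mu are pairwise incongruent modulo m M, so they define distinct characters
  of the dual lattice, and these are linearly independent.\<close>

lemma alt_char_not_identically_zero:
  assumes m: "m > 0" and \<mu>: "\<mu> \<in> reg_fin m"
  shows "\<exists>\<nu>\<in>wlat. alt_char m \<nu> \<mu> \<noteq> 0"
proof (rule ccontr)
  assume "\<not> ?thesis"
  hence z: "alt_char m \<mu> \<nu> = 0" if "\<nu> \<in> wlat" for \<nu> using that alt_char_comm by metis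
  have \<mu>P: "\<mu> \<in> wlat" using \<mu> by (simp add: reg_fin_def)
  have "\<forall>w\<in>Wf. eps w = 0"
  proof (rule independent_characters[where \<psi> = "\<lambda>w \<nu>. exp (- (2 * pi * \<i> * \<langle>w \<mu>, \<nu>\<rangle> / of_nat m))" and P = wlat])
    fix w w' assume w: "w \<in> Wf" "w' \<in> Wf" "w \<noteq> w'"
    show "\<exists>x\<in>wlat. exp (- (2 * pi * \<i> * \<langle>w \<mu>, x\<rangle> / of_nat m)) \<noteq> exp (- (2 * pi * \<i> * \<langle>w' \<mu>, x\<rangle> / of_nat m))"
    proof (rule ccontr)
      assume "\<not> ?thesis"
      then obtain \<alpha> where \<alpha>: "\<alpha> \<in> M" "w \<mu> = w' \<mu> + of_nat m *\<^sub>s \<alpha>"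
        using character_eq_imp_congruent[OF m Wf_wlat[OF w(1) \<mu>P] Wf_wlat[OF w(2) \<mu>P]] by blast
      hence "w \<mu> + of_nat m *\<^sub>s 0 = w' \<mu> + of_nat m *\<^sub>s \<alpha>" by (simp add: scl_def zero_fun_def plus_fun_def)
      from affine_orbit_inj[OF m \<mu> \<mu> w(1,2) M_zero \<alpha>(1) this] w(3) show False by blast
    qed
  next
    fix \<nu> assume "\<nu> \<in> wlat"
    from z[OF this] show "(\<Sum>w\<in>Wf. eps w * exp (- (2 * pi * \<i> * \<langle>w \<mu>, \<nu>\<rangle> / of_nat m))) = 0" by (simp only: alt_char_def)
  next
    fix w x y
    show "exp (- (2 * pi * \<i> * \<langle>w \<mu>, x + y\<rangle> / of_nat m)) = exp (- (2 * pi * \<i> * \<langle>w \<mu>, x\<rangle> / of_nat m)) * exp (- (2 * pi * \<i> * \<langle>w \<mu>, y\<rangle> / of_nat m))"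
      by (rule character_hom)
  qed (auto simp: finite_Wf wlat_closed)
  thus False using id_Wf eps_pm by fastforce
qed

text \<open>Among the weights where the alternating sum does not vanish, take a dominant one of minimal norm,
  \<open>unit_wt + \<eta>\<close>. The sum over the Weyl group of the values at \<open>unit_wt + w \<eta>\<close> is a multiple of the
  value at \<open>unit_wt\<close>, and all its terms with \<open>w \<eta> \<noteq> \<eta>\<close> vanish by minimality.\<close>

lemma alt_char_unit_wt_nonzero:
  assumes m: "m > 0" and \<mu>: "\<mu> \<in> reg_fin m"
  shows "alt_char m unit_wt \<mu> \<noteq> 0"
proof
  assume zero: "alt_char m unit_wt \<mu> = 0"
  define A where "A = {\<nu> \<in> wlat. alt_char m \<nu> \<mu> \<noteq> 0}"
  define N where "N = (\<lambda>v. Re \<langle>v, v\<rangle>)"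
  have w0: "wtr (\<lambda>_. 0) = 0" by (rule Efin_nondegenerate[OF wtr_E]) (simp add: wtr_sroot)
  obtain y where y: "y \<in> A" using alt_char_not_identically_zero[OF m \<mu>] by (auto simp: A_def)
  have "finite {z \<in> A. N z \<le> N y}"
    by (rule finite_subset[OF _ finite_wlat_ball[of "\<lambda>_. 0" "N y"]]) (auto simp: A_def N_def w0)
  from exists_min_finite_sublevel[OF y this]
  obtain z where z: "z \<in> A" "\<And>z'. z' \<in> A \<Longrightarrow> N z \<le> N z'" by blast
  \<comment> \<open>Maximal pairing with \<open>unit_wt\<close> makes the orbit point dominant. The
    nonzero alternating sum keeps it off the walls, so by integrality its pairings with the simple
    roots are at least 1.\<close>
  obtain w where w: "w \<in> Wf" "\<And>w'. w' \<in> Wf \<Longrightarrow> Re \<langle>w' z, unit_wt\<rangle> \<le> Re \<langle>w z, unit_wt\<rangle>"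
  proof -
    define R where "R = (\<lambda>w. Re \<langle>w z, unit_wt\<rangle>) ` Wf"
    have R: "finite R" "R \<noteq> {}" using finite_Wf id_Wf by (auto simp: R_def)
    obtain w where "w \<in> Wf" "Re \<langle>w z, unit_wt\<rangle> = Max R" using Max_in[OF R] unfolding R_def by (metis (no_types, lifting) imageE)
    thus ?thesis using Max_ge[OF R(1)] by (intro that[of w]) (auto simp: R_def)
  qed
  define x where "x = w z"
  have xP: "x \<in> wlat" unfolding x_def by (rule Wf_wlat[OF w(1)]) (use z in \<open>simp add: A_def\<close>)
  have xJ: "alt_char m x \<mu> \<noteq> 0" unfolding x_def alt_char_left[OF w(1)] using z(1) eps_pm[OF w(1)] by (auto simp: A_def)
  have xN: "N x \<le> N z'" if "z' \<in> A" for z' using z(2)[OF that] Wf_form[OF w(1), of z z] by (simp add: N_def x_def)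
  have dom: "Re \<langle>x, sroot i\<rangle> \<ge> 1" if i: "i \<in> S" for i
  proof -
    have "\<langle>x, sroot i\<rangle> \<in> \<int>" using xP i by (simp add: wlat_def)
    then obtain k :: int where k: "\<langle>x, sroot i\<rangle> = of_int k" by (elim Ints_cases)
    have i': "i \<le> l" using i by simp
    have p: "pr x i = of_int k / of_nat (c i)" using form_sroot[OF i', of x] cpos[OF i'] unfolding k by (simp add: field_simps)
    have "k \<ge> 0"
    proof (rule ccontr)
      assume "\<not> k \<ge> 0"
      have "sr i x = (sr i \<circ> w) z" by (simp add: x_def)
      hence "Re \<langle>sr i x, unit_wt\<rangle> \<le> Re \<langle>x, unit_wt\<rangle>" using w(2)[OF Wf_comp[OF sr_Wf[OF i] w(1)]] by (simp add: x_def)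
      moreover have "\<langle>sr i x, unit_wt\<rangle> = \<langle>x, unit_wt\<rangle> - of_real (of_int k / real (c i))"
        unfolding simple_refl_def using unit_wt_sroot[OF i] form_sym[of unit_wt "sroot i"] by (simp add: form_diff_left form_scl_left p)
      moreover have "of_int k / real (c i) < 0" using \<open>\<not> k \<ge> 0\<close> cpos[OF i'] by (simp add: divide_neg_pos)
      ultimately show False by simp
    qed
    moreover have "k \<noteq> 0"
    proof
      assume "k = 0"
      hence "sr i x = x" by (simp add: simple_refl_def p)
      thus False using alt_char_left[OF sr_Wf[OF i], of m x \<mu>] xJ by (simp add: eps_sr[OF i])
    qed
    ultimately show ?thesis unfolding k by simp
  qed
  define \<eta> where "\<eta> = x - unit_wt"
  have \<eta>P: "\<eta> \<in> wlat" by (simp add: \<eta>_def wlat_closed xP unit_wt_wlat)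
  have \<eta>dom: "pr \<eta> i \<in> \<real> \<and> 0 \<le> Re (pr \<eta> i)" if i: "i \<in> S" for i
  proof -
    have i': "i \<le> l" using i by simp
    have "\<langle>\<eta>, sroot i\<rangle> \<in> \<real>" using \<eta>P i by (auto simp: wlat_def intro: Ints_Reals)
    moreover have "Re \<langle>\<eta>, sroot i\<rangle> \<ge> 0" using dom[OF i] by (simp add: \<eta>_def form_diff_left unit_wt_sroot[OF i])
    moreover have "pr \<eta> i = \<langle>\<eta>, sroot i\<rangle> / of_nat (c i)" using cpos[OF i'] by (simp add: form_sroot i')
    ultimately show ?thesis by (auto simp: Re_divide_of_nat intro: Reals_divide)
  qed
  have xe: "x = unit_wt + \<eta>" by (simp add: \<eta>_def)
  have zeroterm: "alt_char m (unit_wt + v \<eta>) \<mu> = (if v \<eta> = \<eta> then alt_char m x \<mu> else 0)" if v: "v \<in> Wf" for v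
  proof (cases "v \<eta> = \<eta>")
    case False
    obtain ks where ks: "set ks \<subseteq> S" "v = word g ks" using v by (elim WfE)
    obtain t where t: "\<And>j. t j \<ge> 0" "\<And>j. j \<notin> S \<Longrightarrow> t j = 0" "\<eta> - v \<eta> = (\<lambda>j. of_real (t j))"
      using dominant_minus_orbit[OF \<eta>dom ks(1)] unfolding ks(2) by blast
    have tE: "\<eta> - v \<eta> \<in> Efin" unfolding t(3) by (simp add: Efin_def t(2))
    have tp: "\<langle>unit_wt, \<eta> - v \<eta>\<rangle> = of_real (\<Sum>j\<in>S. t j)"
      unfolding form_E[OF tE] unfolding t(3) by (simp add: unit_wt_sroot)
    have "(\<Sum>j\<in>S. t j) \<noteq> 0"
    proof
      assume "(\<Sum>j\<in>S. t j) = 0"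
      hence "t j = 0" if "j \<in> S" for j using sum_nonneg_eq_0_iff[of S t] t(1) that by simp
      hence "t j = 0" for j using t(2)[of j] by blast
      hence "\<eta> - v \<eta> = 0" unfolding t(3) by (simp add: zero_fun_def)
      thus False using False by simp
    qed
    hence tpos: "(\<Sum>j\<in>S. t j) > 0" using sum_nonneg[of S t] t(1) by (simp add: less_le)
    \<comment> \<open>As \<open>y\<close> runs through an orbit only the mixed term changes. It is
      strictly smaller at \<open>v \<eta>\<close> than at \<open>\<eta>\<close>, because the
      difference is a nonzero nonnegative combination of simple roots.\<close>
    have nm: "N (unit_wt + y) = Re \<langle>unit_wt, unit_wt\<rangle> + 2 * Re \<langle>unit_wt, y\<rangle> + Re \<langle>y, y\<rangle>" for y
      unfolding N_def by (simp add: form_bilinear form_sym[of y unit_wt])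
    have "Re \<langle>unit_wt, v \<eta>\<rangle> < Re \<langle>unit_wt, \<eta>\<rangle>" using tp tpos by (simp add: form_diff_right) (metis Re_complex_of_real diff_gt_0_iff_gt minus_complex.simps(1) of_real_sum)
    hence "N (unit_wt + v \<eta>) < N x" unfolding xe nm Wf_form[OF v] by simp
    hence "unit_wt + v \<eta> \<notin> A" using xN by (meson not_le)
    thus ?thesis using False wlat_closed(1)[OF unit_wt_wlat Wf_wlat[OF v \<eta>P]] by (simp add: A_def)
  qed (simp add: xe)
  define e where "e = (\<lambda>y. exp (- (2 * pi * \<i> * \<langle>\<mu>, y\<rangle> / of_nat m)))"
  have Je: "alt_char m y \<mu> = (\<Sum>v\<in>Wf. eps v * e (v y))" for y
    unfolding alt_char_def e_def by (intro sum.cong refl) (simp add: form_sym[of \<mu>])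
  \<comment> \<open>Each exponential is multiplicative in its two parts, and for fixed
    \<open>v\<close> the elements \<open>v \<circ> u\<close> run through the whole group again; this
    factors the double sum.\<close>
  have "(\<Sum>u\<in>Wf. alt_char m (unit_wt + u \<eta>) \<mu>) = (\<Sum>u\<in>Wf. \<Sum>v\<in>Wf. eps v * e (v unit_wt) * e ((v \<circ> u) \<eta>))"
    unfolding Je
  proof (intro sum.cong refl)
    fix u v assume "v \<in> Wf"
    have "e (v (unit_wt + u \<eta>)) = e (v unit_wt) * e ((v \<circ> u) \<eta>)"
      unfolding e_def Wf_linear(1)[OF \<open>v \<in> Wf\<close>] character_hom by simp
    thus "eps v * e (v (unit_wt + u \<eta>)) = eps v * e (v unit_wt) * e ((v \<circ> u) \<eta>)" by simp
  qed
  also have "\<dots> = (\<Sum>v\<in>Wf. eps v * e (v unit_wt) * (\<Sum>u\<in>Wf. e ((v \<circ> u) \<eta>)))"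
    by (subst sum.swap) (simp only: sum_distrib_left)
  also have "\<dots> = (\<Sum>v\<in>Wf. eps v * e (v unit_wt) * (\<Sum>u\<in>Wf. e (u \<eta>)))"
    by (intro sum.cong refl arg_cong2[where f = "(*)"] sum.reindex_bij_betw[OF bij_Wf_left, of _ "\<lambda>u. e (u \<eta>)"])
  also have "\<dots> = alt_char m unit_wt \<mu> * (\<Sum>u\<in>Wf. e (u \<eta>))" unfolding Je sum_distrib_right ..
  finally have "(\<Sum>u\<in>Wf. alt_char m (unit_wt + u \<eta>) \<mu>) = 0" using zero by simp
  hence "(\<Sum>u\<in>Wf. if u \<eta> = \<eta> then alt_char m x \<mu> else 0) = 0" by (simp add: zeroterm cong: sum.cong)
  hence "of_nat (card {u \<in> Wf. u \<eta> = \<eta>}) * alt_char m x \<mu> = 0"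
    using finite_Wf by (simp add: sum.If_cases Int_def conj_commute)
  moreover have "card {u \<in> Wf. u \<eta> = \<eta>} \<noteq> 0" using finite_Wf id_Wf by (auto simp: card_eq_0_iff)
  ultimately show False using xJ by simp
qed

end

lemma csqrt_divide_real:
  assumes "Im \<sigma> > 0" "d > 0"
  shows "csqrt (\<sigma> / of_real d) = csqrt \<sigma> / of_real (sqrt d)"
proof (rule csqrt_unique)
  have "of_real (sqrt d) ^ 2 = (of_real d :: complex)" using assms by (simp flip: of_real_power)
  thus "(csqrt \<sigma> / of_real (sqrt d))\<^sup>2 = \<sigma> / of_real d"
    by (simp add: power_divide del: csqrt.simps)
  define s where "s = csqrt \<sigma>"
  have s: "0 < Re s \<or> Re s = 0 \<and> 0 \<le> Im s" unfolding s_def by (rule csqrt_principal)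
  have "0 < Re (s / of_real (sqrt d)) \<or> Re (s / of_real (sqrt d)) = 0 \<and> 0 \<le> Im (s / of_real (sqrt d))"
    using s assms(2) unfolding Re_divide_of_real Im_divide_of_real by auto
  thus "0 < Re (csqrt \<sigma> / of_real (sqrt d)) \<or> Re (csqrt \<sigma> / of_real (sqrt d)) = 0 \<and> 0 \<le> Im (csqrt \<sigma> / of_real (sqrt d))"
    by (simp only: s_def)
qed

section \<open>Coordinates on Y and theta sums\<close>

context aff_data
begin

abbreviation Y where "Y \<equiv> Y_dom g"
abbreviation cs where "cs \<equiv> coord_sigma g"
abbreviation cz where "cz \<equiv> coord_z g"
abbreviation cu where "cu \<equiv> coord_u g"
abbreviation pt where "pt \<equiv> point g"

lemma hdual_decomp: "x \<in> hdual g \<Longrightarrow> x = fin_part g x + x (Suc l) *\<^sub>s L0 + x 0 *\<^sub>s del"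
  by (auto simp: fun_eq_iff fin_part_apply hdual_def Lambda0_def sroot_apply delta_apply a0 not_le Suc_le_eq)

lemma fin_part_E [simp]: "fin_part g x \<in> Efin" by (simp add: Efin_def fin_part_apply)
lemma Efin_hdual: "y \<in> Efin \<Longrightarrow> y \<in> hdual g" by (auto simp: Efin_def hdual_def)
lemma fin_part_E_id: "y \<in> Efin \<Longrightarrow> fin_part g y = y" by (auto simp: Efin_def fin_part_apply fun_eq_iff)
lemma fin_part_add: "fin_part g (x + y) = fin_part g x + fin_part g y"
  by (simp add: fun_eq_iff fin_part_apply algebra_simps)
lemma fin_part_scl: "fin_part g (t *\<^sub>s x) = t *\<^sub>s fin_part g x"
  by (simp add: fun_eq_iff fin_part_apply algebra_simps)
lemma fin_part_L0 [simp]: "fin_part g L0 = 0" by (simp add: fun_eq_iff fin_part_apply Lambda0_def sroot_apply)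
lemma fin_part_del [simp]: "fin_part g del = 0" by (simp add: fun_eq_iff fin_part_apply delta_apply a0)
lemma L0_hdual: "L0 \<in> hdual g" and del_hdual: "del \<in> hdual g"
  by (auto simp: hdual_def Lambda0_def sroot_apply delta_apply)
lemma hdual_add: "x \<in> hdual g \<Longrightarrow> y \<in> hdual g \<Longrightarrow> x + y \<in> hdual g"
  and hdual_scl: "x \<in> hdual g \<Longrightarrow> t *\<^sub>s x \<in> hdual g"
  by (auto simp: hdual_def)

lemma form_E_L0: "y \<in> Efin \<Longrightarrow> \<langle>y, L0\<rangle> = 0" by (simp add: form_Lambda0 Efin_def)
lemma form_L0_E: "y \<in> Efin \<Longrightarrow> \<langle>L0, y\<rangle> = 0" using form_E_L0 form_sym by metis
lemma form_E_del: "y \<in> Efin \<Longrightarrow> \<langle>y, del\<rangle> = 0" by (simp add: form_delta lev_eq Efin_def)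
lemma form_del_E: "y \<in> Efin \<Longrightarrow> \<langle>del, y\<rangle> = 0" using form_E_del form_sym by metis
lemma form_L0_L0: "\<langle>L0, L0\<rangle> = 0" by (simp add: form_Lambda0) (simp add: Lambda0_def sroot_apply)
lemma form_L0_del: "\<langle>L0, del\<rangle> = 1" "\<langle>del, L0\<rangle> = 1" by (simp_all add: form_delta form_delta')
lemma form_del_del: "\<langle>del, del\<rangle> = 0" by (simp add: form_delta)
lemmas form_basis = form_E_L0 form_L0_E form_E_del form_del_E form_L0_L0 form_L0_del form_del_del

lemma form_decomposed:
  assumes "y \<in> Efin" "y' \<in> Efin"
  shows "\<langle>y + t *\<^sub>s L0 + e *\<^sub>s del, y' + t' *\<^sub>s L0 + e' *\<^sub>s del\<rangle> = \<langle>y, y'\<rangle> + t * e' + e * t'"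
  using assms by (simp add: form_bilinear form_basis)

lemma Y_iff: "v \<in> Y \<longleftrightarrow> v \<in> hdual g \<and> Im (cs v) > 0"
proof -
  have "cs v = of_real (1 / (2 * pi)) * (\<i> * \<langle>v, del\<rangle>)"
    unfolding coord_sigma_def by (simp add: field_simps)
  hence "Im (cs v) = Re \<langle>v, del\<rangle> / (2 * pi)" by (simp only: Im_complex_of_real Re_complex_of_real times_complex.sel) simp
  thus ?thesis by (auto simp: Y_dom_def zero_less_divide_iff)
qed

lemma cz_E: "cz v \<in> Efin" unfolding coord_z_def by (intro Efin_closed fin_part_E)

lemma pt_decomp: "pt \<sigma> z u = (2 * pi * \<i>) *\<^sub>s z + (- (2 * pi * \<i>) * \<sigma>) *\<^sub>s L0 + ((2 * pi * \<i>) * u) *\<^sub>s del"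
  by (rule ext) (simp add: point_def algebra_simps)

lemma pt_coords:
  assumes "z \<in> Efin"
  shows "cs (pt \<sigma> z u) = \<sigma>" "cz (pt \<sigma> z u) = z" "cu (pt \<sigma> z u) = u" "pt \<sigma> z u \<in> hdual g"
proof -
  have z: "(2 * pi * \<i>) *\<^sub>s z \<in> Efin" using assms by (rule Efin_closed)
  have "\<langle>pt \<sigma> z u, del\<rangle> = - (2 * pi * \<i>) * \<sigma>"
    unfolding pt_decomp by (simp add: form_bilinear form_basis assms)
  thus "cs (pt \<sigma> z u) = \<sigma>" by (simp add: coord_sigma_def)
  have "\<langle>pt \<sigma> z u, L0\<rangle> = (2 * pi * \<i>) * u"
    unfolding pt_decomp by (simp add: form_bilinear form_basis assms)
  thus "cu (pt \<sigma> z u) = u" by (simp add: coord_u_def)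
  have "fin_part g (pt \<sigma> z u) = (2 * pi * \<i>) *\<^sub>s z"
    unfolding pt_decomp by (simp only: fin_part_add fin_part_scl fin_part_L0 fin_part_del fin_part_E_id[OF assms]) (simp add: fun_eq_iff)
  thus "cz (pt \<sigma> z u) = z" by (simp add: coord_z_def fun_eq_iff)
  show "pt \<sigma> z u \<in> hdual g" unfolding pt_decomp
    by (intro hdual_add hdual_scl Efin_hdual assms L0_hdual del_hdual)
qed

lemma pt_of_coords: "v \<in> hdual g \<Longrightarrow> pt (cs v) (cz v) (cu v) = v"
proof -
  assume v: "v \<in> hdual g"
  have "\<langle>v, del\<rangle> = v (Suc l)" by (simp add: form_delta lev_eq)
  moreover have "\<langle>v, L0\<rangle> = v 0" by (rule form_Lambda0)
  moreover have "(2 * pi * \<i>) *\<^sub>s cz v = fin_part g v" by (simp add: coord_z_def fun_eq_iff)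
  ultimately have "pt (cs v) (cz v) (cu v) = fin_part g v + v (Suc l) *\<^sub>s L0 + v 0 *\<^sub>s del"
    unfolding pt_decomp by (simp add: coord_sigma_def coord_u_def)
  thus ?thesis using hdual_decomp[OF v] by simp
qed

lemma pt_Y: "z \<in> Efin \<Longrightarrow> Im \<sigma> > 0 \<Longrightarrow> pt \<sigma> z u \<in> Y"
  by (simp add: Y_iff pt_coords)

text \<open>The summand of a theta function in the coordinates sigma and z, where beta stands for y
  + m alpha. The factor exp(2 pi i m u), common to all summands, is kept outside.\<close>

definition theta_term :: "nat \<Rightarrow> complex \<Rightarrow> vec \<Rightarrow> vec \<Rightarrow> complex" where
  "theta_term m \<sigma> z \<beta> = exp (2 * pi * \<i> * \<langle>\<beta>, z\<rangle> + pi * \<i> * \<sigma> * \<langle>\<beta>, \<beta>\<rangle> / of_nat m)"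

definition theta_sum :: "nat \<Rightarrow> vec \<Rightarrow> complex \<Rightarrow> vec \<Rightarrow> complex" where
  "theta_sum m y \<sigma> z = (\<Sum>\<^sub>\<infinity>\<alpha>\<in>M. theta_term m \<sigma> z (y + of_nat m *\<^sub>s \<alpha>))"

text \<open>The prefactor and the quadratic part of the translation combine into the norm of y + m
  alpha over 2m. The delta-component of \<open>x\<close> cancels, so only the finite part
  matters.\<close>

lemma Theta_eq:
  assumes m: "m > 0" and x: "x \<in> P_weights g m" and v: "v \<in> Y"
  shows "Theta g m x v = exp (2 * pi * \<i> * of_nat m * cu v) * theta_sum m (fin_part g x) (cs v) (cz v)"
proof -
  define y where "y = fin_part g x"
  define e where "e = x 0"
  define \<sigma> z u where "\<sigma> = cs v" and "z = cz v" and "u = cu v"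
  have lx: "lev x = of_nat m" and xh: "x \<in> hdual g" using x by (auto simp: P_weights_def)
  have xd: "x = y + of_nat m *\<^sub>s L0 + e *\<^sub>s del" using hdual_decomp[OF xh] lx by (simp add: y_def e_def lev_eq)
  have yE: "y \<in> Efin" by (simp add: y_def)
  have zE: "z \<in> Efin" by (simp add: z_def cz_E)
  have "pt \<sigma> z u = v" using v pt_of_coords by (simp add: \<sigma>_def z_def u_def Y_iff)
  hence vd: "v = (2 * pi * \<i>) *\<^sub>s z + (- (2 * pi * \<i>) * \<sigma>) *\<^sub>s L0 + ((2 * pi * \<i>) * u) *\<^sub>s del"
    unfolding pt_decomp by simp
  have z'E: "(2 * pi * \<i>) *\<^sub>s z \<in> Efin" using zE by (rule Efin_closed)
  have xx: "\<langle>x, x\<rangle> = \<langle>y, y\<rangle> + 2 * of_nat m * e" unfolding xd form_decomposed[OF yE yE] by (simp add: algebra_simps)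
  have xv: "\<langle>x, v\<rangle> = 2 * pi * \<i> * (\<langle>y, z\<rangle> + of_nat m * u - e * \<sigma>)"
    unfolding xd vd form_decomposed[OF yE z'E] by (simp add: form_scl_right algebra_simps)
  have dv: "\<langle>del, v\<rangle> = - (2 * pi * \<i>) * \<sigma>" unfolding vd by (simp add: form_bilinear form_basis zE)
  have term_eq: "exp (- (\<langle>x, x\<rangle> / (2 * of_nat m)) * \<langle>del, v\<rangle>) * exp \<langle>tr \<alpha> x, v\<rangle> = exp (2 * pi * \<i> * of_nat m * u) * theta_term m \<sigma> z (y + of_nat m *\<^sub>s \<alpha>)"
    if \<alpha>: "\<alpha> \<in> M" for \<alpha>
  proof -
    have aE: "\<alpha> \<in> Efin" by (rule M_E[OF \<alpha>])
    have av: "\<langle>\<alpha>, v\<rangle> = 2 * pi * \<i> * \<langle>\<alpha>, z\<rangle>" unfolding vd by (simp add: form_bilinear form_basis zE aE)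
    have xa: "\<langle>x, \<alpha>\<rangle> = \<langle>y, \<alpha>\<rangle>" unfolding xd by (simp add: form_bilinear form_basis aE)
    have h1: "\<langle>tr \<alpha> x, v\<rangle> = \<langle>x, v\<rangle> + of_nat m * \<langle>\<alpha>, v\<rangle> - (\<langle>y, \<alpha>\<rangle> + \<langle>\<alpha>, \<alpha>\<rangle> / 2 * of_nat m) * \<langle>del, v\<rangle>"
      unfolding transl_def lx xa by (simp add: form_bilinear)
    have h2: "\<langle>y + of_nat m *\<^sub>s \<alpha>, y + of_nat m *\<^sub>s \<alpha>\<rangle> = \<langle>y, y\<rangle> + 2 * of_nat m * \<langle>y, \<alpha>\<rangle> + of_nat m * of_nat m * \<langle>\<alpha>, \<alpha>\<rangle>"
      by (rule form_square_add_scl)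
    have h3: "\<langle>y + of_nat m *\<^sub>s \<alpha>, z\<rangle> = \<langle>y, z\<rangle> + of_nat m * \<langle>\<alpha>, z\<rangle>" by (simp add: form_bilinear)
    show ?thesis unfolding theta_term_def exp_add[symmetric] h1 h2 h3 xx xv dv av
      by (intro arg_cong[where f = exp]) (use m in \<open>simp add: field_simps\<close>)
  qed
  have "Theta g m x v = exp (- (\<langle>x, x\<rangle> / (2 * of_nat m)) * \<langle>del, v\<rangle>) * (\<Sum>\<^sub>\<infinity>\<alpha>\<in>M. exp \<langle>tr \<alpha> x, v\<rangle>)"
    unfolding Theta_def using v by simp
  also have "\<dots> = (\<Sum>\<^sub>\<infinity>\<alpha>\<in>M. exp (2 * pi * \<i> * of_nat m * u) * theta_term m \<sigma> z (y + of_nat m *\<^sub>s \<alpha>))"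
    unfolding infsum_cmult_right'[symmetric] by (intro infsum_cong term_eq)
  also have "\<dots> = exp (2 * pi * \<i> * of_nat m * u) * theta_sum m y \<sigma> z" unfolding theta_sum_def infsum_cmult_right' ..
  finally show ?thesis by (simp only: u_def y_def \<sigma>_def z_def)
qed

lemma P_weights_iff: "x \<in> P_weights g m \<longleftrightarrow> x \<in> hdual g \<and> x (Suc l) = of_nat m \<and> fin_part g x \<in> wlat"
proof -
  have "\<langle>x, \<alpha>\<rangle> = \<langle>fin_part g x, \<alpha>\<rangle>" if "x \<in> hdual g" "\<alpha> \<in> M" for \<alpha>
    by (subst hdual_decomp[OF that(1)]) (simp add: form_bilinear form_basis M_E[OF that(2)])
  thus ?thesis by (auto simp: P_weights_def wlat_iff lev_eq)
qed

lemma Wf_decomp: "w \<in> Wf \<Longrightarrow> x \<in> hdual g \<Longrightarrow> w x = w (fin_part g x) + x (Suc l) *\<^sub>s L0 + x 0 *\<^sub>s del"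
  by (subst hdual_decomp) (simp_all only: Wf_linear Lambda0_fixed Wf_delta)

lemma Wf_P_weights: "w \<in> Wf \<Longrightarrow> x \<in> P_weights g m \<Longrightarrow> w x \<in> P_weights g m \<and> fin_part g (w x) = w (fin_part g x)"
proof -
  assume w: "w \<in> Wf" and x: "x \<in> P_weights g m"
  have xh: "x \<in> hdual g" and yP: "fin_part g x \<in> wlat" using x by (auto simp: P_weights_iff)
  have wE: "w (fin_part g x) \<in> Efin" by (rule Wf_E[OF w fin_part_E])
  have f: "fin_part g (w x) = w (fin_part g x)"
    unfolding Wf_decomp[OF w xh] by (simp only: fin_part_add fin_part_scl fin_part_L0 fin_part_del fin_part_E_id[OF wE]) (simp add: fun_eq_iff)
  have h: "w x \<in> hdual g" unfolding Wf_decomp[OF w xh] by (intro hdual_add hdual_scl L0_hdual del_hdual Efin_hdual wE)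
  have "w x (Suc l) = of_nat m" using Wf_lev[OF w, of x] x by (simp add: lev_eq P_weights_iff)
  thus ?thesis using f h Wf_wlat[OF w yP] by (simp add: P_weights_iff)
qed

definition alt_theta :: "nat \<Rightarrow> vec \<Rightarrow> cfunc" where
  "alt_theta m y = (\<lambda>v. if v \<in> Y then exp (2 * pi * \<i> * of_nat m * cu v) * (\<Sum>w\<in>Wf. eps w * theta_sum m (w y) (cs v) (cz v)) else 0)"

lemma A_fun_eq:
  assumes m: "m > 0" and x: "x \<in> P_weights g m"
  shows "A_fun g m x = alt_theta m (fin_part g x)"
proof
  fix v
  show "A_fun g m x v = alt_theta m (fin_part g x) v"
  proof (cases "v \<in> Y")
    case True
    have "A_fun g m x v = (\<Sum>w\<in>Wf. eps w * Theta g m (w x) v)" by (simp add: A_fun_def sum_vec_apply)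
    also have "\<dots> = (\<Sum>w\<in>Wf. exp (2 * pi * \<i> * of_nat m * cu v) * (eps w * theta_sum m (w (fin_part g x)) (cs v) (cz v)))"
    proof (intro sum.cong refl)
      fix w assume w: "w \<in> Wf"
      show "eps w * Theta g m (w x) v = exp (2 * pi * \<i> * of_nat m * cu v) * (eps w * theta_sum m (w (fin_part g x)) (cs v) (cz v))"
        using Theta_eq[OF m, of "w x" v] Wf_P_weights[OF w x] True by simp
    qed
    finally show ?thesis using True by (simp add: alt_theta_def sum_distrib_left)
  qed (simp add: A_fun_def sum_vec_apply Theta_def alt_theta_def)
qed

subsection \<open>The inversion formula\<close>

lemma wt_form_E: "z \<in> Efin \<Longrightarrow> \<langle>wt k, z\<rangle> = (\<Sum>i\<in>S. of_int (k i) * z i)"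
  by (subst form_E) (auto simp: wt_sroot mult.commute intro!: sum.cong)

lemma Qd_wt: "Qd (\<lambda>i. of_int (k i)) = \<langle>wt k, wt k\<rangle>"
  by (rule Qd_form[OF wlat_E[OF wt_wlat]]) (simp add: wt_sroot)

lemma Im_scaled: "m > 0 \<Longrightarrow> Im \<sigma> > 0 \<Longrightarrow> Im (\<sigma> / of_nat m) > 0"
  by (simp add: Im_divide_of_nat)

lemma summable_theta_term:
  assumes m: "m > 0" and \<sigma>: "Im \<sigma> > 0" and z: "z \<in> Efin"
  shows "(\<lambda>\<beta>. cmod (theta_term m \<sigma> z \<beta>)) summable_on wlat"
proof -
  obtain e where e: "e > 0" "\<And>y. qfr S Gm y \<ge> e * (\<Sum>i\<in>S. (y i)^2)" using fin_pos_def by blast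
  obtain \<epsilon> where \<epsilon>: "\<epsilon> > 0" "\<And>\<kappa>::nat \<Rightarrow> real. \<exists>q. Qd (\<lambda>i. of_real (\<kappa> i)) = of_real q \<and> q \<ge> \<epsilon> * (\<Sum>i\<in>S. (\<kappa> i)^2)"
    using dual_form_bound[where Qd = Qd, OF _ e poisson_dualD(2)[OF pdual] poisson_dualD(3)[OF pdual] poisson_dualD(4)[OF pdual]]
    by (metis finite_atLeastAtMost)
  have "(\<lambda>k. cmod (exp (pi * \<i> * (\<sigma> / of_nat m) * Qd (\<lambda>i. of_int (k i) - of_real ((\<lambda>_. 0) i)) + 2 * pi * \<i> * (\<Sum>i\<in>S. of_int (k i) * z i)))) summable_on int_vecs S"
    by (rule summable_dual_gauss[where Qd = Qd, OF _ \<epsilon> Im_scaled[OF m \<sigma>]]) simp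
  moreover have "exp (pi * \<i> * (\<sigma> / of_nat m) * Qd (\<lambda>i. of_int (k i) - of_real ((\<lambda>_. 0) i)) + 2 * pi * \<i> * (\<Sum>i\<in>S. of_int (k i) * z i)) = theta_term m \<sigma> z (wt k)" for k :: "nat \<Rightarrow> int"
    unfolding theta_term_def wt_form_E[OF z] Qd_wt[symmetric] by (intro arg_cong[where f = exp]) (simp add: algebra_simps)
  ultimately have "(\<lambda>k. cmod (theta_term m \<sigma> z (wt k))) summable_on int_vecs S" by (simp only:)
  thus ?thesis using summable_on_reindex_bij_betw[OF bij_wt, of "\<lambda>\<beta>. cmod (theta_term m \<sigma> z \<beta>)"] by simp
qed

text \<open>The lattice Poisson formula at tau = sigma/m without linear term. The original sum runs
  over \<open>M\<close>, written in simple root coordinates, and the dual sum over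
  \<open>wlat\<close>.\<close>

lemma theta_inversion:
  assumes m: "m > 0" and \<sigma>: "Im \<sigma> > 0" and z: "z \<in> Efin" and y: "y \<in> Efin"
  shows "exp (2 * pi * \<i> * of_nat m * (u - \<langle>z, z\<rangle> / (2 * \<sigma>))) * theta_sum m y (- 1 / \<sigma>) ((1 / \<sigma>) *\<^sub>s z) =
     Cd * csqrt (\<sigma> / of_nat m) ^ l * exp (2 * pi * \<i> * of_nat m * u) *
     (\<Sum>\<^sub>\<infinity>\<beta>\<in>wlat. exp (- (2 * pi * \<i> * \<langle>y, \<beta>\<rangle> / of_nat m)) * theta_term m \<sigma> z \<beta>)"
proof -
  have s0: "\<sigma> \<noteq> 0" using \<sigma> by auto
  have m0: "of_nat m \<noteq> (0::complex)" using m by simp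
  \<comment> \<open>The terms of the transformed theta sum are Gaussians in alpha + w; the factor
    containing (z, z) / (2 sigma) is what completes the square.\<close>
  define w where "w = (1 / of_nat m) *\<^sub>s y - z"
  have wE: "w \<in> Efin" unfolding w_def by (intro Efin_closed y z)
  have t1: "exp (2 * pi * \<i> * of_nat m * (u - \<langle>z, z\<rangle> / (2 * \<sigma>))) * theta_term m (- 1 / \<sigma>) ((1 / \<sigma>) *\<^sub>s z) (y + of_nat m *\<^sub>s rv n)
     = exp (2 * pi * \<i> * of_nat m * u) * exp (- (pi * \<i> * qf S Gm (\<lambda>i. of_int (n i) + w i) / (\<sigma> / of_nat m)) + 2 * pi * \<i> * (\<Sum>i\<in>S. of_real ((\<lambda>_. 0) i) * (of_int (n i) + w i)))"
    if n: "n \<in> int_vecs S" for n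
  proof -
    define \<alpha> where "\<alpha> = rv n"
    have aE: "\<alpha> \<in> Efin" using n M_E unfolding M_eq \<alpha>_def by blast
    define b where "b = y + of_nat m *\<^sub>s \<alpha>"
    have aw: "\<alpha> + w = (1 / of_nat m) *\<^sub>s b + (- 1) *\<^sub>s z" using m0 by (intro ext) (simp add: w_def b_def field_simps)
    have "qf S Gm (\<lambda>i. of_int (n i) + w i) = qf S Gm (\<alpha> + w)"
      by (rule qf_cong) (auto simp: \<alpha>_def rv_def)
    also have "\<dots> = \<langle>\<alpha> + w, \<alpha> + w\<rangle>" by (rule form_EE[symmetric]) (intro Efin_closed aE wE)
    also have "\<dots> = (1 / of_nat m) * (1 / of_nat m) * \<langle>b, b\<rangle> - 2 * (1 / of_nat m) * \<langle>b, z\<rangle> + \<langle>z, z\<rangle>"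
      unfolding aw form_square_add_scl by (simp add: form_bilinear)
    finally have q: "qf S Gm (\<lambda>i. of_int (n i) + w i) = (1 / of_nat m) * (1 / of_nat m) * \<langle>b, b\<rangle> - 2 * (1 / of_nat m) * \<langle>b, z\<rangle> + \<langle>z, z\<rangle>" .
    show ?thesis
      unfolding q theta_term_def exp_add[symmetric] \<alpha>_def[symmetric] b_def[symmetric] form_scl_right
      by (intro arg_cong[where f = exp]) (use s0 m0 in \<open>simp add: field_simps\<close>)
  qed
  have "exp (2 * pi * \<i> * of_nat m * (u - \<langle>z, z\<rangle> / (2 * \<sigma>))) * theta_sum m y (- 1 / \<sigma>) ((1 / \<sigma>) *\<^sub>s z) =
    (\<Sum>\<^sub>\<infinity>n\<in>int_vecs S. exp (2 * pi * \<i> * of_nat m * (u - \<langle>z, z\<rangle> / (2 * \<sigma>))) * theta_term m (- 1 / \<sigma>) ((1 / \<sigma>) *\<^sub>s z) (y + of_nat m *\<^sub>s rv n))"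
    unfolding theta_sum_def infsum_cmult_right' infsum_reindex_bij_betw[OF bij_rv, symmetric] ..
  also have "\<dots> = exp (2 * pi * \<i> * of_nat m * u) *
    (\<Sum>\<^sub>\<infinity>n\<in>int_vecs S. exp (- (pi * \<i> * qf S Gm (\<lambda>i. of_int (n i) + w i) / (\<sigma> / of_nat m)) + 2 * pi * \<i> * (\<Sum>i\<in>S. of_real ((\<lambda>_. 0) i) * (of_int (n i) + w i))))"
    unfolding infsum_cmult_right'[symmetric] by (intro infsum_cong t1)
  also have "\<dots> = exp (2 * pi * \<i> * of_nat m * u) * (Cd * csqrt (\<sigma> / of_nat m) ^ card S *
      (\<Sum>\<^sub>\<infinity>k\<in>int_vecs S. exp (pi * \<i> * (\<sigma> / of_nat m) * Qd (\<lambda>i. of_int (k i) - of_real ((\<lambda>_. 0) i)) + 2 * pi * \<i> * (\<Sum>i\<in>S. of_int (k i) * w i))))"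
    by (subst poisson_dualD(5)[OF pdual Im_scaled[OF m \<sigma>]]) (rule refl)
  also have "(\<Sum>\<^sub>\<infinity>k\<in>int_vecs S. exp (pi * \<i> * (\<sigma> / of_nat m) * Qd (\<lambda>i. of_int (k i) - of_real ((\<lambda>_. 0) i)) + 2 * pi * \<i> * (\<Sum>i\<in>S. of_int (k i) * w i)))
      = (\<Sum>\<^sub>\<infinity>k\<in>int_vecs S. exp (- (2 * pi * \<i> * \<langle>y, - wt k\<rangle> / of_nat m)) * theta_term m \<sigma> z (- wt k))"
  proof (intro infsum_cong)
    fix k
    have sk: "(\<Sum>i\<in>S. of_int (k i) * w i) = (1 / of_nat m) * \<langle>y, wt k\<rangle> - \<langle>wt k, z\<rangle>"
      unfolding wt_form_E[OF wE, symmetric] unfolding w_def form_sym[of y] by (simp add: form_bilinear)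
    show "exp (pi * \<i> * (\<sigma> / of_nat m) * Qd (\<lambda>i. of_int (k i) - of_real ((\<lambda>_. 0) i)) + 2 * pi * \<i> * (\<Sum>i\<in>S. of_int (k i) * w i)) =
      exp (- (2 * pi * \<i> * \<langle>y, - wt k\<rangle> / of_nat m)) * theta_term m \<sigma> z (- wt k)"
      unfolding theta_term_def exp_add[symmetric] form_minus_left form_minus_right sk
      by (intro arg_cong[where f = exp]) (simp add: Qd_wt algebra_simps)
  qed
  also have "\<dots> = (\<Sum>\<^sub>\<infinity>\<beta>\<in>wlat. exp (- (2 * pi * \<i> * \<langle>y, - \<beta>\<rangle> / of_nat m)) * theta_term m \<sigma> z (- \<beta>))"
    by (rule infsum_reindex_bij_betw[OF bij_wt, of "\<lambda>\<beta>. exp (- (2 * pi * \<i> * \<langle>y, - \<beta>\<rangle> / of_nat m)) * theta_term m \<sigma> z (- \<beta>)"])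
  \<comment> \<open>The Poisson formula produces the dual variable with the opposite sign; the dual
    lattice is symmetric.\<close>
  also have "\<dots> = (\<Sum>\<^sub>\<infinity>\<beta>\<in>wlat. exp (- (2 * pi * \<i> * \<langle>y, \<beta>\<rangle> / of_nat m)) * theta_term m \<sigma> z \<beta>)"
  proof -
    have "bij_betw uminus wlat wlat" by (rule bij_betwI[where g = uminus]) (auto intro: wlat_closed)
    from infsum_reindex_bij_betw[OF this, of "\<lambda>\<beta>. exp (- (2 * pi * \<i> * \<langle>y, \<beta>\<rangle> / of_nat m)) * theta_term m \<sigma> z \<beta>"]
    show ?thesis .
  qed
  finally show ?thesis by (simp only: mult_ac card_atLeastAtMost diff_Suc_1)
qed

text \<open>What is left of \<open>Cd\<close> times the l-th power of csqrt(sigma/m) after division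
  by the automorphy factor, the l-th power of csqrt(sigma).\<close>

definition S_const :: "nat \<Rightarrow> complex" where "S_const m = Cd / of_real (sqrt (real m)) ^ l"

lemma S_const_nonzero: "m > 0 \<Longrightarrow> S_const m \<noteq> 0"
  using poisson_dualD(1)[OF pdual] by (simp add: S_const_def)

lemma slash_S_apply:
  "v \<in> Y \<Longrightarrow> slash g S_mat f v = f (pt (- 1 / cs v) ((1 / cs v) *\<^sub>s cz v) (cu v - \<langle>cz v, cz v\<rangle> / (2 * cs v))) / csqrt (cs v) ^ l"
  by (simp add: slash_def S_mat_def Let_def)

lemma S_point_Y: "v \<in> Y \<Longrightarrow> pt (- 1 / cs v) ((1 / cs v) *\<^sub>s cz v) u \<in> Y"
  using Im_minus_inverse_pos[of "cs v"] by (intro pt_Y Efin_closed cz_E) (auto simp: Y_iff)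

lemma infsum_sum_swap:
  fixes f :: "'a \<Rightarrow> 'b \<Rightarrow> complex"
  assumes "finite A" "\<And>x. x \<in> A \<Longrightarrow> f x summable_on B"
  shows "(\<Sum>\<^sub>\<infinity>y\<in>B. \<Sum>x\<in>A. f x y) = (\<Sum>x\<in>A. \<Sum>\<^sub>\<infinity>y\<in>B. f x y)"
proof -
  have "((\<lambda>y. \<Sum>x\<in>A. f x y) has_sum (\<Sum>x\<in>A. \<Sum>\<^sub>\<infinity>y\<in>B. f x y)) B"
    using assms by (induction A) (auto intro!: has_sum_add has_sum_infsum)
  thus ?thesis by (rule infsumI)
qed

text \<open>Alternating the inversion formula over the finite Weyl group turns the exponentials into
  \<open>alt_char\<close>, and \<open>alt_char_regroup\<close> folds the sum over the dual lattice
  into finitely many alternating theta functions.\<close>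

theorem slash_S_alt_theta:
  assumes m: "m > 0" and y: "y \<in> wlat"
  shows "slash g S_mat (alt_theta m y) = (\<Sum>\<mu>\<in>reg_fin m. (S_const m * alt_char m y \<mu>) *\<^sub>s alt_theta m \<mu>)"
proof
  fix v
  show "slash g S_mat (alt_theta m y) v = (\<Sum>\<mu>\<in>reg_fin m. (S_const m * alt_char m y \<mu>) *\<^sub>s alt_theta m \<mu>) v"
  proof (cases "v \<in> Y")
    case False
    thus ?thesis by (simp add: slash_def S_mat_def sum_vec_apply alt_theta_def)
  next
    case True
    define \<sigma> z u where "\<sigma> = cs v" and "z = cz v" and "u = cu v"
    have \<sigma>: "Im \<sigma> > 0" using True by (simp add: \<sigma>_def Y_iff)
    have zE: "z \<in> Efin" by (simp add: z_def cz_E)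
    have z'E: "(1 / \<sigma>) *\<^sub>s z \<in> Efin" by (intro Efin_closed zE)
    have m': "real m > 0" using m by simp
    define U where "U = exp (2 * pi * \<i> * of_nat m * u)"
    define v' where "v' = pt (- 1 / \<sigma>) ((1 / \<sigma>) *\<^sub>s z) (u - \<langle>z, z\<rangle> / (2 * \<sigma>))"
    have v'Y: "v' \<in> Y" unfolding v'_def \<sigma>_def z_def by (rule S_point_Y[OF True])
    have v'c: "cs v' = - 1 / \<sigma>" "cz v' = (1 / \<sigma>) *\<^sub>s z" "cu v' = u - \<langle>z, z\<rangle> / (2 * \<sigma>)"
      unfolding v'_def by (rule pt_coords[OF z'E])+
    define T where "T = (\<lambda>y. \<Sum>\<^sub>\<infinity>\<beta>\<in>wlat. exp (- (2 * pi * \<i> * \<langle>y, \<beta>\<rangle> / of_nat m)) * theta_term m \<sigma> z \<beta>)"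
    have sm: "(\<lambda>\<beta>. eps w * (exp (- (2 * pi * \<i> * \<langle>w y, \<beta>\<rangle> / of_nat m)) * theta_term m \<sigma> z \<beta>)) summable_on wlat" if w: "w \<in> Wf" for w
    proof -
      have "(\<lambda>\<beta>. cmod (eps w * (exp (- (2 * pi * \<i> * \<langle>w y, \<beta>\<rangle> / of_nat m)) * theta_term m \<sigma> z \<beta>))) summable_on wlat"
      proof (rule Infinite_Sum.abs_summable_on_comparison_test'[OF summable_theta_term[OF m \<sigma> zE]])
        fix \<beta> assume b: "\<beta> \<in> wlat"
        have "\<langle>w y, \<beta>\<rangle> \<in> \<real>" by (rule wlat_form_real[OF Wf_wlat[OF w y] b])
        then obtain t where "\<langle>w y, \<beta>\<rangle> = of_real t" by (elim Reals_cases)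
        hence "exp (- (2 * pi * \<i> * \<langle>w y, \<beta>\<rangle> / of_nat m)) = exp (\<i> * of_real (- 2 * pi * t / real m))" by (simp add: mult_ac)
        thus "cmod (eps w * (exp (- (2 * pi * \<i> * \<langle>w y, \<beta>\<rangle> / of_nat m)) * theta_term m \<sigma> z \<beta>)) \<le> cmod (theta_term m \<sigma> z \<beta>)"
          using eps_pm[OF w] by (auto simp: norm_mult)
      qed
      thus ?thesis by (rule abs_summable_summable)
    qed
    have "alt_theta m y v' = (\<Sum>w\<in>Wf. eps w * (exp (2 * pi * \<i> * of_nat m * (u - \<langle>z, z\<rangle> / (2 * \<sigma>))) * theta_sum m (w y) (- 1 / \<sigma>) ((1 / \<sigma>) *\<^sub>s z)))"
      using v'Y by (simp add: alt_theta_def v'c sum_distrib_left mult_ac)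
    also have "\<dots> = (\<Sum>w\<in>Wf. eps w * (Cd * csqrt (\<sigma> / of_nat m) ^ l * U * T (w y)))"
      by (intro sum.cong refl) (simp only: theta_inversion[OF m \<sigma> zE Wf_E[OF _ wlat_E[OF y]]] T_def U_def)
    also have "\<dots> = Cd * csqrt (\<sigma> / of_nat m) ^ l * U * (\<Sum>w\<in>Wf. eps w * T (w y))"
      by (simp add: sum_distrib_left mult_ac)
    also have "(\<Sum>w\<in>Wf. eps w * T (w y)) = (\<Sum>w\<in>Wf. \<Sum>\<^sub>\<infinity>\<beta>\<in>wlat. eps w * (exp (- (2 * pi * \<i> * \<langle>w y, \<beta>\<rangle> / of_nat m)) * theta_term m \<sigma> z \<beta>))"
      unfolding T_def infsum_cmult_right' ..
    also have "\<dots> = (\<Sum>\<^sub>\<infinity>\<beta>\<in>wlat. \<Sum>w\<in>Wf. eps w * (exp (- (2 * pi * \<i> * \<langle>w y, \<beta>\<rangle> / of_nat m)) * theta_term m \<sigma> z \<beta>))"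
      by (rule infsum_sum_swap[OF finite_Wf sm, symmetric])
    also have "\<dots> = (\<Sum>\<^sub>\<infinity>\<beta>\<in>wlat. alt_char m y \<beta> * theta_term m \<sigma> z \<beta>)"
      unfolding alt_char_def sum_distrib_right by (simp only: mult.assoc)
    also have "\<dots> = (\<Sum>\<mu>\<in>reg_fin m. alt_char m y \<mu> * (\<Sum>w\<in>Wf. eps w * theta_sum m (w \<mu>) \<sigma> z))"
      unfolding theta_sum_def by (rule alt_char_regroup[OF m y summable_theta_term[OF m \<sigma> zE]])
    finally have A: "alt_theta m y v' = Cd * csqrt (\<sigma> / of_nat m) ^ l * U * (\<Sum>\<mu>\<in>reg_fin m. alt_char m y \<mu> * (\<Sum>w\<in>Wf. eps w * theta_sum m (w \<mu>) \<sigma> z))" .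
    have "csqrt \<sigma> \<noteq> 0" using \<sigma> by (auto simp: csqrt_eq_0)
    moreover have "csqrt (\<sigma> / of_nat m) = csqrt \<sigma> / of_real (sqrt (real m))"
      using csqrt_divide_real[OF \<sigma> m'] by simp
    ultimately have K: "Cd * csqrt (\<sigma> / of_nat m) ^ l / csqrt \<sigma> ^ l = S_const m"
      by (simp add: S_const_def power_divide del: csqrt.simps)
    have "slash g S_mat (alt_theta m y) v = alt_theta m y v' / csqrt \<sigma> ^ l"
      unfolding slash_S_apply[OF True] v'_def \<sigma>_def z_def u_def ..
    also have "\<dots> = (Cd * csqrt (\<sigma> / of_nat m) ^ l / csqrt \<sigma> ^ l) * U * (\<Sum>\<mu>\<in>reg_fin m. alt_char m y \<mu> * (\<Sum>w\<in>Wf. eps w * theta_sum m (w \<mu>) \<sigma> z))"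
      unfolding A by (simp del: csqrt.simps)
    also have "\<dots> = (\<Sum>\<mu>\<in>reg_fin m. S_const m * alt_char m y \<mu> * (U * (\<Sum>w\<in>Wf. eps w * theta_sum m (w \<mu>) \<sigma> z)))"
      unfolding K sum_distrib_left by (intro sum.cong refl) (simp only: mult_ac)
    also have "\<dots> = (\<Sum>\<mu>\<in>reg_fin m. S_const m * alt_char m y \<mu> * alt_theta m \<mu> v)"
      using True by (simp add: alt_theta_def U_def u_def \<sigma>_def z_def)
    also have "\<dots> = (\<Sum>\<mu>\<in>reg_fin m. (S_const m * alt_char m y \<mu>) *\<^sub>s alt_theta m \<mu>) v" by (simp add: sum_vec_apply)
    finally show ?thesis .
  qed
qed

subsection \<open>Linear independence\<close>

text \<open>At sigma = i and z = -gamma/m each theta sum becomes a constant times the value at gamma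
  of the character attached to w mu. Letting gamma vary over the dual lattice reduces the claim to
  the independence of distinct characters.\<close>

theorem alt_theta_independent:
  assumes m: "m > 0" and zero: "(\<Sum>\<mu>\<in>reg_fin m. d \<mu> *\<^sub>s alt_theta m \<mu>) = 0"
  shows "\<forall>\<mu>\<in>reg_fin m. d \<mu> = 0"
proof -
  define P where "P = (\<lambda>y. \<Sum>\<^sub>\<infinity>\<alpha>\<in>M. theta_term m \<i> 0 (y + of_nat m *\<^sub>s \<alpha>))"
  have RP: "\<mu> \<in> wlat" if "\<mu> \<in> reg_fin m" for \<mu> using that by (simp add: reg_fin_def)
  have inj: "inj_on (\<lambda>\<alpha>. y + of_nat m *\<^sub>s \<alpha>) M" for y
    using m by (intro inj_onI) (auto simp: fun_eq_iff)
  \<comment> \<open>At z = 0 and sigma = i all terms are positive reals, so the constant cannot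
    vanish.\<close>
  have P0: "P y \<noteq> 0" if y: "y \<in> wlat" for y
  proof -
    define r where "r = (\<lambda>\<alpha>. exp (- (pi * Re \<langle>y + of_nat m *\<^sub>s \<alpha>, y + of_nat m *\<^sub>s \<alpha>\<rangle> / real m)))"
    have r: "theta_term m \<i> 0 (y + of_nat m *\<^sub>s \<alpha>) = of_real (r \<alpha>)" if \<alpha>: "\<alpha> \<in> M" for \<alpha>
    proof -
      have "y + of_nat m *\<^sub>s \<alpha> \<in> wlat" by (rule wlat_closed(1)[OF y wlat_closed(3)[OF M_wlat[OF \<alpha>]]])
      hence "\<langle>y + of_nat m *\<^sub>s \<alpha>, y + of_nat m *\<^sub>s \<alpha>\<rangle> \<in> \<real>" by (intro wlat_form_real)
      then obtain t where t: "\<langle>y + of_nat m *\<^sub>s \<alpha>, y + of_nat m *\<^sub>s \<alpha>\<rangle> = of_real t" by (elim Reals_cases)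
      have "theta_term m \<i> 0 (y + of_nat m *\<^sub>s \<alpha>) = exp (of_real (- (pi * t / real m)))"
        unfolding theta_term_def t by (intro arg_cong[where f = exp]) (simp add: field_simps)
      thus ?thesis unfolding r_def t by (simp only: exp_of_real Re_complex_of_real)
    qed
    have "(\<lambda>\<beta>. cmod (theta_term m \<i> 0 \<beta>)) summable_on wlat" by (rule summable_theta_term[OF m]) (auto simp: Efin_closed)
    hence "(\<lambda>\<beta>. cmod (theta_term m \<i> 0 \<beta>)) summable_on (\<lambda>\<alpha>. y + of_nat m *\<^sub>s \<alpha>) ` M"
      by (rule summable_on_subset_banach) (auto intro: wlat_closed(1)[OF y wlat_closed(3)[OF M_wlat]])
    hence "(\<lambda>\<alpha>. cmod (theta_term m \<i> 0 (y + of_nat m *\<^sub>s \<alpha>))) summable_on M"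
      unfolding summable_on_reindex[OF inj] by (simp add: o_def)
    hence s: "r summable_on M" by (rule summable_on_cong[THEN iffD1, rotated]) (simp add: r r_def)
    have "0 < r 0" by (simp add: r_def)
    also have "\<dots> = sum r {0}" by simp
    also have "\<dots> \<le> infsum r M" by (rule finite_sum_le_infsum[OF s]) (auto simp: M_zero r_def)
    finally have "infsum r M \<noteq> 0" by simp
    moreover have "P y = of_real (infsum r M)"
      unfolding P_def infsumI[OF has_sum_of_real[OF has_sum_infsum[OF s]], symmetric] by (intro infsum_cong r)
    ultimately show ?thesis by simp
  qed
  have "\<forall>p\<in>reg_fin m \<times> Wf. d (fst p) * eps (snd p) * P (snd p (fst p)) = 0"
  proof (rule independent_characters[where P = wlat and \<psi> = "\<lambda>p \<gamma>. exp (- (2 * pi * \<i> * \<langle>snd p (fst p), \<gamma>\<rangle> / of_nat m))"])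
    fix p q assume p: "p \<in> reg_fin m \<times> Wf" and q: "q \<in> reg_fin m \<times> Wf" and "p \<noteq> q"
    show "\<exists>x\<in>wlat. exp (- (2 * pi * \<i> * \<langle>snd p (fst p), x\<rangle> / of_nat m)) \<noteq> exp (- (2 * pi * \<i> * \<langle>snd q (fst q), x\<rangle> / of_nat m))"
    proof (rule ccontr)
      have mem: "snd p (fst p) \<in> wlat" "snd q (fst q) \<in> wlat" using p q by (auto intro: Wf_wlat RP)
      assume "\<not> ?thesis"
      then obtain \<alpha> where \<alpha>: "\<alpha> \<in> M" "snd p (fst p) = snd q (fst q) + of_nat m *\<^sub>s \<alpha>"
        using character_eq_imp_congruent[OF m mem] by blast
      hence "snd p (fst p) + of_nat m *\<^sub>s 0 = snd q (fst q) + of_nat m *\<^sub>s \<alpha>" by (simp add: scl_def zero_fun_def plus_fun_def)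
      with affine_orbit_inj[where w = "snd p" and w' = "snd q" and \<mu> = "fst p" and \<mu>' = "fst q" and \<alpha> = 0 and \<alpha>' = \<alpha>, OF m _ _ _ _ M_zero \<alpha>(1)] p q
      have "p = q" by (auto simp: mem_Times_iff intro: prod_eqI)
      with \<open>p \<noteq> q\<close> show False by simp
    qed
  next
    fix \<gamma> assume \<gamma>: "\<gamma> \<in> wlat"
    define z where "z = (- 1 / of_nat m) *\<^sub>s \<gamma>"
    have zE: "z \<in> Efin" unfolding z_def by (intro Efin_closed wlat_E \<gamma>)
    define v where "v = pt \<i> z 0"
    have v: "v \<in> Y" "cs v = \<i>" "cz v = z" "cu v = 0" unfolding v_def by (auto simp: pt_coords[OF zE] intro: pt_Y zE)
    have T: "theta_sum m y \<i> z = exp (- (2 * pi * \<i> * \<langle>y, \<gamma>\<rangle> / of_nat m)) * P y" for y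
      unfolding theta_sum_def P_def infsum_cmult_right'[symmetric]
    proof (intro infsum_cong)
      fix \<alpha> assume \<alpha>: "\<alpha> \<in> M"
      have "\<langle>\<alpha>, \<gamma>\<rangle> \<in> \<int>" using wlat_M_int[OF \<gamma> \<alpha>] form_sym by metis
      hence e: "exp (- (2 * pi * \<i> * \<langle>\<alpha>, \<gamma>\<rangle>)) = 1" by (rule exp_Ints)
      have "theta_term m \<i> z (y + of_nat m *\<^sub>s \<alpha>) = exp (- (2 * pi * \<i> * \<langle>y, \<gamma>\<rangle> / of_nat m)) * exp (- (2 * pi * \<i> * \<langle>\<alpha>, \<gamma>\<rangle>)) * theta_term m \<i> 0 (y + of_nat m *\<^sub>s \<alpha>)"
        unfolding theta_term_def exp_add[symmetric]
        by (intro arg_cong[where f = exp]) (use m in \<open>simp add: z_def form_add_left form_scl_left form_scl_right form_minus_right field_simps\<close>)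
      thus "theta_term m \<i> z (y + of_nat m *\<^sub>s \<alpha>) = exp (- (2 * pi * \<i> * \<langle>y, \<gamma>\<rangle> / of_nat m)) * theta_term m \<i> 0 (y + of_nat m *\<^sub>s \<alpha>)"
        unfolding e by simp
    qed
    have "0 = (\<Sum>\<mu>\<in>reg_fin m. d \<mu> *\<^sub>s alt_theta m \<mu>) v" unfolding zero by simp
    also have "\<dots> = (\<Sum>\<mu>\<in>reg_fin m. \<Sum>w\<in>Wf. d \<mu> * eps w * P (w \<mu>) * exp (- (2 * pi * \<i> * \<langle>w \<mu>, \<gamma>\<rangle> / of_nat m)))"
      using v by (simp add: sum_vec_apply alt_theta_def T sum_distrib_left mult_ac)
    also have "\<dots> = (\<Sum>p\<in>reg_fin m \<times> Wf. d (fst p) * eps (snd p) * P (snd p (fst p)) * exp (- (2 * pi * \<i> * \<langle>snd p (fst p), \<gamma>\<rangle> / of_nat m)))"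
      by (simp add: sum.cartesian_product case_prod_unfold)
    finally show "(\<Sum>p\<in>reg_fin m \<times> Wf. d (fst p) * eps (snd p) * P (snd p (fst p)) * exp (- (2 * pi * \<i> * \<langle>snd p (fst p), \<gamma>\<rangle> / of_nat m))) = 0" by simp
  next
    fix p x y
    show "exp (- (2 * pi * \<i> * \<langle>snd p (fst p), x + y\<rangle> / of_nat m)) = exp (- (2 * pi * \<i> * \<langle>snd p (fst p), x\<rangle> / of_nat m)) * exp (- (2 * pi * \<i> * \<langle>snd p (fst p), y\<rangle> / of_nat m))"
      by (rule character_hom)
  qed (auto simp: finite_Wf finite_reg_fin wlat_closed)
  hence *: "d \<mu> * P \<mu> = 0" if "\<mu> \<in> reg_fin m" for \<mu>
    using that id_Wf eps_pm[OF id_Wf] by (force dest: bspec[of _ _ "(\<mu>, id)"])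
  show ?thesis using * P0 RP by force
qed

end

section \<open>The closure and the S-matrix\<close>

lemma independent_family:
  fixes f :: "'a \<Rightarrow> cfunc"
  assumes R: "finite R" and ind: "\<And>d. (\<Sum>\<mu>\<in>R. d \<mu> *\<^sub>s f \<mu>) = 0 \<Longrightarrow> \<forall>\<mu>\<in>R. d \<mu> = 0"
  shows "inj_on f R" "cfun.independent (f ` R)"
proof -
  show inj: "inj_on f R"
  proof (rule inj_onI)
    fix x y assume x: "x \<in> R" and y: "y \<in> R" and eq: "f x = f y"
    show "x = y"
    proof (rule ccontr)
      assume ne: "x \<noteq> y"
      define d :: "'a \<Rightarrow> complex" where "d = (\<lambda>\<mu>. if \<mu> = x then 1 else if \<mu> = y then - 1 else 0)"
      have "(\<Sum>\<mu>\<in>R. d \<mu> *\<^sub>s f \<mu>) = (\<Sum>\<mu>\<in>{x, y}. d \<mu> *\<^sub>s f \<mu>)"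
        by (rule sum.mono_neutral_right[OF R]) (auto simp: x y d_def)
      also have "\<dots> = 0" using ne eq by (auto simp: d_def fun_eq_iff)
      finally have "d x = 0" using ind x by blast
      thus False by (simp add: d_def)
    qed
  qed
  show "cfun.independent (f ` R)"
    unfolding cfun.dependent_finite[OF finite_imageI[OF R]]
  proof (intro notI, elim exE conjE)
    fix u assume ne: "\<exists>v\<in>f ` R. u v \<noteq> 0" and s: "(\<Sum>v\<in>f ` R. u v *\<^sub>s v) = 0"
    have "(\<Sum>\<mu>\<in>R. u (f \<mu>) *\<^sub>s f \<mu>) = 0" using s unfolding sum.reindex[OF inj] by (simp add: o_def)
    thus False using ind[of "\<lambda>\<mu>. u (f \<mu>)"] ne by blast
  qed
qed

lemma span_image_iff:
  fixes f :: "'a \<Rightarrow> cfunc"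
  assumes "finite R"
  shows "h \<in> cfun.span (f ` R) \<longleftrightarrow> (\<exists>d. h = (\<Sum>\<mu>\<in>R. d \<mu> *\<^sub>s f \<mu>))"
proof
  assume "h \<in> cfun.span (f ` R)"
  thus "\<exists>d. h = (\<Sum>\<mu>\<in>R. d \<mu> *\<^sub>s f \<mu>)"
  proof (induction rule: cfun.span_induct_alt)
    case base
    show ?case by (rule exI[of _ "\<lambda>_. 0"]) (simp add: zero_fun_def scl_def)
  next
    case (step t x y)
    from step(1) obtain \<nu> where \<nu>: "\<nu> \<in> R" "x = f \<nu>" by blast
    from step(2) obtain d where d: "y = (\<Sum>\<mu>\<in>R. d \<mu> *\<^sub>s f \<mu>)" by blast
    have "t *\<^sub>s x + y = (\<Sum>\<mu>\<in>R. ((if \<mu> = \<nu> then t else 0) + d \<mu>) *\<^sub>s f \<mu>)"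
      unfolding cfun.scale_left_distrib sum.distrib d \<nu>(2)
      by (simp add: if_distrib[where f = "\<lambda>t. t *\<^sub>s _"] sum.delta assms \<nu> cong: if_cong)
    thus ?case by (rule exI[of _ "\<lambda>\<mu>. (if \<mu> = \<nu> then t else 0) + d \<mu>"])
  qed
next
  assume "\<exists>d. h = (\<Sum>\<mu>\<in>R. d \<mu> *\<^sub>s f \<mu>)"
  thus "h \<in> cfun.span (f ` R)" by (auto intro!: cfun.span_sum cfun.span_scale intro: cfun.span_base)
qed

text \<open>\<open>S_inverse\<close> is specified as a right inverse vanishing off the index set; a
  two-sided inverse shows that there is exactly one.\<close>

lemma finite_right_inverse_unique:
  fixes B C :: "'a \<Rightarrow> 'a \<Rightarrow> complex"
  assumes R: "finite R"
    and BC: "\<And>x y. x \<in> R \<Longrightarrow> y \<in> R \<Longrightarrow> (\<Sum>p\<in>R. B x p * C p y) = (if x = y then 1 else 0)"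
    and CB: "\<And>x y. x \<in> R \<Longrightarrow> y \<in> R \<Longrightarrow> (\<Sum>p\<in>R. C x p * B p y) = (if x = y then 1 else 0)"
  shows "\<exists>!T. (\<forall>x y. x \<notin> R \<or> y \<notin> R \<longrightarrow> T x y = 0) \<and>
    (\<forall>x\<in>R. \<forall>y\<in>R. (\<Sum>p\<in>R. B x p * T p y) = (if x = y then 1 else 0))"
proof -
  let ?T = "\<lambda>x y. if x \<in> R \<and> y \<in> R then C x y else 0"
  show ?thesis
  proof (rule ex1I)
  show "(\<forall>x y. x \<notin> R \<or> y \<notin> R \<longrightarrow> ?T x y = 0) \<and> (\<forall>x\<in>R. \<forall>y\<in>R. (\<Sum>p\<in>R. B x p * ?T p y) = (if x = y then 1 else 0))"
    using BC by (simp cong: sum.cong)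
next
  fix T assume T: "(\<forall>x y. x \<notin> R \<or> y \<notin> R \<longrightarrow> T x y = 0) \<and> (\<forall>x\<in>R. \<forall>y\<in>R. (\<Sum>p\<in>R. B x p * T p y) = (if x = y then 1 else 0))"
  have "T x y = C x y" if x: "x \<in> R" and y: "y \<in> R" for x y
  proof -
    have "T x y = (\<Sum>q\<in>R. (if x = q then 1 else 0) * T q y)" using R x by (simp add: if_distrib[where f = "\<lambda>t. t * _"] cong: if_cong)
    also have "\<dots> = (\<Sum>q\<in>R. (\<Sum>p\<in>R. C x p * B p q) * T q y)" by (intro sum.cong refl) (simp add: CB x)
    also have "\<dots> = (\<Sum>p\<in>R. C x p * (\<Sum>q\<in>R. B p q * T q y))"
      unfolding sum_distrib_right sum_distrib_left mult.assoc by (rule sum.swap)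
    also have "\<dots> = (\<Sum>p\<in>R. C x p * (if p = y then 1 else 0))" by (intro sum.cong refl) (use T y in simp)
    also have "\<dots> = C x y" using R y by (simp add: if_distrib[where f = "\<lambda>t. _ * t"] cong: if_cong)
    finally show ?thesis .
  qed
  thus "T = ?T" using T by (auto simp: fun_eq_iff)
qed
qed

lemma slash_add: "slash g X (f + f') = slash g X f + slash g X f'"
  by (cases X) (auto simp: slash_def fun_eq_iff Let_def add_divide_distrib)
lemma slash_scl: "slash g X (t *\<^sub>s f) = t *\<^sub>s slash g X f"
  by (cases X) (auto simp: slash_def fun_eq_iff Let_def)
lemma slash_sum: "slash g X (\<Sum>i\<in>I. d i *\<^sub>s f i) = (\<Sum>i\<in>I. d i *\<^sub>s slash g X (f i))"
proof (induction I rule: infinite_finite_induct)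
  case (insert i I)
  thus ?case by (simp only: sum.insert slash_add slash_scl not_False_eq_True)
qed (cases X; auto simp: slash_def fun_eq_iff Let_def)+

text \<open>The product itself is i or -i according to the branches; its square is free of that
  choice.\<close>

lemma csqrt_minus_inverse:
  assumes "\<sigma> \<noteq> 0"
  shows "(csqrt (- 1 / \<sigma>) * csqrt \<sigma>)\<^sup>2 = - 1"
  using assms by (simp add: power_mult_distrib del: csqrt.simps)

section \<open>The closure as the span of all regular dominant functions\<close>

context aff_data
begin

definition at_level :: "nat \<Rightarrow> vec \<Rightarrow> vec" where "at_level m y = y + of_nat m *\<^sub>s L0"

lemma pr_hdual:
  assumes "x \<in> hdual g"
  shows "i \<in> S \<Longrightarrow> \<langle>fin_part g x, sroot i\<rangle> = of_nat (c i) * pr x i"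
    and "pr x 0 = x (Suc l) - \<langle>fin_part g x, th\<rangle>"
proof -
  have pr: "pr x i = pr (fin_part g x) i + x (Suc l) * pr L0 i" for i
    by (subst hdual_decomp[OF assms]) (simp add: pairing_add pairing_scl)
  show "i \<in> S \<Longrightarrow> \<langle>fin_part g x, sroot i\<rangle> = of_nat (c i) * pr x i" by (simp add: pr pr_L0 form_sroot)
  show "pr x 0 = x (Suc l) - \<langle>fin_part g x, th\<rangle>" by (simp add: pr pr_L0 pr_E0)
qed

lemma at_level_props:
  assumes "y \<in> Efin"
  shows "at_level m y \<in> hdual g" "at_level m y (Suc l) = of_nat m" "at_level m y 0 = 0" "fin_part g (at_level m y) = y"
proof -
  show "at_level m y \<in> hdual g" unfolding at_level_def by (intro hdual_add hdual_scl Efin_hdual assms L0_hdual)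
  show "at_level m y (Suc l) = of_nat m" "at_level m y 0 = 0"
    using assms by (auto simp: at_level_def Efin_def Lambda0_def sroot_apply)
  show "fin_part g (at_level m y) = y"
    unfolding at_level_def by (simp only: fin_part_add fin_part_scl fin_part_L0 fin_part_E_id[OF assms]) (simp add: fun_eq_iff)
qed

lemma at_level_inj: "at_level m y = at_level m y' \<longleftrightarrow> y = y'" by (simp add: at_level_def)

lemma at_level_P: "y \<in> wlat \<Longrightarrow> at_level m y \<in> P_weights g m"
  by (simp add: P_weights_iff at_level_props wlat_E)

lemma A_at_level: "m > 0 \<Longrightarrow> y \<in> wlat \<Longrightarrow> A_fun g m (at_level m y) = alt_theta m y"
  by (simp add: A_fun_eq at_level_P at_level_props wlat_E)

lemma reg_fin_wlat: "y \<in> reg_fin m \<Longrightarrow> y \<in> wlat" by (simp add: reg_fin_def)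

lemma regular_dominant_eq: "regular_dominant g m = at_level m ` reg_fin m"
proof (intro equalityI subsetI)
  fix x assume x: "x \<in> regular_dominant g m"
  have xP: "x \<in> P_weights g m" and x0: "x 0 = 0" and pos: "\<And>i. i \<le> l \<Longrightarrow> 0 < Re (pr x i)"
    using x by (auto simp: regular_dominant_def form_Lambda0)
  have xh: "x \<in> hdual g" and yP: "fin_part g x \<in> wlat" and xl: "x (Suc l) = of_nat m" using xP by (auto simp: P_weights_iff)
  have "x = at_level m (fin_part g x)" using hdual_decomp[OF xh] by (simp add: at_level_def x0 xl)
  moreover have "fin_part g x \<in> reg_fin m"
    unfolding reg_fin_def
  proof (intro CollectI conjI yP ballI)
    fix i assume i: "i \<in> S"
    show "0 < Re \<langle>fin_part g x, sroot i\<rangle>" using pos[of i] i cpos[of i] unfolding pr_hdual(1)[OF xh i] by simp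
  next
    show "Re \<langle>fin_part g x, th\<rangle> < real m" using pos[of 0] unfolding pr_hdual(2)[OF xh] by (simp add: xl)
  qed
  ultimately show "x \<in> at_level m ` reg_fin m" by (rule image_eqI)
next
  fix x assume "x \<in> at_level m ` reg_fin m"
  then obtain y where y: "y \<in> reg_fin m" "x = at_level m y" by blast
  show "x \<in> regular_dominant g m"
    using sdom_level[OF y(1)] at_level_P[OF reg_fin_wlat[OF y(1)]] at_level_props(3)[OF wlat_E[OF reg_fin_wlat[OF y(1)]]]
    by (simp add: regular_dominant_def y(2) form_Lambda0 sdom_def flip: at_level_def)
qed

abbreviation alt_span where "alt_span m \<equiv> cfun.span (alt_theta m ` reg_fin m)"

lemma alt_theta_basis:
  assumes "m > 0"
  shows "inj_on (alt_theta m) (reg_fin m)" "cfun.independent (alt_theta m ` reg_fin m)"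
    using independent_family[where f = "alt_theta m" and R = "reg_fin m", OF finite_reg_fin] alt_theta_independent[OF assms] by blast+

lemma alt_span_iff: "h \<in> alt_span m \<longleftrightarrow> (\<exists>d. h = (\<Sum>\<mu>\<in>reg_fin m. d \<mu> *\<^sub>s alt_theta m \<mu>))"
  by (rule span_image_iff[OF finite_reg_fin])

lemma A_image_at_level: "m > 0 \<Longrightarrow> X \<subseteq> reg_fin m \<Longrightarrow> A_fun g m ` at_level m ` X = alt_theta m ` X"
  unfolding image_image by (intro image_cong refl A_at_level reg_fin_wlat) auto

lemma A_basis_iff:
  assumes m: "m > 0"
  shows "A_basis g m X V \<longleftrightarrow> (\<exists>X0\<subseteq>reg_fin m. X = at_level m ` X0 \<and> V = cfun.span (alt_theta m ` X0))"
proof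
  assume "A_basis g m X V"
  hence X: "X \<subseteq> at_level m ` reg_fin m" and V: "cfun.span (A_fun g m ` X) = V" by (auto simp: A_basis_def regular_dominant_eq)
  from X obtain X0 where X0: "X0 \<subseteq> reg_fin m" "X = at_level m ` X0" by (auto simp: subset_image_iff)
  thus "\<exists>X0\<subseteq>reg_fin m. X = at_level m ` X0 \<and> V = cfun.span (alt_theta m ` X0)" using V A_image_at_level[OF m X0(1)] by auto
next
  assume "\<exists>X0\<subseteq>reg_fin m. X = at_level m ` X0 \<and> V = cfun.span (alt_theta m ` X0)"
  then obtain X0 where X0: "X0 \<subseteq> reg_fin m" "X = at_level m ` X0" "V = cfun.span (alt_theta m ` X0)" by blast
  have "inj_on (A_fun g m) (at_level m ` X0)"
  proof (rule inj_onI)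
    fix p q assume "p \<in> at_level m ` X0" "q \<in> at_level m ` X0" and eq: "A_fun g m p = A_fun g m q"
    then obtain x y where xy: "p = at_level m x" "q = at_level m y" "x \<in> reg_fin m" "y \<in> reg_fin m" using X0(1) by blast
    hence "alt_theta m x = alt_theta m y" using eq A_at_level[OF m] reg_fin_wlat by simp
    thus "p = q" using alt_theta_basis(1)[OF m] xy by (auto dest: inj_onD)
  qed
  moreover have "cfun.independent (alt_theta m ` X0)"
    using alt_theta_basis(2)[OF m] X0(1) by (meson cfun.independent_mono image_mono)
  ultimately show "A_basis g m X V"
    using X0 by (auto simp: A_basis_def regular_dominant_eq A_image_at_level[OF m X0(1)])
qed

lemma A_basisE:
  assumes "m > 0" "A_basis g m X V"
  obtains X0 where "X0 \<subseteq> reg_fin m" "X = at_level m ` X0" "V = cfun.span (alt_theta m ` X0)"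
  using assms(2) unfolding A_basis_iff[OF assms(1)] by (elim exE conjE) (rule that)

text \<open>By linear independence a basis of the full span taken from the alternating theta
  functions must use all of them, so the description of \<open>weight_set\<close> determines
  it.\<close>

lemma A_basis_alt_span:
  assumes m: "m > 0"
  shows "A_basis g m X (alt_span m) \<longleftrightarrow> X = at_level m ` reg_fin m"
proof
  assume "A_basis g m X (alt_span m)"
  then obtain X0 where X0: "X0 \<subseteq> reg_fin m" "X = at_level m ` X0" "alt_span m = cfun.span (alt_theta m ` X0)"
    by (rule A_basisE[OF m])
  have "reg_fin m \<subseteq> X0"
  proof
    fix x assume x: "x \<in> reg_fin m"
    show "x \<in> X0"
    proof (rule ccontr)
      assume "x \<notin> X0"
      hence "alt_theta m ` X0 \<subseteq> alt_theta m ` reg_fin m - {alt_theta m x}" using X0(1) x alt_theta_basis(1)[OF m] by (auto dest: inj_onD)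
      hence "alt_span m \<subseteq> cfun.span (alt_theta m ` reg_fin m - {alt_theta m x})" unfolding X0(3) by (rule cfun.span_mono)
      moreover have "alt_theta m x \<in> alt_span m" using x by (auto intro: cfun.span_base)
      ultimately have "cfun.dependent (alt_theta m ` reg_fin m)" unfolding cfun.dependent_def using x by blast
      thus False using alt_theta_basis(2)[OF m] by blast
    qed
  qed
  thus "X = at_level m ` reg_fin m" using X0 by auto
next
  assume "X = at_level m ` reg_fin m"
  thus "A_basis g m X (alt_span m)" unfolding A_basis_iff[OF m] by (intro exI[of _ "reg_fin m"] conjI) simp_all
qed

definition S_coeff :: "nat \<Rightarrow> vec \<Rightarrow> vec \<Rightarrow> complex" where "S_coeff m \<mu> \<nu> = S_const m * alt_char m \<mu> \<nu>"

lemma slash_S_Af': "m > 0 \<Longrightarrow> \<mu> \<in> reg_fin m \<Longrightarrow> slash g S_mat (alt_theta m \<mu>) = (\<Sum>\<nu>\<in>reg_fin m. S_coeff m \<mu> \<nu> *\<^sub>s alt_theta m \<nu>)"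
  by (simp add: slash_S_alt_theta reg_fin_wlat S_coeff_def)

lemma slash_S_comb:
  assumes m: "m > 0"
  shows "slash g S_mat (\<Sum>\<mu>\<in>reg_fin m. d \<mu> *\<^sub>s alt_theta m \<mu>) = (\<Sum>\<nu>\<in>reg_fin m. (\<Sum>\<mu>\<in>reg_fin m. d \<mu> * S_coeff m \<mu> \<nu>) *\<^sub>s alt_theta m \<nu>)"
proof -
  have "slash g S_mat (\<Sum>\<mu>\<in>reg_fin m. d \<mu> *\<^sub>s alt_theta m \<mu>) = (\<Sum>\<mu>\<in>reg_fin m. \<Sum>\<nu>\<in>reg_fin m. (d \<mu> * S_coeff m \<mu> \<nu>) *\<^sub>s alt_theta m \<nu>)"
    unfolding slash_sum by (intro sum.cong refl) (simp add: slash_S_Af'[OF m] cfun.scale_sum_right)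
  also have "\<dots> = (\<Sum>\<nu>\<in>reg_fin m. (\<Sum>\<mu>\<in>reg_fin m. d \<mu> * S_coeff m \<mu> \<nu>) *\<^sub>s alt_theta m \<nu>)"
    unfolding cfun.scale_sum_left by (rule sum.swap)
  finally show ?thesis .
qed

lemma slash_S_alt_span: "m > 0 \<Longrightarrow> f \<in> alt_span m \<Longrightarrow> slash g S_mat f \<in> alt_span m"
  unfolding alt_span_iff by (elim exE, simp only: slash_S_comb, rule exI, rule refl)

lemma alt_theta_coeffs_unique:
  assumes m: "m > 0" and eq: "(\<Sum>\<mu>\<in>reg_fin m. d \<mu> *\<^sub>s alt_theta m \<mu>) = (\<Sum>\<mu>\<in>reg_fin m. e \<mu> *\<^sub>s alt_theta m \<mu>)" and \<mu>: "\<mu> \<in> reg_fin m"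
  shows "d \<mu> = e \<mu>"
proof -
  have "(\<Sum>\<mu>\<in>reg_fin m. (d \<mu> - e \<mu>) *\<^sub>s alt_theta m \<mu>) = 0"
    unfolding cfun.scale_left_diff_distrib sum_subtractf eq by simp
  from alt_theta_independent[OF m this] \<mu> show ?thesis by simp
qed

lemma alt_span_Th:
  assumes m: "m > 0"
  shows "alt_span m \<subseteq> Th g m"
  unfolding Th_def
proof (rule cfun.span_minimal)
  show "alt_theta m ` reg_fin m \<subseteq> cfun.span (Theta g m ` P_weights g m)"
  proof
    fix f assume "f \<in> alt_theta m ` reg_fin m"
    then obtain y where y: "y \<in> reg_fin m" "f = A_fun g m (at_level m y)" using A_at_level[OF m] reg_fin_wlat by auto
    show "f \<in> cfun.span (Theta g m ` P_weights g m)"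
      unfolding y(2) A_fun_def
      by (intro cfun.span_sum cfun.span_scale cfun.span_base imageI)
         (use Wf_P_weights at_level_P reg_fin_wlat[OF y(1)] in blast)
  qed
qed simp

text \<open>\<open>C\<close> is left abstract so that the statement serves both
  \<open>Ch_minus g k\<close> and the preimage of the corresponding space of the transpose; one
  alternating theta function in \<open>C\<close> starts the argument.\<close>

theorem closure_unique:
  assumes m: "m > 0" and unit_wt: "unit_wt \<in> reg_fin m" and \<mu>0: "\<mu>0 \<in> reg_fin m" "alt_theta m \<mu>0 \<in> C" and C: "C \<subseteq> alt_span m"
  shows "(cfun.subspace V \<and> V \<subseteq> Th g m \<and> C \<subseteq> V \<and> (\<forall>f\<in>V. slash g S_mat f \<in> V) \<and> (\<exists>X. A_basis g m X V)) \<longleftrightarrow> V = alt_span m"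
proof
  assume *: "cfun.subspace V \<and> V \<subseteq> Th g m \<and> C \<subseteq> V \<and> (\<forall>f\<in>V. slash g S_mat f \<in> V) \<and> (\<exists>X. A_basis g m X V)"
  then obtain X where "A_basis g m X V" by blast
  then obtain X0 where X0: "X0 \<subseteq> reg_fin m" "V = cfun.span (alt_theta m ` X0)" by (rule A_basisE[OF m])
  have fX: "finite X0" using X0(1) finite_reg_fin by (rule finite_subset)
  \<comment> \<open>Here it matters that the basis consists of alternating theta functions: a
    nonzero coefficient at \<open>\<nu>\<close> of an element of \<open>V\<close> puts
    \<open>\<nu>\<close> itself into \<open>X0\<close>.\<close>
  have step: "\<nu> \<in> X0" if \<mu>: "\<mu> \<in> reg_fin m" "alt_theta m \<mu> \<in> V" and \<nu>: "\<nu> \<in> reg_fin m" "alt_char m \<mu> \<nu> \<noteq> 0" for \<mu> \<nu>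
  proof (rule ccontr)
    assume n: "\<nu> \<notin> X0"
    have "slash g S_mat (alt_theta m \<mu>) \<in> V" using * \<mu>(2) by blast
    then obtain d where d: "slash g S_mat (alt_theta m \<mu>) = (\<Sum>\<mu>\<in>X0. d \<mu> *\<^sub>s alt_theta m \<mu>)"
      unfolding X0(2) span_image_iff[OF fX] by blast
    have "(\<Sum>\<mu>\<in>X0. d \<mu> *\<^sub>s alt_theta m \<mu>) = (\<Sum>\<mu>\<in>reg_fin m. (if \<mu> \<in> X0 then d \<mu> else 0) *\<^sub>s alt_theta m \<mu>)"
      using X0(1) by (intro sum.mono_neutral_cong_left finite_reg_fin) auto
    with d slash_S_Af'[OF m \<mu>(1)]
    have "(\<Sum>\<nu>\<in>reg_fin m. S_coeff m \<mu> \<nu> *\<^sub>s alt_theta m \<nu>) = (\<Sum>\<mu>\<in>reg_fin m. (if \<mu> \<in> X0 then d \<mu> else 0) *\<^sub>s alt_theta m \<mu>)" by simp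
    from alt_theta_coeffs_unique[OF m this \<nu>(1)] n \<nu>(2) S_const_nonzero[OF m] show False by (simp add: S_coeff_def)
  qed
  have "unit_wt \<in> X0" by (rule step[OF \<mu>0(1) _ unit_wt]) (use * \<mu>0(2) alt_char_unit_wt_nonzero[OF m \<mu>0(1)] in \<open>auto simp: alt_char_comm[of m \<mu>0]\<close>)
  hence "alt_theta m unit_wt \<in> V" unfolding X0(2) by (intro cfun.span_base imageI)
  hence "reg_fin m \<subseteq> X0" using step[OF unit_wt] alt_char_unit_wt_nonzero[OF m] by blast
  thus "V = alt_span m" using X0 by auto
next
  assume V: "V = alt_span m"
  show "cfun.subspace V \<and> V \<subseteq> Th g m \<and> C \<subseteq> V \<and> (\<forall>f\<in>V. slash g S_mat f \<in> V) \<and> (\<exists>X. A_basis g m X V)"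
    unfolding V by (simp add: alt_span_Th[OF m] C slash_S_alt_span[OF m] A_basis_alt_span[OF m])
qed

subsection \<open>Fundamental weights\<close>

lemma hdual_pr_zero:
  assumes x: "x \<in> hdual g" and pr: "\<And>j. j \<le> l \<Longrightarrow> pr x j = 0" and x0: "x 0 = 0"
  shows "x = 0"
proof -
  have "lev x = 0" unfolding level_def by (simp add: pr)
  hence d: "x = fin_part g x" using hdual_decomp[OF x] by (simp add: x0 lev_eq)
  have "fin_part g x = 0"
    by (rule Efin_nondegenerate[OF fin_part_E]) (simp add: pr_hdual(1)[OF x] pr)
  thus ?thesis using d by simp
qed

lemma fund_weight_unique:
  assumes i: "i \<le> l"
  shows "\<exists>!x. x \<in> hdual g \<and> (\<forall>j\<le>l. pr x j = (if j = i then 1 else 0)) \<and> \<langle>x, L0\<rangle> = 0"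
proof (rule ex_ex1I)
  show "\<exists>x. x \<in> hdual g \<and> (\<forall>j\<le>l. pr x j = (if j = i then 1 else 0)) \<and> \<langle>x, L0\<rangle> = 0"
  proof (cases "i = 0")
    case True
    thus ?thesis by (intro exI[of _ L0]) (simp add: L0_hdual pr_L0 form_L0_L0)
  next
    case False
    \<comment> \<open>Pairing c_i with alpha_i means value 1 on the coroot. The multiple of Lambda_0
      added below corrects node 0 without disturbing the other nodes.\<close>
    define y where "y = wtr (\<lambda>j. if j = i then real (c i) else 0)"
    have yE: "y \<in> Efin" by (simp add: y_def wtr_E)
    show ?thesis
    proof (intro exI[of _ "y + \<langle>y, th\<rangle> *\<^sub>s L0"] conjI allI impI)
      show "y + \<langle>y, th\<rangle> *\<^sub>s L0 \<in> hdual g" by (intro hdual_add hdual_scl Efin_hdual yE L0_hdual)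
      show "\<langle>y + \<langle>y, th\<rangle> *\<^sub>s L0, L0\<rangle> = 0" by (simp add: form_bilinear form_basis yE)
      fix j assume j: "j \<le> l"
      have "of_nat (c j) * pr y j = (if j = i then of_nat (c i) else 0)" if "j \<noteq> 0"
      proof -
        have "\<langle>y, sroot j\<rangle> = of_real (if j = i then real (c i) else 0)"
          unfolding y_def by (rule wtr_sroot) (use j that in auto)
        thus ?thesis unfolding form_sroot[OF j] by (cases "j = i") auto
      qed
      thus "pr (y + \<langle>y, th\<rangle> *\<^sub>s L0) j = (if j = i then 1 else 0)"
        using False cpos[OF j] by (cases "j = 0") (auto simp: pairing_add pairing_scl pr_L0 pr_E0[OF yE] split: if_splits)
    qed
  qed
next
  fix x y
  assume x: "x \<in> hdual g \<and> (\<forall>j\<le>l. pr x j = (if j = i then 1 else 0)) \<and> \<langle>x, L0\<rangle> = 0"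
    and y: "y \<in> hdual g \<and> (\<forall>j\<le>l. pr y j = (if j = i then 1 else 0)) \<and> \<langle>y, L0\<rangle> = 0"
  have "x + (-1) *\<^sub>s y = 0"
  proof (rule hdual_pr_zero)
    show "x + (-1) *\<^sub>s y \<in> hdual g" using x y by (intro hdual_add hdual_scl) auto
    show "pr (x + (-1) *\<^sub>s y) j = 0" if "j \<le> l" for j
      using x y that by (simp only: pairing_add pairing_scl) simp
    show "(x + (-1) *\<^sub>s y) 0 = 0" using x y by (simp add: form_Lambda0)
  qed
  thus "x = y" by (simp add: fun_eq_iff)
qed

lemma fund_weight:
  assumes i: "i \<le> l"
  shows "fund_weight g i \<in> hdual g" "j \<le> l \<Longrightarrow> pr (fund_weight g i) j = (if j = i then 1 else 0)" "fund_weight g i 0 = 0"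
  using theI'[OF fund_weight_unique[OF i]] by (auto simp: fund_weight_def form_Lambda0)

lemma pr_sum: "pr (\<Sum>i\<in>I. f i) j = (\<Sum>i\<in>I. pr (f i) j)"
  by (induction I rule: infinite_finite_induct) (simp_all only: sum.infinite sum.empty sum.insert pairing_add simp_thms, simp_all add: pairing_def)

lemma hdual_sum: "(\<And>i. i \<in> I \<Longrightarrow> f i \<in> hdual g) \<Longrightarrow> (\<Sum>i\<in>I. f i) \<in> hdual g"
  by (auto simp: hdual_def sum_vec_apply)

lemma rho: "rho g \<in> hdual g" "j \<le> l \<Longrightarrow> pr (rho g) j = 1" "rho g 0 = 0" "lev (rho g) = of_nat (dual_coxeter g)"
proof -
  show "rho g \<in> hdual g" unfolding rho_def by (intro hdual_sum fund_weight(1)) simp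
  show p: "pr (rho g) j = 1" if "j \<le> l" for j
    using that by (simp add: rho_def pr_sum fund_weight)
  show "rho g 0 = 0" by (simp add: rho_def sum_vec_apply fund_weight)
  show "lev (rho g) = of_nat (dual_coxeter g)" by (simp add: level_def p dual_coxeter_def)
qed

lemma dual_coxeter_eq: "dual_coxeter g = 1 + (\<Sum>j\<in>S. c j * a j)"
proof -
  have "{..l} = insert 0 S" by auto
  thus ?thesis by (simp add: dual_coxeter_def colabel_eq avc c0 a0)
qed

text \<open>The pairing with theta is h - 1, and h <= h^v since all c_j are at least 1.\<close>

lemma unit_wt_reg_fin: assumes "dual_coxeter g \<le> m" shows "unit_wt \<in> reg_fin m"
proof -
  have "\<langle>unit_wt, th\<rangle> = of_nat (\<Sum>j\<in>S. a j)" by (simp add: form_th_E[OF wlat_E[OF unit_wt_wlat]] unit_wt_sroot)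
  moreover have "(\<Sum>j\<in>S. a j) \<le> (\<Sum>j\<in>S. c j * a j)" using cpos by (intro sum_mono) (simp add: Suc_le_eq)
  ultimately show ?thesis using assms dual_coxeter_eq by (simp add: reg_fin_def unit_wt_wlat unit_wt_sroot del: of_nat_sum)
qed

text \<open>Stated through c_i times the coroot pairing, so that it applies to the rho-shifted
  weights of the algebra, where the pairing is a positive integer, and also to those of the
  transpose, where this product is.\<close>

lemma regular_fin_part:
  assumes m: "m > 0" and x: "x \<in> hdual g" "x (Suc l) = of_nat m"
    and n: "\<And>i. i \<in> S \<Longrightarrow> of_nat (c i) * pr x i \<in> \<nat> - {0}" and n0: "0 < Re (pr x 0)"
  shows "fin_part g x \<in> reg_fin m" "A_fun g m x = alt_theta m (fin_part g x)"
proof -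
  have s: "\<langle>fin_part g x, sroot i\<rangle> \<in> \<nat> - {0}" if "i \<in> S" for i using n[OF that] pr_hdual(1)[OF x(1) that] by simp
  hence P: "fin_part g x \<in> wlat" using Nats_subset_Ints by (auto simp: wlat_def)
  have "0 < Re \<langle>fin_part g x, sroot i\<rangle>" if "i \<in> S" for i using s[OF that] by (auto elim!: Nats_cases)
  moreover have "Re \<langle>fin_part g x, th\<rangle> < real m" using n0 unfolding pr_hdual(2)[OF x(1)] by (simp add: x(2))
  ultimately show "fin_part g x \<in> reg_fin m" using P by (simp add: reg_fin_def)
  show "A_fun g m x = alt_theta m (fin_part g x)" by (rule A_fun_eq[OF m]) (simp add: P_weights_iff x P)
qed

lemma nat_plus_one: "(t::complex) \<in> \<nat> \<Longrightarrow> n > 0 \<Longrightarrow> of_nat n * (t + 1) \<in> \<nat> - {0}" "(t::complex) \<in> \<nat> \<Longrightarrow> 0 < Re (t + 1)"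
proof -
  assume "t \<in> \<nat>"
  then obtain k where k: "t = of_nat k" by (elim Nats_cases)
  show "0 < Re (t + 1)" by (simp add: k)
  assume "n > 0"
  hence "of_nat n * (t + 1) = of_nat (n * (k + 1))" "n * (k + 1) \<noteq> 0" by (simp_all add: k algebra_simps)
  thus "of_nat n * (t + 1) \<in> \<nat> - {0}" by (metis DiffI of_nat_eq_0_iff of_nat_in_Nats singletonD)
qed

lemma Ch_minus_generators:
  assumes m: "m = k + dual_coxeter g" "m > 0"
    and x: "x \<in> dominant_integral g" "lev x = of_nat k"
  shows "fin_part g (x + rho g) \<in> reg_fin m" "A_fun g m (x + rho g) = alt_theta m (fin_part g (x + rho g))"
proof -
  have h: "x + rho g \<in> hdual g" using x rho(1) by (intro hdual_add) (auto simp: dominant_integral_def)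
  have xl: "(x + rho g) (Suc l) = of_nat m" using x(2) rho(4) by (simp add: lev_eq m)
  have p: "pr (x + rho g) i = pr x i + 1" "pr x i \<in> \<nat>" if "i \<le> l" for i
    using that x by (simp_all add: pairing_add rho dominant_integral_def)
  have n: "of_nat (c i) * pr (x + rho g) i \<in> \<nat> - {0}" if "i \<in> S" for i
    using that p[of i] nat_plus_one(1)[of "pr x i" "c i"] cpos[of i] by simp
  have n0: "0 < Re (pr (x + rho g) 0)" using p[of 0] nat_plus_one(2)[of "pr x 0"] by simp
  show "fin_part g (x + rho g) \<in> reg_fin m" "A_fun g m (x + rho g) = alt_theta m (fin_part g (x + rho g))"
    by (rule regular_fin_part[OF m(2) h xl n n0]; assumption)+
qed

lemma sl2_closure_eq:
  assumes k: "k > 0"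
  shows "sl2_closure g k = alt_span (k + dual_coxeter g)"
proof -
  define m where "m = k + dual_coxeter g"
  have m: "m > 0" using k by (simp add: m_def)
  \<comment> \<open>A dominant integral weight of level \<open>k\<close>; its shift by rho supplies
    the function in \<open>Ch_minus\<close> from which the closure argument starts.\<close>
  define x where "x = of_nat k *\<^sub>s L0"
  have x: "x \<in> dominant_integral g" "lev x = of_nat k"
    by (auto simp: x_def dominant_integral_def lev_scl pairing_scl pr_L0 intro!: hdual_scl L0_hdual)
  note gen = Ch_minus_generators[OF m_def m]
  have 1: "alt_theta m (fin_part g (x + rho g)) \<in> Ch_minus g k"
    unfolding gen(2)[OF x, symmetric] Ch_minus_def m_def[symmetric] using x by (intro cfun.span_base) blast
  have 2: "Ch_minus g k \<subseteq> alt_span m"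
    unfolding Ch_minus_def m_def[symmetric]
    by (rule cfun.span_minimal) (auto simp: gen intro!: cfun.span_base)
  have "unit_wt \<in> reg_fin m" by (rule unit_wt_reg_fin) (simp add: m_def)
  from closure_unique[OF m this gen(1)[OF x] 1 2] show ?thesis
    unfolding sl2_closure_def m_def[symmetric] by (intro Least_equality) auto
qed

lemma weight_set_eq:
  assumes k: "k > 0"
  shows "weight_set g k = at_level (k + dual_coxeter g) ` reg_fin (k + dual_coxeter g)"
  unfolding weight_set_def sl2_closure_eq[OF k] using A_basis_alt_span[of "k + dual_coxeter g"] k by simp

lemma A_coeff_eq:
  assumes k: "k > 0" and m: "m = k + dual_coxeter g" and \<nu>: "\<nu> \<in> reg_fin m"
  shows "A_coeff g k (\<Sum>\<mu>\<in>reg_fin m. d \<mu> *\<^sub>s alt_theta m \<mu>) (at_level m \<nu>) = d \<nu>"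
proof -
  have m0: "m > 0" using k m by simp
  have b: "A_fun g m ` weight_set g k = alt_theta m ` reg_fin m"
    using A_image_at_level[OF m0, of "reg_fin m"] by (simp add: weight_set_eq[OF k] m)
  define u where "u = (\<lambda>b. if b \<in> alt_theta m ` reg_fin m then d (the_inv_into (reg_fin m) (alt_theta m) b) else 0)"
  have u: "u (alt_theta m \<mu>) = d \<mu>" if "\<mu> \<in> reg_fin m" for \<mu>
    using that the_inv_into_f_f[OF alt_theta_basis(1)[OF m0] that] by (simp add: u_def)
  have "cfun.representation (alt_theta m ` reg_fin m) (\<Sum>\<mu>\<in>reg_fin m. d \<mu> *\<^sub>s alt_theta m \<mu>) = u"
  proof (rule cfun.representation_eqI[OF alt_theta_basis(2)[OF m0]])
    show "(\<Sum>\<mu>\<in>reg_fin m. d \<mu> *\<^sub>s alt_theta m \<mu>) \<in> alt_span m" unfolding alt_span_iff by blast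
    show "b \<in> alt_theta m ` reg_fin m" if "u b \<noteq> 0" for b using that by (auto simp: u_def split: if_splits)
    have s: "{b. u b \<noteq> 0} \<subseteq> alt_theta m ` reg_fin m" by (auto simp: u_def split: if_splits)
    thus "finite {b. u b \<noteq> 0}" by (rule finite_subset) (intro finite_imageI finite_reg_fin)
    have "(\<Sum>b | u b \<noteq> 0. u b *\<^sub>s b) = (\<Sum>b\<in>alt_theta m ` reg_fin m. u b *\<^sub>s b)"
      by (rule sum.mono_neutral_left) (use s finite_reg_fin in auto)
    also have "\<dots> = (\<Sum>\<mu>\<in>reg_fin m. d \<mu> *\<^sub>s alt_theta m \<mu>)"
      unfolding sum.reindex[OF alt_theta_basis(1)[OF m0]] by (intro sum.cong refl) (simp add: u)
    finally show "(\<Sum>b | u b \<noteq> 0. u b *\<^sub>s b) = (\<Sum>\<mu>\<in>reg_fin m. d \<mu> *\<^sub>s alt_theta m \<mu>)" .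
  qed
  thus ?thesis unfolding A_coeff_def m[symmetric] b A_at_level[OF m0 reg_fin_wlat[OF \<nu>]] by (simp add: u \<nu>)
qed

lemma S_entry_eq:
  assumes k: "k > 0" and m: "m = k + dual_coxeter g" and \<mu>: "\<mu> \<in> reg_fin m" and \<nu>: "\<nu> \<in> reg_fin m"
  shows "S_entry g k (at_level m \<mu>) (at_level m \<nu>) = S_coeff m \<mu> \<nu>"
proof -
  have m0: "m > 0" using k m by simp
  show ?thesis unfolding S_entry_def m[symmetric] A_at_level[OF m0 reg_fin_wlat[OF \<mu>]] slash_S_Af'[OF m0 \<mu>]
    by (rule A_coeff_eq[OF k m \<nu>])
qed

section \<open>Invertibility of the S-matrix\<close>

lemma slash_S_twice:
  assumes v: "v \<in> Y"
  shows "slash g S_mat (slash g S_mat f) v = f (pt (cs v) (- cz v) (cu v)) / (csqrt (- 1 / cs v) * csqrt (cs v)) ^ l"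
proof -
  define \<sigma> z u where "\<sigma> = cs v" and "z = cz v" and "u = cu v"
  have \<sigma>: "\<sigma> \<noteq> 0" using v by (auto simp: \<sigma>_def Y_iff)
  have zE: "z \<in> Efin" by (simp add: z_def cz_E)
  have z'E: "(1 / \<sigma>) *\<^sub>s z \<in> Efin" by (intro Efin_closed zE)
  define v' where "v' = pt (- 1 / \<sigma>) ((1 / \<sigma>) *\<^sub>s z) (u - \<langle>z, z\<rangle> / (2 * \<sigma>))"
  have v'Y: "v' \<in> Y" unfolding v'_def \<sigma>_def z_def by (rule S_point_Y[OF v])
  have v'c: "cs v' = - 1 / \<sigma>" "cz v' = (1 / \<sigma>) *\<^sub>s z" "cu v' = u - \<langle>z, z\<rangle> / (2 * \<sigma>)"
    unfolding v'_def by (rule pt_coords[OF z'E])+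
  have z2: "(1 / (- 1 / \<sigma>)) *\<^sub>s ((1 / \<sigma>) *\<^sub>s z) = - z" using \<sigma> by (simp add: fun_eq_iff)
  have u2: "u - \<langle>z, z\<rangle> / (2 * \<sigma>) - \<langle>(1 / \<sigma>) *\<^sub>s z, (1 / \<sigma>) *\<^sub>s z\<rangle> / (2 * (- 1 / \<sigma>)) = u"
    using \<sigma> by (simp add: form_scl_left form_scl_right field_simps)
  have s2: "- 1 / (- 1 / \<sigma>) = \<sigma>" using \<sigma> by simp
  have "slash g S_mat (slash g S_mat f) v = slash g S_mat f v' / csqrt \<sigma> ^ l"
    unfolding slash_S_apply[OF v] v'_def \<sigma>_def z_def u_def ..
  also have "slash g S_mat f v' = f (pt \<sigma> (- z) u) / csqrt (- 1 / \<sigma>) ^ l"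
    unfolding slash_S_apply[OF v'Y] v'c z2 u2 s2 ..
  finally show ?thesis unfolding \<sigma>_def z_def u_def by (simp add: power_mult_distrib)
qed

text \<open>S^2 is z -> -z up to the automorphy factor, so S^4 fixes every point. The accumulated
  factor is the square of the one in \<open>csqrt_minus_inverse\<close> to the power
  \<open>l\<close>, that is (-1)^l for either branch.\<close>

lemma slash_S_four:
  assumes f: "\<And>v. v \<notin> Y \<Longrightarrow> f v = 0"
  shows "slash g S_mat (slash g S_mat (slash g S_mat (slash g S_mat f))) = (-1) ^ l *\<^sub>s f"
proof
  fix v
  show "slash g S_mat (slash g S_mat (slash g S_mat (slash g S_mat f))) v = ((-1) ^ l *\<^sub>s f) v"
  proof (cases "v \<in> Y")
    case False
    thus ?thesis by (simp add: slash_def S_mat_def f)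
  next
    case True
    define \<sigma> z u where "\<sigma> = cs v" and "z = cz v" and "u = cu v"
    have \<sigma>: "Im \<sigma> > 0" using True by (auto simp: \<sigma>_def Y_iff)
    have mzE: "- z \<in> Efin" using cz_E[of v] by (simp add: z_def Efin_def)
    define w where "w = pt \<sigma> (- z) u"
    have w: "w \<in> Y" "cs w = \<sigma>" "cz w = - z" "cu w = u"
      unfolding w_def using pt_Y[OF mzE \<sigma>] pt_coords[OF mzE] by auto
    define s where "s = csqrt (- 1 / \<sigma>) * csqrt \<sigma>"
    have s: "s\<^sup>2 = - 1" unfolding s_def by (rule csqrt_minus_inverse) (use \<sigma> in auto)
    have "slash g S_mat (slash g S_mat (slash g S_mat (slash g S_mat f))) v = slash g S_mat (slash g S_mat f) w / s ^ l"
      unfolding slash_S_twice[OF True] w_def s_def \<sigma>_def z_def u_def ..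
    also have "slash g S_mat (slash g S_mat f) w = f (pt \<sigma> (- (- z)) u) / s ^ l"
      unfolding slash_S_twice[OF w(1)] w s_def ..
    also have "pt \<sigma> (- (- z)) u = v" using True pt_of_coords by (simp add: \<sigma>_def z_def u_def Y_iff)
    also have "f v / s ^ l / s ^ l = f v / (s\<^sup>2) ^ l" by (simp add: power2_eq_square power_mult_distrib)
    also have "\<dots> = ((-1) ^ l *\<^sub>s f) v" unfolding s by (cases "even l") simp_all
    finally show ?thesis .
  qed
qed

lemma S_coeff_sym: "S_coeff m \<mu> \<nu> = S_coeff m \<nu> \<mu>" by (simp add: S_coeff_def alt_char_comm[of m \<mu>])

lemma S_coeff_four:
  assumes m: "m > 0" and \<mu>: "\<mu> \<in> reg_fin m" and \<nu>: "\<nu> \<in> reg_fin m"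
  shows "(\<Sum>r\<in>reg_fin m. (\<Sum>q\<in>reg_fin m. (\<Sum>p\<in>reg_fin m. S_coeff m \<mu> p * S_coeff m p q) * S_coeff m q r) * S_coeff m r \<nu>) = (if \<mu> = \<nu> then (-1) ^ l else 0)"
proof -
  have "slash g S_mat (slash g S_mat (slash g S_mat (slash g S_mat (alt_theta m \<mu>)))) = (-1) ^ l *\<^sub>s alt_theta m \<mu>"
    by (rule slash_S_four) (simp add: alt_theta_def)
  also have "\<dots> = (\<Sum>\<nu>\<in>reg_fin m. (if \<mu> = \<nu> then (-1) ^ l else 0) *\<^sub>s alt_theta m \<nu>)"
    using \<mu> finite_reg_fin by (simp add: if_distrib[where f = "\<lambda>t. t *\<^sub>s _"] cong: if_cong)
  finally show ?thesis
    unfolding slash_S_Af'[OF m \<mu>] slash_S_comb[OF m] by (rule alt_theta_coeffs_unique[OF m _ \<nu>])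
qed

text \<open>The inverse is (-1)^l times the third power of the matrix; it is two-sided because the
  matrix, and hence its cube, is symmetric.\<close>

lemma S_coeff_inverse:
  assumes m: "m > 0"
  shows "\<exists>C. (\<forall>\<mu>\<in>reg_fin m. \<forall>\<nu>\<in>reg_fin m. (\<Sum>p\<in>reg_fin m. C \<mu> p * S_coeff m p \<nu>) = (if \<mu> = \<nu> then 1 else 0)) \<and>
    (\<forall>\<mu>\<in>reg_fin m. \<forall>\<nu>\<in>reg_fin m. (\<Sum>p\<in>reg_fin m. S_coeff m \<mu> p * C p \<nu>) = (if \<mu> = \<nu> then 1 else 0))"
proof -
  define C3 where "C3 = (\<lambda>\<mu> r. \<Sum>q\<in>reg_fin m. (\<Sum>p\<in>reg_fin m. S_coeff m \<mu> p * S_coeff m p q) * S_coeff m q r)"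
  define C where "C = (\<lambda>\<mu> r. (-1) ^ l * C3 \<mu> r)"
  have C3_sym: "C3 \<mu> \<nu> = C3 \<nu> \<mu>" for \<mu> \<nu>
  proof -
    have "C3 \<mu> \<nu> = (\<Sum>q\<in>reg_fin m. \<Sum>p\<in>reg_fin m. S_coeff m \<mu> p * S_coeff m p q * S_coeff m q \<nu>)" by (simp add: C3_def sum_distrib_right)
    also have "\<dots> = (\<Sum>p\<in>reg_fin m. \<Sum>q\<in>reg_fin m. S_coeff m \<mu> p * S_coeff m p q * S_coeff m q \<nu>)" by (rule sum.swap)
    also have "\<dots> = (\<Sum>p\<in>reg_fin m. \<Sum>q\<in>reg_fin m. S_coeff m \<nu> q * S_coeff m q p * S_coeff m p \<mu>)"
    proof (intro sum.cong refl)
      fix p q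
      show "S_coeff m \<mu> p * S_coeff m p q * S_coeff m q \<nu> = S_coeff m \<nu> q * S_coeff m q p * S_coeff m p \<mu>"
        unfolding S_coeff_sym[of m \<mu> p] S_coeff_sym[of m p q] S_coeff_sym[of m q \<nu>] by (simp only: mult_ac)
    qed
    also have "\<dots> = C3 \<nu> \<mu>" by (simp add: C3_def sum_distrib_right)
    finally show ?thesis .
  qed
  have CB: "(\<Sum>p\<in>reg_fin m. C \<mu> p * S_coeff m p \<nu>) = (if \<mu> = \<nu> then 1 else 0)" if "\<mu> \<in> reg_fin m" "\<nu> \<in> reg_fin m" for \<mu> \<nu>
  proof -
    have "(\<Sum>p\<in>reg_fin m. C \<mu> p * S_coeff m p \<nu>) = (-1) ^ l * (\<Sum>p\<in>reg_fin m. C3 \<mu> p * S_coeff m p \<nu>)"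
      by (simp add: C_def sum_distrib_left mult.assoc)
    also have "\<dots> = (if \<mu> = \<nu> then 1 else 0)" unfolding C3_def S_coeff_four[OF m that] by simp
    finally show ?thesis .
  qed
  have BC: "(\<Sum>p\<in>reg_fin m. S_coeff m \<mu> p * C p \<nu>) = (if \<mu> = \<nu> then 1 else 0)" if "\<mu> \<in> reg_fin m" "\<nu> \<in> reg_fin m" for \<mu> \<nu>
  proof -
    have "(\<Sum>p\<in>reg_fin m. S_coeff m \<mu> p * C p \<nu>) = (\<Sum>p\<in>reg_fin m. C \<nu> p * S_coeff m p \<mu>)"
      by (intro sum.cong refl) (simp only: C_def C3_sym[of \<nu>] S_coeff_sym[of m \<mu>] mult_ac)
    thus ?thesis using CB[OF that(2,1)] by auto
  qed
  show ?thesis using CB BC by blast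
qed

lemma S_inverse_unique:
  assumes k: "k > 0"
  shows "\<exists>!T. (\<forall>x y. x \<notin> weight_set g k \<or> y \<notin> weight_set g k \<longrightarrow> T x y = 0) \<and>
             (\<forall>x\<in>weight_set g k. \<forall>y\<in>weight_set g k.
                (\<Sum>p\<in>weight_set g k. S_entry g k x p * T p y) = (if x = y then 1 else 0))"
proof -
  define m where "m = k + dual_coxeter g"
  have m0: "m > 0" using k m_def by simp
  have W: "weight_set g k = at_level m ` reg_fin m" by (simp add: weight_set_eq[OF k] m_def)
  have inj: "inj_on (at_level m) (reg_fin m)" by (rule inj_onI) (simp add: at_level_inj)
  obtain C where C: "\<forall>\<mu>\<in>reg_fin m. \<forall>\<nu>\<in>reg_fin m. (\<Sum>p\<in>reg_fin m. C \<mu> p * S_coeff m p \<nu>) = (if \<mu> = \<nu> then 1 else 0)"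
    "\<forall>\<mu>\<in>reg_fin m. \<forall>\<nu>\<in>reg_fin m. (\<Sum>p\<in>reg_fin m. S_coeff m \<mu> p * C p \<nu>) = (if \<mu> = \<nu> then 1 else 0)"
    using S_coeff_inverse[OF m0] by blast
  have fp: "fin_part g (at_level m \<mu>) = \<mu>" if "\<mu> \<in> reg_fin m" for \<mu> using that by (simp add: at_level_props wlat_E reg_fin_wlat)
  show ?thesis
  proof (rule finite_right_inverse_unique[where C = "\<lambda>x y. C (fin_part g x) (fin_part g y)"])
    show "finite (weight_set g k)" unfolding W by (intro finite_imageI finite_reg_fin)
    fix x y assume "x \<in> weight_set g k" "y \<in> weight_set g k"
    then obtain \<mu> \<nu> where mn: "x = at_level m \<mu>" "y = at_level m \<nu>" "\<mu> \<in> reg_fin m" "\<nu> \<in> reg_fin m" unfolding W by blast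
    show "(\<Sum>p\<in>weight_set g k. S_entry g k x p * C (fin_part g p) (fin_part g y)) = (if x = y then 1 else 0)"
      unfolding W sum.reindex[OF inj] using C(2) mn
      by (simp add: S_entry_eq[OF k m_def] fp at_level_inj cong: sum.cong)
    show "(\<Sum>p\<in>weight_set g k. C (fin_part g x) (fin_part g p) * S_entry g k p y) = (if x = y then 1 else 0)"
      unfolding W sum.reindex[OF inj] using C(1) mn
      by (simp add: S_entry_eq[OF k m_def] fp at_level_inj cong: sum.cong)
  qed
qed

lemma scaled_weights_unit_wt:
  assumes F: "\<And>i. i \<in> S \<Longrightarrow> F i \<in> Efin" "\<And>i j. i \<in> S \<Longrightarrow> j \<in> S \<Longrightarrow> \<langle>F i, sroot j\<rangle> = (if j = i then 1 else 0)"
  shows "(\<Sum>i\<in>S. F i) = unit_wt"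
proof (rule Efin_eqI)
  show "(\<Sum>i\<in>S. F i) \<in> Efin" using F(1) by (auto simp: Efin_def sum_vec_apply)
qed (auto simp: wlat_E unit_wt_wlat unit_wt_sroot form_sum_left F(2))

lemma fund_weight_sroot: "i \<in> S \<Longrightarrow> j \<in> S \<Longrightarrow> \<langle>fin_part g (fund_weight g i), sroot j\<rangle> = (if j = i then of_nat (c i) else 0)"
  using pr_hdual(1)[OF fund_weight(1)] by (simp add: fund_weight)

lemma zero_weight_fin: "(\<Sum>i=1..l. (of_nat (label g i) / of_nat (colabel g i)) *\<^sub>s fin_part g (fund_weight g i)) = unit_wt"
proof (rule scaled_weights_unit_wt)
  fix i j assume i: "i \<in> S" and j: "j \<in> S"
  show "\<langle>(of_nat (label g i) / of_nat (colabel g i)) *\<^sub>s fin_part g (fund_weight g i), sroot j\<rangle> = (if j = i then 1 else 0)"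
    using apos[of i] cpos[of i] i by (simp only: form_scl_left fund_weight_sroot[OF i j]) (simp add: label_eq colabel_eq avc)
qed (intro Efin_closed fin_part_E)

lemma zero_weight_eq:
  assumes k: "k > 0" and t: "twisted g" "\<not> is_A2even g"
  shows "zero_weight g k = at_level (k + dual_coxeter g) unit_wt"
  unfolding zero_weight_def zero_weight_fin weight_set_eq[OF k]
proof (rule the_equality)
  define m where "m = k + dual_coxeter g"
  have unit_wt: "unit_wt \<in> reg_fin m" by (rule unit_wt_reg_fin) (simp add: m_def)
  have fp: "fin_part g (at_level m \<mu>) = \<mu>" if "\<mu> \<in> reg_fin m" for \<mu> using that by (simp add: at_level_props wlat_E reg_fin_wlat)
  show "at_level (k + dual_coxeter g) unit_wt \<in> at_level (k + dual_coxeter g) ` reg_fin (k + dual_coxeter g) \<and>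
    fin_part g (at_level (k + dual_coxeter g) unit_wt) = (if twisted g \<and> \<not> is_A2even g then unit_wt else fin_part g (rho g))"
    unfolding m_def[symmetric] using unit_wt fp[OF unit_wt] t by simp
  show "x = at_level (k + dual_coxeter g) unit_wt" if "x \<in> at_level (k + dual_coxeter g) ` reg_fin (k + dual_coxeter g) \<and>
    fin_part g x = (if twisted g \<and> \<not> is_A2even g then unit_wt else fin_part g (rho g))" for x
    using that fp t unfolding m_def[symmetric] by auto
qed

end

section \<open>Passage to the transpose\<close>

lemma representation_bij_image:
  fixes \<psi> :: "cfunc \<Rightarrow> cfunc"
  assumes hom: "module_hom scl scl \<psi>" and inj: "inj \<psi>"
    and B: "cfun.independent B" and f: "f \<in> cfun.span B" and b: "b \<in> B"
  shows "cfun.representation (\<psi> ` B) (\<psi> f) (\<psi> b) = cfun.representation B f b"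
proof -
  interpret h: module_hom scl scl \<psi> by (rule hom)
  define r where "r = cfun.representation B f"
  define u where "u = (\<lambda>c. r (inv \<psi> c) * (if c \<in> range \<psi> then 1 else 0))"
  have u: "u (\<psi> x) = r x" for x by (simp add: u_def inj)
  have set: "{c. u c \<noteq> 0} = \<psi> ` {x. r x \<noteq> 0}" by (auto simp: u_def inj inj_eq[OF inj] split: if_splits)
  have ind: "cfun.independent (\<psi> ` B)"
    by (rule h.independent_injective_image[OF B]) (use inj in \<open>auto intro: inj_on_subset\<close>)
  have "cfun.representation (\<psi> ` B) (\<psi> f) = u"
  proof (rule cfun.representation_eqI[OF ind])
    show "\<psi> f \<in> cfun.span (\<psi> ` B)" using f by (simp add: h.span_image)
    show "c \<in> \<psi> ` B" if "u c \<noteq> 0" for c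
      using that set cfun.representation_ne_zero[of B f] unfolding r_def by blast
    show "finite {c. u c \<noteq> 0}" unfolding set r_def by (intro finite_imageI cfun.finite_representation)
    have "(\<Sum>c | u c \<noteq> 0. u c *\<^sub>s c) = (\<Sum>x | r x \<noteq> 0. r x *\<^sub>s \<psi> x)"
      unfolding set by (subst sum.reindex[OF inj_on_subset[OF inj]]) (simp_all add: u)
    also have "\<dots> = \<psi> (\<Sum>x | r x \<noteq> 0. r x *\<^sub>s x)" by (simp only: h.sum h.scale)
    also have "(\<Sum>x | r x \<noteq> 0. r x *\<^sub>s x) = f" unfolding r_def by (rule cfun.sum_nonzero_representation_eq[OF B f])
    finally show "(\<Sum>c | u c \<noteq> 0. u c *\<^sub>s c) = \<psi> f" .
  qed
  thus ?thesis by (simp add: u r_def)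
qed

context aff_data
begin

abbreviation gt where "gt \<equiv> plain_transpose g"

lemma gt_simps: "rk gt = l" "cm gt i j = cm g j i" "label gt = av" "colabel gt = a" "plain_transpose gt = g"
proof -
  show t: "plain_transpose gt = g" by (simp add: plain_transpose_def)
  show "colabel gt = a" unfolding colabel_def t by (rule label_eq)
  show "label gt = av" using colabel_eq by (simp add: colabel_def)
qed (simp_all add: plain_transpose_def)

text \<open>Takes vectors of the transpose to vectors of \<open>g\<close>. Coordinates beyond
  \<open>l\<close>, in particular the Lambda_0 coordinate, are left alone.\<close>

definition tmap :: "vec \<Rightarrow> vec" where "tmap x = (\<lambda>i. if i \<le> l then x i / of_nat (c i) else x i)"
definition tinv :: "vec \<Rightarrow> vec" where "tinv x = (\<lambda>i. if i \<le> l then x i * of_nat (c i) else x i)"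

lemma cnz: "i \<le> l \<Longrightarrow> of_nat (c i) \<noteq> (0::complex)" using cpos[of i] by simp

lemma tmap_apply: "tmap x i = (if i \<le> l then x i / of_nat (c i) else x i)" by (simp add: tmap_def)
lemma tmap_tinv [simp]: "tmap (tinv x) = x" and tinv_tmap [simp]: "tinv (tmap x) = x"
  using cnz by (auto simp: tmap_def tinv_def fun_eq_iff)
lemma tmap_inj: "tmap x = tmap y \<longleftrightarrow> x = y" by (metis tinv_tmap)
lemma inj_tmap: "inj_on tmap A" by (simp add: inj_on_def tmap_inj)

lemma tmap_add: "tmap (x + y) = tmap x + tmap y" and tmap_diff: "tmap (x - y) = tmap x - tmap y"
  and tmap_scl: "tmap (t *\<^sub>s x) = t *\<^sub>s tmap x"
  by (auto simp: tmap_def fun_eq_iff add_divide_distrib diff_divide_distrib)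

lemma tmap_sroot: "i \<le> l \<Longrightarrow> tmap (sroot i) = (1 / of_nat (c i)) *\<^sub>s sroot i"
  by (auto simp: tmap_def fun_eq_iff sroot_apply)

lemma form_tmap: "form gt x y = \<langle>tmap x, tmap y\<rangle>"
proof -
  have e: "x i * y j * (of_nat (a i) / of_nat (av i) * of_int (cm g j i)) =
      tmap x i * tmap y j * (of_nat (c i) * of_int (cm g i j))" if "i \<le> l" "j \<le> l" for i j
  proof -
    have "of_int (int (c i) * cm g i j) = (of_int (int (c j) * cm g j i) :: complex)" by (simp only: csym[OF that])
    hence "of_nat (c i) * of_int (cm g i j) = (of_nat (c j) * of_int (cm g j i) :: complex)" by simp
    thus ?thesis using cnz[OF that(1)] cnz[OF that(2)] apos[OF that(1)] that by (simp add: tmap_apply avc field_simps)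
  qed
  have "(\<Sum>i\<le>l. \<Sum>j\<le>l. x i * y j * (of_nat (a i) / of_nat (av i) * of_int (cm g j i))) =
      (\<Sum>i\<le>l. \<Sum>j\<le>l. tmap x i * tmap y j * (of_nat (c i) * of_int (cm g i j)))"
    by (intro sum.cong refl e) auto
  moreover have "form gt x y = (\<Sum>i\<le>l. \<Sum>j\<le>l. x i * y j * (of_nat (a i) / of_nat (av i) * of_int (cm g j i))) + (x 0 * y (Suc l) + x (Suc l) * y 0)"
    unfolding form_def gt_simps by (simp add: avc c0 a0)
  ultimately show ?thesis unfolding form_eq[of "tmap x"] by (simp only:) (simp add: tmap_apply c0)
qed

lemma pairing_tmap: "i \<le> l \<Longrightarrow> pr (tmap x) i = pairing gt x i / of_nat (c i)"
proof -
  assume i: "i \<le> l"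
  have e: "tmap x j * of_int (cm g i j) = x j * of_int (cm g j i) / of_nat (c i)" if j: "j \<le> l" for j
  proof -
    have "of_int (int (c i) * cm g i j) = (of_int (int (c j) * cm g j i) :: complex)" by (simp only: csym[OF i j])
    hence "of_nat (c i) * of_int (cm g i j) = (of_nat (c j) * of_int (cm g j i) :: complex)" by simp
    thus ?thesis using cnz[OF i] cnz[OF j] j by (simp add: tmap_apply field_simps)
  qed
  have "(\<Sum>j\<le>l. tmap x j * of_int (cm g i j)) = (\<Sum>j\<le>l. x j * of_int (cm g j i)) / of_nat (c i)"
    unfolding sum_divide_distrib by (intro sum.cong refl e) auto
  thus ?thesis unfolding pairing_def gt_simps using c0 by (simp add: tmap_apply add_divide_distrib)
qed

lemma level_tmap: "level gt x = lev (tmap x)"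
  unfolding level_def gt_simps
proof (intro sum.cong refl)
  fix i assume "i \<in> {..l}"
  hence i: "i \<le> l" by simp
  show "of_nat (a i) * pairing gt x i = of_nat (colabel g i) * pr (tmap x) i"
    using cnz[OF i] by (simp add: pairing_tmap[OF i] colabel_eq avc[OF i])
qed

lemma tmap_delta: "tmap (delta gt) = del"
proof
  fix j
  have "delta gt j = (if j \<le> l then of_nat (av j) else 0)"
    by (simp add: delta_def gt_simps sum_vec_apply sroot_apply if_distrib[where f = "\<lambda>x. _ * x"] cong: if_cong)
  thus "tmap (delta gt) j = del j" using cnz[of j] by (simp add: tmap_apply delta_apply avc)
qed

lemma tmap_L0: "tmap (Lambda0 gt) = L0"
  by (auto simp: fun_eq_iff tmap_apply Lambda0_def gt_simps sroot_apply)

lemma hdual_tmap: "x \<in> hdual gt \<longleftrightarrow> tmap x \<in> hdual g"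
  by (simp add: hdual_def gt_simps tmap_apply)

lemma tmap_simple_refl: "i \<le> l \<Longrightarrow> tmap (simple_refl gt i x) = sr i (tmap x)"
  by (simp add: simple_refl_def tmap_diff tmap_scl tmap_sroot pairing_tmap fun_eq_iff)

lemma tmap_word: "set is \<subseteq> {1..l} \<Longrightarrow> tmap (word gt is x) = word g is (tmap x)"
  by (induction "is") (simp_all add: tmap_simple_refl)

definition tconj :: "(vec \<Rightarrow> vec) \<Rightarrow> vec \<Rightarrow> vec" where "tconj w = (\<lambda>x. tinv (w (tmap x)))"

lemma tmap_tconj: "tmap (tconj w x) = w (tmap x)" by (simp add: tconj_def)

lemma tconj_word: "set is \<subseteq> {1..l} \<Longrightarrow> word gt is = tconj (word g is)"
  by (simp add: fun_eq_iff tconj_def flip: tmap_word)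

lemma tconj_inj: "tconj w = tconj w' \<longleftrightarrow> w = w'"
proof
  assume "tconj w = tconj w'"
  hence "w (tmap x) = w' (tmap x)" for x by (metis tmap_tconj)
  thus "w = w'" by (metis tmap_tinv ext)
qed simp

lemma finite_weyl_gt: "finite_weyl gt = tconj ` Wf"
proof (intro equalityI subsetI)
  fix w assume "w \<in> finite_weyl gt"
  then obtain "is" where "set is \<subseteq> {1..l}" "w = word gt is" by (auto simp: finite_weyl_def gt_simps)
  thus "w \<in> tconj ` Wf" using tconj_word Wf_word by blast
next
  fix w assume "w \<in> tconj ` Wf"
  then obtain "is" where "set is \<subseteq> {1..l}" "w = word gt is" using tconj_word by (auto elim!: WfE)
  thus "w \<in> finite_weyl gt" by (auto simp: finite_weyl_def gt_simps)
qed

lemma weyl_sign_gt: "w \<in> Wf \<Longrightarrow> weyl_sign gt (tconj w) = eps w"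
proof -
  have "length is = n \<and> set is \<subseteq> {1..l} \<and> tconj w = word gt is \<longleftrightarrow> length is = n \<and> set is \<subseteq> {1..l} \<and> w = word g is" for "is" n
    using tconj_word tconj_inj by auto
  thus ?thesis by (simp add: weyl_sign_def weyl_length_def gt_simps)
qed

lemma tmap_theta: "tmap ((1 / of_nat (label gt 0)) *\<^sub>s theta_root gt) = th"
  unfolding theta_root_def tmap_scl tmap_diff tmap_delta gt_simps tmap_sroot[OF le0] th_def
  by (simp add: fun_eq_iff avc c0 a0)

lemma module_hom_tmap: "module_hom (\<lambda>n::int. scl (of_int n)) (\<lambda>n::int. scl (of_int n)) tmap"
  by unfold_locales (simp_all add: tmap_add tmap_scl)

lemma M_lattice_gt: "tmap ` M_lattice gt = M"
proof -
  have "tmap ` {w ((1 / of_nat (label gt 0)) *\<^sub>s theta_root gt) |w. w \<in> finite_weyl gt} = {w th |w. w \<in> Wf}"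
    unfolding finite_weyl_gt tmap_theta[symmetric] by (auto simp: image_iff tmap_tconj) (metis tmap_tconj)
  thus ?thesis unfolding M_lattice_def[of gt] M_span
    by (simp only: module_hom.span_image[OF module_hom_tmap, symmetric])
qed

lemma tmap_transl: "tmap (transl gt \<alpha> x) = tr (tmap \<alpha>) (tmap x)"
  unfolding transl_def by (simp only: tmap_add tmap_diff tmap_scl tmap_delta level_tmap form_tmap)

lemma Y_gt: "v \<in> Y_dom gt \<longleftrightarrow> tmap v \<in> Y"
  by (simp add: Y_dom_def hdual_tmap form_tmap tmap_delta)

lemma P_weights_gt: "x \<in> P_weights gt m \<longleftrightarrow> tmap x \<in> P_weights g m"
proof -
  have "(\<forall>\<alpha>\<in>M_lattice gt. form gt x \<alpha> \<in> \<int>) \<longleftrightarrow> (\<forall>\<alpha>\<in>M. \<langle>tmap x, \<alpha>\<rangle> \<in> \<int>)"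
    unfolding M_lattice_gt[symmetric] form_tmap by blast
  thus ?thesis unfolding P_weights_def mem_Collect_eq hdual_tmap level_tmap by blast
qed

section \<open>Transport of functions and subspaces\<close>

definition pull :: "cfunc \<Rightarrow> cfunc" where "pull f = (\<lambda>v. f (tmap v))"

lemma pull_add: "pull (f + f') = pull f + pull f'" and pull_scl: "pull (t *\<^sub>s f) = t *\<^sub>s pull f"
  by (simp_all add: pull_def fun_eq_iff)
lemma module_hom_pull: "module_hom scl scl pull" by unfold_locales (simp_all add: pull_add pull_scl)
lemma pull_sum: "pull (\<Sum>i\<in>I. f i) = (\<Sum>i\<in>I. pull (f i))" by (rule module_hom.sum[OF module_hom_pull])
lemma pull_inj: "pull f = pull f' \<longleftrightarrow> f = f'"
proof
  assume "pull f = pull f'"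
  hence "f (tmap v) = f' (tmap v)" for v by - (drule fun_cong[where x = v], simp add: pull_def)
  thus "f = f'" by (metis tmap_tinv ext)
qed simp
lemma inj_pull: "inj_on pull A" by (simp add: inj_on_def pull_inj)
text \<open>A right inverse of \<open>pull\<close>: every set of functions on the transposed side is
  an image under \<open>pull\<close>, which is needed because the closure there ranges over all
  subspaces.\<close>

definition push :: "cfunc \<Rightarrow> cfunc" where "push f = (\<lambda>v. f (tinv v))"
lemma pull_push [simp]: "pull (push f) = f" by (simp add: pull_def push_def)
lemma pull_image_cover: "\<exists>V. V' = pull ` V"
  by (rule exI[of _ "push ` V'"]) (simp add: image_image)
lemma span_pull: "cfun.span (pull ` B) = pull ` cfun.span B" by (rule module_hom.span_image[OF module_hom_pull])

lemma Theta_gt: "Theta gt m x = pull (Theta g m (tmap x))"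
proof
  fix v
  have "(\<Sum>\<^sub>\<infinity>\<alpha>\<in>M_lattice gt. exp (form gt (transl gt \<alpha> x) v)) = (\<Sum>\<^sub>\<infinity>\<alpha>\<in>M. exp \<langle>tr \<alpha> (tmap x), tmap v\<rangle>)"
    unfolding M_lattice_gt[symmetric] infsum_reindex[OF inj_tmap] by (simp add: o_def form_tmap tmap_transl)
  thus "Theta gt m x v = pull (Theta g m (tmap x)) v"
    by (simp add: Theta_def pull_def Y_gt form_tmap tmap_delta)
qed

lemma Th_gt: "Th gt m = pull ` Th g m"
proof -
  have "Theta gt m ` P_weights gt m = pull ` Theta g m ` P_weights g m"
  proof -
    have "tmap ` P_weights gt m = P_weights g m"
      using P_weights_gt by (auto simp: image_iff) (metis tmap_tinv)
    thus ?thesis by (metis (no_types, lifting) Theta_gt image_cong image_image)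
  qed
  thus ?thesis by (simp add: Th_def span_pull)
qed

lemma A_fun_gt: "A_fun gt m x = pull (A_fun g m (tmap x))"
proof -
  have inj: "inj_on tconj Wf" by (simp add: inj_on_def tconj_inj)
  have "A_fun gt m x = (\<Sum>w\<in>Wf. weyl_sign gt (tconj w) *\<^sub>s Theta gt m (tconj w x))"
    unfolding A_fun_def finite_weyl_gt sum.reindex[OF inj] by simp
  also have "\<dots> = (\<Sum>w\<in>Wf. pull (eps w *\<^sub>s Theta g m (w (tmap x))))"
    by (intro sum.cong refl) (simp only: weyl_sign_gt Theta_gt tmap_tconj pull_scl)
  also have "\<dots> = pull (A_fun g m (tmap x))" by (simp add: A_fun_def pull_sum)
  finally show ?thesis .
qed

lemma fin_part_gt: "tmap (fin_part gt x) = fin_part g (tmap x)"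
proof
  fix i
  show "tmap (fin_part gt x) i = fin_part g (tmap x) i"
    using cnz[of i] by (auto simp: tmap_apply fin_part_def gt_simps label_eq a0 avc c0 field_simps)
qed

lemma tmap_point: "tmap (point gt \<sigma> z u) = pt \<sigma> (tmap z) u"
  unfolding point_def by (simp only: tmap_add tmap_diff tmap_scl tmap_delta tmap_L0)

lemma coords_gt: "coord_sigma gt v = cs (tmap v)" "coord_u gt v = cu (tmap v)" "tmap (coord_z gt v) = cz (tmap v)"
  unfolding coord_sigma_def coord_u_def coord_z_def
  by (simp_all only: form_tmap tmap_delta tmap_L0 tmap_scl fin_part_gt)

text \<open>The map \<open>tmap\<close> preserves the coordinates sigma and u and the form, and it
  commutes with \<open>point\<close>; so the actions agree for every matrix, with the same branch of
  the square root.\<close>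

lemma slash_gt: "slash gt X (pull f) = pull (slash g X f)"
proof
  fix v
  obtain p q s t where X: "X = (p, q, s, t)" by (cases X)
  show "slash gt X (pull f) v = pull (slash g X f) v"
    unfolding X slash_def pull_def Let_def prod.case Y_gt coords_gt form_tmap tmap_point tmap_scl gt_simps ..
qed

lemma regular_dominant_gt: "x \<in> regular_dominant gt m \<longleftrightarrow> tmap x \<in> regular_dominant g m"
proof -
  have "pairing gt x i \<in> \<real> \<and> 0 < Re (pairing gt x i) \<longleftrightarrow> pr (tmap x) i \<in> \<real> \<and> 0 < Re (pr (tmap x) i)" if i: "i \<le> l" for i
  proof -
    have p: "pairing gt x i = of_real (real (c i)) * pr (tmap x) i" using cnz[OF i] by (simp add: pairing_tmap[OF i])
    have p': "pr (tmap x) i = pairing gt x i / of_real (real (c i))" by (simp add: pairing_tmap[OF i])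
    have "pairing gt x i \<in> \<real> \<longleftrightarrow> pr (tmap x) i \<in> \<real>"
      using p p' by (metis Reals_divide Reals_mult Reals_of_real)
    thus ?thesis unfolding p using cpos[OF i] by (simp add: zero_less_mult_iff)
  qed
  thus ?thesis unfolding regular_dominant_def mem_Collect_eq P_weights_gt form_tmap tmap_L0 gt_simps by auto
qed

lemma A_basis_gt: "A_basis gt m X (pull ` V) \<longleftrightarrow> A_basis g m (tmap ` X) V"
proof -
  have im: "A_fun gt m ` X = pull ` A_fun g m ` tmap ` X" by (auto simp: A_fun_gt image_image)
  have "X \<subseteq> regular_dominant gt m \<longleftrightarrow> tmap ` X \<subseteq> regular_dominant g m" by (auto simp: regular_dominant_gt)
  moreover have "inj_on (A_fun gt m) X \<longleftrightarrow> inj_on (A_fun g m) (tmap ` X)"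
    by (auto simp: inj_on_def A_fun_gt pull_inj tmap_inj)
  moreover have "cfun.dependent (A_fun gt m ` X) \<longleftrightarrow> cfun.dependent (A_fun g m ` tmap ` X)"
  proof -
    have *: "pull x \<in> cfun.span (pull ` B - {pull x}) \<longleftrightarrow> x \<in> cfun.span (B - {x})" for x B
    proof -
      have "pull ` B - {pull x} = pull ` (B - {x})" by (auto simp: pull_inj)
      thus ?thesis by (auto simp: span_pull pull_inj)
    qed
    show ?thesis unfolding im cfun.dependent_def bex_simps * ..
  qed
  moreover have "cfun.span (A_fun gt m ` X) = pull ` V \<longleftrightarrow> cfun.span (A_fun g m ` tmap ` X) = V"
    unfolding im span_pull by (rule inj_image_eq_iff[OF inj_pull])
  ultimately show ?thesis unfolding A_basis_def by blast
qed

lemma fund_weight_gt: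
  assumes i: "i \<le> l"
  shows "tmap (fund_weight gt i) = (1 / of_nat (c i)) *\<^sub>s fund_weight g i"
proof -
  have "fund_weight gt i = tinv ((1 / of_nat (c i)) *\<^sub>s fund_weight g i)"
    unfolding fund_weight_def[of gt]
  proof (rule the_equality)
    show "tinv ((1 / of_nat (c i)) *\<^sub>s fund_weight g i) \<in> hdual gt \<and>
      (\<forall>j\<le>rk gt. pairing gt (tinv ((1 / of_nat (c i)) *\<^sub>s fund_weight g i)) j = (if j = i then 1 else 0)) \<and>
      form gt (tinv ((1 / of_nat (c i)) *\<^sub>s fund_weight g i)) (Lambda0 gt) = 0"
    proof (intro conjI allI impI)
      show "tinv ((1 / of_nat (c i)) *\<^sub>s fund_weight g i) \<in> hdual gt"
        by (simp only: hdual_tmap tmap_tinv hdual_scl fund_weight(1)[OF i])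
      show "form gt (tinv ((1 / of_nat (c i)) *\<^sub>s fund_weight g i)) (Lambda0 gt) = 0"
        by (simp only: form_tmap tmap_L0 tmap_tinv form_Lambda0) (simp add: fund_weight(3)[OF i])
      fix j assume "j \<le> rk gt"
      hence j: "j \<le> l" by (simp add: gt_simps)
      have "(1 / of_nat (c i)) * (if j = i then 1 else 0) = pairing gt (tinv ((1 / of_nat (c i)) *\<^sub>s fund_weight g i)) j / of_nat (c j)"
        unfolding pairing_tmap[OF j, symmetric] tmap_tinv pairing_scl fund_weight(2)[OF i j] ..
      thus "pairing gt (tinv ((1 / of_nat (c i)) *\<^sub>s fund_weight g i)) j = (if j = i then 1 else 0)"
        using cnz[OF i] cnz[OF j] by (auto split: if_splits)
    qed
  next
    fix x assume x: "x \<in> hdual gt \<and> (\<forall>j\<le>rk gt. pairing gt x j = (if j = i then 1 else 0)) \<and> form gt x (Lambda0 gt) = 0"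
    have fwe: "of_nat (c i) *\<^sub>s tmap x = fund_weight g i"
      unfolding fund_weight_def
    proof (rule the1_equality[OF fund_weight_unique[OF i], symmetric], intro conjI allI impI)
      show "of_nat (c i) *\<^sub>s tmap x \<in> hdual g" using x by (intro hdual_scl) (simp add: hdual_tmap)
      show "\<langle>of_nat (c i) *\<^sub>s tmap x, L0\<rangle> = 0" using x by (simp only: form_scl_left form_tmap tmap_L0) simp
      show "pr (of_nat (c i) *\<^sub>s tmap x) j = (if j = i then 1 else 0)" if j: "j \<le> l" for j
        using x j cnz[OF j] cnz[OF i] by (simp only: pairing_scl pairing_tmap[OF j]) (simp add: gt_simps)
    qed
    have "tmap x = (1 / of_nat (c i)) *\<^sub>s fund_weight g i"
      unfolding fwe[symmetric] using cnz[OF i] by (simp add: fun_eq_iff)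
    thus "x = tinv ((1 / of_nat (c i)) *\<^sub>s fund_weight g i)" by (metis tinv_tmap)
  qed
  thus ?thesis by simp
qed

lemma tmap_sum: "tmap (\<Sum>i\<in>I. f i) = (\<Sum>i\<in>I. tmap (f i))"
  by (induction I rule: infinite_finite_induct) (simp_all only: sum.infinite sum.empty sum.insert tmap_add simp_thms, simp_all add: tmap_def fun_eq_iff)

text \<open>Fundamental weights are divided by c_i under \<open>tmap\<close>, so the image of rho
  pairs to 1 with every simple root and its finite part is \<open>unit_wt\<close>.\<close>

lemma rho_gt:
  shows "tmap (rho gt) \<in> hdual g" "j \<le> l \<Longrightarrow> pairing gt (rho gt) j = 1" "rho gt 0 = 0"
    "level gt (rho gt) = of_nat (dual_coxeter gt)" "fin_part g (tmap (rho gt)) = unit_wt"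
proof -
  have r: "tmap (rho gt) = (\<Sum>i\<le>l. (1 / of_nat (c i)) *\<^sub>s fund_weight g i)"
    unfolding rho_def tmap_sum gt_simps by (intro sum.cong refl fund_weight_gt) simp
  show h: "tmap (rho gt) \<in> hdual g" unfolding r by (intro hdual_sum hdual_scl fund_weight(1)) simp
  have p: "pr (tmap (rho gt)) j = 1 / of_nat (c j)" if "j \<le> l" for j
    using that by (simp add: r pr_sum pairing_scl fund_weight if_distrib[where f = "\<lambda>x. _ * x"] cong: if_cong)
  show p': "pairing gt (rho gt) j = 1" if "j \<le> l" for j
    using p[OF that] cnz[OF that] by (simp add: pairing_tmap[OF that])
  show "level gt (rho gt) = of_nat (dual_coxeter gt)" by (simp add: level_def p' gt_simps dual_coxeter_def)
  have "tmap (rho gt) 0 = 0" by (simp add: r sum_vec_apply fund_weight)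
  thus "rho gt 0 = 0" by (simp add: tmap_apply c0)
  show "fin_part g (tmap (rho gt)) = unit_wt"
  proof (rule Efin_eqI)
    fix i assume i: "i \<in> S"
    show "\<langle>fin_part g (tmap (rho gt)), sroot i\<rangle> = \<langle>unit_wt, sroot i\<rangle>"
      unfolding pr_hdual(1)[OF h i] unit_wt_sroot[OF i] using p[of i] cnz[of i] i by simp
  qed (auto simp: wlat_E unit_wt_wlat)
qed

lemma rho_gt_fin_part: "fin_part gt x = fin_part gt (rho gt) \<longleftrightarrow> fin_part g (tmap x) = unit_wt"
  using rho_gt(5) by (metis fin_part_gt tmap_inj)

lemma Ch_minus_gt_generators:
  assumes m: "m = k' + dual_coxeter gt" "m > 0"
    and x: "x \<in> dominant_integral gt" "level gt x = of_nat k'"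
  shows "fin_part g (tmap (x + rho gt)) \<in> reg_fin m" "A_fun gt m (x + rho gt) = pull (alt_theta m (fin_part g (tmap (x + rho gt))))"
proof -
  have h: "tmap (x + rho gt) \<in> hdual g"
    using x rho_gt(1) unfolding tmap_add by (intro hdual_add) (auto simp: dominant_integral_def hdual_tmap)
  have "lev (tmap (x + rho gt)) = of_nat m"
    unfolding tmap_add lev_add using x(2) rho_gt(4) by (simp add: level_tmap m)
  hence xl: "tmap (x + rho gt) (Suc l) = of_nat m" by (simp add: lev_eq)
  have p: "of_nat (c i) * pr (tmap (x + rho gt)) i = pairing gt x i + 1" "pairing gt x i \<in> \<nat>" if "i \<le> l" for i
    using that x cnz[OF that] by (simp_all add: pairing_tmap[OF that] pairing_add rho_gt dominant_integral_def gt_simps)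
  have n: "of_nat (c i) * pr (tmap (x + rho gt)) i \<in> \<nat> - {0}" if "i \<in> S" for i
    using that p[of i] nat_plus_one(1)[of "pairing gt x i" 1] by simp
  have n0: "0 < Re (pr (tmap (x + rho gt)) 0)" using p[of 0] nat_plus_one(2)[of "pairing gt x 0"] by (simp add: c0)
  note * = regular_fin_part[OF m(2) h xl n n0]
  show "fin_part g (tmap (x + rho gt)) \<in> reg_fin m" by (rule *(1))
  show "A_fun gt m (x + rho gt) = pull (alt_theta m (fin_part g (tmap (x + rho gt))))"
    unfolding A_fun_gt by (rule arg_cong[where f = pull], rule *(2))
qed

end

text \<open>A single \<open>m\<close> is the shifted level of both algebras. That the transpose is
  not twisted decides which case of \<open>zero_weight\<close> applies to it.\<close>

locale aff_transpose = aff_data +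
  fixes k k' m :: nat
  assumes k: "k > 0" and m: "m = k + dual_coxeter g" and m': "m = k' + dual_coxeter (plain_transpose g)"
    and types: "twisted g" "\<not> is_A2even g" "\<not> twisted (plain_transpose g)"
begin

lemma m0: "m > 0" using k m by simp

lemma sl2_closure_gt: "sl2_closure gt k' = pull ` alt_span m"
proof -
  define C where "C = push ` Ch_minus gt k'"
  have C: "Ch_minus gt k' = pull ` C" by (simp add: C_def image_image)
  note gen = Ch_minus_gt_generators[OF m' m0]
  \<comment> \<open>The rho-shift of this weight has finite part exactly \<open>unit_wt\<close>,
    which starts the closure argument on the transposed side.\<close>
  define x where "x = of_nat k' *\<^sub>s Lambda0 gt"
  have tx: "tmap x = of_nat k' *\<^sub>s L0" unfolding x_def tmap_scl tmap_L0 ..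
  have x: "x \<in> dominant_integral gt" "level gt x = of_nat k'"
  proof -
    show "level gt x = of_nat k'" unfolding level_tmap tx by (simp add: lev_scl)
    have "pairing gt x i = of_nat k' * (if i = 0 then 1 else 0)" if "i \<le> l" for i
      using pairing_tmap[OF that, of x] cnz[OF that] unfolding tx pairing_scl pr_L0 by (auto simp: c0 split: if_splits)
    moreover have "x \<in> hdual gt" unfolding hdual_tmap tx by (intro hdual_scl L0_hdual)
    ultimately show "x \<in> dominant_integral gt" by (auto simp: dominant_integral_def gt_simps)
  qed
  have fx: "fin_part g (tmap (x + rho gt)) = unit_wt"
    unfolding tmap_add tx fin_part_add fin_part_scl fin_part_L0 rho_gt(5) by (simp add: fun_eq_iff)
  have unit_wt: "unit_wt \<in> reg_fin m" using gen(1)[OF x] unfolding fx .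
  have "pull (alt_theta m unit_wt) \<in> Ch_minus gt k'"
    unfolding gen(2)[OF x, unfolded fx, symmetric] Ch_minus_def m'[symmetric] using x by (intro cfun.span_base) blast
  hence 1: "alt_theta m unit_wt \<in> C" unfolding C by (auto simp: pull_inj)
  have "Ch_minus gt k' \<subseteq> cfun.span (pull ` alt_theta m ` reg_fin m)"
    unfolding Ch_minus_def m'[symmetric]
    by (rule cfun.span_minimal) (auto simp: gen intro!: cfun.span_base imageI)
  hence 2: "C \<subseteq> alt_span m" unfolding span_pull C by (auto simp: pull_inj)
  have "(cfun.subspace V' \<and> V' \<subseteq> Th gt m \<and> Ch_minus gt k' \<subseteq> V' \<and> (\<forall>f\<in>V'. slash gt S_mat f \<in> V') \<and> (\<exists>X. A_basis gt m X V')) \<longleftrightarrow> V' = pull ` alt_span m" for V'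
  proof -
    obtain V where V: "V' = pull ` V" using pull_image_cover by blast
    have ss: "cfun.subspace (pull ` V) \<longleftrightarrow> cfun.subspace V"
      unfolding cfun.span_eq_iff[symmetric] span_pull by (rule inj_image_eq_iff[OF inj_pull])
    have su: "pull ` A \<subseteq> pull ` B \<longleftrightarrow> A \<subseteq> B" for A B by (auto simp: pull_inj)
    have mem: "pull f \<in> pull ` V \<longleftrightarrow> f \<in> V" for f by (auto simp: pull_inj)
    have bas: "(\<exists>X. A_basis gt m X (pull ` V)) \<longleftrightarrow> (\<exists>X. A_basis g m X V)"
    proof
      assume "\<exists>X. A_basis g m X V"
      then obtain X where "A_basis g m X V" by blast
      hence "A_basis gt m (tinv ` X) (pull ` V)" unfolding A_basis_gt by (simp add: image_image)
      thus "\<exists>X. A_basis gt m X (pull ` V)" by blast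
    qed (auto simp: A_basis_gt)
    show ?thesis unfolding V ss Th_gt C su ball_simps slash_gt mem bas
      using closure_unique[OF m0 unit_wt unit_wt 1 2, of V] by (simp add: inj_image_eq_iff[OF inj_pull])
  qed
  moreover have "(LEAST V. V = F) = F" for F :: "cfunc set" by (rule Least_equality) auto
  ultimately show ?thesis unfolding sl2_closure_def m'[symmetric] by simp
qed

lemma closure_g: "sl2_closure g k = alt_span m" using sl2_closure_eq[OF k] by (simp add: m)

abbreviation W where "W \<equiv> weight_set g k"
abbreviation W' where "W' \<equiv> weight_set gt k'"

lemma W_eq: "W = at_level m ` reg_fin m" using weight_set_eq[OF k] by (simp add: m)

lemma tmap_W: "tmap ` W' = W"
proof -
  have "A_basis gt m X (pull ` alt_span m) \<longleftrightarrow> X = tinv ` W" for X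
  proof -
    have "tmap ` X = W \<longleftrightarrow> X = tinv ` W"
    proof
      assume "tmap ` X = W"
      hence "tinv ` tmap ` X = tinv ` W" by (rule arg_cong)
      thus "X = tinv ` W" by (simp add: image_image)
    qed (simp add: image_image)
    thus ?thesis unfolding A_basis_gt A_basis_alt_span[OF m0] W_eq by simp
  qed
  hence "W' = tinv ` W" unfolding weight_set_def[of gt] sl2_closure_gt m'[symmetric] by simp
  thus ?thesis by (simp add: image_image)
qed

lemma W'_iff: "x \<in> W' \<longleftrightarrow> tmap x \<in> W"
  unfolding tmap_W[symmetric] by (rule inj_image_mem_iff[OF inj_tmap, symmetric])

lemma A_coeff_gt:
  assumes f: "f \<in> alt_span m" and x: "x \<in> W'"
  shows "A_coeff gt k' (pull f) x = A_coeff g k f (tmap x)"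
proof -
  have im: "A_fun gt m ` W' = pull ` A_fun g m ` W" unfolding tmap_W[symmetric] by (auto simp: A_fun_gt image_image)
  have b: "A_fun g m ` W = alt_theta m ` reg_fin m" using A_image_at_level[OF m0, of "reg_fin m"] by (simp add: W_eq)
  have "A_fun g m (tmap x) \<in> A_fun g m ` W" using x W'_iff by blast
  thus ?thesis unfolding A_coeff_def m[symmetric] m'[symmetric] im unfolding A_fun_gt b
    by (intro representation_bij_image[OF module_hom_pull inj_pull alt_theta_basis(2)[OF m0] f])
qed

lemma A_fun_alt_span: "x \<in> W \<Longrightarrow> A_fun g m x \<in> alt_span m"
  using A_image_at_level[OF m0, of "reg_fin m"] unfolding W_eq by (auto intro!: cfun.span_base)

lemma S_entry_gt:
  assumes "x \<in> W'" "y \<in> W'"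
  shows "S_entry gt k' x y = S_entry g k (tmap x) (tmap y)"
  unfolding S_entry_def m[symmetric] m'[symmetric] A_fun_gt slash_gt
  using assms by (intro A_coeff_gt slash_S_alt_span[OF m0] A_fun_alt_span) (simp_all add: W'_iff)

lemma sum_W': "(\<Sum>p\<in>W'. F (tmap p)) = (\<Sum>p\<in>W. F p)"
  unfolding tmap_W[symmetric] sum.reindex[OF inj_tmap] by simp

text \<open>Both sides solve the same equations after renaming indices by \<open>tmap\<close>, and
  the solution is unique.\<close>

lemma S_inverse_gt: "S_inverse gt k' x y = S_inverse g k (tmap x) (tmap y)"
proof -
  let ?P = "\<lambda>T. (\<forall>x y. x \<notin> W \<or> y \<notin> W \<longrightarrow> T x y = 0) \<and>
      (\<forall>x\<in>W. \<forall>y\<in>W. (\<Sum>p\<in>W. S_entry g k x p * T p y) = (if x = y then 1 else 0))"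
  let ?P' = "\<lambda>T. (\<forall>x y. x \<notin> W' \<or> y \<notin> W' \<longrightarrow> T x y = 0) \<and>
      (\<forall>x\<in>W'. \<forall>y\<in>W'. (\<Sum>p\<in>W'. S_entry gt k' x p * T p y) = (if x = y then 1 else 0))"
  have P': "?P' (\<lambda>x y. T (tmap x) (tmap y)) \<longleftrightarrow> ?P T" for T
  proof -
    have s: "(\<Sum>p\<in>W'. S_entry gt k' x p * T (tmap p) (tmap y)) = (\<Sum>p\<in>W. S_entry g k (tmap x) p * T p (tmap y))" if "x \<in> W'" for x y
      unfolding sum_W'[symmetric] using that by (intro sum.cong refl) (simp add: S_entry_gt)
    have all: "(\<forall>x. Q (tmap x)) \<longleftrightarrow> (\<forall>x. Q x)" for Q by (metis tmap_tinv)
    have "(\<forall>x\<in>W'. \<forall>y\<in>W'. (\<Sum>p\<in>W'. S_entry gt k' x p * T (tmap p) (tmap y)) = (if x = y then 1 else 0)) \<longleftrightarrow>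
      (\<forall>x\<in>W. \<forall>y\<in>W. (\<Sum>p\<in>W. S_entry g k x p * T p y) = (if x = y then 1 else 0))"
      unfolding tmap_W[symmetric] ball_simps tmap_inj by (simp add: s tmap_W)
    moreover have "(\<forall>x y. x \<notin> W' \<or> y \<notin> W' \<longrightarrow> T (tmap x) (tmap y) = 0) \<longleftrightarrow> (\<forall>x y. x \<notin> W \<or> y \<notin> W \<longrightarrow> T x y = 0)"
      unfolding W'_iff by (metis tmap_tinv)
    ultimately show ?thesis by blast
  qed
  have S: "?P (S_inverse g k)" unfolding S_inverse_def by (rule theI'[OF S_inverse_unique[OF k]])
  have "S_inverse gt k' = (\<lambda>x y. S_inverse g k (tmap x) (tmap y))"
    unfolding S_inverse_def[of gt]
  proof (rule the_equality)
    show "?P' (\<lambda>x y. S_inverse g k (tmap x) (tmap y))" using S P' by blast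
    fix T assume T: "?P' T"
    have "?P (\<lambda>x y. T (tinv x) (tinv y))" using T P'[of "\<lambda>x y. T (tinv x) (tinv y)"] by simp
    hence "(\<lambda>x y. T (tinv x) (tinv y)) = S_inverse g k"
      unfolding S_inverse_def by (rule the1_equality[OF S_inverse_unique[OF k], symmetric])
    thus "T = (\<lambda>x y. S_inverse g k (tmap x) (tmap y))" by (metis tinv_tmap)
  qed
  thus ?thesis by simp
qed

text \<open>The two algebras fall under different cases of the definition, the label quotients for
  \<open>g\<close> and rho for the transpose; both cases give the finite part
  \<open>unit_wt\<close>.\<close>

lemma zero_weight_gt: "tmap (zero_weight gt k') = zero_weight g k"
proof -
  have z: "zero_weight g k = at_level m unit_wt" using zero_weight_eq[OF k types(1,2)] by (simp add: m)
  have unit_wt: "unit_wt \<in> reg_fin m" by (rule unit_wt_reg_fin) (simp add: m)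
  have fp: "fin_part g (at_level m \<mu>) = \<mu>" if "\<mu> \<in> reg_fin m" for \<mu> using that by (simp add: at_level_props wlat_E reg_fin_wlat)
  have "zero_weight gt k' = tinv (at_level m unit_wt)"
    unfolding zero_weight_def
  proof (rule the_equality)
    show "tinv (at_level m unit_wt) \<in> W' \<and> fin_part gt (tinv (at_level m unit_wt)) = (if twisted gt \<and> \<not> is_A2even gt
           then \<Sum>i=1..rk gt. (of_nat (label gt i) / of_nat (colabel gt i)) *\<^sub>s fin_part gt (fund_weight gt i)
           else fin_part gt (rho gt))"
      using types(3) unit_wt by (simp add: W'_iff rho_gt_fin_part W_eq fp)
    fix x assume x: "x \<in> W' \<and> fin_part gt x = (if twisted gt \<and> \<not> is_A2even gt
           then \<Sum>i=1..rk gt. (of_nat (label gt i) / of_nat (colabel gt i)) *\<^sub>s fin_part gt (fund_weight gt i)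
           else fin_part gt (rho gt))"
    hence "tmap x \<in> at_level m ` reg_fin m" "fin_part g (tmap x) = unit_wt" using types(3) by (simp_all add: W'_iff rho_gt_fin_part W_eq)
    hence "tmap x = at_level m unit_wt" using fp by auto
    thus "x = tinv (at_level m unit_wt)" by (metis tinv_tmap)
  qed
  thus ?thesis using z by simp
qed

lemma zero_weight_W': "zero_weight gt k' \<in> W'"
proof -
  have "unit_wt \<in> reg_fin m" by (rule unit_wt_reg_fin) (simp add: m)
  thus ?thesis unfolding W'_iff zero_weight_gt W_eq using zero_weight_eq[OF k types(1,2)] by (simp add: m)
qed

lemma fusion_gt:
  assumes "x \<in> W'" "y \<in> W'"
  shows "fusion gt k' x y n = fusion g k (tmap x) (tmap y) (tmap n)"
  unfolding fusion_def sum_W'[symmetric]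
  using assms zero_weight_W' by (intro sum.cong refl) (simp add: S_entry_gt S_inverse_gt zero_weight_gt)

lemma verlinde_mult_gt:
  assumes f: "f \<in> alt_span m" and f': "f' \<in> alt_span m"
  shows "pull (verlinde_mult g k f f') = verlinde_mult gt k' (pull f) (pull f')"
  unfolding verlinde_mult_def m[symmetric] m'[symmetric] sum_W'[symmetric] pull_sum pull_scl
  by (intro sum.cong refl) (simp only: A_coeff_gt[OF f] A_coeff_gt[OF f'] fusion_gt A_fun_gt)

text \<open>All scalars are 1, since \<open>pull\<close> commutes with \<open>slash\<close> for
  every matrix.\<close>

theorem pull_iso: "verlinde_iso g k gt k' pull \<and> intertwines_up_to_scalar g k gt pull"
proof
  show "verlinde_iso g k gt k' pull"
    unfolding verlinde_iso_def closure_g sl2_closure_gt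
    by (auto simp: linear_on_def pull_add pull_scl bij_betw_def inj_pull verlinde_mult_gt)
  show "intertwines_up_to_scalar g k gt pull"
    unfolding intertwines_up_to_scalar_def linear_on_def
    by (auto simp: pull_add pull_scl slash_gt intro!: exI[of _ 1])
qed

end

section \<open>The twisted types\<close>

text \<open>A Perron-Frobenius argument: subtracting from \<open>b\<close> the largest multiple of
  \<open>a\<close> that keeps it nonnegative leaves, up to scaling, a nonnegative kernel vector with
  a zero entry, and zeros spread along the edges of the connected diagram. The entry
  \<open>a z = 1\<close> and the gcd condition then fix the factor.\<close>

lemma label_eqI:
  assumes a: "\<And>i. rk g < i \<Longrightarrow> a i = 0" "\<And>i. i \<le> rk g \<Longrightarrow> 0 < a i"
    and z: "z \<le> rk g" "a z = 1"
    and ker: "\<And>i. i \<le> rk g \<Longrightarrow> (\<Sum>j\<le>rk g. cm g i j * int (a j)) = 0"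
    and offd: "\<And>i j. i \<le> rk g \<Longrightarrow> j \<le> rk g \<Longrightarrow> i \<noteq> j \<Longrightarrow> cm g i j \<le> 0"
    and sym: "\<And>i j. i \<le> rk g \<Longrightarrow> j \<le> rk g \<Longrightarrow> cm g i j \<noteq> 0 \<Longrightarrow> cm g j i \<noteq> 0"
    and conn: "\<And>i. i \<le> rk g \<Longrightarrow> (0, i) \<in> {(i, j). i \<le> rk g \<and> j \<le> rk g \<and> cm g i j \<noteq> 0}\<^sup>*"
  shows "label g = a"
  unfolding label_def
proof (rule the_equality, intro conjI allI impI)
  have "1 \<in> a ` {..rk g}" using z by (auto simp: image_iff intro: bexI[of _ z])
  thus "Gcd (a ` {..rk g}) = 1" by (metis Gcd_dvd is_unit_gcd_iff gcd.commute gcd_dvd_antisym nat_dvd_1_iff_1)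
next
  fix b assume b: "(\<forall>i>rk g. b i = 0) \<and> (\<forall>i\<le>rk g. 0 < b i) \<and> Gcd (b ` {..rk g}) = 1 \<and>
    (\<forall>i\<le>rk g. (\<Sum>j\<le>rk g. cm g i j * int (b j)) = 0)"
  define E where "E = {(i, j). i \<le> rk g \<and> j \<le> rk g \<and> cm g i j \<noteq> 0}"
  obtain s where "is_arg_min (\<lambda>i. of_nat (b i) / of_nat (a i) :: rat) (\<lambda>i. i \<in> {..rk g}) s"
    using ex_is_arg_min_if_finite[of "{..rk g}"] by fastforce
  hence s: "s \<le> rk g" "\<And>i. i \<le> rk g \<Longrightarrow> (of_nat (b s) / of_nat (a s) :: rat) \<le> of_nat (b i) / of_nat (a i)"
    by (auto simp: is_arg_min_linorder)
  define d where "d = (\<lambda>i. int (b i) * int (a s) - int (b s) * int (a i))"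
  have d0: "d i \<ge> 0" if i: "i \<le> rk g" for i
  proof -
    have "(of_nat (b s) * of_nat (a i) :: rat) \<le> of_nat (b i) * of_nat (a s)"
      using s(2)[OF i] a(2)[OF i] a(2)[OF s(1)] by (simp add: field_simps)
    hence "b s * a i \<le> b i * a s" by (simp only: of_nat_mult[symmetric] of_nat_le_iff)
    thus ?thesis unfolding d_def by (metis diff_ge_0_iff_ge of_nat_le_iff of_nat_mult)
  qed
  have dk: "(\<Sum>j\<le>rk g. cm g i j * d j) = 0" if i: "i \<le> rk g" for i
  proof -
    have "(\<Sum>j\<le>rk g. cm g i j * d j) = int (a s) * (\<Sum>j\<le>rk g. cm g i j * int (b j)) - int (b s) * (\<Sum>j\<le>rk g. cm g i j * int (a j))"
      by (simp add: d_def sum_distrib_left sum_subtractf algebra_simps)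
    thus ?thesis using b ker[OF i] i by simp
  qed
  have step: "d j = 0" if i: "d i = 0" and e: "(i, j) \<in> E" for i j
  proof (cases "i = j")
    case False
    have ij: "i \<le> rk g" "j \<le> rk g" "cm g i j \<noteq> 0" using e by (auto simp: E_def)
    have nonpos: "cm g i p * d p \<le> 0" if "p \<le> rk g" for p
      using offd[OF ij(1) that] d0[OF that] i by (cases "i = p") (auto intro: mult_nonpos_nonneg)
    have "(\<Sum>p\<le>rk g. - (cm g i p * d p)) = 0" using dk[OF ij(1)] by (simp add: sum_negf)
    hence "\<forall>p\<in>{..rk g}. - (cm g i p * d p) = 0" by (subst (asm) sum_nonneg_eq_0_iff) (use nonpos in auto)
    thus ?thesis using ij by auto
  qed (use i in simp)
  have symE: "sym E" using sym by (auto simp: sym_def E_def)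
  have "(s, 0) \<in> E\<^sup>*" using conn[OF s(1)] sym_rtrancl[OF symE] unfolding E_def by (auto dest: symD)
  hence reach: "(s, i) \<in> E\<^sup>*" if "i \<le> rk g" for i using conn[OF that] unfolding E_def by (rule rtrancl_trans)
  have dz: "d i = 0" if "i \<le> rk g" for i
    using reach[OF that] by (induction rule: rtrancl_induct) (simp add: d_def, rule step)
  have eq: "b i * a s = b s * a i" if "i \<le> rk g" for i
    using dz[OF that] unfolding d_def by (metis eq_iff_diff_eq_0 of_nat_eq_iff of_nat_mult)
  have bs: "b s = b z * a s" using eq[OF z(1)] z(2) by simp
  have bi: "b i = b z * a i" if "i \<le> rk g" for i
    using eq[OF that] a(2)[OF s(1)] unfolding bs by (simp add: mult_ac)
  have "b z dvd Gcd (b ` {..rk g})" by (rule Gcd_greatest) (use bi in auto)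
  hence "b z = 1" using b by simp
  show "b = a"
  proof
    fix i show "b i = a i" using bi[of i] b a(1)[of i] \<open>b z = 1\<close> by (cases "i \<le> rk g") auto
  qed
qed (use a ker in auto)

text \<open>The paths in \<open>reach\<close> use entries -1 only and are required only up to the
  node before the last; \<open>clast\<close> attaches the last node, and together they give
  connectedness. That c_i a_i are the dual labels follows from the symmetry of c_i a_ij.\<close>

lemma aff_dataI:
  fixes c :: "nat \<Rightarrow> nat"
  assumes rk2: "2 \<le> rk g"
    and cm_out: "\<And>i j. rk g < i \<or> rk g < j \<Longrightarrow> cm g i j = 0"
    and diag: "\<And>i. i \<le> rk g \<Longrightarrow> cm g i i = 2"
    and offd: "\<And>i j. i \<le> rk g \<Longrightarrow> j \<le> rk g \<Longrightarrow> i \<noteq> j \<Longrightarrow> cm g i j \<le> 0"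
    and apos: "\<And>i. i \<le> rk g \<Longrightarrow> 0 < a i" and a_out: "\<And>i. rk g < i \<Longrightarrow> a i = 0" and a0: "a 0 = 1"
    and cval: "\<And>i. i \<le> rk g \<Longrightarrow> c i = 1 \<or> c i = r" and c0: "c 0 = 1" and r0: "r > 0"
    and csym: "\<And>i j. i \<le> rk g \<Longrightarrow> j \<le> rk g \<Longrightarrow> int (c i) * cm g i j = int (c j) * cm g j i"
    and ker: "\<And>i. i \<le> rk g \<Longrightarrow> (\<Sum>j\<le>rk g. cm g i j * int (a j)) = 0"
    and alast: "a (rk g) = 1" and clast: "cm g (rk g) (rk g - 1) \<noteq> 0"
    and reach: "\<And>i. 1 \<le> i \<Longrightarrow> i < rk g \<Longrightarrow> (0, i) \<in> {(j, i). j \<le> rk g \<and> 1 \<le> i \<and> i \<le> rk g \<and> cm g i j = -1}\<^sup>*"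
  shows "aff_data g a (\<lambda>i. c i * a i) c r"
proof -
  have cpos: "0 < c i" if "i \<le> rk g" for i using cval[OF that] r0 by auto
  have sym: "cm g j i \<noteq> 0" if "i \<le> rk g" "j \<le> rk g" "cm g i j \<noteq> 0" for i j
    using csym[OF that(1,2)] cpos[OF that(1)] that(3) by auto
  define E where "E = {(i, j). i \<le> rk g \<and> j \<le> rk g \<and> cm g i j \<noteq> 0}"
  have sub: "{(j, i). j \<le> rk g \<and> 1 \<le> i \<and> i \<le> rk g \<and> cm g i j = -1} \<subseteq> E"
    using sym by (force simp: E_def)
  have conn': "(0, i) \<in> E\<^sup>*" if "i < rk g" for i
    using reach[of i] that rtrancl_mono[OF sub] by (cases "i = 0") auto
  have conn: "(0, i) \<in> E\<^sup>*" if "i \<le> rk g" for i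
  proof (cases "i = rk g")
    case True
    have "(rk g - 1, rk g) \<in> E" using sym[OF _ _ clast] rk2 by (simp add: E_def)
    thus ?thesis using conn'[of "rk g - 1"] rk2 True by (auto intro: rtrancl_into_rtrancl)
  qed (use conn' that in simp)
  have la: "label g = a"
    by (rule label_eqI[where z = 0]) (use apos a_out a0 ker offd sym conn in \<open>auto simp: E_def\<close>)
  have connt: "(0, i) \<in> {(i, j). i \<le> rk g \<and> j \<le> rk g \<and> cm g j i \<noteq> 0}\<^sup>*" if "i \<le> rk g" for i
  proof -
    have "{(i, j). i \<le> rk g \<and> j \<le> rk g \<and> cm g j i \<noteq> 0} = E" using sym by (auto simp: E_def)
    thus ?thesis using conn[OF that] by simp
  qed
  have kert: "(\<Sum>j\<le>rk g. cm g j i * int (c j * a j)) = 0" if i: "i \<le> rk g" for i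
  proof -
    have "(\<Sum>j\<le>rk g. cm g j i * int (c j * a j)) = (\<Sum>j\<le>rk g. int (c i) * (cm g i j * int (a j)))"
    proof (intro sum.cong refl)
      fix j assume "j \<in> {..rk g}"
      hence "int (c i) * cm g i j = int (c j) * cm g j i" using csym i by simp
      thus "cm g j i * int (c j * a j) = int (c i) * (cm g i j * int (a j))"
        by (simp add: mult.assoc[symmetric])
    qed
    thus ?thesis using ker[OF i] by (simp flip: sum_distrib_left)
  qed
  have ca: "colabel g = (\<lambda>i. c i * a i)"
    unfolding colabel_def
    by (rule label_eqI[where z = 0]) (use apos a_out a0 c0 kert offd sym connt cpos in \<open>auto simp: plain_transpose_def\<close>)
  show ?thesis
    by unfold_locales (use rk2 la ca cm_out diag offd apos a0 cval c0 r0 csym ker conn alast reach in \<open>auto simp: E_def\<close>)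
qed

section \<open>Labels and symmetrisers of the types other than \<open>A2even\<close>\<close>

lemma affine_of_simps [simp]:
  "rk (affine_of t) = type_rank t"
  "cm (affine_of t) i j = (if i > type_rank t \<or> j > type_rank t then 0 else if i = j then 2 else offdiag t i j)"
  by (simp_all add: affine_of_def)

lemma chain_path:
  fixes i n :: nat
  assumes "\<And>j. p \<le> j \<Longrightarrow> j < n \<Longrightarrow> (j, Suc j) \<in> E" "p \<le> i" "i \<le> n"
  shows "(p, i) \<in> E\<^sup>*"
  using assms(2,3)
proof (induction i rule: dec_induct)
  case (step j)
  thus ?case using assms(1)[of j] by (auto intro: rtrancl_into_rtrancl)
qed simp

lemma sum_support: "B \<subseteq> {..n} \<Longrightarrow> (\<And>j. j \<le> n \<Longrightarrow> j \<notin> B \<Longrightarrow> f j = 0) \<Longrightarrow> sum f {..n} = sum f B" for f :: "nat \<Rightarrow> int"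
  by (rule sum.mono_neutral_right) auto

text \<open>Labels and the quotients of dual labels by labels. The products 1, 2, ..., 2, 1 are the
  labels of the transpose, of type C_l^(1).\<close>

definition D2_a :: "nat \<Rightarrow> nat \<Rightarrow> nat" where "D2_a l = (\<lambda>i. if i \<le> l then 1 else 0)"
definition D2_c :: "nat \<Rightarrow> nat \<Rightarrow> nat" where "D2_c l = (\<lambda>i. if i = 0 \<or> i = l then 1 else 2)"

lemma aff_data_D2:
  assumes l: "2 \<le> l"
  shows "aff_data (affine_of (D2 l)) (D2_a l) (\<lambda>i. D2_c l i * D2_a l i) (D2_c l) 2"
proof (rule aff_dataI)
  fix i assume i: "i \<le> rk (affine_of (D2 l))"
  consider "i = 0" | "0 < i" "i < l" | "i = l" "0 < i" using i by fastforce
  thus "(\<Sum>j\<le>rk (affine_of (D2 l)). cm (affine_of (D2 l)) i j * int (D2_a l j)) = 0"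
  proof cases
    case 1
    show ?thesis
      by (subst sum_support[of "{0, 1}"]) (use l 1 in \<open>auto simp: chain_def D2_a_def\<close>)
  next
    case 2
    then obtain p where p: "i = Suc p" by (cases i) auto
    show ?thesis
      by (subst sum_support[of "{p, Suc p, Suc (Suc p)}"]) (use l 2 p in \<open>auto simp: chain_def D2_a_def\<close>)
  next
    case 3
    then obtain p where p: "l = Suc p" by (cases l) auto
    show ?thesis
      by (subst sum_support[of "{p, Suc p}"]) (use l 3 p in \<open>auto simp: chain_def D2_a_def\<close>)
  qed
next
  fix i assume i: "1 \<le> i" "i < rk (affine_of (D2 l))"
  show "(0, i) \<in> {(j, i). j \<le> rk (affine_of (D2 l)) \<and> 1 \<le> i \<and> i \<le> rk (affine_of (D2 l)) \<and> cm (affine_of (D2 l)) i j = -1}\<^sup>*"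
    by (rule chain_path[where n = "l - 1"]) (use l i in \<open>auto simp: chain_def\<close>)
qed (use l in \<open>auto simp: chain_def D2_a_def D2_c_def\<close>)

text \<open>The products with \<open>A2odd_c\<close> are 1, 1, 2, ..., 2, the labels of the
  transpose, of type B_l^(1).\<close>

definition A2odd_a :: "nat \<Rightarrow> nat \<Rightarrow> nat" where "A2odd_a l = (\<lambda>i. if i > l then 0 else if i = 0 \<or> i = 1 \<or> i = l then 1 else 2)"
definition A2odd_c :: "nat \<Rightarrow> nat \<Rightarrow> nat" where "A2odd_c l = (\<lambda>i. if i = l then 2 else 1)"

lemma aff_data_A2odd:
  assumes l: "3 \<le> l"
  shows "aff_data (affine_of (A2odd l)) (A2odd_a l) (\<lambda>i. A2odd_c l i * A2odd_a l i) (A2odd_c l) 2"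
proof (rule aff_dataI)
  fix i assume i: "i \<le> rk (affine_of (A2odd l))"
  consider "i = 0" | "i = 1" | "i = 2" | "2 < i" "i < l" | "i = l" "2 < i" using i by fastforce
  thus "(\<Sum>j\<le>rk (affine_of (A2odd l)). cm (affine_of (A2odd l)) i j * int (A2odd_a l j)) = 0"
  proof cases
    case 1
    show ?thesis by (subst sum_support[of "{0, 2}"]) (use l 1 in \<open>auto simp: chain_def A2odd_a_def\<close>)
  next
    case 2
    show ?thesis by (subst sum_support[of "{1, 2}"]) (use l 2 in \<open>auto simp: chain_def A2odd_a_def\<close>)
  next
    case 3
    show ?thesis by (subst sum_support[of "{0, 1, 2, 3}"]) (use l 3 in \<open>auto simp: chain_def A2odd_a_def\<close>)
  next
    case 4
    then obtain p where p: "i = Suc p" by (cases i) auto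
    show ?thesis
      by (subst sum_support[of "{p, Suc p, Suc (Suc p)}"]) (use l 4 p in \<open>auto simp: chain_def A2odd_a_def\<close>)
  next
    case 5
    then obtain p where p: "l = Suc p" by (cases l) auto
    show ?thesis
      by (subst sum_support[of "{p, Suc p}"]) (use l 5 p in \<open>auto simp: chain_def A2odd_a_def\<close>)
  qed
next
  fix i assume i: "1 \<le> i" "i < rk (affine_of (A2odd l))"
  let ?E = "{(j, i). j \<le> rk (affine_of (A2odd l)) \<and> 1 \<le> i \<and> i \<le> rk (affine_of (A2odd l)) \<and> cm (affine_of (A2odd l)) i j = -1}"
  have 02: "(0, 2) \<in> ?E" using l by (auto simp: chain_def)
  have 21: "(2, 1) \<in> ?E" using l by (auto simp: chain_def)
  show "(0, i) \<in> ?E\<^sup>*"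
  proof (cases "i = 1")
    case True
    show ?thesis unfolding True by (rule rtrancl_trans[OF r_into_rtrancl[OF 02] r_into_rtrancl[OF 21]])
  next
    case False
    have "(2, i) \<in> ?E\<^sup>*" by (rule chain_path[where n = "l - 1"]) (use l i False in \<open>auto simp: chain_def\<close>)
    thus ?thesis by (rule converse_rtrancl_into_rtrancl[OF 02])
  qed
next
  fix i j assume "i \<le> rk (affine_of (A2odd l))" "j \<le> rk (affine_of (A2odd l))"
  hence ij: "i \<le> l" "j \<le> l" by simp_all
  consider "i = j" | "i = l - 1" "j = l" | "i = l" "j = l - 1" | "i = l" "j < l - 1" | "j = l" "i < l - 1" | "i < l" "j < l" "i \<noteq> j"
    using ij l by linarith
  thus "int (A2odd_c l i) * cm (affine_of (A2odd l)) i j = int (A2odd_c l j) * cm (affine_of (A2odd l)) j i"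
    by cases (use l in \<open>auto simp: A2odd_c_def chain_def\<close>)
qed (use l in \<open>auto simp: chain_def A2odd_a_def A2odd_c_def\<close>)

text \<open>The products with \<open>E6_c\<close> are 1, 2, 3, 4, 2, the labels of the transpose, of
  type F_4^(1).\<close>

definition E6_a :: "nat \<Rightarrow> nat" where "E6_a = (\<lambda>i. if i > 4 then 0 else [1, 2, 3, 2, 1] ! i)"
definition E6_c :: "nat \<Rightarrow> nat" where "E6_c = (\<lambda>i. if i \<le> 2 then 1 else 2)"

lemma le_4_cases: "(i::nat) \<le> 4 \<longleftrightarrow> i = 0 \<or> i = 1 \<or> i = 2 \<or> i = 3 \<or> i = 4" by auto
lemma le_2_cases: "(i::nat) \<le> 2 \<longleftrightarrow> i = 0 \<or> i = 1 \<or> i = 2" by auto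

lemma aff_data_E6: "aff_data (affine_of E6_2) E6_a (\<lambda>i. E6_c i * E6_a i) E6_c 2"
proof (rule aff_dataI)
  fix i assume i: "1 \<le> i" "i < rk (affine_of E6_2)"
  show "(0, i) \<in> {(j, i). j \<le> rk (affine_of E6_2) \<and> 1 \<le> i \<and> i \<le> rk (affine_of E6_2) \<and> cm (affine_of E6_2) i j = -1}\<^sup>*"
    by (rule chain_path[where n = 3]) (use i in \<open>auto simp: chain_def\<close>)
next
  fix i assume "i \<le> rk (affine_of E6_2)"
  hence "i = 0 \<or> i = 1 \<or> i = 2 \<or> i = 3 \<or> i = 4" by (simp add: le_4_cases)
  moreover have "{..4::nat} = {0, 1, 2, 3, 4}" by auto
  ultimately show "(\<Sum>j\<le>rk (affine_of E6_2). cm (affine_of E6_2) i j * int (E6_a j)) = 0"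
    by (auto simp: E6_a_def chain_def)
next
  fix i j assume "i \<le> rk (affine_of E6_2)" "j \<le> rk (affine_of E6_2)"
  thus "int (E6_c i) * cm (affine_of E6_2) i j = int (E6_c j) * cm (affine_of E6_2) j i"
    by (auto simp: E6_c_def chain_def le_4_cases)
qed (auto simp: chain_def E6_a_def E6_c_def le_4_cases)

text \<open>The products with \<open>D4_c\<close> are 1, 2, 3, the labels of the transpose, of type
  G_2^(1).\<close>

definition D4_a :: "nat \<Rightarrow> nat" where "D4_a = (\<lambda>i. if i > 2 then 0 else [1, 2, 1] ! i)"
definition D4_c :: "nat \<Rightarrow> nat" where "D4_c = (\<lambda>i. if i \<le> 1 then 1 else 3)"

lemma aff_data_D4: "aff_data (affine_of D4_3) D4_a (\<lambda>i. D4_c i * D4_a i) D4_c 3"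
proof (rule aff_dataI)
  fix i assume i: "1 \<le> i" "i < rk (affine_of D4_3)"
  show "(0, i) \<in> {(j, i). j \<le> rk (affine_of D4_3) \<and> 1 \<le> i \<and> i \<le> rk (affine_of D4_3) \<and> cm (affine_of D4_3) i j = -1}\<^sup>*"
    by (rule chain_path[where n = 1]) (use i in \<open>auto simp: chain_def\<close>)
next
  fix i assume "i \<le> rk (affine_of D4_3)"
  hence "i = 0 \<or> i = 1 \<or> i = 2" by (simp add: le_2_cases)
  moreover have "{..2::nat} = {0, 1, 2}" by auto
  ultimately show "(\<Sum>j\<le>rk (affine_of D4_3). cm (affine_of D4_3) i j * int (D4_a j)) = 0"
    by (auto simp: D4_a_def chain_def)
next
  fix i j assume "i \<le> rk (affine_of D4_3)" "j \<le> rk (affine_of D4_3)"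
  thus "int (D4_c i) * cm (affine_of D4_3) i j = int (D4_c j) * cm (affine_of D4_3) j i"
    by (auto simp: D4_c_def chain_def le_2_cases)
qed (auto simp: chain_def D4_a_def D4_c_def le_2_cases)

lemma affine_of_eqD:
  assumes "plain_transpose (affine_of t) = affine_of t'"
  shows "type_rank t = type_rank t'" "cm (affine_of t) j i = cm (affine_of t') i j"
  using arg_cong[OF assms, of rk] arg_cong[OF assms, of "\<lambda>g. cm g i j"]
  by (simp_all only: plain_transpose_def affine.select_convs affine_of_simps(1))

fun A2even_type :: "twisted_type \<Rightarrow> bool" where
  "A2even_type (A2even l) = True"
| "A2even_type _ = False"

text \<open>Equality of records is equality of labelled matrices, so comparing the rank and one or
  two entries excludes every type. The result places the transpose under the rho case of
  \<open>zero_weight\<close>.\<close>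

lemma transpose_not_twisted:
  assumes t: "valid_type t" "\<not> A2even_type t"
  shows "\<not> twisted (plain_transpose (affine_of t))"
proof
  assume "twisted (plain_transpose (affine_of t))"
  then obtain t' where t': "valid_type t'" "plain_transpose (affine_of t) = affine_of t'" by (auto simp: twisted_def)
  note r = affine_of_eqD(1)[OF t'(2)] and e = affine_of_eqD(2)[OF t'(2)]
  show False
  proof (cases t)
    case (A2odd l)
    show False using t t'(1) r e[where i = 0 and j = 1] e[where i = l and j = "l - 1"] A2odd
      by (cases t') (auto simp: chain_def split: if_splits)
  next
    case (D2 l)
    show False using t t'(1) r e[where i = 1 and j = 0] D2
      by (cases t') (auto simp: chain_def split: if_splits)
  next
    case E6_2
    show False using t'(1) r e[where i = 0 and j = 1] e[where i = 3 and j = 2] E6_2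
      by (cases t') (auto simp: chain_def split: if_splits)
  next
    case D4_3
    show False using t'(1) r e[where i = 0 and j = 1] e[where i = 2 and j = 1] D4_3
      by (cases t') (auto simp: chain_def split: if_splits)
  qed (use t in simp)
qed

lemma not_is_A2even:
  assumes t: "valid_type t" "\<not> A2even_type t"
  shows "\<not> is_A2even (affine_of t)"
proof
  assume "is_A2even (affine_of t)"
  then obtain l where l: "1 \<le> l" "affine_of t = affine_of (A2even l)" by (auto simp: is_A2even_def)
  have r: "type_rank t = l" using arg_cong[OF l(2), of rk] by simp
  have e: "cm (affine_of t) i j = cm (affine_of (A2even l)) i j" for i j by (simp only: l(2))
  show False
    using t r l(1) e[of 0 1] e[of l "l - 1"] by (cases t) (auto simp: chain_def split: if_splits)
qed

lemma iso_of_aff_data: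
  assumes aff: "aff_data (affine_of t) a av c r" and t: "valid_type t" "\<not> A2even_type t" and k: "k > 0"
  shows "\<exists>\<phi>. verlinde_iso (affine_of t) k (transpose_alg (affine_of t)) (k + dual_coxeter (affine_of t) - coxeter (affine_of t)) \<phi> \<and>
    intertwines_up_to_scalar (affine_of t) k (transpose_alg (affine_of t)) \<phi>"
proof -
  define g where "g = affine_of t"
  interpret aff_data g a av c r using aff by (simp add: g_def)
  have A: "\<not> is_A2even g" unfolding g_def by (rule not_is_A2even[OF t])
  have tr: "transpose_alg g = plain_transpose g" using A by (simp add: transpose_alg_def)
  have h: "dual_coxeter (plain_transpose g) = coxeter g"
    by (simp add: dual_coxeter_def coxeter_def gt_simps label_eq)
  \<comment> \<open>This makes the subtraction of natural numbers in the level of the transpose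
    exact.\<close>
  have le: "coxeter g \<le> dual_coxeter g"
    unfolding dual_coxeter_def coxeter_def label_eq colabel_eq
    using cpos by (intro sum_mono) (simp add: avc Suc_le_eq)
  interpret aff_transpose g a av c r k "k + dual_coxeter g - coxeter g" "k + dual_coxeter g"
    by unfold_locales (use k le h A t transpose_not_twisted[OF t] in \<open>auto simp: g_def twisted_def\<close>)
  show ?thesis using pull_iso unfolding g_def[symmetric] tr by blast
qed

section \<open>Type \<open>A2even\<close> as its own transpose\<close>

definition A2even_a :: "nat \<Rightarrow> nat \<Rightarrow> nat" where "A2even_a l = (\<lambda>i. if i > l then 0 else if i = l then 1 else 2)"

lemma A2even_ker:
  assumes l: "1 \<le> l" and i: "i \<le> l"
  shows "(\<Sum>j\<le>l. cm (affine_of (A2even l)) i j * int (A2even_a l j)) = 0"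
proof (cases "l = 1")
  case True
  have "{..1::nat} = {0, 1}" by auto
  thus ?thesis using True i by (auto simp: A2even_a_def)
next
  case False
  consider "i = 0" | "0 < i" "i < l" | "i = l" "0 < i" using i l by fastforce
  thus ?thesis
  proof cases
    case 1
    show ?thesis by (subst sum_support[of "{0, 1}"]) (use l False 1 in \<open>auto simp: chain_def A2even_a_def\<close>)
  next
    case 2
    then obtain p where p: "i = Suc p" by (cases i) auto
    show ?thesis
      by (subst sum_support[of "{p, Suc p, Suc (Suc p)}"]) (use l False 2 p in \<open>auto simp: chain_def A2even_a_def\<close>)
  next
    case 3
    then obtain p where p: "l = Suc p" by (cases l) auto
    show ?thesis
      by (subst sum_support[of "{p, Suc p}"]) (use l False 3 p in \<open>auto simp: chain_def A2even_a_def\<close>)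
  qed
qed

text \<open>Transposition followed by i -> l - i exchanges the two special positions (0, 1) and (l -
  1, l) and preserves adjacency; for l = 1 the two positions coincide.\<close>

lemma A2even_reverse:
  assumes "1 \<le> l" "i \<le> l" "j \<le> l"
  shows "cm (affine_of (A2even l)) (l - j) (l - i) = cm (affine_of (A2even l)) i j"
proof -
  have e: "l - j = l - i \<longleftrightarrow> i = j" "l - j = 0 \<and> l - i = 1 \<longleftrightarrow> i = l - 1 \<and> j = l"
    "l - j = l - 1 \<and> l - i = l \<longleftrightarrow> i = 0 \<and> j = 1"
    "l - i = Suc (l - j) \<or> l - j = Suc (l - i) \<longleftrightarrow> j = Suc i \<or> i = Suc j"
    using assms by linarith+
  have b: "(l < l - j \<or> l < l - i) = False" "(l < i \<or> l < j) = False" using assms by auto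
  show ?thesis
  proof (cases "l = 1")
    case True
    hence "i = 0 \<or> i = 1" "j = 0 \<or> j = 1" using assms by auto
    thus ?thesis using True by auto
  next
    case False
    show ?thesis
      unfolding affine_of_simps offdiag.simps type_rank.simps chain_def prod.inject e b if_False
      by (simp only: False if_False disj_commute cong: if_cong)
  qed
qed

lemma A2even_self_transpose:
  assumes l: "1 \<le> l"
  defines "g \<equiv> affine_of (A2even l)"
  shows "transpose_alg g = g" "dual_coxeter g = coxeter g"
proof -
  have "is_A2even g" using l by (auto simp: is_A2even_def g_def)
  thus "transpose_alg g = g" using A2even_reverse[OF l]
    by (auto simp: transpose_alg_def g_def fun_eq_iff intro!: affine.equality simp del: offdiag.simps)
  have rk: "rk g = l" by (simp add: g_def)
  have offd: "cm g i j \<le> 0" if "i \<noteq> j" for i j using that by (auto simp: g_def chain_def)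
  have sym: "cm g j i \<noteq> 0" if "cm g i j \<noteq> 0" for i j
    using that by (auto simp: g_def chain_def split: if_splits)
  have "(j, Suc j) \<in> {(i, j). i \<le> l \<and> j \<le> l \<and> cm g i j \<noteq> 0}" if "j < l" for j
    using that by (auto simp: g_def chain_def)
  hence conn: "(0, i) \<in> {(i, j). i \<le> l \<and> j \<le> l \<and> cm g i j \<noteq> 0}\<^sup>*" if "i \<le> l" for i
    by (rule chain_path[where n = l]) (use that in auto)
  have la: "label g = A2even_a l"
    by (rule label_eqI[where z = l])
       (use offd sym conn A2even_ker[OF l] in \<open>auto simp: rk A2even_a_def simp flip: g_def\<close>)
  \<comment> \<open>Reversing the nodes carries the labels to the dual labels, so both have the same
    sum.\<close>
  define b where "b = (\<lambda>i. if i > l then 0 else A2even_a l (l - i))"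
  have kt: "(\<Sum>j\<le>l. cm g j i * int (b j)) = 0" if i: "i \<le> l" for i
  proof -
    have "(\<Sum>j\<le>l. cm g j i * int (b j)) = (\<Sum>j\<le>l. cm g (l - i) (l - j) * int (A2even_a l (l - j)))"
    proof (intro sum.cong refl)
      fix j assume "j \<in> {..l}"
      hence j: "j \<le> l" by simp
      show "cm g j i * int (b j) = cm g (l - i) (l - j) * int (A2even_a l (l - j))"
        unfolding g_def A2even_reverse[OF l j i] using j by (simp only: b_def) simp
    qed
    also have "\<dots> = (\<Sum>j\<le>l. cm g (l - i) j * int (A2even_a l j))"
      by (rule sum.reindex_bij_witness[where i = "\<lambda>j. l - j" and j = "\<lambda>j. l - j"]) auto
    also have "\<dots> = 0" unfolding g_def by (rule A2even_ker[OF l]) simp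
    finally show ?thesis .
  qed
  have conn': "(0, i) \<in> {(i, j). i \<le> l \<and> j \<le> l \<and> cm g j i \<noteq> 0}\<^sup>*" if "i \<le> l" for i
  proof -
    have "{(i, j). i \<le> l \<and> j \<le> l \<and> cm g j i \<noteq> 0} = {(i, j). i \<le> l \<and> j \<le> l \<and> cm g i j \<noteq> 0}" using sym by auto
    thus ?thesis using conn[OF that] by simp
  qed
  have ca: "colabel g = b" unfolding colabel_def
    by (rule label_eqI[where z = 0])
       (use offd sym conn' kt in \<open>auto simp: rk plain_transpose_def b_def A2even_a_def\<close>)
  have "(\<Sum>i\<le>l. b i) = (\<Sum>i\<le>l. A2even_a l i)"
    by (rule sum.reindex_bij_witness[where i = "\<lambda>j. l - j" and j = "\<lambda>j. l - j"]) (auto simp: b_def)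
  thus "dual_coxeter g = coxeter g" by (simp add: dual_coxeter_def coxeter_def rk la ca)
qed

theorem theorem1p3:
  fixes g :: affine and k :: nat
  assumes "twisted g" and "k > 0"
  shows "\<exists>\<phi>. verlinde_iso g k (transpose_alg g) (k + dual_coxeter g - coxeter g) \<phi> \<and>
             intertwines_up_to_scalar g k (transpose_alg g) \<phi>"
proof -
  obtain t where t: "valid_type t" "g = affine_of t" using assms(1) by (auto simp: twisted_def)
  show ?thesis
  proof (cases t)
    case (A2even l)
    have l: "1 \<le> l" using t A2even by simp
    note st = A2even_self_transpose[OF l, folded A2even t(2)[unfolded A2even]]
    \<comment> \<open>Here h = h^v, so the algebra and the level are unchanged, and the identity
      intertwines with all scalars equal to 1.\<close>
    have "verlinde_iso g k g k id \<and> intertwines_up_to_scalar g k g id"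
      by (auto simp: verlinde_iso_def intertwines_up_to_scalar_def linear_on_def intro!: exI[of _ 1])
    thus ?thesis using st t(2) A2even by auto
  next
    case (A2odd l)
    thus ?thesis using iso_of_aff_data[OF aff_data_A2odd[of l] _ _ assms(2)] t by simp
  next
    case (D2 l)
    thus ?thesis using iso_of_aff_data[OF aff_data_D2[of l] _ _ assms(2)] t by simp
  next
    case E6_2
    thus ?thesis using iso_of_aff_data[OF aff_data_E6 _ _ assms(2)] t by simp
  next
    case D4_3
    thus ?thesis using iso_of_aff_data[OF aff_data_D4 _ _ assms(2)] t by simp
  qed
qed

end
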